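(* Let $\Omega\subset\mathbf{R}^3$ be a bounded domain with smooth boundary $\partial\Omega$, let $m>0$, $q\in\mathbf{R}\setminus\{0\}$, $\omega\in\mathbf{R}$, and let $h,\zeta$ be smooth real functions on $\partial\Omega$. Let $\lambda_1$ be the first eigenvalue of $-\Delta$ on $\Omega$ with homogeneous Dirichlet boundary conditions. Assume $$\|q\zeta-\omega\|_{\infty}^2<m^2+\lambda_1 ,$$ where $\|\cdot\|_\infty$ is the supremum norm on $\partial\Omega$. Consider the boundary value problem, for real functions $u,\phi$ on $\Omega$, $$\begin{cases}-\Delta u-\phi^2u+m^2u=0 & \text{in }\Omega,\\ \Delta\phi=\phi u^2 & \text{in }\Omega,\\ u=\sqrt{4\pi}\,q\,h & \text{on }\partial\Omega,\\ \phi=q\zeta-\omega & \text{on }\partial\Omega.\end{cases}$$ Then: (1) If $h\neq0$ (i.e. $h$ is not identically zero), the problem has a nontrivial solution. (2) If $h=0$ (identically), the problem has no nontrivial solutions.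
   Context: Solutions $(u,\phi)$ are understood as weak solutions in $H^1(\Omega)\times H^1(\Omega)$, with the boundary conditions in the sense of traces. A solution $(u,\phi)$ is called nontrivial if $u\neq0$ (i.e. $u$ is not identically zero), and trivial if $u=0$. *)

theory Defs
  imports "HOL-Analysis.Analysis"
begin

text \<open>\<open>Ck_on\<close> and \<open>smooth_on\<close> are meant for open sets: the derivatives are taken in the
  ambient space.\<close>

primrec Ck_on :: "nat \<Rightarrow> 'a::real_normed_vector set \<Rightarrow> ('a \<Rightarrow> real) \<Rightarrow> bool" where
  "Ck_on 0 U f \<longleftrightarrow> continuous_on U f"
| "Ck_on (Suc k) U f \<longleftrightarrow>
     (\<forall>x\<in>U. f differentiable (at x)) \<and> (\<forall>v. Ck_on k U (\<lambda>x. frechet_derivative f (at x) v))"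

definition smooth_on :: "'a::real_normed_vector set \<Rightarrow> ('a \<Rightarrow> real) \<Rightarrow> bool" where
  "smooth_on U f \<longleftrightarrow> (\<forall>k. Ck_on k U f)"

text \<open>Near each boundary point, \<open>\<Omega>\<close> is the negativity set of a smooth function without critical
  points; in particular \<open>\<Omega>\<close> lies locally on one side of its boundary, and the boundary is locally
  the zero set of that function.\<close>

definition smooth_boundary :: "'a::real_normed_vector set \<Rightarrow> bool" where
  "smooth_boundary \<Omega> \<longleftrightarrow>
     (\<forall>p\<in>frontier \<Omega>. \<exists>U \<psi>. open U \<and> p \<in> U \<and> smooth_on U \<psi> \<and>
        (\<forall>x\<in>U. \<exists>v. frechet_derivative \<psi> (at x) v \<noteq> 0) \<and>
        \<Omega> \<inter> U = {x\<in>U. \<psi> x < 0})"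

text \<open>Smoothness of a function on a set which need not be open, such as \<open>\<partial>\<Omega>\<close>: locally it is the
  restriction of a smooth function on the ambient space.\<close>

definition smooth_fun_on_subset :: "'a::real_normed_vector set \<Rightarrow> ('a \<Rightarrow> real) \<Rightarrow> bool" where
  "smooth_fun_on_subset A f \<longleftrightarrow>
     (\<forall>p\<in>A. \<exists>U g. open U \<and> p \<in> U \<and> smooth_on U g \<and> (\<forall>x\<in>A \<inter> U. g x = f x))"

text \<open>Elements of these spaces are represented by functions on the whole space of which only the
  values almost everywhere on \<open>\<Omega>\<close> matter.\<close>

definition L2_on :: "'a::euclidean_space set \<Rightarrow> ('a \<Rightarrow> 'b::euclidean_space) set" where
  "L2_on \<Omega> = {f \<in> borel_measurable (lebesgue_on \<Omega>).
                 integrable (lebesgue_on \<Omega>) (\<lambda>x. (norm (f x))\<^sup>2)}"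

definition test_functions :: "'a::euclidean_space set \<Rightarrow> ('a \<Rightarrow> real) set" where
  "test_functions \<Omega> =
     {\<eta>. smooth_on UNIV \<eta> \<and> compact (closure {x. \<eta> x \<noteq> 0}) \<and> closure {x. \<eta> x \<noteq> 0} \<subseteq> \<Omega>}"

definition has_weak_gradient ::
  "'a::euclidean_space set \<Rightarrow> ('a \<Rightarrow> real) \<Rightarrow> ('a \<Rightarrow> 'a) \<Rightarrow> bool" where
  "has_weak_gradient \<Omega> u G \<longleftrightarrow> G \<in> L2_on \<Omega> \<and>
     (\<forall>\<eta>\<in>test_functions \<Omega>. \<forall>b\<in>Basis.
        (\<integral>x. u x * frechet_derivative \<eta> (at x) b \<partial>(lebesgue_on \<Omega>))
          = - (\<integral>x. (G x \<bullet> b) * \<eta> x \<partial>(lebesgue_on \<Omega>)))"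

definition H1 :: "'a::euclidean_space set \<Rightarrow> ('a \<Rightarrow> real) set" where
  "H1 \<Omega> = {u \<in> L2_on \<Omega>. \<exists>G. has_weak_gradient \<Omega> u G}"

text \<open>For \<open>u\<close> in \<open>H1 \<Omega>\<close> the weak gradient is determined almost everywhere on \<open>\<Omega>\<close>, so the choice
  below does not affect any of the integrals in which it is used.\<close>

definition weak_gradient :: "'a::euclidean_space set \<Rightarrow> ('a \<Rightarrow> real) \<Rightarrow> 'a \<Rightarrow> 'a" where
  "weak_gradient \<Omega> u = (SOME G. has_weak_gradient \<Omega> u G)"

definition H1_norm :: "'a::euclidean_space set \<Rightarrow> ('a \<Rightarrow> real) \<Rightarrow> real" where
  "H1_norm \<Omega> u =
     sqrt (\<integral>x. (u x)\<^sup>2 + (norm (weak_gradient \<Omega> u x))\<^sup>2 \<partial>(lebesgue_on \<Omega>))"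

definition H10 :: "'a::euclidean_space set \<Rightarrow> ('a \<Rightarrow> real) set" where
  "H10 \<Omega> = {u \<in> H1 \<Omega>. \<exists>\<eta>. (\<forall>k. \<eta> k \<in> test_functions \<Omega>) \<and>
                 (\<lambda>k::nat. H1_norm \<Omega> (\<lambda>x. \<eta> k x - u x)) \<longlonglongrightarrow> 0}"

text \<open>Surface measure is the two-dimensional Hausdorff measure, normalised by \<open>\<pi>/4\<close> so that it
  coincides with area.\<close>

definition hausdorff2_content :: "real \<Rightarrow> 'a::metric_space set \<Rightarrow> ennreal" where
  "hausdorff2_content \<delta> A =
     (INF C\<in>{C :: nat \<Rightarrow> 'a set. A \<subseteq> (\<Union>i. C i) \<and> (\<forall>i. bounded (C i) \<and> diameter (C i) \<le> \<delta>)}.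
        \<Sum>i. ennreal (pi / 4 * (diameter (C i))\<^sup>2))"

definition hausdorff2 :: "'a::metric_space measure" where
  "hausdorff2 = measure_of UNIV (sets borel) (\<lambda>A. SUP \<delta>\<in>{0<..}. hausdorff2_content \<delta> A)"

definition surface_measure :: "(real^3) set \<Rightarrow> (real^3) measure" where
  "surface_measure \<Omega> = restrict_space hausdorff2 (frontier \<Omega>)"

text \<open>The trace operator from \<open>H\<^sup>1(\<Omega>)\<close> to \<open>L\<^sup>2(\<partial>\<Omega>)\<close> is the continuous extension of the restriction
  map \<open>w \<mapsto> w|\<partial>\<Omega>\<close> from the functions that are smooth up to the boundary, which are dense in
  \<open>H\<^sup>1(\<Omega>)\<close> when \<open>\<Omega>\<close> is bounded with smooth boundary: the trace of \<open>u\<close> is the \<open>L\<^sup>2(\<partial>\<Omega>)\<close> limit of the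
  restrictions of smooth functions converging to \<open>u\<close> in \<open>H\<^sup>1(\<Omega>)\<close>.\<close>

definition has_trace :: "(real^3) set \<Rightarrow> (real^3 \<Rightarrow> real) \<Rightarrow> (real^3 \<Rightarrow> real) \<Rightarrow> bool" where
  "has_trace \<Omega> u g \<longleftrightarrow>
     u \<in> H1 \<Omega> \<and> g \<in> borel_measurable (surface_measure \<Omega>) \<and>
     (\<exists>w. (\<forall>k. smooth_on UNIV (w k)) \<and>
        (\<lambda>k::nat. H1_norm \<Omega> (\<lambda>x. w k x - u x)) \<longlonglongrightarrow> 0 \<and>
        (\<lambda>k. \<integral>\<^sup>+x. ennreal ((w k x - g x)\<^sup>2) \<partial>(surface_measure \<Omega>)) \<longlonglongrightarrow> 0)"

definition dirichlet_eigenvalue :: "'a::euclidean_space set \<Rightarrow> real \<Rightarrow> bool" where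
  "dirichlet_eigenvalue \<Omega> \<mu> \<longleftrightarrow>
     (\<exists>v\<in>H10 \<Omega>. \<not> (AE x in lebesgue_on \<Omega>. v x = 0) \<and>
        (\<forall>w\<in>H10 \<Omega>.
           (\<integral>x. weak_gradient \<Omega> v x \<bullet> weak_gradient \<Omega> w x \<partial>(lebesgue_on \<Omega>))
             = \<mu> * (\<integral>x. v x * w x \<partial>(lebesgue_on \<Omega>))))"

definition first_dirichlet_eigenvalue :: "'a::euclidean_space set \<Rightarrow> real" where
  "first_dirichlet_eigenvalue \<Omega> = (LEAST \<mu>. dirichlet_eigenvalue \<Omega> \<mu>)"

text \<open>For a bounded \<open>\<Omega>\<close> with smooth boundary in dimension three, \<open>H\<^sup>1(\<Omega>)\<close> embeds into \<open>L\<^sup>6(\<Omega>)\<close>, so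
  all products below are integrable.\<close>

definition weak_solution ::
  "(real^3) set \<Rightarrow> real \<Rightarrow> (real^3 \<Rightarrow> real) \<Rightarrow> (real^3 \<Rightarrow> real) \<Rightarrow>
     (real^3 \<Rightarrow> real) \<Rightarrow> (real^3 \<Rightarrow> real) \<Rightarrow> bool" where
  "weak_solution \<Omega> m f g u \<phi> \<longleftrightarrow>
     u \<in> H1 \<Omega> \<and> \<phi> \<in> H1 \<Omega> \<and>
     (\<forall>v\<in>H10 \<Omega>.
        (\<integral>x. weak_gradient \<Omega> u x \<bullet> weak_gradient \<Omega> v x - (\<phi> x)\<^sup>2 * u x * v x
              + m\<^sup>2 * u x * v x \<partial>(lebesgue_on \<Omega>)) = 0) \<and>
     (\<forall>v\<in>H10 \<Omega>.
        (\<integral>x. - (weak_gradient \<Omega> \<phi> x \<bullet> weak_gradient \<Omega> v x) \<partial>(lebesgue_on \<Omega>))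
          = (\<integral>x. \<phi> x * (u x)\<^sup>2 * v x \<partial>(lebesgue_on \<Omega>))) \<and>
     has_trace \<Omega> u f \<and> has_trace \<Omega> \<phi> g"

definition nontrivial_on :: "(real^3) set \<Rightarrow> (real^3 \<Rightarrow> real) \<Rightarrow> bool" where
  "nontrivial_on \<Omega> u \<longleftrightarrow> \<not> (AE x in lebesgue_on \<Omega>. u x = 0)"

end

theory Submission
  imports Defs "HOL-Complex_Analysis.Great_Picard"
begin

text \<open>The system is variational: for \<open>u\<close> fixed, the second equation is solved by minimizing
  \<open>\<integral> |\<nabla>\<phi>|\<^sup>2 + \<phi>\<^sup>2 u\<^sup>2\<close>, and the maximum principle bounds \<open>|\<phi>|\<close> by the supremum of its boundary
  values. By the assumption on \<open>\<lambda>\<^sub>1\<close> the form \<open>\<integral> |\<nabla>u|\<^sup>2 + (m\<^sup>2 - \<phi>\<^sup>2) u\<^sup>2\<close> is then coercive on functions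
  with zero trace. Hence the reduced functional, a maximum over \<open>\<phi>\<close> of functionals of \<open>u\<close>, is
  uniformly convex and has a minimizer with the prescribed trace, which solves the first equation. If
  \<open>h = 0\<close>, a solution \<open>u\<close> may be used as a test function in its own equation, and coercivity gives
  \<open>u = 0\<close>. The link between the trace and \<open>H10\<close> is a bound for the \<open>L\<^sup>2\<close> norm on a boundary strip of
  width \<open>e\<close> by \<open>e\<close> times the boundary integral plus \<open>e\<^sup>2\<close> times the energy in the strip.\<close>

section \<open>Smooth functions\<close>

text \<open>The joint energy is indefinite, and its term -\<phi>^2 u^2 destroys convexity in u
  unless \<phi> is bounded by the supremum of its boundary values. That bound is available only for
  solutions of the second equation. Stationarity of the reduced functional is extracted from such
  comparisons together with a Lipschitz estimate for \<phi> in terms of u.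

  Functions are paired with their gradients in L^2, so that the choice in
  \<open>weak_gradient\<close> matters only where the definitions are entered or left. Compactness
  of the embedding serves to identify the least eigenvalue with the infimum of the Rayleigh
  quotient; the sixth power bound makes \<phi> u^2 square integrable. The minimizer is nontrivial
  because u = 0 would place a smooth extension of its boundary values in the zero trace class, and
  such functions vanish on the boundary.\<close>

lemma frechet_derivative_cong_open:
  assumes "open U" "x \<in> U" "\<And>y. y \<in> U \<Longrightarrow> f y = g y"
  shows "frechet_derivative f (at x) = frechet_derivative g (at x)"
proof -
  have "(f has_derivative D) (at x) \<longleftrightarrow> (g has_derivative D) (at x)" for D
    using has_derivative_transform_within_open[OF _ assms(1,2), of f D UNIV g]
      has_derivative_transform_within_open[OF _ assms(1,2), of g D UNIV f] assms(3)
    by auto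
  then show ?thesis
    unfolding frechet_derivative_def by presburger
qed

lemma differentiable_cong_open:
  assumes "open U" "x \<in> U" "\<And>y. y \<in> U \<Longrightarrow> f y = g y" "f differentiable (at x)"
  shows "g differentiable (at x)"
  using assms has_derivative_transform_within_open[OF _ assms(1,2), of f _ UNIV g]
  unfolding differentiable_def by blast

lemma Ck_on_cong:
  assumes "open U" "\<And>x. x \<in> U \<Longrightarrow> f x = g x" "Ck_on k U f"
  shows "Ck_on k U g"
  using assms(2,3)
proof (induction k arbitrary: f g)
  case 0
  from 0(2) have "continuous_on U f" by simp
  then have "continuous_on U g" by (rule continuous_on_eq) (rule 0(1))
  then show ?case by simp
next
  case (Suc k)
  have "Ck_on k U (\<lambda>x. frechet_derivative g (at x) v)" for v
  proof (rule Suc.IH[of "\<lambda>x. frechet_derivative f (at x) v"])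
    show "frechet_derivative f (at x) v = frechet_derivative g (at x) v" if "x \<in> U" for x
      using frechet_derivative_cong_open[OF assms(1) that Suc.prems(1)] by (rule fun_cong)
  qed (use Suc.prems(2) in auto)
  moreover have "g differentiable (at x)" if "x \<in> U" for x
  proof (rule differentiable_cong_open[OF assms(1) that Suc.prems(1)])
    show "f differentiable (at x)" using Suc.prems(2) that by auto
  qed
  ultimately show ?case by simp
qed

lemma Ck_on_subset: "Ck_on k U f \<Longrightarrow> V \<subseteq> U \<Longrightarrow> Ck_on k V f"
  by (induction k arbitrary: f) (auto intro: continuous_on_subset)

lemma Ck_on_Suc_imp: "Ck_on (Suc k) U f \<Longrightarrow> Ck_on k U f"
proof (induction k arbitrary: f)
  case 0
  then show ?case
    by (auto intro!: continuous_at_imp_continuous_on differentiable_imp_continuous_within)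
next
  case (Suc k)
  have "Ck_on k U (\<lambda>x. frechet_derivative f (at x) v)" for v
    using Suc.prems by (intro Suc.IH) simp
  then show ?case using Suc.prems by simp
qed

lemma Ck_on_const: "Ck_on k U (\<lambda>x. c)"
  by (induction k arbitrary: c) (auto)

lemma Ck_on_local:
  assumes "\<And>x. x \<in> U \<Longrightarrow> \<exists>V. open V \<and> x \<in> V \<and> Ck_on k V f"
  shows "Ck_on k U f"
  using assms
proof (induction k arbitrary: f)
  case 0
  have "isCont f x" if "x \<in> U" for x
    using 0[OF that] by (auto simp: continuous_on_eq_continuous_at)
  then show ?case
    by (auto intro!: continuous_at_imp_continuous_on)
next
  case (Suc k)
  have "f differentiable (at x)" if "x \<in> U" for x
    using Suc.prems[OF that] by auto
  moreover have "Ck_on k U (\<lambda>x. frechet_derivative f (at x) v)" for v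
  proof (rule Suc.IH)
    fix x assume "x \<in> U"
    then obtain V where "open V" "x \<in> V" "Ck_on (Suc k) V f" using Suc.prems by blast
    then show "\<exists>V. open V \<and> x \<in> V \<and> Ck_on k V (\<lambda>x. frechet_derivative f (at x) v)" by auto
  qed
  ultimately show ?case by simp
qed

lemma frechet_derivative_eqI:
  assumes "(f has_derivative D) (at x)"
  shows "frechet_derivative f (at x) v = D v"
  using frechet_derivative_at[OF assms] by simp

text \<open>\<open>Ck_on\<close> refers to the derivative selected by
  \<open>frechet_derivative\<close>; uniqueness of derivatives on an open set allows it to be
  replaced by an explicit formula \<open>D\<close>. Most concrete smoothness proofs go through this
  rule.\<close>

lemma Ck_on_SucI:
  assumes "open U" "\<And>x. x \<in> U \<Longrightarrow> (f has_derivative D x) (at x)" "\<And>v. Ck_on k U (\<lambda>x. D x v)"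
  shows "Ck_on (Suc k) U f"
proof -
  have "Ck_on k U (\<lambda>x. frechet_derivative f (at x) v)" for v
    by (rule Ck_on_cong[OF assms(1) _ assms(3)[of v]]) (simp add: frechet_derivative_eqI[OF assms(2)])
  then show ?thesis
    using assms(2) by (auto simp: differentiable_def)
qed

lemma Ck_on_has_derivative:
  assumes "Ck_on (Suc k) U f" "x \<in> U"
  shows "(f has_derivative frechet_derivative f (at x)) (at x)"
  using assms frechet_derivative_works by auto

lemma Ck_on_add:
  assumes "open U" shows "Ck_on k U f \<Longrightarrow> Ck_on k U g \<Longrightarrow> Ck_on k U (\<lambda>x. f x + g x)"
proof (induction k arbitrary: f g)
  case 0 then show ?case by (simp add: continuous_on_add)
next
  case (Suc k)
  show ?case
    by (rule Ck_on_SucI[OF assms,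
          of _ "\<lambda>x v. frechet_derivative f (at x) v + frechet_derivative g (at x) v"])
      (use Suc in \<open>auto intro!: has_derivative_add Ck_on_has_derivative[of k U]\<close>)
qed

lemma Ck_on_mult:
  assumes "open U" shows "Ck_on k U f \<Longrightarrow> Ck_on k U g \<Longrightarrow> Ck_on k U (\<lambda>x. f x * g x)"
proof (induction k arbitrary: f g)
  case 0 then show ?case by (simp add: continuous_on_mult)
next
  case (Suc k)
  have f: "Ck_on k U f" and g: "Ck_on k U g" using Suc.prems by (auto intro: Ck_on_Suc_imp simp del: Ck_on.simps)
  have f': "Ck_on k U (\<lambda>x. frechet_derivative f (at x) v)"
    and g': "Ck_on k U (\<lambda>x. frechet_derivative g (at x) v)" for v using Suc.prems by auto
  show ?case
  proof (rule Ck_on_SucI[OF assms,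
          of _ "\<lambda>x v. f x * frechet_derivative g (at x) v + frechet_derivative f (at x) v * g x"])
    show "((\<lambda>x. f x * g x) has_derivative
        (\<lambda>v. f x * frechet_derivative g (at x) v + frechet_derivative f (at x) v * g x)) (at x)" if "x \<in> U" for x
      by (intro has_derivative_mult Ck_on_has_derivative[OF _ that, of k] Suc.prems)
    show "Ck_on k U (\<lambda>x. f x * frechet_derivative g (at x) v + frechet_derivative f (at x) v * g x)" for v
      by (intro Ck_on_add assms Suc.IH f g f' g')
  qed
qed

text \<open>The chain rule replaces the outer function \<open>g\<close> by its derivative while the
  order asked of \<open>f\<close> drops by one. Asking for all orders of \<open>g\<close> keeps the
  hypothesis on the outer function unchanged throughout the induction.\<close>

lemma Ck_on_compose:
  fixes f :: "'a::real_normed_vector \<Rightarrow> real" and g :: "real \<Rightarrow> real"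
  assumes "open U" shows "\<lbrakk>\<And>j. Ck_on j V g; Ck_on k U f; f ` U \<subseteq> V\<rbrakk> \<Longrightarrow> Ck_on k U (\<lambda>x. g (f x))"
proof (induction k arbitrary: g)
  case 0
  have "continuous_on V g" "continuous_on U f" using 0(1)[of 0] 0(2) by auto
  then show ?case using continuous_on_compose2[of V g U f] 0(3) by auto
next
  case (Suc k)
  let ?g' = "\<lambda>t. frechet_derivative g (at t) 1"
  have g': "Ck_on j V ?g'" for j using Suc.prems(1)[of "Suc j"] by simp
  have "(g has_derivative (\<lambda>h. h * ?g' t)) (at t)" if "t \<in> V" for t
  proof -
    have D: "(g has_derivative frechet_derivative g (at t)) (at t)"
      by (rule Ck_on_has_derivative[OF Suc.prems(1)[of "Suc 0"] that])
    interpret bounded_linear "frechet_derivative g (at t)" by (rule has_derivative_bounded_linear[OF D])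
    have eq: "frechet_derivative g (at t) = (\<lambda>h. h * ?g' t)"
    proof
      fix h :: real
      show "frechet_derivative g (at t) h = h * ?g' t" using scaleR[of h 1] by simp
    qed
    show ?thesis by (rule subst[OF eq, of "\<lambda>F. (g has_derivative F) (at t)"]) (rule D)
  qed
  note Dg = this
  have D: "((\<lambda>x. g (f x)) has_derivative (\<lambda>v. frechet_derivative f (at x) v * ?g' (f x))) (at x)"
    if "x \<in> U" for x
    by (rule has_derivative_compose[OF Ck_on_has_derivative[OF Suc.prems(2) that] Dg])
      (use Suc.prems(3) that in blast)
  show ?case
    by (rule Ck_on_SucI[OF assms D])
      (use Suc.prems(2) in \<open>auto intro!: Ck_on_mult[OF assms] Suc.IH[OF g' Ck_on_Suc_imp[OF Suc.prems(2)] Suc.prems(3)]\<close>)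
qed

section \<open>Closure properties of smoothness of all orders\<close>

lemma smooth_on_cong: "open U \<Longrightarrow> (\<And>x. x \<in> U \<Longrightarrow> f x = g x) \<Longrightarrow> smooth_on U f \<Longrightarrow> smooth_on U g"
  unfolding smooth_on_def using Ck_on_cong by blast

lemma smooth_on_subset: "smooth_on U f \<Longrightarrow> V \<subseteq> U \<Longrightarrow> smooth_on V f"
  unfolding smooth_on_def using Ck_on_subset by blast

lemma smooth_on_const [simp]: "smooth_on U (\<lambda>x. c)"
  unfolding smooth_on_def using Ck_on_const by blast

lemma smooth_on_local:
  assumes "\<And>x. x \<in> U \<Longrightarrow> \<exists>V. open V \<and> x \<in> V \<and> smooth_on V f"
  shows "smooth_on U f"
  unfolding smooth_on_def
proof (intro allI Ck_on_local)
  fix k x assume "x \<in> U"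
  then show "\<exists>V. open V \<and> x \<in> V \<and> Ck_on k V f"
    using assms unfolding smooth_on_def by blast
qed

lemma smooth_on_add: "open U \<Longrightarrow> smooth_on U f \<Longrightarrow> smooth_on U g \<Longrightarrow> smooth_on U (\<lambda>x. f x + g x)"
  unfolding smooth_on_def using Ck_on_add by blast

lemma smooth_on_mult: "open U \<Longrightarrow> smooth_on U f \<Longrightarrow> smooth_on U g \<Longrightarrow> smooth_on U (\<lambda>x. f x * g x)"
  unfolding smooth_on_def using Ck_on_mult by blast

lemma smooth_on_cmult: "open U \<Longrightarrow> smooth_on U f \<Longrightarrow> smooth_on U (\<lambda>x. c * f x)"
  by (rule smooth_on_mult) auto

lemma smooth_on_minus: "open U \<Longrightarrow> smooth_on U f \<Longrightarrow> smooth_on U (\<lambda>x. - f x)"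
  using smooth_on_cmult[of U f "-1"] by simp

lemma smooth_on_diff: "open U \<Longrightarrow> smooth_on U f \<Longrightarrow> smooth_on U g \<Longrightarrow> smooth_on U (\<lambda>x. f x - g x)"
  using smooth_on_add[of U f "\<lambda>x. - g x"] smooth_on_minus[of U g] by simp

lemma smooth_on_prod:
  "open U \<Longrightarrow> (\<And>i. i \<in> I \<Longrightarrow> smooth_on U (f i)) \<Longrightarrow> smooth_on U (\<lambda>x. \<Prod>i\<in>I. f i x)"
  by (induction I rule: infinite_finite_induct) (auto intro!: smooth_on_mult)

lemma smooth_on_compose:
  fixes f :: "'a::real_normed_vector \<Rightarrow> real" and g :: "real \<Rightarrow> real"
  shows "open U \<Longrightarrow> smooth_on V g \<Longrightarrow> smooth_on U f \<Longrightarrow> f ` U \<subseteq> V \<Longrightarrow> smooth_on U (\<lambda>x. g (f x))"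
  unfolding smooth_on_def using Ck_on_compose by blast

lemma smooth_on_has_derivative:
  "smooth_on U f \<Longrightarrow> x \<in> U \<Longrightarrow> (f has_derivative frechet_derivative f (at x)) (at x)"
  using Ck_on_has_derivative[of 0 U f] unfolding smooth_on_def by blast

lemma smooth_on_frechet_derivative:
  assumes "smooth_on U f" shows "smooth_on U (\<lambda>x. frechet_derivative f (at x) v)"
  unfolding smooth_on_def
proof
  fix k have "Ck_on (Suc k) U f" using assms unfolding smooth_on_def by blast
  then show "Ck_on k U (\<lambda>x. frechet_derivative f (at x) v)" by simp
qed

lemma smooth_on_imp_continuous_on:
  assumes "smooth_on U f" shows "continuous_on U f"
proof -
  have "Ck_on 0 U f" using assms unfolding smooth_on_def by blast
  then show ?thesis by simp
qed

lemma smooth_on_derivI: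
  assumes "open U" "\<And>x. x \<in> U \<Longrightarrow> (f has_derivative D x) (at x)" "\<And>v. smooth_on U (\<lambda>x. D x v)"
  shows "smooth_on U f"
  unfolding smooth_on_def
proof
  fix k show "Ck_on k U f"
  proof (rule Ck_on_Suc_imp[OF Ck_on_SucI[OF assms(1,2)]])
    show "Ck_on k U (\<lambda>x. D x v)" for v using assms(3)[of v] unfolding smooth_on_def by blast
  qed
qed

lemma smooth_on_bounded_linear:
  assumes "bounded_linear f" "open U" shows "smooth_on U f"
  by (rule smooth_on_derivI[of _ _ "\<lambda>x. f"]) (use assms in \<open>auto intro: bounded_linear_imp_has_derivative\<close>)

lemma smooth_on_id [simp]: "open U \<Longrightarrow> smooth_on U (\<lambda>x::real. x)"
  by (rule smooth_on_bounded_linear) auto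

lemma smooth_on_inner [simp]: "open U \<Longrightarrow> smooth_on U (\<lambda>x::'a::real_inner. x \<bullet> b)"
  by (rule smooth_on_bounded_linear) (auto intro: bounded_linear_inner_left)

lemma smooth_on_norm_square [simp]:
  fixes p :: "'a::real_inner"
  assumes "open U" shows "smooth_on U (\<lambda>x. (norm (x - p))\<^sup>2)"
  unfolding power2_norm_eq_inner
proof (rule smooth_on_derivI[OF assms])
  show "((\<lambda>x. (x - p) \<bullet> (x - p)) has_derivative (\<lambda>v. 2 * (x \<bullet> v - p \<bullet> v))) (at x)" for x
    by (auto intro!: derivative_eq_intros simp: inner_commute algebra_simps)
  show "smooth_on U (\<lambda>x. 2 * (x \<bullet> v - p \<bullet> v))" for v
    using assms by (intro smooth_on_cmult smooth_on_diff) auto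
qed

text \<open>The derivative of the inverse is, up to a constant, the product of two copies of the
  inverse, so order \<open>k\<close> yields order \<open>Suc k\<close>.\<close>

lemma smooth_on_inverse: "smooth_on {0<..} (\<lambda>s::real. inverse s)"
  unfolding smooth_on_def
proof
  fix k
  show "Ck_on k {0<..} (\<lambda>s::real. inverse s)"
  proof (induction k)
    case 0
    then show ?case by (auto intro!: continuous_intros)
  next
    case (Suc k)
    show ?case
    proof (rule Ck_on_SucI)
      show "(inverse has_derivative (\<lambda>v. (- v) * (inverse s * inverse s))) (at s)" if "s \<in> {0<..}" for s::real
        using that by (auto intro!: derivative_eq_intros simp: algebra_simps)
      show "Ck_on k {0<..} (\<lambda>x. - v * (inverse x * inverse x))" for v :: real
        by (intro Ck_on_mult Suc Ck_on_const) auto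
    qed auto
  qed
qed

subsection \<open>Bump functions\<close>

text \<open>The classical flat function. It builds the cutoffs, and it also stands in for the
  positive part in the maximum principle: it is positive exactly for positive arguments and
  increasing there, but smooth and bounded together with its derivative.\<close>

definition \<beta> :: "real \<Rightarrow> real" where "\<beta> t = (if t > 0 then exp (- inverse t) else 0)"

definition \<beta>' :: "real \<Rightarrow> real" where "\<beta>' t = (if t > 0 then (inverse t)\<^sup>2 * exp (- inverse t) else 0)"

lemma poly_exp_flat:
  fixes p :: "real poly"
  shows "((\<lambda>t. poly p (inverse t) * exp (- inverse t)) \<longlongrightarrow> 0) (at_right 0)"
proof -
  have "((\<lambda>x. poly p x * exp (- x)) \<longlongrightarrow> 0) at_top"
  proof -
    have "((\<lambda>x. \<Sum>i\<le>degree p. coeff p i * (x ^ i / exp x)) \<longlongrightarrow> (\<Sum>i\<le>degree p. coeff p i * 0)) at_top"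
      by (intro tendsto_sum tendsto_mult tendsto_const tendsto_power_div_exp_0)
    then show ?thesis
      by (simp add: poly_altdef sum_distrib_right exp_minus divide_inverse mult.assoc)
  qed
  then show ?thesis
    by (rule filterlim_compose[OF _ filterlim_inverse_at_top_right])
qed

text \<open>For t > 0 the derivative of p(1/t) exp(-1/t) is (1/t)^2 (p - p')(1/t) exp(-1/t). The
  family is thus closed under differentiation, and smoothness of all its members follows by one
  induction.\<close>

lemma poly_exp_has_derivative:
  fixes p :: "real poly"
  defines "f \<equiv> \<lambda>p t. if t > 0 then poly p (inverse t) * exp (- inverse t) else (0::real)"
  shows "(f p has_real_derivative f (monom 1 2 * (p - pderiv p)) t) (at t)"
proof (cases t "0::real" rule: linorder_cases)
  case greater
  have "((\<lambda>t. poly p (inverse t) * exp (- inverse t)) has_real_derivative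
      f (monom 1 2 * (p - pderiv p)) t) (at t)"
    using greater by (auto intro!: derivative_eq_intros simp: f_def poly_monom algebra_simps power2_eq_square)
  then show ?thesis
    by (rule has_field_derivative_transform_within_open[of _ _ _ "{0<..}"])
      (use greater in \<open>auto simp: f_def\<close>)
next
  case less
  have "((\<lambda>t. 0) has_real_derivative 0) (at t)" by simp
  then have "(f p has_real_derivative 0) (at t)"
    by (rule has_field_derivative_transform_within_open[of _ _ _ "{..<0}"])
      (use less in \<open>auto simp: f_def\<close>)
  then show ?thesis using less by (simp add: f_def)
next
  case equal
  \<comment> \<open>Dividing by \<open>h\<close> contributes one more factor 1/h, which
    \<open>pCons 0 p\<close> absorbs into the polynomial.\<close>
  have "((\<lambda>h. (f p h - f p 0) / h) \<longlongrightarrow> 0) (at_right 0)"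
  proof (rule Lim_transform_eventually[OF poly_exp_flat[of "pCons 0 p"]])
    show "\<forall>\<^sub>F t in at_right 0. poly (pCons 0 p) (inverse t) * exp (- inverse t) = (f p t - f p 0) / t"
      using eventually_at_right_less[of "0::real"] by eventually_elim (auto simp: f_def field_simps)
  qed
  moreover have "((\<lambda>h. (f p h - f p 0) / h) \<longlongrightarrow> 0) (at_left 0)"
  proof (rule Lim_transform_eventually[of "\<lambda>_. 0"])
    show "\<forall>\<^sub>F t in at_left 0. 0 = (f p t - f p 0) / t"
      by (auto simp: eventually_at_filter f_def)
  qed simp
  ultimately have "((\<lambda>h. (f p (0 + h) - f p 0) / h) \<longlongrightarrow> 0) (at 0)"
    by (simp add: filterlim_split_at)
  then show ?thesis using equal unfolding DERIV_def by (simp add: f_def)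
qed

lemma smooth_poly_exp:
  fixes p :: "real poly"
  shows "smooth_on UNIV (\<lambda>t. if t > 0 then poly p (inverse t) * exp (- inverse t) else (0::real))"
  unfolding smooth_on_def
proof
  fix k show "Ck_on k UNIV (\<lambda>t. if t > 0 then poly p (inverse t) * exp (- inverse t) else (0::real))"
  proof (induction k arbitrary: p)
    case 0
    have "continuous_on UNIV (\<lambda>t. if t > 0 then poly p (inverse t) * exp (- inverse t) else (0::real))"
      by (rule continuous_at_imp_continuous_on, rule ballI, rule DERIV_isCont, rule poly_exp_has_derivative)
    then show ?case by simp
  next
    case (Suc k)
    show ?case
    proof (rule Ck_on_SucI[OF open_UNIV])
      show "((\<lambda>t. if t > 0 then poly p (inverse t) * exp (- inverse t) else 0) has_derivative
        (\<lambda>v. v * (if t > 0 then poly (monom 1 2 * (p - pderiv p)) (inverse t) * exp (- inverse t) else 0))) (at t)"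
        for t
        using poly_exp_has_derivative[of p t, THEN has_field_derivative_imp_has_derivative]
        by (rule has_derivative_eq_rhs) (simp add: fun_eq_iff mult.commute)
    qed (intro Ck_on_mult Ck_on_const Suc open_UNIV)
  qed
qed

lemma smooth_beta: "smooth_on UNIV \<beta>"
  using smooth_poly_exp[of "[:1:]"] by (simp add: \<beta>_def[abs_def] cong: if_cong)

lemma beta_has_derivative: "(\<beta> has_real_derivative \<beta>' t) (at t)"
  using poly_exp_has_derivative[of "[:1:]" t] by (simp add: \<beta>_def[abs_def] \<beta>'_def poly_monom cong: if_cong)

lemma smooth_beta': "smooth_on UNIV \<beta>'"
  using smooth_poly_exp[of "monom 1 2"] by (simp add: \<beta>'_def[abs_def] poly_monom cong: if_cong)

lemma beta_pos_iff [simp]: "\<beta> t > 0 \<longleftrightarrow> t > 0" and beta_nonneg [simp]: "\<beta> t \<ge> 0"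
  and beta'_pos_iff [simp]: "\<beta>' t > 0 \<longleftrightarrow> t > 0" and beta'_nonneg [simp]: "\<beta>' t \<ge> 0"
  and beta_eq_0_iff [simp]: "\<beta> t = 0 \<longleftrightarrow> t \<le> 0" and beta'_eq_0_iff [simp]: "\<beta>' t = 0 \<longleftrightarrow> t \<le> 0"
  and beta_le_1: "\<beta> t \<le> 1"
  by (auto simp: \<beta>_def \<beta>'_def)

text \<open>With s = 1/t the claim reads s^2 exp(-s) \<le> 2, and exp s \<ge> s^2/2. The same 2 is
  later the Lipschitz constant of \<beta>.\<close>

lemma beta'_le_2: "\<beta>' t \<le> 2"
proof (cases "t > 0")
  case True
  let ?s = "inverse t"
  have "?s\<^sup>2 / 2 \<le> exp ?s"
    using exp_lower_Taylor_quadratic[of ?s] True by (smt (verit) inverse_positive_iff_positive)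
  then show ?thesis
    using True by (simp add: \<beta>'_def exp_minus field_simps)
qed (simp add: \<beta>'_def)

text \<open>A smooth step from 0 to 1. The rise starts at 1/2 rather than at 0, so the step vanishes
  near 0, and composing it with a function that is zero on the boundary gives a support away from
  the boundary.\<close>

definition \<kappa> :: "real \<Rightarrow> real" where
  "\<kappa> t = \<beta> (t - 1/2) * inverse (\<beta> (t - 1/2) + \<beta> (1 - t))"

lemma kappa_denominator_pos: "\<beta> (t - 1/2) + \<beta> (1 - t) > 0"
proof (cases "t > 1/2")
  case True
  then have "\<beta> (t - 1/2) > 0" by simp
  then show ?thesis using beta_nonneg[of "1-t"] by linarith
next
  case False
  then have "\<beta> (1 - t) > 0" by simp
  then show ?thesis using beta_nonneg[of "t-1/2"] by linarith
qed

lemma smooth_on_affine: "smooth_on UNIV (\<lambda>t::real. a * t + b)"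
  by (intro smooth_on_add smooth_on_mult) auto

lemma smooth_kappa: "smooth_on UNIV \<kappa>"
proof -
  have 1: "smooth_on UNIV (\<lambda>t. \<beta> (a * t + b))" for a b
    by (rule smooth_on_compose[OF _ smooth_beta smooth_on_affine]) auto
  have 2: "smooth_on UNIV (\<lambda>t. \<beta> (t - 1/2))" "smooth_on UNIV (\<lambda>t. \<beta> (1 - t))"
    using 1[of 1 "-1/2"] 1[of "-1" 1] by simp_all
  have "smooth_on UNIV (\<lambda>t. inverse (\<beta> (t - 1/2) + \<beta> (1 - t)))"
    by (rule smooth_on_compose[OF _ smooth_on_inverse smooth_on_add[OF _ 2]])
      (use kappa_denominator_pos in auto)
  then have "smooth_on UNIV (\<lambda>t. \<beta> (t - 1/2) * inverse (\<beta> (t - 1/2) + \<beta> (1 - t)))"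
    by (rule smooth_on_mult[OF open_UNIV 2(1)])
  then show ?thesis
    by (simp add: \<kappa>_def[abs_def])
qed

lemma kappa_eq_0: "t \<le> 1/2 \<Longrightarrow> \<kappa> t = 0" and kappa_eq_1: "t \<ge> 1 \<Longrightarrow> \<kappa> t = 1"
  and kappa_nonneg: "0 \<le> \<kappa> t" and kappa_le_1: "\<kappa> t \<le> 1"
  using kappa_denominator_pos[of t] beta_nonneg[of "1 - t"] by (auto simp: \<kappa>_def field_simps)

text \<open>The argument of \<open>\<kappa>\<close> is at least \<open>1\<close> on \<open>cball p r\<close> and at most \<open>0\<close> off \<open>cball p (2 r)\<close>.\<close>

definition bump :: "'a::euclidean_space \<Rightarrow> real \<Rightarrow> 'a \<Rightarrow> real" where
  "bump p r x = \<kappa> ((4 * r\<^sup>2 - (norm (x - p))\<^sup>2) / (3 * r\<^sup>2))"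

lemma smooth_bump: "smooth_on UNIV (bump p r)"
proof -
  have "smooth_on UNIV (\<lambda>x. \<kappa> ((inverse (3 * r\<^sup>2)) * (4 * r\<^sup>2 - (norm (x - p))\<^sup>2)))"
    by (intro smooth_on_compose[OF _ smooth_kappa] smooth_on_cmult smooth_on_diff) auto
  moreover have "bump p r = (\<lambda>x. \<kappa> ((inverse (3 * r\<^sup>2)) * (4 * r\<^sup>2 - (norm (x - p))\<^sup>2)))"
    unfolding bump_def[abs_def] divide_inverse_commute ..
  ultimately show ?thesis by simp
qed

lemma bump_eq_1: assumes "r > 0" "x \<in> cball p r" shows "bump p r x = 1"
proof -
  have "(norm (x - p))\<^sup>2 \<le> r\<^sup>2"
    using assms by (intro power_mono) (auto simp: dist_norm norm_minus_commute)
  then show ?thesis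
    unfolding bump_def using assms by (intro kappa_eq_1) (simp add: field_simps)
qed

lemma bump_eq_0: assumes "r > 0" "x \<notin> cball p (2 * r)" shows "bump p r x = 0"
proof -
  have "(2 * r)\<^sup>2 \<le> (norm (x - p))\<^sup>2"
    using assms by (intro power_mono) (auto simp: dist_norm norm_minus_commute)
  then have "(4 * r\<^sup>2 - (norm (x - p))\<^sup>2) / (3 * r\<^sup>2) \<le> 0"
    using assms by (intro divide_nonpos_pos) (auto simp: power_mult_distrib)
  then show ?thesis
    unfolding bump_def by (intro kappa_eq_0) linarith
qed

section \<open>Supports, extension by zero and partitions of unity\<close>

definition supp :: "('a::topological_space \<Rightarrow> real) \<Rightarrow> 'a set" where
  "supp f = closure {x. f x \<noteq> 0}"

lemma supp_subset: "closed S \<Longrightarrow> (\<And>x. x \<notin> S \<Longrightarrow> f x = 0) \<Longrightarrow> supp f \<subseteq> S"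
  unfolding supp_def by (rule closure_minimal) auto

lemma not_in_supp: "x \<notin> supp f \<Longrightarrow> f x = 0"
  unfolding supp_def using closure_subset[of "{x. f x \<noteq> 0}"] by auto

lemma closed_supp [simp]: "closed (supp f)"
  by (simp add: supp_def)

lemma supp_bump: "r > 0 \<Longrightarrow> supp (bump p r) \<subseteq> cball p (2 * r)"
  using bump_eq_0 by (intro supp_subset) auto

lemma test_functions_iff:
  "\<eta> \<in> test_functions \<Omega> \<longleftrightarrow> smooth_on UNIV \<eta> \<and> compact (supp \<eta>) \<and> supp \<eta> \<subseteq> \<Omega>"
  unfolding test_functions_def supp_def by simp

lemma test_functionsI:
  assumes "smooth_on UNIV \<eta>" "compact K" "K \<subseteq> \<Omega>" "\<And>x. x \<notin> K \<Longrightarrow> \<eta> x = 0"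
  shows "\<eta> \<in> test_functions \<Omega>"
proof -
  have "supp \<eta> \<subseteq> K"
    using assms compact_imp_closed by (intro supp_subset) auto
  moreover have "compact (supp \<eta>)"
    using compact_Int_closed[OF assms(2) closed_supp[of \<eta>]] calculation by (simp add: Int_absorb1)
  ultimately show ?thesis
    using assms(1,3) unfolding test_functions_iff by blast
qed

text \<open>The open sets \<open>U\<close> and \<open>- supp \<theta>\<close> cover the space; on
  the second the extended function is identically zero.\<close>

lemma smooth_on_extend_zero:
  assumes "open U" "smooth_on UNIV \<theta>" "supp \<theta> \<subseteq> U" "smooth_on U g"
  shows "smooth_on UNIV (\<lambda>x. if x \<in> U then \<theta> x * g x else 0)"
proof (rule smooth_on_local)
  fix x :: 'a
  show "\<exists>V. open V \<and> x \<in> V \<and> smooth_on V (\<lambda>x. if x \<in> U then \<theta> x * g x else 0)"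
  proof (cases "x \<in> U")
    case True
    have *: "smooth_on U (\<lambda>x. \<theta> x * g x)"
      using smooth_on_mult[OF assms(1) smooth_on_subset[OF assms(2)] assms(4)] by simp
    show ?thesis
      using True assms(1) smooth_on_cong[OF assms(1) _ *,
          of "\<lambda>x. if x \<in> U then \<theta> x * g x else 0"] by (intro exI[of _ U]) simp
  next
    case False
    have "smooth_on (- supp \<theta>) (\<lambda>x. if x \<in> U then \<theta> x * g x else 0)"
      by (rule smooth_on_cong[of "- supp \<theta>" "\<lambda>_. 0"]) (auto simp: open_Compl not_in_supp)
    then show ?thesis
      using False assms(3) by (intro exI[of _ "- supp \<theta>"]) (auto simp: open_Compl)
  qed
qed

text \<open>Multiplication by a bump exchanges local data for a globally smooth function without
  changing it near \<open>p\<close>. This allows calculus on the whole space for functions given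
  only near a boundary point.\<close>

lemma smooth_on_extend_local:
  fixes p :: "'a::euclidean_space"
  assumes "open U" "p \<in> U" "smooth_on U g"
  obtains r h where "r > 0" "cball p r \<subseteq> U" "smooth_on UNIV h" "\<And>x. x \<in> cball p r \<Longrightarrow> h x = g x"
proof -
  obtain e where e: "e > 0" "cball p e \<subseteq> U"
    using assms open_contains_cball by blast
  let ?h = "\<lambda>x. if x \<in> U then bump p (e/2) x * g x else 0"
  have "supp (bump p (e/2)) \<subseteq> U" using supp_bump[of "e/2" p] e by auto
  then have "smooth_on UNIV ?h"
    by (intro smooth_on_extend_zero assms smooth_bump)
  moreover have "?h x = g x" if "x \<in> cball p (e/2)" for x
  proof -
    have "x \<in> cball p e" using that e by auto
    then have "x \<in> U" using e by blast
    then show ?thesis using e that bump_eq_1[of "e/2" x p] by auto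
  qed
  moreover have "cball p (e/2) \<subseteq> U" using e by auto
  ultimately show ?thesis using e by (intro that[of "e/2" ?h]) auto
qed

text \<open>A partition of unity in the form of an induction principle: a property of cutoffs that is additive
  and holds for cutoffs with small support holds for a cutoff equal to \<open>1\<close> on a compact set.\<close>

lemma smooth_localize:
  fixes K :: "'a::euclidean_space set"
  assumes "compact K" and Q0: "Q (\<lambda>x. 0)"
    and add: "\<And>f g. Q f \<Longrightarrow> Q g \<Longrightarrow> Q (\<lambda>x. f x + g x)"
    and loc: "\<And>p. p \<in> K \<Longrightarrow> \<exists>U. open U \<and> p \<in> U \<and>
      (\<forall>\<theta>. smooth_on UNIV \<theta> \<and> compact (supp \<theta>) \<and> supp \<theta> \<subseteq> U \<longrightarrow> Q \<theta>)"
  obtains \<theta> where "smooth_on UNIV \<theta>" "\<And>x. x \<in> K \<Longrightarrow> \<theta> x = 1" "Q \<theta>"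
proof -
  have "\<forall>p\<in>K. \<exists>r>0. \<forall>\<theta>. smooth_on UNIV \<theta> \<and> compact (supp \<theta>) \<and> supp \<theta> \<subseteq> cball p (2 * r) \<longrightarrow> Q \<theta>"
  proof
    fix p assume p: "p \<in> K"
    obtain U where U: "open U" "p \<in> U" "\<forall>\<theta>. smooth_on UNIV \<theta> \<and> compact (supp \<theta>) \<and> supp \<theta> \<subseteq> U \<longrightarrow> Q \<theta>"
      using loc[OF p] by blast
    obtain e where e: "e > 0" "cball p e \<subseteq> U"
      using U open_contains_cball by blast
    have "Q \<theta>" if "smooth_on UNIV \<theta> \<and> compact (supp \<theta>) \<and> supp \<theta> \<subseteq> cball p (2 * (e/2))" for \<theta>
      using that e(2) U(3) by auto
    then show "\<exists>r>0. \<forall>\<theta>. smooth_on UNIV \<theta> \<and> compact (supp \<theta>) \<and> supp \<theta> \<subseteq> cball p (2 * r) \<longrightarrow> Q \<theta>"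
      using e(1) by (intro exI[of _ "e/2"]) auto
  qed
  from bchoice[OF this] obtain r where r: "\<And>p. p \<in> K \<Longrightarrow> r p > 0"
    "\<And>p \<theta>. p \<in> K \<Longrightarrow> smooth_on UNIV \<theta> \<Longrightarrow> compact (supp \<theta>) \<Longrightarrow> supp \<theta> \<subseteq> cball p (2 * r p) \<Longrightarrow> Q \<theta>"
    by auto
  have "K \<subseteq> (\<Union>p\<in>K. ball p (r p))" using r(1) by auto
  then obtain S where S: "S \<subseteq> K" "finite S" "K \<subseteq> (\<Union>p\<in>S. ball p (r p))"
    by (rule compactE_image[OF assms(1) open_ball])
  have "\<exists>\<theta>. smooth_on UNIV \<theta> \<and> (\<forall>x\<in>(\<Union>p\<in>S. ball p (r p)). \<theta> x = 1) \<and> Q \<theta>"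
    using S(2,1)
  proof (induction S)
    case empty
    then show ?case using Q0 by (auto intro!: exI[of _ "\<lambda>_. 0"])
  next
    case (insert p S)
    then obtain \<theta> where t: "smooth_on UNIV \<theta>" "\<And>x. x\<in>(\<Union>p\<in>S. ball p (r p)) \<Longrightarrow> \<theta> x = 1" "Q \<theta>"
      by blast
    have rp: "p \<in> K" "r p > 0" using insert r by auto
    \<comment> \<open>The new cutoff is \<theta> + b (1 - \<theta>) = 1 - (1 - \<theta>)(1 - b) with
      b the bump, which equals 1 wherever one of the two does.\<close>
    let ?f = "\<lambda>x. bump p (r p) x * (1 - \<theta> x)"
    have f: "smooth_on UNIV ?f"
      using t by (intro smooth_on_mult smooth_on_diff smooth_bump) auto
    have "supp ?f \<subseteq> cball p (2 * r p)"
      by (rule supp_subset) (use bump_eq_0 rp in auto)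
    moreover from this have "compact (supp ?f)"
      using compact_Int_closed[OF compact_cball closed_supp[of ?f]] by (metis Int_absorb1)
    ultimately have "Q ?f" using r(2)[OF rp(1) f] by blast
    then have "Q (\<lambda>x. \<theta> x + ?f x)" using add t by blast
    moreover have "smooth_on UNIV (\<lambda>x. \<theta> x + ?f x)" using f t by (intro smooth_on_add) auto
    moreover have "\<theta> x + ?f x = 1" if "x \<in> (\<Union>p\<in>insert p S. ball p (r p))" for x
      using that t(2)[of x] bump_eq_1[OF rp(2), of x p] by (cases "x \<in> ball p (r p)") auto
    ultimately show ?case by blast
  qed
  then obtain \<theta> where t: "smooth_on UNIV \<theta>" "\<forall>x\<in>(\<Union>p\<in>S. ball p (r p)). \<theta> x = 1" "Q \<theta>"
    by (elim exE conjE)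
  show ?thesis
    by (rule that[OF t(1) _ t(3)]) (use t(2) S(3) in blast)
qed

text \<open>The additive property of cutoffs is that \<theta> f, restricted to \<open>K\<close>, has
  a smooth extension. It holds for small supports by assumption, and for a cutoff equal to 1 on
  \<open>K\<close> it is the claim.\<close>

lemma smooth_extension:
  fixes K :: "'a::euclidean_space set"
  assumes "compact K" "smooth_fun_on_subset K f"
  obtains F where "smooth_on UNIV F" "\<And>x. x \<in> K \<Longrightarrow> F x = f x"
proof -
  let ?Q = "\<lambda>\<theta>. \<exists>g. smooth_on UNIV g \<and> (\<forall>x\<in>K. g x = \<theta> x * f x)"
  obtain \<theta> where "smooth_on UNIV \<theta>" "\<And>x. x \<in> K \<Longrightarrow> \<theta> x = 1" "?Q \<theta>"
  proof (rule smooth_localize[OF assms(1), of ?Q])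
    show "?Q (\<lambda>x. 0)" by (rule exI[of _ "\<lambda>_. 0"]) auto
  next
    fix a b assume "?Q a" "?Q b"
    then obtain g h where gh: "smooth_on UNIV g" "\<forall>x\<in>K. g x = a x * f x" "smooth_on UNIV h" "\<forall>x\<in>K. h x = b x * f x"
      by blast
    then show "?Q (\<lambda>x. a x + b x)"
      by (intro exI[of _ "\<lambda>x. g x + h x"]) (auto intro: smooth_on_add simp: algebra_simps)
  next
    fix p assume p: "p \<in> K"
    obtain U g where U: "open U" "p \<in> U" "smooth_on U g" "\<forall>x\<in>K \<inter> U. g x = f x"
      using assms(2) p unfolding smooth_fun_on_subset_def by blast
    have "?Q \<theta>" if t: "smooth_on UNIV \<theta>" "supp \<theta> \<subseteq> U" for \<theta>
      using smooth_on_extend_zero[OF U(1) t U(3)] U(4) not_in_supp[of _ \<theta>] t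
      by (intro exI[of _ "\<lambda>x. if x \<in> U then \<theta> x * g x else 0"]) auto
    then show "\<exists>U. open U \<and> p \<in> U \<and> (\<forall>\<theta>. smooth_on UNIV \<theta> \<and> compact (supp \<theta>) \<and> supp \<theta> \<subseteq> U \<longrightarrow> ?Q \<theta>)"
      using U by blast
  qed blast
  then obtain g where "smooth_on UNIV g" "\<forall>x\<in>K. g x = \<theta> x * f x" by blast
  then show ?thesis using \<open>\<And>x. x \<in> K \<Longrightarrow> \<theta> x = 1\<close> by (intro that[of g]) auto
qed

section \<open>Square integrable functions\<close>

definition sqi :: "'a measure \<Rightarrow> ('a \<Rightarrow> 'b::euclidean_space) \<Rightarrow> bool" where
  "sqi M f \<longleftrightarrow> f \<in> borel_measurable M \<and> integrable M (\<lambda>x. (norm (f x))\<^sup>2)"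

text \<open>The norm is kept squared: the functionals of the proof are quadratic, and their
  expansions and midpoint identities are then polynomial.\<close>

definition nsq :: "'a measure \<Rightarrow> ('a \<Rightarrow> 'b::euclidean_space) \<Rightarrow> real" where
  "nsq M f = (\<integral>x. (norm (f x))\<^sup>2 \<partial>M)"

lemma L2_on_iff: "f \<in> L2_on \<Omega> \<longleftrightarrow> sqi (lebesgue_on \<Omega>) f"
  by (simp add: L2_on_def sqi_def)

lemma norm_add_square_le: "(norm (a + b))\<^sup>2 \<le> 2 * (norm a)\<^sup>2 + 2 * (norm (b::'b::real_inner))\<^sup>2"
  using inner_ge_zero[of "a - b"] by (simp add: power2_norm_eq_inner algebra_simps inner_commute)

lemma norm_diff_square_le: "(norm (a - b))\<^sup>2 \<le> 2 * (norm a)\<^sup>2 + 2 * (norm (b::'b::real_inner))\<^sup>2"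
  using norm_add_square_le[of a "- b"] by simp

lemma abs_inner_le_squares: "\<bar>a \<bullet> b\<bar> \<le> (norm a)\<^sup>2 + (norm (b::'b::real_inner))\<^sup>2"
proof -
  have "\<bar>a \<bullet> b\<bar> \<le> norm a * norm b" by (rule Cauchy_Schwarz_ineq2)
  also have "\<dots> \<le> (norm a)\<^sup>2 + (norm b)\<^sup>2"
    using sum_squares_bound[of "norm a" "norm b"] mult_nonneg_nonneg[OF norm_ge_zero[of a] norm_ge_zero[of b]]
    by linarith
  finally show ?thesis .
qed

lemma sqi_measurable [measurable_dest]: "sqi M f \<Longrightarrow> f \<in> borel_measurable M"
  by (simp add: sqi_def)

lemma sqi_integrable: "sqi M f \<Longrightarrow> integrable M (\<lambda>x. (norm (f x))\<^sup>2)"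
  by (simp add: sqi_def)

lemma sqi_bound:
  assumes "f \<in> borel_measurable M" "integrable M g" "AE x in M. (norm (f x))\<^sup>2 \<le> g x"
  shows "sqi M f"
  unfolding sqi_def
proof
  show "integrable M (\<lambda>x. (norm (f x))\<^sup>2)"
    by (rule Bochner_Integration.integrable_bound[OF assms(2)]) (use assms(1,3) in auto)
qed fact

lemma sqi_add: assumes "sqi M f" "sqi M g" shows "sqi M (\<lambda>x. f x + g x)"
proof (rule sqi_bound)
  show "integrable M (\<lambda>x. 2 * (norm (f x))\<^sup>2 + 2 * (norm (g x))\<^sup>2)"
    using assms sqi_integrable by (intro Bochner_Integration.integrable_add) auto
qed (use assms norm_add_square_le in \<open>auto simp: sqi_measurable\<close>)

lemma sqi_scaleR: "sqi M f \<Longrightarrow> sqi M (\<lambda>x. c *\<^sub>R f x)"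
  by (auto simp: sqi_def power_mult_distrib)

lemma sqi_diff: assumes "sqi M f" "sqi M g" shows "sqi M (\<lambda>x. f x - g x)"
  using sqi_add[OF assms(1) sqi_scaleR[OF assms(2), of "-1"]] by simp

lemma sqi_zero [simp]: "sqi M (\<lambda>x. 0)"
  by (simp add: sqi_def)

lemma sqi_inner:
  assumes "sqi M f" "sqi M g" shows "integrable M (\<lambda>x. f x \<bullet> g x)"
proof (rule Bochner_Integration.integrable_bound)
  show "integrable M (\<lambda>x. (norm (f x))\<^sup>2 + (norm (g x))\<^sup>2)"
    using assms sqi_integrable by (intro Bochner_Integration.integrable_add) auto
qed (use assms abs_inner_le_squares in \<open>auto simp: sqi_measurable intro!: AE_I2 order_trans[OF abs_inner_le_squares]\<close>)

lemma sqi_mult: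
  fixes f g :: "'a \<Rightarrow> real"
  shows "sqi M f \<Longrightarrow> sqi M g \<Longrightarrow> integrable M (\<lambda>x. f x * g x)"
  using sqi_inner[of M f g] by simp

lemma sqi_bounded_scaleR:
  assumes "h \<in> borel_measurable M" "AE x in M. \<bar>h x\<bar> \<le> B" "sqi M f"
  shows "sqi M (\<lambda>x. h x *\<^sub>R f x)"
proof (rule sqi_bound)
  show "integrable M (\<lambda>x. B\<^sup>2 * (norm (f x))\<^sup>2)"
    using assms sqi_integrable by auto
  show "AE x in M. (norm (h x *\<^sub>R f x))\<^sup>2 \<le> B\<^sup>2 * (norm (f x))\<^sup>2"
    using assms(2)
  proof eventually_elim
    case (elim x)
    then have "\<bar>h x\<bar>\<^sup>2 \<le> B\<^sup>2" by (intro power_mono) auto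
    then show ?case by (simp add: power_mult_distrib mult_right_mono)
  qed
qed (use assms sqi_measurable in auto)

lemma sqi_const:
  assumes "finite_measure M" shows "sqi M (\<lambda>x. c)"
  using finite_measure.integrable_const[OF assms] by (simp add: sqi_def)

lemma (in finite_measure) sqi_imp_integrable:
  assumes "sqi M f" shows "integrable M f"
proof (rule Bochner_Integration.integrable_bound)
  show "integrable M (\<lambda>x. 1 + (norm (f x))\<^sup>2)"
    using assms sqi_integrable by (intro Bochner_Integration.integrable_add) auto
  show "AE x in M. norm (f x) \<le> norm (1 + (norm (f x))\<^sup>2)"
  proof (rule AE_I2)
    fix x
    have "0 \<le> (norm (f x) - 1)\<^sup>2" by simp
    then show "norm (f x) \<le> norm (1 + (norm (f x))\<^sup>2)"
      unfolding power2_diff using zero_le_power2[of "norm (f x)"] by (simp, linarith)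
  qed
qed (use assms in \<open>auto simp: sqi_measurable\<close>)

lemma nsq_nonneg [simp]: "0 \<le> nsq M f"
  unfolding nsq_def by simp

lemma nsq_eq_inner: "nsq M f = (\<integral>x. f x \<bullet> f x \<partial>M)"
  unfolding nsq_def power2_norm_eq_inner ..

lemma nsq_scaleR: "nsq M (\<lambda>x. c *\<^sub>R f x) = c\<^sup>2 * nsq M f"
  by (simp add: nsq_def power_mult_distrib)

lemma nsq_cong_AE:
  assumes "sqi M f" "sqi M g" "AE x in M. f x = g x" shows "nsq M f = nsq M g"
  unfolding nsq_def by (rule integral_cong_AE) (use assms sqi_measurable in auto)

lemma nsq_add_le:
  assumes "sqi M f" "sqi M g" shows "nsq M (\<lambda>x. f x + g x) \<le> 2 * nsq M f + 2 * nsq M g"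
proof -
  have "nsq M (\<lambda>x. f x + g x) \<le> (\<integral>x. 2 * (norm (f x))\<^sup>2 + 2 * (norm (g x))\<^sup>2 \<partial>M)"
    unfolding nsq_def
    by (intro integral_mono norm_add_square_le sqi_integrable[OF sqi_add[OF assms]])
      (use assms sqi_integrable in \<open>auto intro!: Bochner_Integration.integrable_add\<close>)
  also have "\<dots> = 2 * nsq M f + 2 * nsq M g"
    using assms sqi_integrable unfolding nsq_def by (subst Bochner_Integration.integral_add) auto
  finally show ?thesis .
qed

lemma nsq_minus_commute: "nsq M (\<lambda>x. f x - g x) = nsq M (\<lambda>x. g x - f x)"
  unfolding nsq_def by (simp add: norm_minus_commute)

lemma nsq_triangle_le:
  assumes "sqi M f" "sqi M g" "sqi M h"
  shows "nsq M (\<lambda>x. f x - h x) \<le> 2 * nsq M (\<lambda>x. f x - g x) + 2 * nsq M (\<lambda>x. g x - h x)"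
  using nsq_add_le[OF sqi_diff[OF assms(1,2)] sqi_diff[OF assms(2,3)]] by simp

lemma nsq_add_eq:
  assumes "sqi M f" "sqi M g"
  shows "nsq M (\<lambda>x. f x + g x) = nsq M f + 2 * (\<integral>x. f x \<bullet> g x \<partial>M) + nsq M g"
proof -
  have "nsq M (\<lambda>x. f x + g x) = (\<integral>x. (norm (f x))\<^sup>2 + 2 * (f x \<bullet> g x) + (norm (g x))\<^sup>2 \<partial>M)"
    unfolding nsq_def power2_norm_eq_inner
    by (rule Bochner_Integration.integral_cong) (auto simp: inner_add inner_commute)
  also have "\<dots> = nsq M f + 2 * (\<integral>x. f x \<bullet> g x \<partial>M) + nsq M g"
    unfolding nsq_def using assms sqi_integrable sqi_inner[OF assms]
    by (subst Bochner_Integration.integral_add, auto)+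
  finally show ?thesis .
qed

text \<open>Besides Cauchy-Schwarz, this yields the Euler-Lagrange equations: for a = 0 the
  conclusion forces b = 0, so a minimum along a line has no linear term.\<close>

lemma quadratic_nonneg_discriminant:
  fixes a b c :: real
  assumes "\<And>t. a + 2 * t * b + t\<^sup>2 * c \<ge> 0" "c \<ge> 0"
  shows "b\<^sup>2 \<le> a * c"
proof (cases "c = 0")
  case True
  have "b = 0"
  proof (rule ccontr)
    assume "b \<noteq> 0"
    \<comment> \<open>At this \<open>t\<close> the expression equals -1.\<close>
    then show False using assms(1)[of "- (a + 1) / (2 * b)"] True by (simp add: field_simps)
  qed
  then show ?thesis using True by simp
next
  case False
  then have c: "c > 0" using assms by simp
  have "a + 2 * (- b / c) * b + (- b / c)\<^sup>2 * c \<ge> 0" by (rule assms(1))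
  then show ?thesis using c by (simp add: field_simps power2_eq_square)
qed

lemma nsq_Cauchy_Schwarz:
  assumes "sqi M f" "sqi M g"
  shows "(\<integral>x. f x \<bullet> g x \<partial>M)\<^sup>2 \<le> nsq M f * nsq M g"
proof (rule quadratic_nonneg_discriminant)
  fix t
  show "0 \<le> nsq M f + 2 * t * (\<integral>x. f x \<bullet> g x \<partial>M) + t\<^sup>2 * nsq M g"
    using nsq_add_eq[OF assms(1) sqi_scaleR[OF assms(2), of t]] nsq_nonneg[of M "\<lambda>x. f x + t *\<^sub>R g x"]
    by (simp add: nsq_scaleR)
qed simp

lemma nsq_Cauchy_Schwarz_abs:
  assumes "sqi M f" "sqi M g"
  shows "\<bar>\<integral>x. f x \<bullet> g x \<partial>M\<bar> \<le> sqrt (nsq M f) * sqrt (nsq M g)"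
  using real_sqrt_le_mono[OF nsq_Cauchy_Schwarz[OF assms]] by (simp add: real_sqrt_mult)

lemma sqi_tendsto_inner_const:
  assumes "\<And>n. sqi M (f n)" "sqi M f'" "sqi M g" "(\<lambda>n. nsq M (\<lambda>x. f n x - f' x)) \<longlonglongrightarrow> 0"
  shows "(\<lambda>n. \<integral>x. f n x \<bullet> g x \<partial>M) \<longlonglongrightarrow> (\<integral>x. f' x \<bullet> g x \<partial>M)"
proof -
  have "(\<lambda>n. (\<integral>x. f n x \<bullet> g x \<partial>M) - (\<integral>x. f' x \<bullet> g x \<partial>M)) \<longlonglongrightarrow> 0"
  proof (rule Lim_null_comparison)
    show "\<forall>\<^sub>F n in sequentially. norm ((\<integral>x. f n x \<bullet> g x \<partial>M) - (\<integral>x. f' x \<bullet> g x \<partial>M))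
        \<le> sqrt (nsq M (\<lambda>x. f n x - f' x)) * sqrt (nsq M g)"
    proof (rule always_eventually, rule allI)
      fix n
      have "(\<integral>x. f n x \<bullet> g x \<partial>M) - (\<integral>x. f' x \<bullet> g x \<partial>M) = (\<integral>x. (f n x - f' x) \<bullet> g x \<partial>M)"
        unfolding inner_diff_left by (rule Bochner_Integration.integral_diff[symmetric]) (intro sqi_inner assms)+
      then show "norm ((\<integral>x. f n x \<bullet> g x \<partial>M) - (\<integral>x. f' x \<bullet> g x \<partial>M))
          \<le> sqrt (nsq M (\<lambda>x. f n x - f' x)) * sqrt (nsq M g)"
        using nsq_Cauchy_Schwarz_abs[OF sqi_diff[OF assms(1,2)] assms(3)] by simp
    qed
    have "(\<lambda>n. sqrt (nsq M (\<lambda>x. f n x - f' x)) * sqrt (nsq M g)) \<longlonglongrightarrow> sqrt 0 * sqrt (nsq M g)"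
      by (intro tendsto_intros assms(4))
    then show "(\<lambda>n. sqrt (nsq M (\<lambda>x. f n x - f' x)) * sqrt (nsq M g)) \<longlonglongrightarrow> 0" by simp
  qed
  then show ?thesis by (rule LIM_zero_cancel)
qed

lemma nsq_tendsto:
  assumes "\<And>n. sqi M (f n)" "sqi M f'" "(\<lambda>n. nsq M (\<lambda>x. f n x - f' x)) \<longlonglongrightarrow> 0"
  shows "(\<lambda>n. nsq M (f n)) \<longlonglongrightarrow> nsq M f'"
proof -
  have "nsq M (f n) = nsq M (\<lambda>x. f n x - f' x) + 2 * (\<integral>x. f n x \<bullet> f' x \<partial>M) - nsq M f'" for n
  proof -
    have "nsq M (f n) = nsq M (\<lambda>x. f n x - f' x) + 2 * (\<integral>x. (f n x - f' x) \<bullet> f' x \<partial>M) + nsq M f'"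
      using nsq_add_eq[OF sqi_diff[OF assms(1,2)] assms(2)] by simp
    also have "(\<integral>x. (f n x - f' x) \<bullet> f' x \<partial>M) = (\<integral>x. f n x \<bullet> f' x \<partial>M) - nsq M f'"
      unfolding inner_diff_left nsq_eq_inner
      by (rule Bochner_Integration.integral_diff) (intro sqi_inner assms)+
    finally show ?thesis by simp
  qed
  moreover have "(\<lambda>n. nsq M (\<lambda>x. f n x - f' x) + 2 * (\<integral>x. f n x \<bullet> f' x \<partial>M) - nsq M f') \<longlonglongrightarrow>
      0 + 2 * (\<integral>x. f' x \<bullet> f' x \<partial>M) - nsq M f'"
    by (intro tendsto_intros assms(3) sqi_tendsto_inner_const assms)
  ultimately show ?thesis by (simp add: nsq_eq_inner)
qed

lemma nsq_AE_subseq: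
  assumes "\<And>n. sqi M (f n)" "sqi M f'" "(\<lambda>n. nsq M (\<lambda>x. f n x - f' x)) \<longlonglongrightarrow> 0"
  obtains r where "strict_mono (r::nat\<Rightarrow>nat)" "AE x in M. (\<lambda>n. f (r n) x) \<longlonglongrightarrow> f' x"
proof -
  have i: "integrable M (\<lambda>x. (norm (f n x - f' x))\<^sup>2)" for n
    by (rule sqi_integrable[OF sqi_diff[OF assms(1,2)]])
  have l: "(\<lambda>n. \<integral>x. norm ((norm (f n x - f' x))\<^sup>2) \<partial>M) \<longlonglongrightarrow> 0" using assms(3) unfolding nsq_def by simp
  from tendsto_L1_AE_subseq[of M "\<lambda>n x. (norm (f n x - f' x))\<^sup>2", OF i l]
  obtain r :: "nat \<Rightarrow> nat" where r: "strict_mono r" "AE x in M. (\<lambda>n. (norm (f (r n) x - f' x))\<^sup>2) \<longlonglongrightarrow> 0"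
    by blast
  have "AE x in M. (\<lambda>n. f (r n) x) \<longlonglongrightarrow> f' x"
    using r(2)
  proof eventually_elim
    case (elim x)
    from tendsto_real_sqrt[OF this] show ?case
      by (simp add: tendsto_norm_zero_iff LIM_zero_iff)
  qed
  with r(1) show ?thesis by (rule that)
qed

lemma (in finite_measure) L1_le_nsq:
  assumes "sqi M f" shows "(\<integral>x. norm (f x) \<partial>M) \<le> sqrt (measure M (space M)) * sqrt (nsq M f)"
proof -
  have "sqi M (\<lambda>x. 1::real)" by (rule sqi_const) unfold_locales
  moreover have "sqi M (\<lambda>x. norm (f x))" using assms by (auto simp: sqi_def)
  ultimately have "\<bar>\<integral>x. 1 \<bullet> norm (f x) \<partial>M\<bar> \<le> sqrt (nsq M (\<lambda>x. 1::real)) * sqrt (nsq M (\<lambda>x. norm (f x)))"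
    by (rule nsq_Cauchy_Schwarz_abs)
  then show ?thesis by (simp add: nsq_def)
qed

text \<open>The Riesz-Fischer argument on a finite measure space: an L^2 Cauchy sequence is Cauchy
  in L^1 and so has an almost everywhere convergent subsequence, whose pointwise limit is the L^2
  limit by Fatou's lemma.\<close>

lemma (in finite_measure) sqi_complete:
  fixes f :: "nat \<Rightarrow> 'a \<Rightarrow> 'b::euclidean_space"
  assumes f: "\<And>n. sqi M (f n)"
    and C: "\<And>e. e > 0 \<Longrightarrow> \<exists>N. \<forall>m\<ge>N. \<forall>n\<ge>N. nsq M (\<lambda>x. f m x - f n x) < e"
  obtains g where "sqi M g" "(\<lambda>n. nsq M (\<lambda>x. f n x - g x)) \<longlonglongrightarrow> 0"
proof -
  \<comment> \<open>The summand 1 makes the divisor positive even on a null space.\<close>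
  let ?V = "measure M (space M) + 1"
  have V: "?V > 0" by (smt (verit) measure_nonneg)
  have L1: "\<exists>N. \<forall>i\<ge>N. \<forall>j\<ge>N. (\<integral>x. norm (f i x - f j x) \<partial>M) < e" if e: "e > 0" for e
  proof -
    have "e\<^sup>2 / ?V > 0" using e V by simp
    from C[OF this] obtain N where N: "\<And>m n. m \<ge> N \<Longrightarrow> n \<ge> N \<Longrightarrow> nsq M (\<lambda>x. f m x - f n x) < e\<^sup>2 / ?V"
      by blast
    have "(\<integral>x. norm (f i x - f j x) \<partial>M) < e" if "i \<ge> N" "j \<ge> N" for i j
    proof -
      have "(\<integral>x. norm (f i x - f j x) \<partial>M) \<le> sqrt (measure M (space M)) * sqrt (nsq M (\<lambda>x. f i x - f j x))"
        by (rule L1_le_nsq[OF sqi_diff[OF f f]])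
      also have "\<dots> \<le> sqrt ?V * sqrt (nsq M (\<lambda>x. f i x - f j x))"
        by (intro mult_right_mono) auto
      also have "\<dots> < sqrt ?V * sqrt (e\<^sup>2 / ?V)"
        using V N[OF that] by (intro mult_strict_left_mono) auto
      also have "\<dots> = e" using V e by (simp add: real_sqrt_divide)
      finally show ?thesis .
    qed
    then show ?thesis by blast
  qed
  obtain r where r: "strict_mono r" "AE x in M. Cauchy (\<lambda>i. f (r i) x)"
    by (rule cauchy_L1_AE_cauchy_subseq[of M f, OF sqi_imp_integrable[OF f] L1])
  have [measurable]: "f n \<in> borel_measurable M" for n using f by (rule sqi_measurable)
  define g where "g x = lim (\<lambda>i. f (r i) x)" for x
  have g[measurable]: "g \<in> borel_measurable M" unfolding g_def[abs_def] by measurable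
  have lim: "AE x in M. (\<lambda>i. f (r i) x) \<longlonglongrightarrow> g x"
    using r(2) by eventually_elim (auto simp: g_def Cauchy_convergent_iff convergent_LIMSEQ_iff)
  \<comment> \<open>For fixed \<open>n\<close>, Fatou's lemma along the subsequence carries the
    Cauchy bound over from \<open>f (r i)\<close> to \<open>g\<close>.\<close>
  have bd: "\<exists>N. \<forall>n\<ge>N. sqi M (\<lambda>x. f n x - g x) \<and> nsq M (\<lambda>x. f n x - g x) \<le> e" if e: "e > 0" for e
  proof -
    obtain N where N: "\<And>m n. m \<ge> N \<Longrightarrow> n \<ge> N \<Longrightarrow> nsq M (\<lambda>x. f m x - f n x) < e" using C[OF e] by blast
    have "sqi M (\<lambda>x. f n x - g x) \<and> nsq M (\<lambda>x. f n x - g x) \<le> e" if n: "n \<ge> N" for n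
    proof -
      have "(\<integral>\<^sup>+x. ennreal ((norm (f n x - g x))\<^sup>2) \<partial>M) = (\<integral>\<^sup>+x. liminf (\<lambda>i. ennreal ((norm (f n x - f (r i) x))\<^sup>2)) \<partial>M)"
      proof (rule nn_integral_cong_AE)
        show "AE x in M. ennreal ((norm (f n x - g x))\<^sup>2) = liminf (\<lambda>i. ennreal ((norm (f n x - f (r i) x))\<^sup>2))"
          using lim
        proof eventually_elim
          case (elim x)
          have "(\<lambda>i. ennreal ((norm (f n x - f (r i) x))\<^sup>2)) \<longlonglongrightarrow> ennreal ((norm (f n x - g x))\<^sup>2)"
            by (intro tendsto_intros tendsto_ennrealI elim)
          then show ?case by (intro lim_imp_Liminf[symmetric]) auto
        qed
      qed
      also have "\<dots> \<le> liminf (\<lambda>i. \<integral>\<^sup>+x. ennreal ((norm (f n x - f (r i) x))\<^sup>2) \<partial>M)"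
        by (rule nn_integral_liminf) measurable
      also have "\<dots> \<le> ennreal e"
      proof (rule Liminf_le)
        show "\<forall>\<^sub>F i in sequentially. (\<integral>\<^sup>+x. ennreal ((norm (f n x - f (r i) x))\<^sup>2) \<partial>M) \<le> ennreal e"
        proof (rule eventually_sequentiallyI[of N])
          fix i assume "i \<ge> N"
          then have "r i \<ge> N" using seq_suble[OF r(1), of i] by linarith
          have "(\<integral>\<^sup>+x. ennreal ((norm (f n x - f (r i) x))\<^sup>2) \<partial>M) = ennreal (nsq M (\<lambda>x. f n x - f (r i) x))"
            unfolding nsq_def by (rule nn_integral_eq_integral) (use sqi_integrable[OF sqi_diff[OF f f]] in auto)
          also have "\<dots> \<le> ennreal e" using N[OF n \<open>r i \<ge> N\<close>] by (intro ennreal_leI) simp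
          finally show "(\<integral>\<^sup>+x. ennreal ((norm (f n x - f (r i) x))\<^sup>2) \<partial>M) \<le> ennreal e" .
        qed
      qed simp
      finally have le: "(\<integral>\<^sup>+x. ennreal ((norm (f n x - g x))\<^sup>2) \<partial>M) \<le> ennreal e" .
      have "integrable M (\<lambda>x. (norm (f n x - g x))\<^sup>2)"
        by (rule integrableI_bounded) (use le in \<open>auto intro: order_le_less_trans\<close>)
      moreover from this have "ennreal (nsq M (\<lambda>x. f n x - g x)) \<le> ennreal e"
        unfolding nsq_def by (subst nn_integral_eq_integral[symmetric]) (use le in auto)
      ultimately show ?thesis using e by (simp add: sqi_def)
    qed
    then show ?thesis by blast
  qed
  obtain N where N: "sqi M (\<lambda>x. f N x - g x)" using bd[of 1] by auto
  have "sqi M g" using sqi_diff[OF f[of N] N] by simp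
  moreover have "(\<lambda>n. nsq M (\<lambda>x. f n x - g x)) \<longlonglongrightarrow> 0"
  proof (rule LIMSEQ_I)
    fix e :: real assume "e > 0"
    then obtain N where "\<forall>n\<ge>N. nsq M (\<lambda>x. f n x - g x) \<le> e/2" using bd[of "e/2"] by auto
    then show "\<exists>no. \<forall>n\<ge>no. norm (nsq M (\<lambda>x. f n x - g x) - 0) < e"
      using \<open>e > 0\<close> by (intro exI[of _ N]) force
  qed
  ultimately show ?thesis by (rule that)
qed

section \<open>Square integrable pairs\<close>

lemma sqi_fst: assumes "sqi M (z::'a \<Rightarrow> 'b::euclidean_space \<times> 'c::euclidean_space)" shows "sqi M (\<lambda>x. fst (z x))"
proof (rule sqi_bound[OF _ sqi_integrable[OF assms]])
  show "AE x in M. (norm (fst (z x)))\<^sup>2 \<le> (norm (z x))\<^sup>2"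
    using norm_fst_le[of "fst (z x)" "snd (z x)" for x] by (auto intro!: AE_I2 power_mono)
  show "(\<lambda>x. fst (z x)) \<in> borel_measurable M"
    by (rule measurable_compose[OF sqi_measurable[OF assms] borel_measurable_continuous_onI])
      (intro continuous_intros)
qed

lemma sqi_snd: assumes "sqi M (z::'a \<Rightarrow> 'b::euclidean_space \<times> 'c::euclidean_space)" shows "sqi M (\<lambda>x. snd (z x))"
proof (rule sqi_bound[OF _ sqi_integrable[OF assms]])
  show "AE x in M. (norm (snd (z x)))\<^sup>2 \<le> (norm (z x))\<^sup>2"
    using norm_snd_le[of "snd (z x)" "fst (z x)" for x] by (auto intro!: AE_I2 power_mono)
  show "(\<lambda>x. snd (z x)) \<in> borel_measurable M"
    by (rule measurable_compose[OF sqi_measurable[OF assms] borel_measurable_continuous_onI])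
      (intro continuous_intros)
qed

lemma norm_Pair_square: "(norm (a, b))\<^sup>2 = (norm a)\<^sup>2 + (norm b)\<^sup>2"
  by (simp add: norm_Pair)

lemma sqi_Pair:
  assumes "sqi M f" "sqi M g" shows "sqi M (\<lambda>x. (f x, g x))"
  using assms by (auto simp: sqi_def norm_Pair_square)

lemma nsq_Pair:
  assumes "sqi M f" "sqi M g" shows "nsq M (\<lambda>x. (f x, g x)) = nsq M f + nsq M g"
  using assms by (auto simp: sqi_def norm_Pair_square nsq_def)

lemma nsq_fst_snd:
  assumes "sqi M z" shows "nsq M z = nsq M (\<lambda>x. fst (z x)) + nsq M (\<lambda>x. snd (z x))"
  using nsq_Pair[OF sqi_fst[OF assms] sqi_snd[OF assms]] by simp

lemma (in finite_measure) sqi_bounded: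
  assumes "f \<in> borel_measurable M" "AE x in M. norm (f x) \<le> B"
  shows "sqi M f"
proof (rule sqi_bound[OF assms(1)])
  show "integrable M (\<lambda>x. B\<^sup>2)" by simp
  show "AE x in M. (norm (f x))\<^sup>2 \<le> B\<^sup>2" using assms(2) by eventually_elim (auto intro: power_mono)
qed

section \<open>Gradients and test functions\<close>

definition grad :: "('a::euclidean_space \<Rightarrow> real) \<Rightarrow> 'a \<Rightarrow> 'a" where
  "grad f x = (\<Sum>b\<in>Basis. frechet_derivative f (at x) b *\<^sub>R b)"

text \<open>The graph of the gradient. The squared L^2 norm of \<open>gr f\<close> is the squared
  H^1 norm of \<open>f\<close>, so arguments in H^1 become arguments in L^2 about functions with
  values in pairs.\<close>

definition gr :: "('a::euclidean_space \<Rightarrow> real) \<Rightarrow> 'a \<Rightarrow> real \<times> 'a" where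
  "gr f x = (f x, grad f x)"

lemma fst_gr [simp]: "fst (gr f x) = f x" and snd_gr [simp]: "snd (gr f x) = grad f x"
  by (simp_all add: gr_def)

lemma grad_inner_Basis: "b \<in> Basis \<Longrightarrow> grad f x \<bullet> b = frechet_derivative f (at x) b"
  unfolding grad_def inner_sum_left
  by (simp add: inner_Basis if_distrib cong: if_cong)

lemma gradI:
  assumes "(f has_derivative (\<lambda>v. g \<bullet> v)) (at x)" shows "grad f x = g"
  by (rule euclidean_eqI) (simp add: grad_inner_Basis frechet_derivative_eqI[OF assms])

lemma differentiable_has_derivative_grad:
  assumes "f differentiable (at x)" shows "(f has_derivative (\<lambda>v. grad f x \<bullet> v)) (at x)"
proof -
  let ?D = "frechet_derivative f (at x)"
  have D: "(f has_derivative ?D) (at x)" using assms frechet_derivative_works by blast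
  interpret bounded_linear ?D by (rule has_derivative_bounded_linear[OF D])
  have "?D v = grad f x \<bullet> v" for v
  proof -
    have "?D v = ?D (\<Sum>b\<in>Basis. (v \<bullet> b) *\<^sub>R b)" by (simp only: euclidean_representation)
    also have "\<dots> = (\<Sum>b\<in>Basis. (v \<bullet> b) * ?D b)" by (simp add: sum scaleR)
    also have "\<dots> = grad f x \<bullet> v"
      unfolding grad_def inner_sum_left by (simp add: inner_commute mult.commute)
    finally show ?thesis .
  qed
  then have "?D = (\<lambda>v. grad f x \<bullet> v)" by (rule ext)
  from subst[OF this, of "\<lambda>F. (f has_derivative F) (at x)"] D show ?thesis by blast
qed

lemma smooth_has_derivative_grad:
  "smooth_on U f \<Longrightarrow> x \<in> U \<Longrightarrow> (f has_derivative (\<lambda>v. grad f x \<bullet> v)) (at x)"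
  by (rule differentiable_has_derivative_grad) (auto simp: differentiable_def dest: smooth_on_has_derivative)

lemma smooth_grad_inner:
  assumes "smooth_on UNIV f" shows "smooth_on UNIV (\<lambda>x. grad f x \<bullet> v)"
  using smooth_on_frechet_derivative[OF assms, of v]
    frechet_derivative_eqI[OF smooth_has_derivative_grad[OF assms UNIV_I]] by simp

lemma continuous_on_grad:
  assumes "smooth_on UNIV f" shows "continuous_on UNIV (grad f)"
  unfolding grad_def[abs_def]
  by (intro continuous_intros smooth_on_imp_continuous_on smooth_on_frechet_derivative assms)

lemma continuous_on_gr:
  assumes "smooth_on UNIV f" shows "continuous_on UNIV (gr f)"
  unfolding gr_def[abs_def]
  by (intro continuous_intros continuous_on_grad smooth_on_imp_continuous_on assms)

lemma grad_cong_open: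
  "open U \<Longrightarrow> x \<in> U \<Longrightarrow> (\<And>y. y \<in> U \<Longrightarrow> f y = g y) \<Longrightarrow> grad f x = grad g x"
  unfolding grad_def using frechet_derivative_cong_open[of U x f g] by simp

lemma grad_const [simp]: "grad (\<lambda>x. c) x = 0"
  by (rule gradI) simp

lemma grad_add:
  assumes "f differentiable (at x)" "g differentiable (at x)"
  shows "grad (\<lambda>x. f x + g x) x = grad f x + grad g x"
  by (rule gradI) (use has_derivative_add[OF assms[THEN differentiable_has_derivative_grad]] in \<open>simp add: inner_add_left\<close>)

lemma grad_mult:
  assumes "f differentiable (at x)" "g differentiable (at x)"
  shows "grad (\<lambda>x. f x * g x) x = f x *\<^sub>R grad g x + g x *\<^sub>R grad f x"
  by (rule gradI) (use has_derivative_mult[OF assms[THEN differentiable_has_derivative_grad]]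
    in \<open>simp add: inner_add_left mult.commute\<close>)

lemma grad_compose:
  fixes g :: "real \<Rightarrow> real"
  assumes "(g has_real_derivative g') (at (f x))" "f differentiable (at x)"
  shows "grad (\<lambda>x. g (f x)) x = g' *\<^sub>R grad f x"
  by (rule gradI) (use has_derivative_compose[OF differentiable_has_derivative_grad[OF assms(2)]
    assms(1)[THEN has_field_derivative_imp_has_derivative]] in \<open>simp\<close>)

lemma smooth_differentiable: "smooth_on UNIV f \<Longrightarrow> f differentiable (at x)"
  using smooth_on_has_derivative[of UNIV f x] by (auto simp: differentiable_def)

lemma gr_add:
  "smooth_on UNIV f \<Longrightarrow> smooth_on UNIV g \<Longrightarrow> gr (\<lambda>x. f x + g x) x = gr f x + gr g x"
  by (simp add: gr_def grad_add smooth_differentiable)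

lemma gr_cmult:
  "smooth_on UNIV f \<Longrightarrow> gr (\<lambda>x. c * f x) x = c *\<^sub>R gr f x"
  by (simp add: gr_def grad_mult[of "\<lambda>_. c" x f] smooth_differentiable)

lemma gr_mult:
  assumes "smooth_on UNIV f" "smooth_on UNIV g"
  shows "gr (\<lambda>x. f x * g x) x = (f x * g x, f x *\<^sub>R grad g x + g x *\<^sub>R grad f x)"
  by (simp add: gr_def grad_mult[OF assms[THEN smooth_differentiable]])

lemma gr_diff:
  assumes "smooth_on UNIV f" "smooth_on UNIV g" shows "gr (\<lambda>x. f x - g x) x = gr f x - gr g x"
  using gr_add[OF assms(1) smooth_on_cmult[OF open_UNIV assms(2)], of "-1" x] gr_cmult[OF assms(2), of "-1" x]
  by simp

lemma smooth_lipschitz: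
  assumes "smooth_on UNIV f" "\<And>x. norm (grad f x) \<le> B"
  shows "\<bar>f x - f y\<bar> \<le> B * norm (x - y)"
proof -
  have "norm (f x - f y) \<le> B * norm (x - y)"
  proof (rule differentiable_bound[of UNIV f "\<lambda>x v. grad f x \<bullet> v"])
    show "(f has_derivative (\<bullet>) (grad f x)) (at x within UNIV)" for x
      using smooth_has_derivative_grad[OF assms(1), of x] by simp
    have "0 \<le> B" using assms(2)[of undefined] norm_ge_zero order_trans by blast
    then show "onorm (\<lambda>v. grad f x \<bullet> v) \<le> B" for x
    proof (rule onorm_bound)
      fix v
      have "norm (grad f x \<bullet> v) \<le> norm (grad f x) * norm v" by (simp add: Cauchy_Schwarz_ineq2)
      also have "\<dots> \<le> B * norm v" by (intro mult_right_mono assms) simp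
      finally show "norm (grad f x \<bullet> v) \<le> B * norm v" .
    qed
  qed auto
  then show ?thesis by simp
qed

lemma test_functions_smooth: "\<eta> \<in> test_functions \<Omega> \<Longrightarrow> smooth_on UNIV \<eta>"
  and test_functions_compact: "\<eta> \<in> test_functions \<Omega> \<Longrightarrow> compact (supp \<eta>)"
  and test_functions_supp: "\<eta> \<in> test_functions \<Omega> \<Longrightarrow> supp \<eta> \<subseteq> \<Omega>"
  by (simp_all add: test_functions_iff)

lemma test_functions_UNIV: "\<eta> \<in> test_functions \<Omega> \<Longrightarrow> \<eta> \<in> test_functions UNIV"
  by (simp add: test_functions_iff)

lemma gr_eq_0: "x \<notin> supp \<eta> \<Longrightarrow> gr \<eta> x = 0"
  using grad_cong_open[of "- supp \<eta>" x \<eta> "\<lambda>_. 0"]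
  by (auto simp: gr_def not_in_supp open_Compl zero_prod_def)

lemma grad_eq_0: "x \<notin> supp \<eta> \<Longrightarrow> grad \<eta> x = 0"
  using gr_eq_0[of x \<eta>] by (simp add: gr_def zero_prod_def)

lemma continuous_compact_support_bounded:
  fixes f :: "'a::euclidean_space \<Rightarrow> 'b::euclidean_space"
  assumes "continuous_on UNIV f" "compact K" "\<And>x. x \<notin> K \<Longrightarrow> f x = 0"
  obtains B where "B \<ge> 0" "\<And>x. norm (f x) \<le> B"
proof -
  have "bounded (f ` K)"
    using assms by (intro compact_imp_bounded compact_continuous_image) (auto intro: continuous_on_subset)
  then obtain B where B: "\<forall>y\<in>f ` K. norm y \<le> B" by (auto simp: bounded_iff)
  have "norm (f x) \<le> max B 0" for x
    using B assms(3)[of x] by (cases "x \<in> K") (auto intro: max.coboundedI1 simp: le_max_iff_disj)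
  then show ?thesis by (intro that[of "max B 0"]) auto
qed

lemma continuous_compact_support_integrable:
  fixes f :: "'a::euclidean_space \<Rightarrow> 'b::euclidean_space"
  assumes "continuous_on UNIV f" "compact K" "\<And>x. x \<notin> K \<Longrightarrow> f x = 0"
  shows "integrable lborel f"
proof -
  have "integrable lborel (\<lambda>x. indicator K x *\<^sub>R f x)"
    by (rule borel_integrable_compact[OF assms(2)]) (rule continuous_on_subset[OF assms(1)], simp)
  moreover have "(\<lambda>x. indicator K x *\<^sub>R f x) = f"
    by (auto simp: fun_eq_iff indicator_def assms(3))
  ultimately show ?thesis by simp
qed

lemma test_function_gr_bounded:
  assumes "\<eta> \<in> test_functions \<Omega>"
  obtains B where "B \<ge> 0" "\<And>x. norm (gr \<eta> x) \<le> B"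
  by (rule continuous_compact_support_bounded[OF continuous_on_gr[OF test_functions_smooth[OF assms]]
      test_functions_compact[OF assms] gr_eq_0]) auto

lemma test_functions_add:
  assumes "f \<in> test_functions \<Omega>" "g \<in> test_functions \<Omega>" shows "(\<lambda>x. f x + g x) \<in> test_functions \<Omega>"
proof (rule test_functionsI[of _ "supp f \<union> supp g"])
  show "smooth_on UNIV (\<lambda>x. f x + g x)" using assms by (intro smooth_on_add test_functions_smooth) auto
qed (use assms in \<open>auto simp: test_functions_iff not_in_supp\<close>)

lemma test_functions_mult:
  assumes "f \<in> test_functions \<Omega>" "smooth_on UNIV g" shows "(\<lambda>x. f x * g x) \<in> test_functions \<Omega>"
proof (rule test_functionsI[of _ "supp f"])
  show "smooth_on UNIV (\<lambda>x. f x * g x)"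
    by (intro smooth_on_mult test_functions_smooth[OF assms(1)] assms(2)) simp
qed (use assms in \<open>auto simp: test_functions_iff not_in_supp\<close>)

lemma test_functions_cmult:
  assumes "f \<in> test_functions \<Omega>" shows "(\<lambda>x. c * f x) \<in> test_functions \<Omega>"
  using test_functions_mult[OF assms, of "\<lambda>_. c"] by (simp add: mult.commute)

lemma test_functions_zero: "(\<lambda>x. 0) \<in> test_functions \<Omega>"
  by (rule test_functionsI[of _ "{}"]) auto

subsection \<open>Translations\<close>

lemma lborel_nn_integral_translate:
  fixes f :: "'a::euclidean_space \<Rightarrow> ennreal"
  assumes [measurable]: "f \<in> borel_measurable borel"
  shows "(\<integral>\<^sup>+x. f (x + c) \<partial>lborel) = (\<integral>\<^sup>+x. f x \<partial>lborel)"
proof -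
  have "(\<integral>\<^sup>+x. f x \<partial>lborel) = (\<integral>\<^sup>+x. f x \<partial>(distr lborel borel ((+) c)))"
    by (simp only: lborel_distr_plus)
  also have "\<dots> = (\<integral>\<^sup>+x. f (c + x) \<partial>lborel)" by (rule nn_integral_distr) auto
  finally show ?thesis by (simp add: add.commute)
qed

lemma lborel_integral_translate:
  fixes f :: "'a::euclidean_space \<Rightarrow> real"
  assumes [measurable]: "f \<in> borel_measurable borel"
  shows "(\<integral>x. f (x + c) \<partial>lborel) = (\<integral>x. f x \<partial>lborel)"
proof -
  have "(\<integral>x. f x \<partial>lborel) = (\<integral>x. f x \<partial>(distr lborel borel ((+) c)))"
    by (simp only: lborel_distr_plus)
  also have "\<dots> = (\<integral>x. f (c + x) \<partial>lborel)" by (rule integral_distr) auto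
  finally show ?thesis by (simp add: add.commute)
qed

lemma lborel_integrable_translate:
  fixes f :: "'a::euclidean_space \<Rightarrow> real"
  assumes "integrable lborel f"
  shows "integrable lborel (\<lambda>x. f (x + c))"
proof -
  have "integrable (distr lborel borel ((+) c)) f"
    using assms by (simp only: lborel_distr_plus)
  then have "integrable lborel (\<lambda>x. f (c + x))"
    by (rule integrable_distr[rotated]) simp
  then show ?thesis by (simp add: add.commute)
qed

lemma smooth_line_derivative:
  assumes "smooth_on UNIV f"
  shows "((\<lambda>t. f (x + t *\<^sub>R h)) has_real_derivative (grad f (x + t *\<^sub>R h) \<bullet> h)) (at t within S)"
proof -
  have 1: "((\<lambda>t. x + t *\<^sub>R h) has_derivative (\<lambda>s. s *\<^sub>R h)) (at t within S)"
    by (auto intro!: derivative_eq_intros)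
  from has_derivative_compose[OF 1 smooth_has_derivative_grad[OF assms UNIV_I]]
  show ?thesis unfolding has_field_derivative_def
    by (rule has_derivative_eq_rhs) (simp add: fun_eq_iff)
qed

text \<open>By translation invariance every difference quotient of \<open>f\<close> has integral zero.\<close>

lemma integral_grad_eq_0:
  fixes f :: "'a::euclidean_space \<Rightarrow> real"
  assumes f: "f \<in> test_functions UNIV"
  shows "(\<integral>x. grad f x \<bullet> h \<partial>lborel) = 0"
proof -
  note sm = test_functions_smooth[OF f]
  obtain B where B: "B \<ge> 0" "\<And>x. norm (gr f x) \<le> B"
    using test_function_gr_bounded[OF f] by blast
  have gB: "norm (grad f x) \<le> B" for x
    using B(2)[of x] norm_snd_le[of "grad f x" "f x"] by (simp add: gr_def)
  obtain R where R: "\<And>x. x \<in> supp f \<Longrightarrow> norm x \<le> R"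
    using compact_imp_bounded[OF test_functions_compact[OF f]] by (auto simp: bounded_iff)
  have fm[measurable]: "f \<in> borel_measurable borel"
    using smooth_on_imp_continuous_on[OF sm] by (rule borel_measurable_continuous_onI)
  have gm[measurable]: "grad f \<in> borel_measurable borel"
    using continuous_on_grad[OF sm] by (rule borel_measurable_continuous_onI)
  have fi: "integrable lborel f"
    by (rule continuous_compact_support_integrable[OF smooth_on_imp_continuous_on[OF sm]
        test_functions_compact[OF f]]) (rule not_in_supp)
  \<comment> \<open>Steps of size at most 1 keep the supports of all difference quotients in the
    ball of radius \<open>R + norm h\<close>, which provides an integrable majorant.\<close>
  define s where "s n = inverse (real (Suc n))" for n
  have s: "0 < s n" "s n \<le> 1" for n by (auto simp: s_def field_simps)
  define F where "F n x = (f (x + s n *\<^sub>R h) - f x) / s n" for n x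
  have "(\<lambda>n. \<integral>x. F n x \<partial>lborel) \<longlonglongrightarrow> (\<integral>x. grad f x \<bullet> h \<partial>lborel)"
  proof (rule integral_dominated_convergence[where w="\<lambda>x. B * norm h * indicator (cball 0 (R + norm h)) x"])
    show "F n \<in> borel_measurable lborel" for n unfolding F_def[abs_def] by measurable
    show "integrable lborel (\<lambda>x::'a. B * norm h * indicator (cball 0 (R + norm h)) x)"
      by (intro integrable_mult_right integrable_real_indicator emeasure_lborel_cball_finite) auto
    show "AE x in lborel. (\<lambda>n. F n x) \<longlonglongrightarrow> grad f x \<bullet> h"
    proof (rule AE_I2)
      fix x
      have "((\<lambda>t. (f (x + (0 + t) *\<^sub>R h) - f (x + 0 *\<^sub>R h)) / t) \<longlongrightarrow> grad f (x + 0 *\<^sub>R h) \<bullet> h) (at 0)"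
        using smooth_line_derivative[OF sm, of x h 0 UNIV] unfolding DERIV_def .
      moreover have "filterlim s (at 0) sequentially"
        unfolding s_def[abs_def] by (rule filterlim_atI[OF LIMSEQ_inverse_real_of_nat]) simp
      ultimately have "(\<lambda>n. (f (x + (0 + s n) *\<^sub>R h) - f (x + 0 *\<^sub>R h)) / s n) \<longlonglongrightarrow> grad f (x + 0 *\<^sub>R h) \<bullet> h"
        by (rule filterlim_compose)
      then show "(\<lambda>n. F n x) \<longlonglongrightarrow> grad f x \<bullet> h" by (simp add: F_def)
    qed
    show "AE x in lborel. norm (F n x) \<le> B * norm h * indicator (cball 0 (R + norm h)) x" for n
    proof (rule AE_I2)
      fix x
      show "norm (F n x) \<le> B * norm h * indicator (cball 0 (R + norm h)) x"
      proof (cases "x \<in> cball 0 (R + norm h)")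
        case True
        have "\<bar>f (x + s n *\<^sub>R h) - f x\<bar> \<le> B * (s n * norm h)"
          using smooth_lipschitz[OF sm gB, of "x + s n *\<^sub>R h" x] s[of n] by simp
        then show ?thesis using True s[of n] by (simp add: F_def field_simps)
      next
        case False
        then have "norm x > R + norm h" by simp
        moreover have "norm (s n *\<^sub>R h) \<le> norm h" using s[of n] by (simp add: mult_left_le_one_le)
        moreover have "norm x \<le> norm (x + s n *\<^sub>R h) + norm (s n *\<^sub>R h)"
          using norm_triangle_ineq4[of "x + s n *\<^sub>R h" "s n *\<^sub>R h"] by simp
        ultimately have "norm (x + s n *\<^sub>R h) > R" "norm x > R" using norm_ge_zero[of h] by linarith+
        then have "f (x + s n *\<^sub>R h) = 0" "f x = 0" using R by (force intro: not_in_supp)+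
        then show ?thesis using B by (simp add: F_def)
      qed
    qed
  qed measurable
  moreover have "(\<integral>x. F n x \<partial>lborel) = 0" for n
    unfolding F_def using lborel_integral_translate[OF fm, of "s n *\<^sub>R h"] fi lborel_integrable_translate[OF fi]
    by simp
  ultimately show ?thesis by (simp add: LIMSEQ_const_iff)
qed

text \<open>Cauchy-Schwarz applied to the fundamental theorem of calculus on [0, T]. The length
  stays general because near the boundary it will be the time at which a line leaves
  \<Omega>.\<close>

lemma line_estimate:
  fixes f :: "'a::euclidean_space \<Rightarrow> real"
  assumes sm: "smooth_on UNIV f" and T: "0 \<le> T"
  shows "ennreal ((f (x + T *\<^sub>R h) - f x)\<^sup>2) \<le>
    ennreal T * (\<integral>\<^sup>+t. ennreal ((grad f (x + t *\<^sub>R h) \<bullet> h)\<^sup>2) * indicator {0..T} t \<partial>lborel)"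
proof -
  define p where "p t = grad f (x + t *\<^sub>R h) \<bullet> h" for t
  have cp: "continuous_on S p" for S
    unfolding p_def[abs_def]
    by (intro continuous_intros continuous_on_compose2[OF continuous_on_grad[OF sm]]) auto
  have pm[measurable]: "p \<in> borel_measurable borel"
    by (rule borel_measurable_continuous_onI[OF cp])
  have I: "integral\<^sup>L lborel (\<lambda>t. indicator {0..T} t *\<^sub>R p t) = f (x + T *\<^sub>R h) - f x"
  proof (subst integral_FTC_atLeastAtMost[OF T, of "\<lambda>t. f (x + t *\<^sub>R h)"])
    show "((\<lambda>t. f (x + t *\<^sub>R h)) has_vector_derivative p t) (at t within {0..T})" for t
      using smooth_line_derivative[OF sm] unfolding p_def has_real_derivative_iff_has_vector_derivative .
  qed (use cp in auto)
  have "ennreal (norm (f (x + T *\<^sub>R h) - f x)) \<le> (\<integral>\<^sup>+t. ennreal (norm (indicator {0..T} t *\<^sub>R p t)) \<partial>lborel)"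
    unfolding I[symmetric]
    by (rule integral_norm_bound_ennreal[OF borel_integrable_compact]) (auto intro: cp)
  also have "\<dots> = (\<integral>\<^sup>+t. (ennreal \<bar>p t\<bar> * indicator {0..T} t) * indicator {0..T} t \<partial>lborel)"
    by (intro nn_integral_cong) (auto simp: indicator_def)
  finally have "(ennreal \<bar>f (x + T *\<^sub>R h) - f x\<bar>)\<^sup>2 \<le>
      (\<integral>\<^sup>+t. (ennreal \<bar>p t\<bar> * indicator {0..T} t) * indicator {0..T} t \<partial>lborel)\<^sup>2"
    by (intro power_mono_ennreal) simp
  also have "\<dots> \<le> (\<integral>\<^sup>+t. (ennreal \<bar>p t\<bar> * indicator {0..T} t)\<^sup>2 \<partial>lborel) * (\<integral>\<^sup>+t. (indicator {0..T} t)\<^sup>2 \<partial>lborel)"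
    by (rule Cauchy_Schwarz_nn_integral) measurable
  also have "(\<integral>\<^sup>+t. (indicator {0..T} t)\<^sup>2 \<partial>lborel) = (\<integral>\<^sup>+t. indicator {0..T} t \<partial>lborel)"
    by (intro nn_integral_cong) (auto simp: indicator_def)
  also have "\<dots> = ennreal T" using T by simp
  also have "(\<integral>\<^sup>+t. (ennreal \<bar>p t\<bar> * indicator {0..T} t)\<^sup>2 \<partial>lborel)
      = (\<integral>\<^sup>+t. ennreal ((p t)\<^sup>2) * indicator {0..T} t \<partial>lborel)"
    by (intro nn_integral_cong) (auto simp: indicator_def ennreal_power)
  finally show ?thesis
    unfolding p_def by (simp add: ennreal_power mult.commute)
qed

text \<open>After exchanging the order of integration, every translate of the squared gradient
  contributes the same integral. The Poincare inequality and the compactness theorem both rest on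
  this bound.\<close>

lemma translation_estimate:
  fixes f :: "'a::euclidean_space \<Rightarrow> real"
  assumes sm: "smooth_on UNIV f"
  shows "(\<integral>\<^sup>+x. ennreal ((f (x + h) - f x)\<^sup>2) \<partial>lborel) \<le>
    ennreal ((norm h)\<^sup>2) * (\<integral>\<^sup>+x. ennreal ((norm (grad f x))\<^sup>2) \<partial>lborel)"
proof -
  have gm[measurable]: "grad f \<in> borel_measurable borel"
    using continuous_on_grad[OF sm] by (rule borel_measurable_continuous_onI)
  let ?I = "\<integral>\<^sup>+x. ennreal ((norm (grad f x))\<^sup>2) \<partial>lborel"
  have le: "(u \<bullet> h)\<^sup>2 \<le> (norm h)\<^sup>2 * (norm u)\<^sup>2" for u :: 'a
    using power_mono[OF Cauchy_Schwarz_ineq2[of u h] abs_ge_zero, of 2] by (simp add: power_mult_distrib mult.commute)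
  have "(\<integral>\<^sup>+x. ennreal ((f (x + h) - f x)\<^sup>2) \<partial>lborel)
      \<le> (\<integral>\<^sup>+x. \<integral>\<^sup>+t. ennreal ((norm h)\<^sup>2) * (ennreal ((norm (grad f (x + t *\<^sub>R h)))\<^sup>2) * indicator {0..1} t) \<partial>lborel \<partial>lborel)"
  proof (rule nn_integral_mono)
    fix x
    have "ennreal ((f (x + h) - f x)\<^sup>2) \<le> (\<integral>\<^sup>+t. ennreal ((grad f (x + t *\<^sub>R h) \<bullet> h)\<^sup>2) * indicator {0..1} t \<partial>lborel)"
      using line_estimate[OF sm, of 1 x h] by simp
    also have "\<dots> \<le> (\<integral>\<^sup>+t. ennreal ((norm h)\<^sup>2) * (ennreal ((norm (grad f (x + t *\<^sub>R h)))\<^sup>2) * indicator {0..1} t) \<partial>lborel)"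
      by (intro nn_integral_mono)
        (auto simp: indicator_def ennreal_mult[symmetric] intro!: ennreal_leI le)
    finally show "ennreal ((f (x + h) - f x)\<^sup>2) \<le> \<dots>" .
  qed
  also have "\<dots> = (\<integral>\<^sup>+t. \<integral>\<^sup>+x. ennreal ((norm h)\<^sup>2) * (ennreal ((norm (grad f (x + t *\<^sub>R h)))\<^sup>2) * indicator {0..1} t) \<partial>lborel \<partial>lborel)"
    by (rule lborel_pair.Fubini') measurable
  also have "\<dots> = (\<integral>\<^sup>+(t::real). ennreal ((norm h)\<^sup>2) * (indicator {0..1} t * ?I) \<partial>lborel)"
  proof (rule nn_integral_cong)
    fix t :: real
    have "(\<integral>\<^sup>+x. ennreal ((norm h)\<^sup>2) * (ennreal ((norm (grad f (x + t *\<^sub>R h)))\<^sup>2) * indicator {0..1} t) \<partial>lborel)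
        = ennreal ((norm h)\<^sup>2) * ((\<integral>\<^sup>+x. ennreal ((norm (grad f (x + t *\<^sub>R h)))\<^sup>2) \<partial>lborel) * indicator {0..1} t)"
      by (subst nn_integral_cmult, measurable) (subst nn_integral_multc, auto)
    also have "(\<integral>\<^sup>+x. ennreal ((norm (grad f (x + t *\<^sub>R h)))\<^sup>2) \<partial>lborel) = ?I"
      by (rule lborel_nn_integral_translate) measurable
    finally show "(\<integral>\<^sup>+x. ennreal ((norm h)\<^sup>2) * (ennreal ((norm (grad f (x + t *\<^sub>R h)))\<^sup>2) * indicator {0..1} t) \<partial>lborel)
        = ennreal ((norm h)\<^sup>2) * (indicator {0..1} t * ?I)" by (simp add: mult.commute)
  qed
  also have "\<dots> = ennreal ((norm h)\<^sup>2) * ?I"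
    by (subst nn_integral_cmult, measurable) (subst nn_integral_multc, auto)
  finally show ?thesis .
qed

subsection \<open>The fundamental lemma of the calculus of variations\<close>

text \<open>The open box \<open>box a b\<close> is the positivity set of a smooth function \<open>f\<close>, so its indicator is the
  limit of \<open>1 - exp (- n f)\<close>.\<close>

lemma box_smooth_approx:
  fixes a b :: "'a::euclidean_space"
  obtains e :: "nat \<Rightarrow> 'a \<Rightarrow> real" where "\<And>n. smooth_on UNIV (e n)" "\<And>n x. \<bar>e n x\<bar> \<le> 1"
    "\<And>x. (\<lambda>n. e n x) \<longlonglongrightarrow> indicator (box a b) x"
proof -
  define f where "f x = (\<Prod>i\<in>Basis. \<beta> (x \<bullet> i - a \<bullet> i) * \<beta> (b \<bullet> i - x \<bullet> i))" for x :: 'a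
  have sf: "smooth_on UNIV f"
    unfolding f_def[abs_def]
    by (intro smooth_on_prod smooth_on_mult smooth_on_compose[OF _ smooth_beta] smooth_on_diff
        smooth_on_inner smooth_on_const) auto
  have f0: "f x \<ge> 0" for x unfolding f_def by (intro prod_nonneg) auto
  have f1: "f x > 0" if "x \<in> box a b" for x
    unfolding f_def using that by (intro prod_pos) (auto simp: box_def)
  have f2: "f x = 0" if xnb: "x \<notin> box a b" for x
  proof -
    obtain i where "i \<in> Basis" "\<not> (a \<bullet> i < x \<bullet> i \<and> x \<bullet> i < b \<bullet> i)"
      using xnb unfolding mem_box by blast
    then have "i \<in> Basis" "\<beta> (x \<bullet> i - a \<bullet> i) * \<beta> (b \<bullet> i - x \<bullet> i) = 0" by auto
    then show ?thesis unfolding f_def by (intro prod_zero bexI[of _ i]) auto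
  qed
  have smexp: "smooth_on UNIV (exp :: real \<Rightarrow> real)"
    unfolding smooth_on_def
  proof
    fix k show "Ck_on k UNIV (exp :: real \<Rightarrow> real)"
    proof (induction k)
      case 0 show ?case by (auto intro: continuous_intros)
    next
      case (Suc k)
      show ?case
        by (rule Ck_on_SucI[of _ _ "\<lambda>t v. exp t * v"]) (auto intro!: derivative_eq_intros Ck_on_mult Ck_on_const Suc)
    qed
  qed
  define e where "e n x = 1 - exp (- real n * f x)" for n x
  show ?thesis
  proof (rule that[of e])
    show "smooth_on UNIV (e n)" for n
      unfolding e_def[abs_def]
      by (intro smooth_on_diff smooth_on_const smooth_on_compose[OF _ smexp] smooth_on_cmult sf) auto
    show "\<bar>e n x\<bar> \<le> 1" for n x
    proof -
      have "exp (- (real n * f x)) \<le> 1" using f0[of x] by simp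
      then show ?thesis unfolding e_def using exp_gt_zero[of "- (real n * f x)"] by (simp add: abs_if)
    qed
    show "(\<lambda>n. e n x) \<longlonglongrightarrow> indicator (box a b) x" for x
    proof (cases "x \<in> box a b")
      case True
      have "(\<lambda>n. exp (- f x) ^ n) \<longlonglongrightarrow> 0"
        using f1[OF True] by (intro LIMSEQ_power_zero) simp
      then have "(\<lambda>n. 1 - exp (- f x) ^ n) \<longlonglongrightarrow> 1 - 0"
        by (rule tendsto_diff[OF tendsto_const])
      then show ?thesis using True by (simp add: e_def exp_of_nat_mult[symmetric])
    next
      case False
      then show ?thesis by (simp add: e_def f2)
    qed
  qed
qed

text \<open>The positive and the negative part of \<open>k\<close> are densities of two finite
  measures that agree on boxes. Boxes form an intersection stable generator of the Borel sets, so
  the measures and hence the densities agree.\<close>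

lemma integral_boxes_zero_imp_AE_zero:
  fixes k :: "'a::euclidean_space \<Rightarrow> real"
  assumes k: "integrable lborel k" and z: "\<And>a b. (\<integral>x. indicator (box a b) x * k x \<partial>lborel) = 0"
  shows "AE x in lborel. k x = 0"
proof -
  have [measurable]: "k \<in> borel_measurable borel" using k by auto
  define P where "P x = ennreal (max 0 (k x))" for x
  define N where "N x = ennreal (max 0 (- k x))" for x
  have [measurable]: "P \<in> borel_measurable borel" "N \<in> borel_measurable borel"
    unfolding P_def[abs_def] N_def[abs_def] by measurable
  have ip: "integrable lborel (\<lambda>x. max 0 (k x))" "integrable lborel (\<lambda>x. max 0 (- k x))"
    using k by auto
  have box: "emeasure (density lborel P) (box a b) = emeasure (density lborel N) (box a b)" for a b
  proof -
    have ib: "integrable lborel (\<lambda>x. indicator (box a b) x * max 0 (k x))"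
      "integrable lborel (\<lambda>x. indicator (box a b) x * max 0 (- k x))"
      using integrable_mult_indicator[OF _ ip(1), of "box a b"] integrable_mult_indicator[OF _ ip(2), of "box a b"]
      by auto
    have "(\<integral>x. indicator (box a b) x * max 0 (k x) \<partial>lborel) - (\<integral>x. indicator (box a b) x * max 0 (- k x) \<partial>lborel)
        = (\<integral>x. indicator (box a b) x * max 0 (k x) - indicator (box a b) x * max 0 (- k x) \<partial>lborel)"
      by (rule Bochner_Integration.integral_diff[symmetric, OF ib])
    also have "\<dots> = (\<integral>x. indicator (box a b) x * k x \<partial>lborel)"
      by (rule Bochner_Integration.integral_cong) (auto simp: max_def algebra_simps)
    finally have eq: "(\<integral>x. indicator (box a b) x * max 0 (k x) \<partial>lborel) = (\<integral>x. indicator (box a b) x * max 0 (- k x) \<partial>lborel)"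
      using z by simp
    have "emeasure (density lborel P) (box a b) = (\<integral>\<^sup>+x. ennreal (indicator (box a b) x * max 0 (k x)) \<partial>lborel)"
      by (subst emeasure_density) (auto simp: P_def indicator_def intro!: nn_integral_cong)
    also have "\<dots> = ennreal (\<integral>x. indicator (box a b) x * max 0 (k x) \<partial>lborel)"
      by (rule nn_integral_eq_integral[OF ib(1)]) simp
    also have "\<dots> = (\<integral>\<^sup>+x. ennreal (indicator (box a b) x * max 0 (- k x)) \<partial>lborel)"
      unfolding eq by (rule nn_integral_eq_integral[OF ib(2), symmetric]) simp
    also have "\<dots> = emeasure (density lborel N) (box a b)"
      by (subst emeasure_density) (auto simp: N_def indicator_def intro!: nn_integral_cong)
    finally show ?thesis .
  qed
  have fin: "(\<integral>\<^sup>+x. P x \<partial>lborel) \<noteq> \<infinity>"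
    unfolding P_def by (subst nn_integral_eq_integral[OF ip(1)]) auto
  have "density lborel P = density lborel N"
  proof (rule measure_eqI_generator_eq)
    let ?E = "range (\<lambda>(a, b). box a b::'a set)"
    let ?A = "\<lambda>n::nat. box (- (real n *\<^sub>R One)) (real n *\<^sub>R One) :: 'a set"
    show "Int_stable ?E" by (auto simp: Int_stable_def box_Int_box)
    show "?E \<subseteq> Pow UNIV" "sets (density lborel P) = sigma_sets UNIV ?E" "sets (density lborel N) = sigma_sets UNIV ?E"
      by (simp_all add: borel_eq_box)
    show "range ?A \<subseteq> ?E" "(\<Union>i. ?A i) = UNIV" unfolding UN_box_eq_UNIV by auto
    show "emeasure (density lborel P) X = emeasure (density lborel N) X" if "X \<in> ?E" for X
      using that box by auto
    show "emeasure (density lborel P) (?A i) \<noteq> \<infinity>" for i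
    proof -
      have "emeasure (density lborel P) (?A i) \<le> (\<integral>\<^sup>+x. P x \<partial>lborel)"
        by (subst emeasure_density) (auto intro!: nn_integral_mono simp: indicator_def)
      then show ?thesis using fin by (auto simp: top_unique)
    qed
  qed
  then have "AE x in lborel. P x = N x"
    by (subst (asm) finite_density_unique) (use fin in auto)
  then show ?thesis
    by eventually_elim (auto simp: P_def N_def max_def split: if_splits)
qed

section \<open>Integration on a bounded open set\<close>

locale bounded_open =
  fixes \<Omega> :: "'a::euclidean_space set"
  assumes open_\<Omega>: "open \<Omega>" and bounded_\<Omega>: "bounded \<Omega>"
begin

abbreviation "M \<equiv> lebesgue_on \<Omega>"

lemma \<Omega>_lmeasurable: "\<Omega> \<in> lmeasurable"
  using bounded_\<Omega> open_\<Omega> by (simp add: lmeasurable_open)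

lemma \<Omega>_sets [simp, measurable]: "\<Omega> \<in> sets lebesgue"
  using \<Omega>_lmeasurable by auto

lemma space_M [simp]: "space M = \<Omega>"
  by (simp add: space_restrict_space)

sublocale M: finite_measure M
  by (rule finite_measure_lebesgue_on[OF \<Omega>_lmeasurable])

lemma borel_imp_measurable_M:
  assumes "f \<in> borel_measurable borel" shows "f \<in> borel_measurable M"
  by (rule measurable_restrict_space1) (use assms in \<open>auto intro: measurable_completion\<close>)

lemma continuous_imp_measurable_M: "continuous_on UNIV f \<Longrightarrow> f \<in> borel_measurable M"
  by (rule borel_imp_measurable_M) (rule borel_measurable_continuous_onI)

lemma continuous_bounded_on:
  assumes "continuous_on UNIV f"
  obtains B where "B \<ge> 0" "\<And>x. x \<in> \<Omega> \<Longrightarrow> norm (f x) \<le> B"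
proof -
  have "bounded (f ` closure \<Omega>)"
    using bounded_\<Omega> assms by (intro compact_imp_bounded compact_continuous_image) (auto intro: continuous_on_subset)
  then obtain B where B: "\<And>x. x \<in> closure \<Omega> \<Longrightarrow> norm (f x) \<le> B" by (auto simp: bounded_iff)
  have "norm (f x) \<le> max B 0" if "x \<in> \<Omega>" for x
    using B[of x] that closure_subset[of \<Omega>] by (auto simp: le_max_iff_disj)
  then show ?thesis by (intro that[of "max B 0"]) auto
qed

lemma sqi_continuous:
  fixes f :: "'a \<Rightarrow> 'b::euclidean_space"
  assumes "continuous_on UNIV f" shows "sqi M f"
proof -
  obtain B where "\<And>x. x \<in> \<Omega> \<Longrightarrow> norm (f x) \<le> B" using continuous_bounded_on[OF assms] by blast
  then show ?thesis
    by (intro M.sqi_bounded[of f B] continuous_imp_measurable_M assms AE_I2) simp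
qed

lemma sqi_gr: "smooth_on UNIV f \<Longrightarrow> sqi M (gr f)"
  by (rule sqi_continuous[OF continuous_on_gr])

lemma sqi_grad: "smooth_on UNIV f \<Longrightarrow> sqi M (grad f)"
  by (rule sqi_continuous[OF continuous_on_grad])

lemma sqi_smooth: "smooth_on UNIV f \<Longrightarrow> sqi M f"
  by (rule sqi_continuous[OF smooth_on_imp_continuous_on])

lemma integral_M_eq_lborel:
  fixes f :: "'a \<Rightarrow> real"
  assumes "f \<in> borel_measurable borel" "\<And>x. x \<notin> \<Omega> \<Longrightarrow> f x = 0"
  shows "(\<integral>x. f x \<partial>M) = (\<integral>x. f x \<partial>lborel)"
proof -
  have "(\<integral>x. f x \<partial>M) = (\<integral>x. indicator \<Omega> x *\<^sub>R f x \<partial>lebesgue)"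
    by (rule integral_restrict_space) simp
  also have "\<dots> = (\<integral>x. f x \<partial>lebesgue)"
    by (rule Bochner_Integration.integral_cong) (auto simp: indicator_def assms(2))
  also have "\<dots> = (\<integral>x. f x \<partial>lborel)"
    by (rule integral_completion) (use assms(1) in simp)
  finally show ?thesis .
qed

text \<open>The product of \<eta> and \<open>w\<close> has compact support in \<Omega>, so its
  gradient integrates to zero over the whole space.\<close>

lemma integral_by_parts:
  assumes w: "smooth_on UNIV w" and e: "\<eta> \<in> test_functions \<Omega>"
  shows "(\<integral>x. w x * (grad \<eta> x \<bullet> b) \<partial>M) = - (\<integral>x. (grad w x \<bullet> b) * \<eta> x \<partial>M)"
proof -
  note sme = test_functions_smooth[OF e]
  have t: "(\<lambda>x. \<eta> x * w x) \<in> test_functions \<Omega>" by (rule test_functions_mult[OF e w])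
  have "(\<integral>x. w x * (grad \<eta> x \<bullet> b) \<partial>M) + (\<integral>x. (grad w x \<bullet> b) * \<eta> x \<partial>M)
     = (\<integral>x. w x * (grad \<eta> x \<bullet> b) + (grad w x \<bullet> b) * \<eta> x \<partial>M)"
    by (intro Bochner_Integration.integral_add[symmetric] sqi_mult sqi_smooth smooth_grad_inner w sme)
  also have "\<dots> = (\<integral>x. grad (\<lambda>x. \<eta> x * w x) x \<bullet> b \<partial>M)"
    by (simp add: grad_mult[OF smooth_differentiable[OF sme] smooth_differentiable[OF w]] inner_add_left
        mult.commute add.commute)
  also have "\<dots> = (\<integral>x. grad (\<lambda>x. \<eta> x * w x) x \<bullet> b \<partial>lborel)"
  proof (rule integral_M_eq_lborel)
    show "(\<lambda>x. grad (\<lambda>x. \<eta> x * w x) x \<bullet> b) \<in> borel_measurable borel"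
      by (intro borel_measurable_continuous_onI continuous_intros continuous_on_grad test_functions_smooth[OF t])
    show "grad (\<lambda>x. \<eta> x * w x) x \<bullet> b = 0" if "x \<notin> \<Omega>" for x
    proof -
      have "x \<notin> supp (\<lambda>x. \<eta> x * w x)" using test_functions_supp[OF t] that by blast
      then show ?thesis by (simp add: grad_eq_0)
    qed
  qed
  also have "\<dots> = 0" by (rule integral_grad_eq_0[OF test_functions_UNIV[OF t]])
  finally show ?thesis by simp
qed

text \<open>For a test function \<theta>, the product g \<theta> extended by zero is integrable on
  the whole space and orthogonal to every smooth \<open>e\<close>, since \<theta> e is again a test
  function. Indicators of boxes are bounded limits of such \<open>e\<close>, so g \<theta> vanishes;
  finally \<theta> runs through countably many bumps that cover \<Omega>.\<close>

lemma fundamental_lemma: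
  fixes g :: "'a \<Rightarrow> real"
  assumes g: "integrable M g" and z: "\<And>\<eta>. \<eta> \<in> test_functions \<Omega> \<Longrightarrow> (\<integral>x. g x * \<eta> x \<partial>M) = 0"
  shows "AE x in M. g x = 0"
proof -
  have loc: "AE x in lebesgue. x \<in> \<Omega> \<longrightarrow> g x * \<theta> x = 0" if \<theta>: "\<theta> \<in> test_functions \<Omega>" for \<theta>
  proof -
    obtain B where B: "B \<ge> 0" "\<And>x. norm (gr \<theta> x) \<le> B" using test_function_gr_bounded[OF \<theta>] by blast
    have \<theta>B: "\<bar>\<theta> x\<bar> \<le> B" for x using B(2)[of x] norm_fst_le[of "\<theta> x" "grad \<theta> x"] by (simp add: gr_def)
    have \<theta>c: "continuous_on UNIV \<theta>" by (rule smooth_on_imp_continuous_on[OF test_functions_smooth[OF \<theta>]])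
    have gm[measurable]: "g \<in> borel_measurable M" using g by auto
    have \<theta>m[measurable]: "\<theta> \<in> borel_measurable M" by (rule continuous_imp_measurable_M[OF \<theta>c])
    have gi: "integrable M (\<lambda>x. g x * \<theta> x)"
      by (rule Bochner_Integration.integrable_bound[of _ "\<lambda>x. B * g x"])
        (use g \<theta>B B(1) in \<open>auto intro!: AE_I2 mult_right_mono simp: abs_mult mult.commute\<close>)
    define k where "k x = indicator \<Omega> x *\<^sub>R (g x * \<theta> x)" for x
    have ki: "integrable lebesgue k"
      using gi unfolding k_def[abs_def] by (subst (asm) integrable_restrict_space) auto
    \<comment> \<open>A Borel representative, because the uniqueness statement on boxes is about
      \<open>lborel\<close> while \<open>k\<close> is only Lebesgue measurable.\<close>
    obtain k' where k': "k' \<in> borel_measurable lborel" "AE x in lborel. k x = k' x"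
      using completion_ex_borel_measurable_real[of k lborel] ki by auto
    have k'm[measurable]: "k' \<in> borel_measurable borel" using k' by simp
    have kk: "AE x in lebesgue. k x = k' x" using k'(2) by (rule AE_completion)
    have k'i: "integrable lborel k'"
    proof -
      have "integrable lebesgue k'"
        by (rule integrable_cong_AE_imp[OF ki]) (use kk in \<open>auto intro: measurable_completion\<close>)
      then show ?thesis using k'(1) by (simp add: integrable_completion)
    qed
    have sm: "(\<integral>x. e x * k' x \<partial>lborel) = 0" if e: "smooth_on UNIV e" for e
    proof -
      have em[measurable]: "e \<in> borel_measurable borel"
        by (intro borel_measurable_continuous_onI smooth_on_imp_continuous_on e)
      have "(\<integral>x. e x * k' x \<partial>lborel) = (\<integral>x. e x * k' x \<partial>lebesgue)"
        by (rule integral_completion[symmetric]) measurable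
      also have "\<dots> = (\<integral>x. e x * k x \<partial>lebesgue)"
        by (rule integral_cong_AE) (use kk ki in \<open>auto intro: measurable_completion intro!: borel_measurable_times\<close>)
      also have "\<dots> = (\<integral>x. indicator \<Omega> x *\<^sub>R (g x * (\<theta> x * e x)) \<partial>lebesgue)"
        by (rule Bochner_Integration.integral_cong) (auto simp: k_def)
      also have "\<dots> = (\<integral>x. g x * (\<theta> x * e x) \<partial>M)"
        by (rule integral_restrict_space[symmetric]) simp
      also have "\<dots> = 0" by (rule z[OF test_functions_mult[OF \<theta> e]])
      finally show ?thesis .
    qed
    have "AE x in lborel. k' x = 0"
    proof (rule integral_boxes_zero_imp_AE_zero[OF k'i])
      fix a b :: 'a
      obtain e :: "nat \<Rightarrow> 'a \<Rightarrow> real" where e: "\<And>n. smooth_on UNIV (e n)" "\<And>n x. \<bar>e n x\<bar> \<le> 1"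
        "\<And>x. (\<lambda>n. e n x) \<longlonglongrightarrow> indicator (box a b) x"
        using box_smooth_approx[of a b] by blast
      have em[measurable]: "e n \<in> borel_measurable borel" for n
        by (intro borel_measurable_continuous_onI smooth_on_imp_continuous_on e)
      have "(\<lambda>n. \<integral>x. e n x * k' x \<partial>lborel) \<longlonglongrightarrow> (\<integral>x. indicator (box a b) x * k' x \<partial>lborel)"
      proof (rule integral_dominated_convergence[where w="\<lambda>x. \<bar>k' x\<bar>"])
        show "AE x in lborel. (\<lambda>n. e n x * k' x) \<longlonglongrightarrow> indicator (box a b) x * k' x"
          by (intro AE_I2 tendsto_intros e)
        show "AE x in lborel. norm (e n x * k' x) \<le> \<bar>k' x\<bar>" for n
          using e(2)[of n] by (auto simp: abs_mult intro!: AE_I2 mult_left_le_one_le)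
      qed (use k'i in auto)
      then show "(\<integral>x. indicator (box a b) x * k' x \<partial>lborel) = 0"
        using sm[OF e(1)] by (simp add: LIMSEQ_const_iff)
    qed
    then have "AE x in lebesgue. k' x = 0" by (rule AE_completion)
    with kk show ?thesis by eventually_elim (auto simp: k_def indicator_def split: if_splits)
  qed
  have "\<forall>p\<in>\<Omega>. \<exists>r>0. cball p (2 * r) \<subseteq> \<Omega>"
  proof
    fix p assume "p \<in> \<Omega>"
    then obtain e where "e > 0" "cball p e \<subseteq> \<Omega>" using open_\<Omega> open_contains_cball by blast
    then show "\<exists>r>0. cball p (2 * r) \<subseteq> \<Omega>" by (intro exI[of _ "e/2"]) auto
  qed
  from bchoice[OF this] obtain r where r: "\<And>p. p \<in> \<Omega> \<Longrightarrow> r p > 0" "\<And>p. p \<in> \<Omega> \<Longrightarrow> cball p (2 * r p) \<subseteq> \<Omega>"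
    by auto
  \<comment> \<open>Countability is essential: one exceptional null set arises for each
    ball.\<close>
  obtain \<F>' where F': "\<F>' \<subseteq> (\<lambda>p. ball p (r p)) ` \<Omega>" "countable \<F>'" "\<Union>\<F>' = \<Union>((\<lambda>p. ball p (r p)) ` \<Omega>)"
    using Lindelof[of "(\<lambda>p. ball p (r p)) ` \<Omega>"] by auto
  obtain S where S: "countable S" "S \<subseteq> \<Omega>" "\<F>' = (\<lambda>p. ball p (r p)) ` S"
    using F'(1,2) countable_subset_image[of \<F>' "\<lambda>p. ball p (r p)" \<Omega>] by auto
  have "AE x in lebesgue. \<forall>p\<in>S. x \<in> \<Omega> \<longrightarrow> g x * bump p (r p) x = 0"
  proof (rule AE_ball_countable'[OF _ S(1)])
    fix p assume "p \<in> S"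
    then have p: "r p > 0" "cball p (2 * r p) \<subseteq> \<Omega>" using S r by auto
    have "bump p (r p) \<in> test_functions \<Omega>"
      by (rule test_functionsI[OF smooth_bump compact_cball p(2)]) (rule bump_eq_0[OF p(1)])
    then show "AE x in lebesgue. x \<in> \<Omega> \<longrightarrow> g x * bump p (r p) x = 0" by (rule loc)
  qed
  then have "AE x in lebesgue. x \<in> \<Omega> \<longrightarrow> g x = 0"
  proof eventually_elim
    case (elim x)
    show ?case
    proof
      assume x: "x \<in> \<Omega>"
      then have "x \<in> \<Union>\<F>'" unfolding F'(3) using r(1)[OF x] by (intro UnionI[of "ball x (r x)"]) auto
      then obtain p where p: "p \<in> S" "x \<in> ball p (r p)" unfolding S(3) by auto
      then have "bump p (r p) x = 1" using r(1) S(2) by (intro bump_eq_1) auto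
      then show "g x = 0" using elim p(1) x by auto
    qed
  qed
  then show ?thesis by (simp add: AE_restrict_space_iff)
qed

end

section \<open>Weak gradients and the space of zero traces\<close>

lemma sqi_inner_const:
  assumes "sqi N G" shows "sqi N (\<lambda>x. G x \<bullet> c)"
proof (rule sqi_bound)
  show "integrable N (\<lambda>x. (norm c)\<^sup>2 * (norm (G x))\<^sup>2)" using sqi_integrable[OF assms] by simp
  show "AE x in N. (norm (G x \<bullet> c))\<^sup>2 \<le> (norm c)\<^sup>2 * (norm (G x))\<^sup>2"
  proof (rule AE_I2)
    fix x
    have "(norm (G x \<bullet> c))\<^sup>2 \<le> (norm (G x) * norm c)\<^sup>2"
      by (intro power_mono) (simp_all add: Cauchy_Schwarz_ineq2)
    then show "(norm (G x \<bullet> c))\<^sup>2 \<le> (norm c)\<^sup>2 * (norm (G x))\<^sup>2"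
      by (simp add: power_mult_distrib mult.commute)
  qed
qed (use sqi_measurable[OF assms] in measurable)

context bounded_open
begin

lemma has_weak_gradient_iff:
  "has_weak_gradient \<Omega> u G \<longleftrightarrow> sqi M G \<and> (\<forall>\<eta>\<in>test_functions \<Omega>. \<forall>b\<in>Basis.
     (\<integral>x. u x * (grad \<eta> x \<bullet> b) \<partial>M) = - (\<integral>x. (G x \<bullet> b) * \<eta> x \<partial>M))"
  unfolding has_weak_gradient_def L2_on_iff by (simp add: grad_inner_Basis)

lemma sqi_test: "\<eta> \<in> test_functions \<Omega> \<Longrightarrow> sqi M \<eta>"
  and sqi_grad_test: "\<eta> \<in> test_functions \<Omega> \<Longrightarrow> sqi M (grad \<eta>)"
  and sqi_gr_test: "\<eta> \<in> test_functions \<Omega> \<Longrightarrow> sqi M (gr \<eta>)"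
  by (auto intro: sqi_smooth sqi_grad sqi_gr test_functions_smooth)

lemma has_weak_gradient_unique:
  assumes "has_weak_gradient \<Omega> u G" "has_weak_gradient \<Omega> u G'"
  shows "AE x in M. G x = G' x"
proof -
  have G: "sqi M G" "sqi M G'" using assms unfolding has_weak_gradient_iff by blast+
  have "AE x in M. (G x - G' x) \<bullet> b = 0" if b: "b \<in> Basis" for b
  proof (rule fundamental_lemma)
    show "integrable M (\<lambda>x. (G x - G' x) \<bullet> b)"
      by (rule M.sqi_imp_integrable[OF sqi_inner_const[OF sqi_diff[OF G]]])
    fix \<eta> assume e: "\<eta> \<in> test_functions \<Omega>"
    have i: "integrable M (\<lambda>x. (G x \<bullet> b) * \<eta> x)" "integrable M (\<lambda>x. (G' x \<bullet> b) * \<eta> x)"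
      by (intro sqi_mult sqi_inner_const G sqi_test e)+
    have "(\<integral>x. ((G x - G' x) \<bullet> b) * \<eta> x \<partial>M) = (\<integral>x. (G x \<bullet> b) * \<eta> x - (G' x \<bullet> b) * \<eta> x \<partial>M)"
      by (simp add: inner_diff_left left_diff_distrib)
    also have "\<dots> = (\<integral>x. (G x \<bullet> b) * \<eta> x \<partial>M) - (\<integral>x. (G' x \<bullet> b) * \<eta> x \<partial>M)"
      by (rule Bochner_Integration.integral_diff[OF i])
    also have "\<dots> = 0"
    proof -
      have "(\<integral>x. u x * (grad \<eta> x \<bullet> b) \<partial>M) = - (\<integral>x. (G x \<bullet> b) * \<eta> x \<partial>M)"
        "(\<integral>x. u x * (grad \<eta> x \<bullet> b) \<partial>M) = - (\<integral>x. (G' x \<bullet> b) * \<eta> x \<partial>M)"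
        using assms e b unfolding has_weak_gradient_iff by blast+
      then show ?thesis by linarith
    qed
    finally show "(\<integral>x. ((G x - G' x) \<bullet> b) * \<eta> x \<partial>M) = 0" .
  qed
  then have "AE x in M. \<forall>b\<in>Basis. (G x - G' x) \<bullet> b = 0"
    by (intro AE_finite_allI) auto
  then show ?thesis
  proof eventually_elim
    case (elim x)
    show ?case by (rule euclidean_eqI) (use elim in \<open>simp add: inner_diff_left\<close>)
  qed
qed

lemma weak_gradient_AE:
  assumes "has_weak_gradient \<Omega> u G"
  shows "has_weak_gradient \<Omega> u (weak_gradient \<Omega> u)" "AE x in M. weak_gradient \<Omega> u x = G x"
proof -
  show 1: "has_weak_gradient \<Omega> u (weak_gradient \<Omega> u)"
    unfolding weak_gradient_def by (rule someI[of _ G]) (rule assms)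
  show "AE x in M. weak_gradient \<Omega> u x = G x" by (rule has_weak_gradient_unique[OF 1 assms])
qed

lemma has_weak_gradient_sqi: "has_weak_gradient \<Omega> u G \<Longrightarrow> sqi M G"
  unfolding has_weak_gradient_iff by (erule conjunct1)

lemma has_weak_gradient_smooth: "smooth_on UNIV w \<Longrightarrow> has_weak_gradient \<Omega> w (grad w)"
  unfolding has_weak_gradient_iff by (intro conjI ballI sqi_grad integral_by_parts)

lemma has_weak_gradient_lincomb:
  assumes u: "sqi M u" "has_weak_gradient \<Omega> u G" and v: "sqi M v" "has_weak_gradient \<Omega> v H"
  shows "has_weak_gradient \<Omega> (\<lambda>x. u x + c * v x) (\<lambda>x. G x + c *\<^sub>R H x)"
  unfolding has_weak_gradient_iff
proof (intro conjI ballI)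
  have G: "sqi M G" "sqi M H" using assms has_weak_gradient_sqi by auto
  show "sqi M (\<lambda>x. G x + c *\<^sub>R H x)" by (intro sqi_add sqi_scaleR G)
  fix \<eta> and b :: 'a assume e: "\<eta> \<in> test_functions \<Omega>" and b: "b \<in> Basis"
  note sg = sqi_inner_const[OF sqi_grad_test[OF e], of b]
  have i: "integrable M (\<lambda>x. u x * (grad \<eta> x \<bullet> b))" "integrable M (\<lambda>x. c * (v x * (grad \<eta> x \<bullet> b)))"
    "integrable M (\<lambda>x. (G x \<bullet> b) * \<eta> x)" "integrable M (\<lambda>x. c * ((H x \<bullet> b) * \<eta> x))"
    using sqi_mult[OF u(1) sg] sqi_mult[OF v(1) sg] sqi_mult[OF sqi_inner_const[OF G(1)] sqi_test[OF e], of b]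
      sqi_mult[OF sqi_inner_const[OF G(2)] sqi_test[OF e], of b] by auto
  have "(\<integral>x. (u x + c * v x) * (grad \<eta> x \<bullet> b) \<partial>M)
      = (\<integral>x. u x * (grad \<eta> x \<bullet> b) + c * (v x * (grad \<eta> x \<bullet> b)) \<partial>M)"
    by (simp add: algebra_simps)
  also have "\<dots> = (\<integral>x. u x * (grad \<eta> x \<bullet> b) \<partial>M) + c * (\<integral>x. v x * (grad \<eta> x \<bullet> b) \<partial>M)"
    by (subst Bochner_Integration.integral_add[OF i(1,2)]) simp
  also have "\<dots> = - (\<integral>x. (G x \<bullet> b) * \<eta> x \<partial>M) - c * (\<integral>x. (H x \<bullet> b) * \<eta> x \<partial>M)"
    using u(2) v(2) e b unfolding has_weak_gradient_iff by simp
  also have "\<dots> = - (\<integral>x. (G x \<bullet> b) * \<eta> x + c * ((H x \<bullet> b) * \<eta> x) \<partial>M)"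
    by (subst Bochner_Integration.integral_add[OF i(3,4)]) simp
  also have "\<dots> = - (\<integral>x. ((G x + c *\<^sub>R H x) \<bullet> b) * \<eta> x \<partial>M)"
    by (simp add: inner_add_left algebra_simps)
  finally show "(\<integral>x. (u x + c * v x) * (grad \<eta> x \<bullet> b) \<partial>M) = - (\<integral>x. ((G x + c *\<^sub>R H x) \<bullet> b) * \<eta> x \<partial>M)" .
qed

lemma H1I: "sqi M u \<Longrightarrow> has_weak_gradient \<Omega> u G \<Longrightarrow> u \<in> H1 \<Omega>"
  unfolding H1_def L2_on_iff by blast

lemma H1D:
  assumes "u \<in> H1 \<Omega>" shows "sqi M u" "has_weak_gradient \<Omega> u (weak_gradient \<Omega> u)"
proof -
  show "sqi M u" using assms unfolding H1_def L2_on_iff by blast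
  obtain G where "has_weak_gradient \<Omega> u G" using assms unfolding H1_def by blast
  then show "has_weak_gradient \<Omega> u (weak_gradient \<Omega> u)" by (rule weak_gradient_AE(1))
qed

text \<open>The bridge from \<open>H1_norm\<close>, which uses the selected weak gradient of a
  difference, to squared norms of pairs formed with any known weak gradient.\<close>

lemma H1_norm_diff_eq:
  assumes w: "smooth_on UNIV w" and u: "sqi M u" "has_weak_gradient \<Omega> u G"
  shows "H1_norm \<Omega> (\<lambda>x. w x - u x) = sqrt (nsq M (\<lambda>x. gr w x - (u x, G x)))"
proof -
  let ?d = "\<lambda>x. w x - u x"
  have h: "has_weak_gradient \<Omega> ?d (\<lambda>x. grad w x - G x)"
    using has_weak_gradient_lincomb[OF sqi_smooth[OF w] has_weak_gradient_smooth[OF w] u, of "-1"] by simp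
  note wg = weak_gradient_AE[OF h]
  have s: "sqi M ?d" "sqi M (weak_gradient \<Omega> ?d)" "sqi M (\<lambda>x. grad w x - G x)"
    by (rule sqi_diff[OF sqi_smooth[OF w] u(1)], rule has_weak_gradient_sqi[OF wg(1)], rule has_weak_gradient_sqi[OF h])
  have "(\<integral>x. (?d x)\<^sup>2 + (norm (weak_gradient \<Omega> ?d x))\<^sup>2 \<partial>M) = nsq M (\<lambda>x. (?d x, weak_gradient \<Omega> ?d x))"
    by (simp add: nsq_def norm_Pair_square)
  also have "\<dots> = nsq M (\<lambda>x. (?d x, grad w x - G x))"
    by (rule nsq_cong_AE) (use wg(2) in \<open>auto intro!: sqi_Pair s\<close>)
  also have "\<dots> = nsq M (\<lambda>x. gr w x - (u x, G x))"
    by (simp add: gr_def)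
  finally show ?thesis unfolding H1_norm_def by simp
qed

text \<open>The graph of the weak gradient on \<open>H10 \<Omega>\<close>.\<close>

definition Z :: "('a \<Rightarrow> real \<times> 'a) set" where
  "Z = {z. sqi M z \<and> (\<forall>e>0. \<exists>\<eta>\<in>test_functions \<Omega>. nsq M (\<lambda>x. gr \<eta> x - z x) < e)}"

lemma Z_sqi: "z \<in> Z \<Longrightarrow> sqi M z"
  by (simp add: Z_def)

lemma Z_sqi_fst: "z \<in> Z \<Longrightarrow> sqi M (\<lambda>x. fst (z x))" and Z_sqi_snd: "z \<in> Z \<Longrightarrow> sqi M (\<lambda>x. snd (z x))"
  using Z_sqi sqi_fst sqi_snd by blast+

lemma Z_seq:
  assumes "z \<in> Z"
  obtains \<eta> where "\<And>k::nat. \<eta> k \<in> test_functions \<Omega>" "(\<lambda>k. nsq M (\<lambda>x. gr (\<eta> k) x - z x)) \<longlonglongrightarrow> 0"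
proof -
  have "\<forall>k::nat. \<exists>\<eta>\<in>test_functions \<Omega>. nsq M (\<lambda>x. gr \<eta> x - z x) < inverse (real (Suc k))"
    using assms by (auto simp: Z_def)
  then obtain \<eta> where e: "\<And>k::nat. \<eta> k \<in> test_functions \<Omega>"
    "\<And>k. nsq M (\<lambda>x. gr (\<eta> k) x - z x) < inverse (real (Suc k))" by metis
  have "(\<lambda>k. nsq M (\<lambda>x. gr (\<eta> k) x - z x)) \<longlonglongrightarrow> 0"
    by (rule tendsto_sandwich[OF _ _ tendsto_const LIMSEQ_inverse_real_of_nat])
      (use e(2) in \<open>auto intro!: always_eventually less_imp_le\<close>)
  with e(1) show ?thesis by (rule that)
qed

lemma ZI_seq:
  assumes "sqi M z" "\<And>k::nat. \<eta> k \<in> test_functions \<Omega>" "(\<lambda>k. nsq M (\<lambda>x. gr (\<eta> k) x - z x)) \<longlonglongrightarrow> 0"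
  shows "z \<in> Z"
  unfolding Z_def
proof (intro CollectI conjI allI impI)
  fix e :: real assume "e > 0"
  with assms(3) have "\<forall>\<^sub>F k in sequentially. nsq M (\<lambda>x. gr (\<eta> k) x - z x) < e"
    by (rule order_tendstoD(2))
  then obtain k where "nsq M (\<lambda>x. gr (\<eta> k) x - z x) < e" by (auto simp: eventually_sequentially)
  then show "\<exists>\<eta>\<in>test_functions \<Omega>. nsq M (\<lambda>x. gr \<eta> x - z x) < e" using assms(2) by blast
qed fact

lemma Z_gr: "\<eta> \<in> test_functions \<Omega> \<Longrightarrow> gr \<eta> \<in> Z"
  by (rule ZI_seq[of _ "\<lambda>_. \<eta>"]) (auto simp: sqi_gr_test nsq_def)

lemma Z_closed:
  assumes "\<And>n::nat. z n \<in> Z" "sqi M z'" "(\<lambda>n. nsq M (\<lambda>x. z n x - z' x)) \<longlonglongrightarrow> 0"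
  shows "z' \<in> Z"
  unfolding Z_def
proof (intro CollectI conjI allI impI)
  fix e :: real assume e: "e > 0"
  then have "\<forall>\<^sub>F n in sequentially. nsq M (\<lambda>x. z n x - z' x) < e/4"
    using assms(3) by (intro order_tendstoD(2)) auto
  then obtain n where n: "nsq M (\<lambda>x. z n x - z' x) < e/4" by (auto simp: eventually_sequentially)
  have e4: "e/4 > 0" using e by simp
  obtain \<eta> where h: "\<eta> \<in> test_functions \<Omega>" "nsq M (\<lambda>x. gr \<eta> x - z n x) < e/4"
    using assms(1)[of n] e4 unfolding Z_def by blast
  have "nsq M (\<lambda>x. gr \<eta> x - z' x) \<le> 2 * nsq M (\<lambda>x. gr \<eta> x - z n x) + 2 * nsq M (\<lambda>x. z n x - z' x)"
    by (rule nsq_triangle_le) (use assms h sqi_gr_test Z_sqi in auto)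
  then show "\<exists>\<eta>\<in>test_functions \<Omega>. nsq M (\<lambda>x. gr \<eta> x - z' x) < e"
    using h n by (intro bexI[of _ \<eta>]) auto
qed fact

lemma Z_cong_AE:
  assumes "z \<in> Z" "sqi M z'" "AE x in M. z x = z' x" shows "z' \<in> Z"
proof (rule Z_closed[of "\<lambda>_. z", OF assms(1,2)])
  have "nsq M (\<lambda>x. z x - z' x) = nsq M (\<lambda>x. 0 :: real \<times> 'a)"
    by (rule nsq_cong_AE[OF sqi_diff[OF Z_sqi[OF assms(1)] assms(2)] sqi_zero]) (use assms(3) in simp)
  then show "(\<lambda>n. nsq M (\<lambda>x. z x - z' x)) \<longlonglongrightarrow> 0" by (simp add: nsq_def)
qed

lemma Z_scaleR: assumes "z \<in> Z" shows "(\<lambda>x. c *\<^sub>R z x) \<in> Z"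
proof -
  obtain \<eta> where e: "\<And>k::nat. \<eta> k \<in> test_functions \<Omega>" "(\<lambda>k. nsq M (\<lambda>x. gr (\<eta> k) x - z x)) \<longlonglongrightarrow> 0"
    using Z_seq[OF assms] by blast
  show ?thesis
  proof (rule ZI_seq[of _ "\<lambda>k x. c * \<eta> k x"])
    have "(\<lambda>k. c\<^sup>2 * nsq M (\<lambda>x. gr (\<eta> k) x - z x)) \<longlonglongrightarrow> c\<^sup>2 * 0" by (intro tendsto_intros e)
    then show "(\<lambda>k. nsq M (\<lambda>x. gr (\<lambda>x. c * \<eta> k x) x - c *\<^sub>R z x)) \<longlonglongrightarrow> 0"
      by (simp add: gr_cmult[OF test_functions_smooth[OF e(1)]] nsq_scaleR flip: scaleR_diff_right)
  qed (use assms e in \<open>auto intro: sqi_scaleR Z_sqi test_functions_cmult\<close>)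
qed

lemma Z_add: assumes "z \<in> Z" "w \<in> Z" shows "(\<lambda>x. z x + w x) \<in> Z"
proof -
  obtain \<eta> where e: "\<And>k::nat. \<eta> k \<in> test_functions \<Omega>" "(\<lambda>k. nsq M (\<lambda>x. gr (\<eta> k) x - z x)) \<longlonglongrightarrow> 0"
    using Z_seq[OF assms(1)] by blast
  obtain \<xi> where x: "\<And>k::nat. \<xi> k \<in> test_functions \<Omega>" "(\<lambda>k. nsq M (\<lambda>x. gr (\<xi> k) x - w x)) \<longlonglongrightarrow> 0"
    using Z_seq[OF assms(2)] by blast
  have t: "(\<lambda>x. \<eta> k x + \<xi> k x) \<in> test_functions \<Omega>" for k using e x by (intro test_functions_add)
  have g: "gr (\<lambda>x. \<eta> k x + \<xi> k x) x = gr (\<eta> k) x + gr (\<xi> k) x" for k x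
    using e x by (intro gr_add test_functions_smooth)
  show ?thesis
  proof (rule ZI_seq[OF sqi_add[OF assms[THEN Z_sqi]] t], rule tendsto_sandwich[OF _ _ tendsto_const])
    show "\<forall>\<^sub>F k in sequentially. nsq M (\<lambda>xa. gr (\<lambda>x. \<eta> k x + \<xi> k x) xa - (z xa + w xa))
        \<le> 2 * nsq M (\<lambda>x. gr (\<eta> k) x - z x) + 2 * nsq M (\<lambda>x. gr (\<xi> k) x - w x)"
      using nsq_add_le[OF sqi_diff[OF sqi_gr_test[OF e(1)] Z_sqi[OF assms(1)]] sqi_diff[OF sqi_gr_test[OF x(1)] Z_sqi[OF assms(2)]]]
      by (intro always_eventually) (simp add: g algebra_simps)
    have "(\<lambda>k. 2 * nsq M (\<lambda>x. gr (\<eta> k) x - z x) + 2 * nsq M (\<lambda>x. gr (\<xi> k) x - w x)) \<longlonglongrightarrow> 2 * 0 + 2 * 0"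
      by (intro tendsto_intros e x)
    then show "(\<lambda>k. 2 * nsq M (\<lambda>x. gr (\<eta> k) x - z x) + 2 * nsq M (\<lambda>x. gr (\<xi> k) x - w x)) \<longlonglongrightarrow> 0" by simp
  qed simp
qed

lemma Z_diff: "z \<in> Z \<Longrightarrow> w \<in> Z \<Longrightarrow> (\<lambda>x. z x - w x) \<in> Z"
  using Z_add[of z "\<lambda>x. (-1) *\<^sub>R w x"] Z_scaleR[of w "-1"] by simp

lemma Z_zero: "(\<lambda>x. 0) \<in> Z"
  using Z_gr[OF test_functions_zero] by (simp add: gr_def[abs_def] zero_prod_def)

lemma Z_has_weak_gradient:
  assumes "z \<in> Z" shows "has_weak_gradient \<Omega> (\<lambda>x. fst (z x)) (\<lambda>x. snd (z x))"
  unfolding has_weak_gradient_iff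
proof (intro conjI ballI)
  fix \<eta> and b :: 'a assume e: "\<eta> \<in> test_functions \<Omega>" and b: "b \<in> Basis"
  obtain w where w: "\<And>k::nat. w k \<in> test_functions \<Omega>" "(\<lambda>k. nsq M (\<lambda>x. gr (w k) x - z x)) \<longlonglongrightarrow> 0"
    using Z_seq[OF assms] by blast
  have g: "sqi M (\<lambda>x. (grad \<eta> x \<bullet> b, \<eta> x *\<^sub>R b))"
    using sqi_inner_const[OF sqi_grad_test[OF e]] sqi_test[OF e]
    by (intro sqi_Pair) (auto intro!: sqi_continuous continuous_intros smooth_on_imp_continuous_on test_functions_smooth[OF e])
  have i: "(\<integral>x. z' x \<bullet> (grad \<eta> x \<bullet> b, \<eta> x *\<^sub>R b) \<partial>M) = (\<integral>x. fst (z' x) * (grad \<eta> x \<bullet> b) \<partial>M) + (\<integral>x. (snd (z' x) \<bullet> b) * \<eta> x \<partial>M)"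
    if "sqi M z'" for z'
  proof -
    have "(\<integral>x. z' x \<bullet> (grad \<eta> x \<bullet> b, \<eta> x *\<^sub>R b) \<partial>M) = (\<integral>x. fst (z' x) * (grad \<eta> x \<bullet> b) + (snd (z' x) \<bullet> b) * \<eta> x \<partial>M)"
      by (rule Bochner_Integration.integral_cong) (auto simp: inner_prod_def)
    also have "\<dots> = (\<integral>x. fst (z' x) * (grad \<eta> x \<bullet> b) \<partial>M) + (\<integral>x. (snd (z' x) \<bullet> b) * \<eta> x \<partial>M)"
      by (intro Bochner_Integration.integral_add sqi_mult sqi_inner_const sqi_fst[OF that] sqi_snd[OF that]
        sqi_grad_test[OF e] sqi_test[OF e])
    finally show ?thesis .
  qed
  have "(\<lambda>k. \<integral>x. gr (w k) x \<bullet> (grad \<eta> x \<bullet> b, \<eta> x *\<^sub>R b) \<partial>M) \<longlonglongrightarrow> (\<integral>x. z x \<bullet> (grad \<eta> x \<bullet> b, \<eta> x *\<^sub>R b) \<partial>M)"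
    by (rule sqi_tendsto_inner_const[OF sqi_gr_test[OF w(1)] Z_sqi[OF assms] g w(2)])
  moreover have "(\<integral>x. gr (w k) x \<bullet> (grad \<eta> x \<bullet> b, \<eta> x *\<^sub>R b) \<partial>M) = 0" for k
    using integral_by_parts[OF test_functions_smooth[OF w(1)[of k]] e, of b] by (simp add: i[OF sqi_gr_test[OF w(1)]])
  ultimately have "(\<integral>x. z x \<bullet> (grad \<eta> x \<bullet> b, \<eta> x *\<^sub>R b) \<partial>M) = 0" by (simp add: LIMSEQ_const_iff)
  then show "(\<integral>x. fst (z x) * (grad \<eta> x \<bullet> b) \<partial>M) = - (\<integral>x. (snd (z x) \<bullet> b) * \<eta> x \<partial>M)"
    by (simp add: i[OF Z_sqi[OF assms]])
qed (rule Z_sqi_snd[OF assms])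

lemma Z_weak_gradient_AE: "z \<in> Z \<Longrightarrow> AE x in M. weak_gradient \<Omega> (\<lambda>x. fst (z x)) x = snd (z x)"
  by (rule weak_gradient_AE(2)[OF Z_has_weak_gradient])

text \<open>With the converse below, the first components of \<open>Z\<close> are exactly the
  elements of \<open>H10 \<Omega>\<close>, so the weak equations may be tested with members of
  \<open>Z\<close> and conversely.\<close>

lemma Z_imp_H10:
  assumes "z \<in> Z" shows "(\<lambda>x. fst (z x)) \<in> H10 \<Omega>"
proof -
  note h = Z_has_weak_gradient[OF assms] and s = Z_sqi_fst[OF assms]
  obtain \<eta> where e: "\<And>k::nat. \<eta> k \<in> test_functions \<Omega>" "(\<lambda>k. nsq M (\<lambda>x. gr (\<eta> k) x - z x)) \<longlonglongrightarrow> 0"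
    using Z_seq[OF assms] by blast
  have "(\<lambda>k. sqrt (nsq M (\<lambda>x. gr (\<eta> k) x - z x))) \<longlonglongrightarrow> sqrt 0"
    by (intro tendsto_intros e)
  then have "(\<lambda>k. H1_norm \<Omega> (\<lambda>x. \<eta> k x - fst (z x))) \<longlonglongrightarrow> 0"
    by (simp add: H1_norm_diff_eq[OF test_functions_smooth[OF e(1)] s h])
  then show ?thesis
    unfolding H10_def using e(1) H1I[OF s h] by (intro CollectI conjI exI[of _ \<eta>]) auto
qed

lemma H10_imp_Z:
  assumes "u \<in> H10 \<Omega>" shows "(\<lambda>x. (u x, weak_gradient \<Omega> u x)) \<in> Z"
proof -
  have u: "u \<in> H1 \<Omega>" using assms by (simp add: H10_def)
  note s = H1D(1)[OF u] and h = H1D(2)[OF u]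
  obtain \<eta> where e: "\<And>k::nat. \<eta> k \<in> test_functions \<Omega>" "(\<lambda>k. H1_norm \<Omega> (\<lambda>x. \<eta> k x - u x)) \<longlonglongrightarrow> 0"
    using assms by (auto simp: H10_def)
  have "(\<lambda>k. (H1_norm \<Omega> (\<lambda>x. \<eta> k x - u x))\<^sup>2) \<longlonglongrightarrow> 0\<^sup>2" by (intro tendsto_intros e)
  then show ?thesis
    by (intro ZI_seq[of _ \<eta>] sqi_Pair s has_weak_gradient_sqi[OF h] e(1))
      (simp add: H1_norm_diff_eq[OF test_functions_smooth[OF e(1)] s h])
qed

subsection \<open>The Poincare inequality\<close>

lemma nsq_M_eq_nn_integral:
  fixes f :: "'a \<Rightarrow> 'b::euclidean_space"
  assumes "continuous_on UNIV f" "compact K" "K \<subseteq> \<Omega>" "\<And>x. x \<notin> K \<Longrightarrow> f x = 0"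
  shows "ennreal (nsq M f) = (\<integral>\<^sup>+x. ennreal ((norm (f x))\<^sup>2) \<partial>lborel)"
proof -
  have c: "continuous_on UNIV (\<lambda>x. (norm (f x))\<^sup>2)" by (intro continuous_intros assms)
  have "integrable lborel (\<lambda>x. (norm (f x))\<^sup>2)"
    by (rule continuous_compact_support_integrable[OF c assms(2)]) (simp add: assms(4))
  then have "(\<integral>\<^sup>+x. ennreal ((norm (f x))\<^sup>2) \<partial>lborel) = ennreal (\<integral>x. (norm (f x))\<^sup>2 \<partial>lborel)"
    by (intro nn_integral_eq_integral) auto
  also have "(\<integral>x. (norm (f x))\<^sup>2 \<partial>lborel) = nsq M f"
    unfolding nsq_def by (rule integral_M_eq_lborel[symmetric])
      (use assms in \<open>auto intro!: borel_measurable_continuous_onI c\<close>)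
  finally show ?thesis by simp
qed

lemma nsq_test_eq_nn_integral:
  assumes "\<eta> \<in> test_functions \<Omega>"
  shows "ennreal (nsq M \<eta>) = (\<integral>\<^sup>+x. ennreal ((\<eta> x)\<^sup>2) \<partial>lborel)"
    "ennreal (nsq M (grad \<eta>)) = (\<integral>\<^sup>+x. ennreal ((norm (grad \<eta> x))\<^sup>2) \<partial>lborel)"
  using nsq_M_eq_nn_integral[of \<eta> "supp \<eta>"] nsq_M_eq_nn_integral[of "grad \<eta>" "supp \<eta>"] assms
    continuous_on_grad[of \<eta>] smooth_on_imp_continuous_on[of UNIV \<eta>]
  by (simp_all add: test_functions_iff not_in_supp grad_eq_0)

text \<open>For \<open>|h|\<close> larger than the diameter of \<open>\<Omega>\<close> the supports of \<open>\<eta>\<close> and its translate are disjoint.\<close>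

lemma poincare_test:
  obtains P where "P > 0" "\<And>\<eta>. \<eta> \<in> test_functions \<Omega> \<Longrightarrow> nsq M \<eta> \<le> P * nsq M (grad \<eta>)"
proof -
  obtain R where R: "R > 0" "\<And>x. x \<in> \<Omega> \<Longrightarrow> norm x \<le> R" using bounded_\<Omega> by (auto simp: bounded_pos)
  obtain b :: 'a where b: "b \<in> Basis" using nonempty_Basis by blast
  \<comment> \<open>Length 3 R exceeds 2 R, the largest possible distance between two points of
    \<Omega>.\<close>
  define h where "h = (3 * R) *\<^sub>R b"
  have nh: "norm h = 3 * R" using b R by (simp add: h_def)
  have "nsq M \<eta> \<le> (3 * R)\<^sup>2 * nsq M (grad \<eta>)" if e: "\<eta> \<in> test_functions \<Omega>" for \<eta>
  proof -
    have *: "\<eta> x = 0 \<or> \<eta> (x + h) = 0" for x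
    proof (rule ccontr)
      assume "\<not> ?thesis"
      then have "x \<in> \<Omega>" "x + h \<in> \<Omega>" using test_functions_supp[OF e] not_in_supp by blast+
      then have "norm x \<le> R" "norm (x + h) \<le> R" using R by auto
      moreover have "norm h \<le> norm (x + h) + norm x" using norm_triangle_ineq4[of "x + h" x] by simp
      ultimately show False using nh R(1) by linarith
    qed
    have "ennreal (nsq M \<eta>) = (\<integral>\<^sup>+x. ennreal ((\<eta> x)\<^sup>2) \<partial>lborel)" by (rule nsq_test_eq_nn_integral[OF e])
    also have "\<dots> \<le> (\<integral>\<^sup>+x. ennreal ((\<eta> (x + h) - \<eta> x)\<^sup>2) \<partial>lborel)"
    proof (intro nn_integral_mono ennreal_leI)
      fix x show "(\<eta> x)\<^sup>2 \<le> (\<eta> (x + h) - \<eta> x)\<^sup>2" using *[of x] by auto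
    qed
    also have "\<dots> \<le> ennreal ((norm h)\<^sup>2) * ennreal (nsq M (grad \<eta>))"
      unfolding nsq_test_eq_nn_integral[OF e] by (rule translation_estimate[OF test_functions_smooth[OF e]])
    also have "\<dots> = ennreal ((3 * R)\<^sup>2 * nsq M (grad \<eta>))" by (simp add: ennreal_mult nh)
    finally show ?thesis by simp
  qed
  then show ?thesis using R(1) by (intro that[of "(3 * R)\<^sup>2"]) auto
qed

text \<open>Both sides are continuous along the approximating sequence of test functions, so an
  inequality between quadratic forms passes to the closure.\<close>

lemma Z_limit_inequality:
  assumes t: "\<And>\<eta>. \<eta> \<in> test_functions \<Omega> \<Longrightarrow> a * nsq M \<eta> \<le> c * nsq M (grad \<eta>)" and z: "z \<in> Z"
  shows "a * nsq M (\<lambda>x. fst (z x)) \<le> c * nsq M (\<lambda>x. snd (z x))"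
proof -
  obtain \<eta> where e: "\<And>k::nat. \<eta> k \<in> test_functions \<Omega>" "(\<lambda>k. nsq M (\<lambda>x. gr (\<eta> k) x - z x)) \<longlonglongrightarrow> 0"
    using Z_seq[OF z] by blast
  have n: "nsq M (\<lambda>x. gr (\<eta> k) x - z x) = nsq M (\<lambda>x. \<eta> k x - fst (z x)) + nsq M (\<lambda>x. grad (\<eta> k) x - snd (z x))" for k
    using nsq_fst_snd[OF sqi_diff[OF sqi_gr_test[OF e(1)[of k]] Z_sqi[OF z]]] by simp
  have "(\<lambda>k. nsq M (\<lambda>x. \<eta> k x - fst (z x))) \<longlonglongrightarrow> 0" "(\<lambda>k. nsq M (\<lambda>x. grad (\<eta> k) x - snd (z x))) \<longlonglongrightarrow> 0"
    by (rule tendsto_sandwich[OF _ _ tendsto_const e(2)], simp, simp add: n)+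
  note lim = nsq_tendsto[OF sqi_test[OF e(1)] Z_sqi_fst[OF z] this(1)]
    nsq_tendsto[OF sqi_grad_test[OF e(1)] Z_sqi_snd[OF z] this(2)]
  have "(\<lambda>k. a * nsq M (\<eta> k)) \<longlonglongrightarrow> a * nsq M (\<lambda>x. fst (z x))"
    "(\<lambda>k. c * nsq M (grad (\<eta> k))) \<longlonglongrightarrow> c * nsq M (\<lambda>x. snd (z x))"
    by (intro tendsto_mult tendsto_const lim)+
  then show ?thesis by (rule LIMSEQ_le) (use t[OF e(1)] in auto)
qed

lemma poincare:
  obtains P where "P > 0" "\<And>z. z \<in> Z \<Longrightarrow> nsq M (\<lambda>x. fst (z x)) \<le> P * nsq M (\<lambda>x. snd (z x))"
proof -
  obtain P where P: "P > 0" "\<And>\<eta>. \<eta> \<in> test_functions \<Omega> \<Longrightarrow> nsq M \<eta> \<le> P * nsq M (grad \<eta>)" using poincare_test by blast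
  show ?thesis using Z_limit_inequality[of 1 P] P by (intro that[of P]) auto
qed

end

subsection \<open>Compactness\<close>

text \<open>The indicator of the event that \<open>x\<close> and \<open>y\<close> lie in the same
  half-open cube of the grid of mesh 1/N. The product form makes joint measurability
  immediate.\<close>

definition cell :: "real \<Rightarrow> 'a::euclidean_space \<Rightarrow> 'a \<Rightarrow> real" where
  "cell N x y = (\<Prod>b\<in>Basis. if \<lfloor>N * (x \<bullet> b)\<rfloor> = \<lfloor>N * (y \<bullet> b)\<rfloor> then 1 else 0)"

lemma cell_eq: "cell N x y = (if \<forall>b\<in>Basis. \<lfloor>N * (x \<bullet> b)\<rfloor> = \<lfloor>N * (y \<bullet> b)\<rfloor> then 1 else 0)"
proof (cases "\<forall>b\<in>Basis. \<lfloor>N * (x \<bullet> b)\<rfloor> = \<lfloor>N * (y \<bullet> b)\<rfloor>")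
  case True
  then show ?thesis unfolding cell_def by (simp add: prod.neutral)
next
  case False
  then show ?thesis unfolding cell_def by (auto intro!: prod_zero)
qed

lemma cell_measurable [measurable]:
  "(\<lambda>z. cell N (fst z) (snd z)) \<in> borel_measurable (borel \<Otimes>\<^sub>M borel)"
  "cell N x \<in> borel_measurable borel"
  unfolding cell_def[abs_def] by measurable

lemma cell_box:
  fixes x :: "'a::euclidean_space"
  assumes N: "N > 0"
  defines "l \<equiv> \<Sum>b\<in>Basis. (real_of_int \<lfloor>N * (x \<bullet> b)\<rfloor> / N) *\<^sub>R b"
  shows "y \<in> box l (l + (1/N) *\<^sub>R One) \<Longrightarrow> cell N x y = 1"
    and "cell N x y \<noteq> 0 \<Longrightarrow> y \<in> cbox l (l + (1/N) *\<^sub>R One)"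
proof -
  have l: "l \<bullet> b = real_of_int \<lfloor>N * (x \<bullet> b)\<rfloor> / N" if "b \<in> Basis" for b
    unfolding l_def using that by simp
  show "cell N x y = 1" if y: "y \<in> box l (l + (1/N) *\<^sub>R One)"
  proof -
    have "\<lfloor>N * (x \<bullet> b)\<rfloor> = \<lfloor>N * (y \<bullet> b)\<rfloor>" if b: "b \<in> Basis" for b
    proof -
      have "l \<bullet> b < y \<bullet> b" "y \<bullet> b < l \<bullet> b + 1 / N"
        using y b by (auto simp: mem_box inner_add_left)
      then have "real_of_int \<lfloor>N * (x \<bullet> b)\<rfloor> < N * (y \<bullet> b)" "N * (y \<bullet> b) < real_of_int \<lfloor>N * (x \<bullet> b)\<rfloor> + 1"
        using N unfolding l[OF b] by (simp_all add: field_simps)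
      then show ?thesis by linarith
    qed
    then show ?thesis by (simp add: cell_eq)
  qed
  show "y \<in> cbox l (l + (1/N) *\<^sub>R One)" if y: "cell N x y \<noteq> 0"
    unfolding mem_box
  proof
    fix b :: 'a assume b: "b \<in> Basis"
    have "\<lfloor>N * (x \<bullet> b)\<rfloor> = \<lfloor>N * (y \<bullet> b)\<rfloor>" using y b by (auto simp: cell_eq split: if_splits)
    then have "real_of_int \<lfloor>N * (x \<bullet> b)\<rfloor> \<le> N * (y \<bullet> b)" "N * (y \<bullet> b) \<le> real_of_int \<lfloor>N * (x \<bullet> b)\<rfloor> + 1"
      by linarith+
    then show "l \<bullet> b \<le> y \<bullet> b \<and> y \<bullet> b \<le> (l + (1/N) *\<^sub>R One) \<bullet> b"
      using N b by (simp add: l inner_add_left field_simps)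
  qed
qed

text \<open>The half-open cube lies between an open and a closed box with the same corners, and
  these have equal volume.\<close>

lemma nn_integral_cell:
  fixes x :: "'a::euclidean_space"
  assumes N: "N > 0"
  shows "(\<integral>\<^sup>+y. ennreal (cell N x y) \<partial>lborel) = ennreal ((1/N) ^ DIM('a))"
proof -
  let ?l = "\<Sum>b\<in>Basis. (real_of_int \<lfloor>N * (x \<bullet> b)\<rfloor> / N) *\<^sub>R b :: 'a"
  let ?u = "?l + (1/N) *\<^sub>R One"
  have lu: "?l \<bullet> b \<le> ?u \<bullet> b" "(?u - ?l) \<bullet> b = 1 / N" if "b \<in> Basis" for b
    using N that by (simp_all add: inner_add_left)
  have e: "emeasure lborel (box ?l ?u) = ennreal ((1/N) ^ DIM('a))"
    "emeasure lborel (cbox ?l ?u) = ennreal ((1/N) ^ DIM('a))"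
    by (simp_all only: emeasure_lborel_box[OF lu(1)] emeasure_lborel_cbox[OF lu(1)] lu(2) prod_constant cong: prod.cong)
  show ?thesis
  proof (rule antisym)
    have "(\<integral>\<^sup>+y. ennreal (cell N x y) \<partial>lborel) \<le> (\<integral>\<^sup>+y. indicator (cbox ?l ?u) y \<partial>lborel)"
    proof (rule nn_integral_mono)
      fix y show "ennreal (cell N x y) \<le> indicator (cbox ?l ?u) y"
        using cell_box(2)[OF N, of x y] cell_eq[of N x y] by (cases "cell N x y = 0") (auto simp: indicator_def)
    qed
    then show "(\<integral>\<^sup>+y. ennreal (cell N x y) \<partial>lborel) \<le> ennreal ((1/N) ^ DIM('a))" by (simp add: e)
    have "(\<integral>\<^sup>+y. indicator (box ?l ?u) y \<partial>lborel) \<le> (\<integral>\<^sup>+y. ennreal (cell N x y) \<partial>lborel)"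
    proof (rule nn_integral_mono)
      fix y show "indicator (box ?l ?u) y \<le> ennreal (cell N x y)"
        using cell_box(1)[OF N, of y x] by (cases "y \<in> box ?l ?u") (auto simp: indicator_def)
    qed
    then show "ennreal ((1/N) ^ DIM('a)) \<le> (\<integral>\<^sup>+y. ennreal (cell N x y) \<partial>lborel)" by (simp add: e)
  qed
qed

lemma cell_translate_norm:
  fixes h :: "'a::euclidean_space"
  assumes N: "N > 0" and c: "cell N x (x + h) \<noteq> 0"
  shows "h \<in> cbox (- ((1/N) *\<^sub>R One)) ((1/N) *\<^sub>R One)"
  unfolding mem_box
proof
  fix b :: 'a assume b: "b \<in> Basis"
  have "\<lfloor>N * (x \<bullet> b)\<rfloor> = \<lfloor>N * (x \<bullet> b) + N * (h \<bullet> b)\<rfloor>"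
    using c b by (auto simp: cell_eq inner_add_left distrib_left split: if_splits)
  then have "\<bar>N * (h \<bullet> b)\<bar> \<le> 1" by linarith
  then show "- ((1/N) *\<^sub>R One) \<bullet> b \<le> h \<bullet> b \<and> h \<bullet> b \<le> (1/N) *\<^sub>R One \<bullet> b"
    using N b by (simp add: abs_le_iff field_simps)
qed

text \<open>The mean of \<open>f\<close> over the grid cube containing \<open>x\<close>: the factor
  is the reciprocal of the volume of a cube.\<close>

definition cell_average :: "real \<Rightarrow> ('a::euclidean_space \<Rightarrow> real) \<Rightarrow> 'a \<Rightarrow> real" where
  "cell_average N f x = (\<integral>y. cell N x y * f y \<partial>lborel) * N ^ DIM('a)"

lemma integrable_cell:
  fixes x :: "'a::euclidean_space"
  assumes "N > 0" shows "integrable lborel (cell N x)" "(\<integral>y. cell N x y \<partial>lborel) = (1/N) ^ DIM('a)"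
proof -
  have nn: "0 \<le> cell N x y" for y by (simp add: cell_eq)
  have "has_bochner_integral lborel (cell N x) ((1/N) ^ DIM('a))"
    by (rule has_bochner_integral_nn_integral) (use nn nn_integral_cell[OF assms, of x] assms in auto)
  then show "integrable lborel (cell N x)" "(\<integral>y. cell N x y \<partial>lborel) = (1/N) ^ DIM('a)"
    by (auto simp: has_bochner_integral_iff)
qed

text \<open>By Cauchy-Schwarz in the cell, v |f x - average|^2 is at most the integral of |f (x + h)
  - f x|^2 over the h with coordinates bounded by 1/N, where v = N^(-d) is the cell volume. The
  translation estimate contributes |h|^2 \<le> d / N^2 and the cube of all h has volume (2/N)^d;
  dividing by v leaves 2^d d / N^2.\<close>

lemma cell_average_estimate:
  fixes f :: "'a::euclidean_space \<Rightarrow> real"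
  assumes f: "f \<in> test_functions UNIV" and N: "N > 0"
  shows "(\<integral>\<^sup>+x. ennreal ((f x - cell_average N f x)\<^sup>2) \<partial>lborel) \<le>
    ennreal (2 ^ DIM('a) * DIM('a) / N\<^sup>2) * (\<integral>\<^sup>+x. ennreal ((norm (grad f x))\<^sup>2) \<partial>lborel)"
proof -
  note sm = test_functions_smooth[OF f]
  have fm[measurable]: "f \<in> borel_measurable borel"
    using smooth_on_imp_continuous_on[OF sm] by (rule borel_measurable_continuous_onI)
  obtain B where "B \<ge> 0" and B: "\<And>x. norm (f x) \<le> B"
    using continuous_compact_support_bounded[of f "supp f", OF smooth_on_imp_continuous_on[OF sm]
        test_functions_compact[OF f] not_in_supp[of _ f]] by blast
  let ?v = "(1/N) ^ DIM('a)" and ?D = "\<integral>\<^sup>+x. ennreal ((norm (grad f x))\<^sup>2) \<partial>lborel"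
  let ?Q = "cbox (- ((1/N) *\<^sub>R One)) ((1/N) *\<^sub>R One) :: 'a set"
  have v: "?v > 0" using N by simp
  have cc: "cell N x y * cell N x y = cell N x y" "0 \<le> cell N x y" "cell N x y \<le> 1" for x y :: 'a
    by (simp_all add: cell_eq)
  have ic: "integrable lborel (\<lambda>y. cell N x y * f y)" for x
    by (rule Bochner_Integration.integrable_bound[of _ "\<lambda>y. B * cell N x y"])
      (use integrable_cell(1)[OF N, of x] B cc \<open>B \<ge> 0\<close> in \<open>auto intro!: AE_I2 mult_right_mono simp: abs_mult mult.commute[of _ "f _"]\<close>)
  have pt: "ennreal ?v * ennreal ((f x - cell_average N f x)\<^sup>2) \<le>
      (\<integral>\<^sup>+h. indicator ?Q h * ennreal ((f (x + h) - f x)\<^sup>2) \<partial>lborel)" for x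
  proof -
    have i1: "integrable lborel (\<lambda>y. f x * cell N x y)" using integrable_cell(1)[OF N, of x] by simp
    have eq: "?v * (f x - cell_average N f x) = (\<integral>y. cell N x y * (f x - f y) \<partial>lborel)"
    proof -
      have "(\<integral>y. cell N x y * (f x - f y) \<partial>lborel) = (\<integral>y. f x * cell N x y - cell N x y * f y \<partial>lborel)"
        by (simp add: algebra_simps)
      also have "\<dots> = f x * ?v - (\<integral>y. cell N x y * f y \<partial>lborel)"
        by (subst Bochner_Integration.integral_diff[OF i1 ic]) (simp add: integrable_cell(2)[OF N])
      finally show ?thesis using N by (simp add: cell_average_def field_simps)
    qed
    have "ennreal \<bar>?v * (f x - cell_average N f x)\<bar> \<le> (\<integral>\<^sup>+y. ennreal (norm (cell N x y * (f x - f y))) \<partial>lborel)"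
    proof -
      have "integrable lborel (\<lambda>y. cell N x y * (f x - f y))"
        using Bochner_Integration.integrable_diff[OF i1 ic[of x]] by (simp add: algebra_simps)
      from integral_norm_bound_ennreal[OF this] show ?thesis unfolding eq by simp
    qed
    also have "\<dots> = (\<integral>\<^sup>+y. ennreal (cell N x y * \<bar>f x - f y\<bar>) * ennreal (cell N x y) \<partial>lborel)"
    proof (intro nn_integral_cong)
      fix y
      have "cell N x y = 0 \<or> cell N x y = 1" by (simp add: cell_eq)
      then show "ennreal (norm (cell N x y * (f x - f y))) = ennreal (cell N x y * \<bar>f x - f y\<bar>) * ennreal (cell N x y)"
        by auto
    qed
    finally have "(ennreal \<bar>?v * (f x - cell_average N f x)\<bar>)\<^sup>2 \<le>
      (\<integral>\<^sup>+y. ennreal (cell N x y * \<bar>f x - f y\<bar>) * ennreal (cell N x y) \<partial>lborel)\<^sup>2"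
      by (intro power_mono_ennreal)
    also have "\<dots> \<le> (\<integral>\<^sup>+y. (ennreal (cell N x y * \<bar>f x - f y\<bar>))\<^sup>2 \<partial>lborel) * (\<integral>\<^sup>+y. (ennreal (cell N x y))\<^sup>2 \<partial>lborel)"
      by (rule Cauchy_Schwarz_nn_integral) measurable
    also have "(\<integral>\<^sup>+y. (ennreal (cell N x y))\<^sup>2 \<partial>lborel) = ennreal ?v"
      unfolding nn_integral_cell[OF N, of x, symmetric]
      by (intro nn_integral_cong) (simp add: power2_eq_square cc flip: ennreal_mult)
    also have "(\<integral>\<^sup>+y. (ennreal (cell N x y * \<bar>f x - f y\<bar>))\<^sup>2 \<partial>lborel) = (\<integral>\<^sup>+y. ennreal (cell N x y * (f x - f y)\<^sup>2) \<partial>lborel)"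
    proof (intro nn_integral_cong)
      fix y
      have "(cell N x y)\<^sup>2 = cell N x y" using cc(1)[of x y] by (simp add: power2_eq_square)
      then show "(ennreal (cell N x y * \<bar>f x - f y\<bar>))\<^sup>2 = ennreal (cell N x y * (f x - f y)\<^sup>2)"
        by (simp add: ennreal_power cc power_mult_distrib)
    qed
    also have "\<dots> = (\<integral>\<^sup>+h. ennreal (cell N x (h + x) * (f x - f (h + x))\<^sup>2) \<partial>lborel)"
      by (rule lborel_nn_integral_translate[symmetric]) measurable
    also have "\<dots> \<le> (\<integral>\<^sup>+h. indicator ?Q h * ennreal ((f (x + h) - f x)\<^sup>2) \<partial>lborel)"
    proof (intro nn_integral_mono)
      fix h
      show "ennreal (cell N x (h + x) * (f x - f (h + x))\<^sup>2) \<le> indicator ?Q h * ennreal ((f (x + h) - f x)\<^sup>2)"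
      proof (cases "cell N x (x + h) = 0")
        case False
        then have "cell N x (x + h) = 1" by (auto simp: cell_eq split: if_splits)
        then show ?thesis using cell_translate_norm[OF N False] by (simp add: add.commute power2_commute)
      qed (simp add: add.commute)
    qed
    finally have "(ennreal \<bar>?v * (f x - cell_average N f x)\<bar>)\<^sup>2 \<le>
      (\<integral>\<^sup>+h. indicator ?Q h * ennreal ((f (x + h) - f x)\<^sup>2) \<partial>lborel) * ennreal ?v"
      by (simp add: mult_right_mono)
    also have "(ennreal \<bar>?v * (f x - cell_average N f x)\<bar>)\<^sup>2 = ennreal ?v * (ennreal ?v * ennreal ((f x - cell_average N f x)\<^sup>2))"
      using v by (simp add: ennreal_power ennreal_mult[symmetric] power_mult_distrib power2_eq_square[of ?v] mult.assoc)
    finally have "ennreal ?v * (ennreal ?v * ennreal ((f x - cell_average N f x)\<^sup>2)) \<le>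
        ennreal ?v * (\<integral>\<^sup>+h. indicator ?Q h * ennreal ((f (x + h) - f x)\<^sup>2) \<partial>lborel)"
      by (simp add: mult.commute)
    then show ?thesis by (subst (asm) ennreal_mult_le_mult_iff) (use N in auto)
  qed
  have am[measurable]: "cell_average N f \<in> borel_measurable borel"
    unfolding cell_average_def[abs_def] by measurable
  have "ennreal ?v * (\<integral>\<^sup>+x. ennreal ((f x - cell_average N f x)\<^sup>2) \<partial>lborel)
      = (\<integral>\<^sup>+x. ennreal ?v * ennreal ((f x - cell_average N f x)\<^sup>2) \<partial>lborel)"
    by (rule nn_integral_cmult[symmetric]) measurable
  also have "\<dots> \<le> (\<integral>\<^sup>+x. \<integral>\<^sup>+h. indicator ?Q h * ennreal ((f (x + h) - f x)\<^sup>2) \<partial>lborel \<partial>lborel)"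
    by (intro nn_integral_mono pt)
  also have "\<dots> = (\<integral>\<^sup>+h. \<integral>\<^sup>+x. indicator ?Q h * ennreal ((f (x + h) - f x)\<^sup>2) \<partial>lborel \<partial>lborel)"
    by (rule lborel_pair.Fubini') measurable
  also have "\<dots> \<le> (\<integral>\<^sup>+h. (ennreal (DIM('a) / N\<^sup>2) * ?D) * indicator ?Q h \<partial>lborel)"
  proof (intro nn_integral_mono)
    fix h :: 'a
    have "(\<integral>\<^sup>+x. indicator ?Q h * ennreal ((f (x + h) - f x)\<^sup>2) \<partial>lborel)
        = indicator ?Q h * (\<integral>\<^sup>+x. ennreal ((f (x + h) - f x)\<^sup>2) \<partial>lborel)"
      by (rule nn_integral_cmult) measurable
    also have "\<dots> \<le> (ennreal (DIM('a) / N\<^sup>2) * ?D) * indicator ?Q h"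
    proof (cases "h \<in> ?Q")
      case True
      have "(norm h)\<^sup>2 = (\<Sum>b\<in>Basis. (h \<bullet> b)\<^sup>2)"
        unfolding power2_norm_eq_inner by (subst euclidean_inner) (simp add: power2_eq_square)
      also have "\<dots> \<le> (\<Sum>b\<in>(Basis::'a set). (1/N)\<^sup>2)"
      proof (rule sum_mono)
        fix b :: 'a assume b: "b \<in> Basis"
        have "\<bar>h \<bullet> b\<bar> \<le> 1 / N" using True b by (auto simp: mem_box abs_le_iff)
        then show "(h \<bullet> b)\<^sup>2 \<le> (1/N)\<^sup>2" by (metis abs_ge_zero power2_abs power_mono)
      qed
      finally have "(norm h)\<^sup>2 \<le> DIM('a) / N\<^sup>2" by (simp add: power_divide)
      then have "ennreal ((norm h)\<^sup>2) * ?D \<le> ennreal (DIM('a) / N\<^sup>2) * ?D"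
        by (intro mult_right_mono ennreal_leI) auto
      then show ?thesis using translation_estimate[OF sm, of h] True by simp
    qed simp
    finally show "(\<integral>\<^sup>+x. indicator ?Q h * ennreal ((f (x + h) - f x)\<^sup>2) \<partial>lborel) \<le> (ennreal (DIM('a) / N\<^sup>2) * ?D) * indicator ?Q h" .
  qed
  also have "\<dots> = (ennreal (DIM('a) / N\<^sup>2) * ?D) * emeasure lborel ?Q"
    by (rule nn_integral_cmult_indicator) simp
  also have "emeasure lborel ?Q = ennreal ((2/N) ^ DIM('a))"
  proof -
    have "(- ((1/N) *\<^sub>R One)) \<bullet> b \<le> ((1/N) *\<^sub>R One) \<bullet> b" "((1/N) *\<^sub>R One - - ((1/N) *\<^sub>R One)) \<bullet> b = 2 / N"
      if "b \<in> Basis" for b :: 'a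
      using N that by (simp_all add: inner_diff_left inner_add_left)
    then show ?thesis by (simp only: emeasure_lborel_cbox prod_constant cong: prod.cong)
  qed
  also have "(ennreal (DIM('a) / N\<^sup>2) * ?D) * ennreal ((2/N) ^ DIM('a))
      = ennreal ?v * (ennreal (2 ^ DIM('a) * DIM('a) / N\<^sup>2) * ?D)"
  proof -
    have "ennreal (DIM('a) / N\<^sup>2) * ennreal ((2/N) ^ DIM('a)) = ennreal ?v * ennreal (2 ^ DIM('a) * DIM('a) / N\<^sup>2)"
      using N by (simp add: ennreal_mult[symmetric] power_divide mult.commute)
    moreover have "(a * d) * b = v * (w * d)" if "a * b = v * w" for a b d v w :: ennreal
    proof -
      have "(a * d) * b = (a * b) * d" by (simp add: mult_ac)
      also have "\<dots> = v * (w * d)" unfolding that by (simp add: mult_ac)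
      finally show ?thesis .
    qed
    ultimately show ?thesis by blast
  qed
  finally show ?thesis by (subst (asm) ennreal_mult_le_mult_iff) (use N in auto)
qed

lemma nsq_parallelogram:
  assumes "sqi M a" "sqi M b"
  shows "nsq M (\<lambda>x. a x - b x) + nsq M (\<lambda>x. a x + b x) = 2 * nsq M a + 2 * nsq M b"
proof -
  have "nsq M (\<lambda>x. a x - b x) = nsq M a - 2 * (\<integral>x. a x \<bullet> b x \<partial>M) + nsq M b"
    using nsq_add_eq[OF assms(1) sqi_scaleR[OF assms(2), of "-1"]] nsq_scaleR[of M "-1" b] by simp
  then show ?thesis using nsq_add_eq[OF assms] by simp
qed

context bounded_open
begin

lemma nsq_le_nn_integral:
  assumes "sqi M f" "f \<in> borel_measurable borel"
  shows "ennreal (nsq M f) \<le> (\<integral>\<^sup>+x. ennreal ((norm (f x))\<^sup>2) \<partial>lborel)"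
proof -
  have "ennreal (nsq M f) = (\<integral>\<^sup>+x. ennreal ((norm (f x))\<^sup>2) \<partial>M)"
    unfolding nsq_def by (rule nn_integral_eq_integral[symmetric]) (use sqi_integrable[OF assms(1)] in auto)
  also have "\<dots> = (\<integral>\<^sup>+x. ennreal ((norm (f x))\<^sup>2) * indicator \<Omega> x \<partial>lebesgue)"
    by (rule nn_integral_restrict_space) simp
  also have "\<dots> \<le> (\<integral>\<^sup>+x. ennreal ((norm (f x))\<^sup>2) \<partial>lebesgue)"
    by (intro nn_integral_mono) (auto simp: indicator_def)
  finally show ?thesis by (simp add: nn_integral_completion)
qed

text \<open>Cell averages approximate all the functions uniformly in \<open>n\<close>, with an error
  controlled by the gradients. For a fixed mesh the averages are bounded and depend only on
  countably many cells, so a diagonal subsequence makes them converge pointwise, and by boundedness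
  also in L^2.\<close>

theorem rellich:
  assumes e: "\<And>n. \<eta> n \<in> test_functions \<Omega>" and K: "\<And>n::nat. nsq M (grad (\<eta> n)) \<le> K"
  obtains r where "strict_mono (r::nat\<Rightarrow>nat)"
    "\<forall>e>0. \<exists>k. \<forall>m\<ge>k. \<forall>n\<ge>k. nsq M (\<lambda>x. \<eta> (r m) x - \<eta> (r n) x) < e"
proof -
  have K0: "K \<ge> 0" using K[of 0] nsq_nonneg order_trans by blast
  obtain P where P: "P > 0" "\<And>\<eta>. \<eta> \<in> test_functions \<Omega> \<Longrightarrow> nsq M \<eta> \<le> P * nsq M (grad \<eta>)"
    using poincare_test by blast
  define C where "C = sqrt (measure M (space M)) * sqrt (P * K)"
  have C0: "C \<ge> 0" unfolding C_def using P(1) K0 by simp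
  have em[measurable]: "\<eta> n \<in> borel_measurable borel" for n
    by (intro borel_measurable_continuous_onI smooth_on_imp_continuous_on test_functions_smooth[OF e])
  have ei: "integrable lborel (\<lambda>y. \<bar>\<eta> n y\<bar>)" for n
    using continuous_compact_support_integrable[of "\<eta> n" "supp (\<eta> n)",
        OF smooth_on_imp_continuous_on[OF test_functions_smooth[OF e]] test_functions_compact[OF e] not_in_supp[of _ "\<eta> n"]]
    by (rule integrable_abs)
  have bd: "\<bar>\<integral>y. cell N x y * \<eta> n y \<partial>lborel\<bar> \<le> C" for N x n
  proof -
    have c: "\<bar>cell N x y\<bar> \<le> 1" for y by (simp add: cell_eq)
    have "norm (\<integral>y. cell N x y * \<eta> n y \<partial>lborel) \<le> (\<integral>y. \<bar>\<eta> n y\<bar> \<partial>lborel)"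
    proof (rule order_trans[OF integral_norm_bound integral_mono])
      have le: "norm (cell N x y * \<eta> n y) \<le> \<bar>\<eta> n y\<bar>" for y
        using c[of y] by (simp add: abs_mult mult_left_le_one_le)
      then show "norm (cell N x y * \<eta> n y) \<le> \<bar>\<eta> n y\<bar>" for y .
      show "integrable lborel (\<lambda>y. norm (cell N x y * \<eta> n y))"
        by (rule Bochner_Integration.integrable_bound[OF ei[of n]]) (use le in \<open>auto intro!: AE_I2\<close>)
    qed (rule ei)
    also have "\<dots> = (\<integral>y. norm (\<eta> n y) \<partial>M)"
      by (subst integral_M_eq_lborel) (use test_functions_supp[OF e[of n]] in \<open>auto intro: not_in_supp\<close>)
    also have "\<dots> \<le> sqrt (measure M (space M)) * sqrt (nsq M (\<eta> n))"
      by (rule M.L1_le_nsq[OF sqi_test[OF e]])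
    also have "\<dots> \<le> C"
      unfolding C_def using order_trans[OF P(2)[OF e[of n]] mult_left_mono[OF K[of n] less_imp_le[OF P(1)]]]
      by (intro mult_left_mono real_sqrt_le_mono) auto
    finally show ?thesis by simp
  qed
  obtain D :: "'a set" where D: "countable D" "\<And>X. open X \<Longrightarrow> X \<noteq> {} \<Longrightarrow> \<exists>d\<in>D. d \<in> X"
    using countable_dense_setE by blast
  \<comment> \<open>Every cell contains a point of the dense set \<open>D\<close>, so convergence at
    the countably many pairs (mesh, point of \<open>D\<close>) gives convergence of the averages at
    every point.\<close>
  define A where "A n p = (\<integral>y. cell (real (Suc (fst p))) (snd p) y * \<eta> n y \<partial>lborel)" for n and p :: "nat \<times> 'a"
  have "countable ((UNIV::nat set) \<times> D)" using D by auto
  then obtain r where r: "strict_mono (r::nat\<Rightarrow>nat)" "\<And>p. p \<in> UNIV \<times> D \<Longrightarrow> \<exists>l. (\<lambda>n. A (r n) p) \<longlonglongrightarrow> l"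
    by (rule function_convergent_subsequence[of _ A C]) (auto simp: A_def bd)
  have conv: "\<exists>l. (\<lambda>n. cell_average (real (Suc N)) (\<eta> (r n)) x) \<longlonglongrightarrow> l" for N x
  proof -
    let ?l = "\<Sum>b\<in>Basis. (real_of_int \<lfloor>real (Suc N) * (x \<bullet> b)\<rfloor> / real (Suc N)) *\<^sub>R b :: 'a"
    have "box ?l (?l + (1/real (Suc N)) *\<^sub>R One) \<noteq> {}"
      unfolding box_ne_empty by (simp add: inner_add_left)
    then obtain d where d: "d \<in> D" "d \<in> box ?l (?l + (1/real (Suc N)) *\<^sub>R One)"
      using D(2)[OF open_box] by blast
    then have "cell (real (Suc N)) x d = 1" by (intro cell_box(1)) auto
    then have "\<forall>b\<in>Basis. \<lfloor>real (Suc N) * (x \<bullet> b)\<rfloor> = \<lfloor>real (Suc N) * (d \<bullet> b)\<rfloor>"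
      by (simp add: cell_eq split: if_splits)
    then have "cell (real (Suc N)) x = cell (real (Suc N)) d" by (auto simp: cell_eq fun_eq_iff)
    moreover obtain l where "(\<lambda>n. A (r n) (N, d)) \<longlonglongrightarrow> l" using r(2)[of "(N, d)"] d by auto
    ultimately have "(\<lambda>n. cell_average (real (Suc N)) (\<eta> (r n)) x) \<longlonglongrightarrow> l * real (Suc N) ^ DIM('a)"
      unfolding cell_average_def A_def by (intro tendsto_intros) simp
    then show ?thesis by blast
  qed
  have "\<forall>e0>0. \<exists>k. \<forall>m\<ge>k. \<forall>n\<ge>k. nsq M (\<lambda>x. \<eta> (r m) x - \<eta> (r n) x) < e0"
  proof (intro allI impI)
    fix e0 :: real assume e0: "e0 > 0"
    let ?E = "2 ^ DIM('a) * DIM('a) * K"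
    have E0: "?E \<ge> 0" using K0 by simp
    \<comment> \<open>The factor 2 of \<open>nsq_triangle_le\<close> is paid twice: two errors of
      e0/16 add up to e0/4, and two of e0/4 to e0.\<close>
    obtain N where N: "16 * ?E / e0 < real (Suc N)"
    proof -
      obtain k where "16 * ?E / e0 < real k" using reals_Archimedean2 by blast
      then have "16 * ?E / e0 < real (Suc k)" by simp
      then show thesis by (rule that)
    qed
    let ?N = "real (Suc N)"
    let ?a = "\<lambda>n. cell_average ?N (\<eta> (r n))"
    define g where "g x = lim (\<lambda>n. ?a n x)" for x
    have am[measurable]: "?a n \<in> borel_measurable borel" for n
      unfolding cell_average_def[abs_def] by measurable
    have gm[measurable]: "g \<in> borel_measurable borel" unfolding g_def[abs_def] by measurable
    have lim: "(\<lambda>n. ?a n x) \<longlonglongrightarrow> g x" for x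
      unfolding g_def using conv[of N x] convergent_LIMSEQ_iff unfolding convergent_def by blast
    have ab: "\<bar>?a n x\<bar> \<le> C * ?N ^ DIM('a)" for n x
      unfolding cell_average_def abs_mult using bd C0 by (intro mult_mono) auto
    have gb: "\<bar>g x\<bar> \<le> C * ?N ^ DIM('a)" for x
      by (rule LIMSEQ_le_const2[OF tendsto_rabs[OF lim]]) (use ab in auto)
    have sa: "sqi M (?a n)" for n
      by (rule M.sqi_bounded[OF borel_imp_measurable_M[OF am], of n "C * ?N ^ DIM('a)"])
        (rule AE_I2, unfold real_norm_def, rule ab)
    have sg: "sqi M g"
      by (rule M.sqi_bounded[OF borel_imp_measurable_M[OF gm], of "C * ?N ^ DIM('a)"])
        (rule AE_I2, unfold real_norm_def, rule gb)
    have "(\<lambda>n. nsq M (\<lambda>x. ?a n x - g x)) \<longlonglongrightarrow> (\<integral>x. 0 \<partial>M)"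
      unfolding nsq_def
    proof (rule integral_dominated_convergence[where w="\<lambda>_. (2 * (C * ?N ^ DIM('a)))\<^sup>2"])
      show "AE x in M. (\<lambda>n. (norm (?a n x - g x))\<^sup>2) \<longlonglongrightarrow> 0"
      proof (rule AE_I2)
        fix x
        have "(\<lambda>n. (norm (?a n x - g x))\<^sup>2) \<longlonglongrightarrow> (norm (g x - g x))\<^sup>2" by (intro tendsto_intros lim)
        then show "(\<lambda>n. (norm (?a n x - g x))\<^sup>2) \<longlonglongrightarrow> 0" by simp
      qed
      show "AE x in M. norm ((norm (?a n x - g x))\<^sup>2) \<le> (2 * (C * ?N ^ DIM('a)))\<^sup>2" for n
      proof (rule AE_I2)
        fix x
        have "\<bar>?a n x - g x\<bar> \<le> 2 * (C * ?N ^ DIM('a))" using ab[of n x] gb[of x] by linarith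
        then have "\<bar>?a n x - g x\<bar>\<^sup>2 \<le> (2 * (C * ?N ^ DIM('a)))\<^sup>2" by (intro power_mono) auto
        then show "norm ((norm (?a n x - g x))\<^sup>2) \<le> (2 * (C * ?N ^ DIM('a)))\<^sup>2" by simp
      qed
      show "(\<lambda>x. (norm (?a n x - g x))\<^sup>2) \<in> borel_measurable M" for n
        by (rule borel_imp_measurable_M) measurable
    qed auto
    then have "(\<lambda>n. nsq M (\<lambda>x. ?a n x - g x)) \<longlonglongrightarrow> 0" by simp
    moreover have "e0 / 16 > 0" using e0 by simp
    ultimately have "\<forall>\<^sub>F n in sequentially. nsq M (\<lambda>x. ?a n x - g x) < e0 / 16"
      by (rule order_tendstoD(2))
    then obtain k where k: "\<And>n. n \<ge> k \<Longrightarrow> nsq M (\<lambda>x. ?a n x - g x) < e0 / 16"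
      by (auto simp: eventually_sequentially)
    have st: "sqi M (\<eta> n)" for n by (rule sqi_test[OF e])
    have b1: "nsq M (\<lambda>x. \<eta> (r n) x - ?a n x) \<le> e0 / 16" for n
    proof -
      have "ennreal (nsq M (\<lambda>x. \<eta> (r n) x - ?a n x)) \<le> (\<integral>\<^sup>+x. ennreal ((\<eta> (r n) x - ?a n x)\<^sup>2) \<partial>lborel)"
        using nsq_le_nn_integral[OF sqi_diff[OF st sa] borel_measurable_diff[OF em am], of "r n" n] by simp
      also have "\<dots> \<le> ennreal (2 ^ DIM('a) * DIM('a) / ?N\<^sup>2) * ennreal (nsq M (grad (\<eta> (r n))))"
        unfolding nsq_test_eq_nn_integral[OF e]
        by (rule cell_average_estimate[OF test_functions_UNIV[OF e]]) simp
      also have "\<dots> = ennreal (2 ^ DIM('a) * DIM('a) / ?N\<^sup>2 * nsq M (grad (\<eta> (r n))))"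
        by (rule ennreal_mult[symmetric]) auto
      finally have "nsq M (\<lambda>x. \<eta> (r n) x - ?a n x) \<le> 2 ^ DIM('a) * DIM('a) / ?N\<^sup>2 * nsq M (grad (\<eta> (r n)))"
        by (subst (asm) ennreal_le_iff) auto
      also have "\<dots> \<le> 2 ^ DIM('a) * DIM('a) / ?N\<^sup>2 * K"
        by (intro mult_left_mono K) auto
      also have "\<dots> = ?E / ?N\<^sup>2" by simp
      also have "\<dots> \<le> ?E / ?N"
      proof (rule divide_left_mono[OF _ E0])
        have "?N * 1 \<le> ?N * ?N" by (intro mult_left_mono) auto
        then show "?N \<le> ?N\<^sup>2" by (simp only: power2_eq_square mult_1_right)
      qed simp
      also have "\<dots> \<le> e0 / 16" using N e0 by (simp add: field_simps)
      finally show ?thesis .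
    qed
    have b2: "nsq M (\<lambda>x. \<eta> (r n) x - g x) < e0 / 4" if "n \<ge> k" for n
      using nsq_triangle_le[OF st sa sg, of "r n" n] b1[of n] k[OF that] by linarith
    have "nsq M (\<lambda>x. \<eta> (r m) x - \<eta> (r n) x) < e0" if "m \<ge> k" "n \<ge> k" for m n
      using nsq_triangle_le[OF st sg st, of "r m" "r n"] b2[OF that(1)] b2[OF that(2)]
        nsq_minus_commute[of M g "\<eta> (r n)"] by linarith
    then show "\<exists>k. \<forall>m\<ge>k. \<forall>n\<ge>k. nsq M (\<lambda>x. \<eta> (r m) x - \<eta> (r n) x) < e0" by blast
  qed
  with r(1) show ?thesis by (rule that)
qed

subsection \<open>The first Dirichlet eigenvalue\<close>

text \<open>\<open>LEAST\<close> is meaningful only if a least eigenvalue exists. The direct method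
  supplies it: a minimizing sequence of the Rayleigh quotient converges to an eigenfunction whose
  eigenvalue is the infimum \<Lambda>, and no eigenvalue is below \<Lambda>.\<close>

theorem first_dirichlet_eigenvalue_rayleigh:
  assumes ne: "\<Omega> \<noteq> {}" and z: "z \<in> Z"
  shows "first_dirichlet_eigenvalue \<Omega> * nsq M (\<lambda>x. fst (z x)) \<le> nsq M (\<lambda>x. snd (z x))"
proof -
  let ?R = "{nsq M (grad \<eta>) |\<eta>. \<eta> \<in> test_functions \<Omega> \<and> nsq M \<eta> = 1}"
  define \<Lambda> where "\<Lambda> = Inf ?R"
  have bdd: "bdd_below ?R" by (rule bdd_belowI[of _ 0]) auto
  have nrm: "\<exists>\<xi>\<in>test_functions \<Omega>. nsq M \<xi> = 1 \<and> nsq M (grad \<eta>) = nsq M \<eta> * nsq M (grad \<xi>)"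
    if e: "\<eta> \<in> test_functions \<Omega>" and p: "nsq M \<eta> > 0" for \<eta>
  proof -
    let ?c = "1 / sqrt (nsq M \<eta>)"
    have "grad (\<lambda>x. ?c * \<eta> x) = (\<lambda>x. ?c *\<^sub>R grad \<eta> x)"
      using gr_cmult[OF test_functions_smooth[OF e], of ?c] by (simp add: gr_def fun_eq_iff)
    then have "nsq M (grad (\<lambda>x. ?c * \<eta> x)) = ?c\<^sup>2 * nsq M (grad \<eta>)" by (simp only: nsq_scaleR)
    moreover have "nsq M (\<lambda>x. ?c * \<eta> x) = ?c\<^sup>2 * nsq M \<eta>" using nsq_scaleR[of M ?c \<eta>] by simp
    moreover have "?c\<^sup>2 = 1 / nsq M \<eta>" using p by (simp add: power_divide)
    ultimately show ?thesis
      using p test_functions_cmult[OF e, of ?c] by (intro bexI[of _ "\<lambda>x. ?c * \<eta> x"]) auto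
  qed
  have Lt: "\<Lambda> * nsq M \<eta> \<le> 1 * nsq M (grad \<eta>)" if e: "\<eta> \<in> test_functions \<Omega>" for \<eta>
  proof (cases "nsq M \<eta> = 0")
    case False
    then have p: "nsq M \<eta> > 0" using nsq_nonneg[of M \<eta>] by linarith
    obtain \<xi> where x: "\<xi> \<in> test_functions \<Omega>" "nsq M \<xi> = 1" "nsq M (grad \<eta>) = nsq M \<eta> * nsq M (grad \<xi>)"
      using nrm[OF e p] by blast
    have "\<Lambda> \<le> nsq M (grad \<xi>)" unfolding \<Lambda>_def using x by (intro cInf_lower bdd) auto
    then show ?thesis using p x(3) by (simp add: mult.commute mult_left_mono)
  qed simp
  have LZ: "\<Lambda> * nsq M (\<lambda>x. fst (y x)) \<le> 1 * nsq M (\<lambda>x. snd (y x))" if "y \<in> Z" for y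
    by (rule Z_limit_inequality[OF Lt that])
  \<comment> \<open>A bump inside the nonempty set \<Omega>, once normalized, keeps the infimum from
    being taken over the empty set.\<close>
  have "?R \<noteq> {}"
  proof -
    obtain p where "p \<in> \<Omega>" using ne by blast
    then obtain r where r: "r > 0" "cball p r \<subseteq> \<Omega>" using open_\<Omega> open_contains_cball by blast
    have b: "bump p (r/2) \<in> test_functions \<Omega>"
      by (rule test_functionsI[OF smooth_bump compact_cball r(2)]) (use bump_eq_0[of "r/2"] r in auto)
    have "nsq M (bump p (r/2)) \<noteq> 0"
    proof
      assume "nsq M (bump p (r/2)) = 0"
      then have "(\<integral>\<^sup>+x. ennreal ((bump p (r/2) x)\<^sup>2) \<partial>lborel) = 0"
        using nsq_test_eq_nn_integral(1)[OF b] by simp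
      moreover have "(\<integral>\<^sup>+x. indicator (ball p (r/2)) x \<partial>lborel) \<le> (\<integral>\<^sup>+x. ennreal ((bump p (r/2) x)\<^sup>2) \<partial>lborel)"
      proof (intro nn_integral_mono)
        fix x
        show "indicator (ball p (r/2)) x \<le> ennreal ((bump p (r/2) x)\<^sup>2)"
        proof (cases "x \<in> ball p (r/2)")
          case True
          then have "bump p (r/2) x = 1" using r by (intro bump_eq_1) auto
          then show ?thesis by (simp add: indicator_def)
        qed simp
      qed
      ultimately have "emeasure lborel (ball p (r/2)) = 0" by simp
      then have "ball p (r/2) \<in> null_sets lborel" by auto
      then have "negligible (ball p (r/2))" unfolding negligible_iff_null_sets by (rule null_sets_completionI)
      then show False using open_not_negligible[of "ball p (r/2)"] r by auto
    qed
    then have "nsq M (bump p (r/2)) > 0" using nsq_nonneg[of M "bump p (r/2)"] by linarith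
    from nrm[OF b this] obtain \<xi> where "\<xi> \<in> test_functions \<Omega>" "nsq M \<xi> = 1" by blast
    then have "nsq M (grad \<xi>) \<in> ?R" by blast
    then show ?thesis by blast
  qed
  then have "\<exists>\<eta>\<in>test_functions \<Omega>. nsq M \<eta> = 1 \<and> nsq M (grad \<eta>) < \<Lambda> + inverse (real (Suc n))" for n
    using cInf_lessD[of ?R "\<Lambda> + inverse (real (Suc n))"] unfolding \<Lambda>_def by auto
  then obtain \<eta> where e: "\<And>n. \<eta> n \<in> test_functions \<Omega>" "\<And>n. nsq M (\<eta> n) = 1"
    "\<And>n. nsq M (grad (\<eta> n)) < \<Lambda> + inverse (real (Suc n))" by metis
  have "nsq M (grad (\<eta> n)) \<le> \<Lambda> + 1" for n
  proof -
    have "inverse (real (Suc n)) \<le> 1" by (simp add: field_simps)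
    then show ?thesis using e(3)[of n] by linarith
  qed
  then obtain r where r: "strict_mono (r::nat\<Rightarrow>nat)"
    "\<forall>e>0. \<exists>k. \<forall>m\<ge>k. \<forall>n\<ge>k. nsq M (\<lambda>x. \<eta> (r m) x - \<eta> (r n) x) < e"
    by (rule rellich[of \<eta>, OF e(1)])
  have L0: "\<Lambda> \<ge> 0" unfolding \<Lambda>_def using \<open>?R \<noteq> {}\<close> by (intro cInf_greatest) auto
  let ?d = "\<lambda>m n. nsq M (\<lambda>x. \<eta> (r m) x - \<eta> (r n) x)"
  \<comment> \<open>The parallelogram law upgrades L^2 convergence to convergence of gradients: the
    sum f + g has squared norm 4 - d, hence energy at least \<Lambda> (4 - d), and the terms 4
    \<Lambda> cancel against the energies of f and g.\<close>
  have par: "nsq M (\<lambda>x. gr (\<eta> (r m)) x - gr (\<eta> (r n)) x)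
      \<le> 2 * inverse (real (Suc m)) + 2 * inverse (real (Suc n)) + (\<Lambda> + 1) * ?d m n" for m n
  proof -
    let ?f = "\<eta> (r m)" and ?g = "\<eta> (r n)"
    have g: "grad (\<lambda>x. ?f x + ?g x) = (\<lambda>x. grad ?f x + grad ?g x)"
      using grad_add[OF test_functions_smooth[OF e(1), THEN smooth_differentiable] test_functions_smooth[OF e(1), THEN smooth_differentiable]]
      by (simp add: fun_eq_iff)
    have 1: "nsq M (\<lambda>x. ?f x + ?g x) = 4 - ?d m n"
      using nsq_parallelogram[OF sqi_test[OF e(1)] sqi_test[OF e(1)], of "r m" "r n"] e(2) by simp
    have 2: "\<Lambda> * nsq M (\<lambda>x. ?f x + ?g x) \<le> nsq M (\<lambda>x. grad ?f x + grad ?g x)"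
      using Lt[OF test_functions_add[OF e(1)[of "r m"] e(1)[of "r n"]]] by (simp add: g)
    have 3: "nsq M (\<lambda>x. grad ?f x - grad ?g x) = 2 * nsq M (grad ?f) + 2 * nsq M (grad ?g) - nsq M (\<lambda>x. grad ?f x + grad ?g x)"
      using nsq_parallelogram[OF sqi_grad_test[OF e(1)] sqi_grad_test[OF e(1)], of "r m" "r n"] by simp
    have 4: "nsq M (grad (\<eta> (r k))) \<le> \<Lambda> + inverse (real (Suc k))" for k
    proof -
      have "inverse (real (Suc (r k))) \<le> inverse (real (Suc k))"
        using seq_suble[OF r(1), of k] by (intro le_imp_inverse_le) auto
      then show ?thesis using e(3)[of "r k"] by linarith
    qed
    have "nsq M (\<lambda>x. gr ?f x - gr ?g x) = ?d m n + nsq M (\<lambda>x. grad ?f x - grad ?g x)"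
      using nsq_fst_snd[OF sqi_diff[OF sqi_gr_test[OF e(1)[of "r m"]] sqi_gr_test[OF e(1)[of "r n"]]]] by simp
    also have "\<dots> \<le> ?d m n + 2 * (\<Lambda> + inverse (real (Suc m))) + 2 * (\<Lambda> + inverse (real (Suc n))) - \<Lambda> * (4 - ?d m n)"
      using 2 3 4[of m] 4[of n] unfolding 1 right_diff_distrib distrib_left by linarith
    finally show ?thesis by (simp add: algebra_simps)
  qed
  have "\<exists>k. \<forall>m\<ge>k. \<forall>n\<ge>k. nsq M (\<lambda>x. gr (\<eta> (r m)) x - gr (\<eta> (r n)) x) < e0" if e0: "e0 > 0" for e0
  proof -
    have "e0 / (4 * (\<Lambda> + 1)) > 0" using e0 L0 by simp
    then obtain k1 where k1: "\<And>m n. m \<ge> k1 \<Longrightarrow> n \<ge> k1 \<Longrightarrow> ?d m n < e0 / (4 * (\<Lambda> + 1))" using r(2) by blast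
    obtain k2 where k2: "inverse (real (Suc k2)) < e0 / 8" using reals_Archimedean[of "e0/8"] e0 by auto
    have "nsq M (\<lambda>x. gr (\<eta> (r m)) x - gr (\<eta> (r n)) x) < e0" if mn: "m \<ge> max k1 k2" "n \<ge> max k1 k2" for m n
    proof -
      have "inverse (real (Suc m)) \<le> inverse (real (Suc k2))" "inverse (real (Suc n)) \<le> inverse (real (Suc k2))"
        using mn by (intro le_imp_inverse_le; simp)+
      moreover have "(\<Lambda> + 1) * ?d m n < e0 / 4"
        using k1[of m n] mn L0 by (simp add: field_simps)
      ultimately show ?thesis using par[of m n] k2 e0 by linarith
    qed
    then show ?thesis by blast
  qed
  then obtain v where v: "sqi M v" "(\<lambda>n. nsq M (\<lambda>x. gr (\<eta> (r n)) x - v x)) \<longlonglongrightarrow> 0"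
    by (rule M.sqi_complete[of "\<lambda>n. gr (\<eta> (r n))", OF sqi_gr_test[OF e(1)]])
  have vZ: "v \<in> Z" by (rule ZI_seq[OF v(1) e(1) v(2)])
  have n: "nsq M (\<lambda>x. gr (\<eta> (r k)) x - v x) = nsq M (\<lambda>x. \<eta> (r k) x - fst (v x)) + nsq M (\<lambda>x. grad (\<eta> (r k)) x - snd (v x))" for k
    using nsq_fst_snd[OF sqi_diff[OF sqi_gr_test[OF e(1)[of "r k"]] v(1)]] by simp
  have "(\<lambda>k. nsq M (\<lambda>x. \<eta> (r k) x - fst (v x))) \<longlonglongrightarrow> 0" "(\<lambda>k. nsq M (\<lambda>x. grad (\<eta> (r k)) x - snd (v x))) \<longlonglongrightarrow> 0"
    by (rule tendsto_sandwich[OF _ _ tendsto_const v(2)], simp, simp add: n)+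
  note lim = nsq_tendsto[OF sqi_test[OF e(1)] Z_sqi_fst[OF vZ] this(1)]
    nsq_tendsto[OF sqi_grad_test[OF e(1)] Z_sqi_snd[OF vZ] this(2)]
  have v1: "nsq M (\<lambda>x. fst (v x)) = 1" using lim(1) by (simp add: e(2) LIMSEQ_const_iff)
  have v2: "nsq M (\<lambda>x. snd (v x)) = \<Lambda>"
  proof (rule antisym)
    show "\<Lambda> \<le> nsq M (\<lambda>x. snd (v x))" using LZ[OF vZ] v1 by simp
    have "(\<lambda>n. \<Lambda> + inverse (real (Suc n))) \<longlonglongrightarrow> \<Lambda> + 0" by (intro tendsto_intros LIMSEQ_inverse_real_of_nat)
    then have l: "(\<lambda>n. \<Lambda> + inverse (real (Suc (r n)))) \<longlonglongrightarrow> \<Lambda>"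
      using LIMSEQ_subseq_LIMSEQ[OF _ r(1), of "\<lambda>n. \<Lambda> + inverse (real (Suc n))" \<Lambda>] by (simp add: o_def)
    show "nsq M (\<lambda>x. snd (v x)) \<le> \<Lambda>"
      by (rule LIMSEQ_le[OF lim(2) l]) (use less_imp_le[OF e(3)] in blast)
  qed
  \<comment> \<open>The form energy minus \<Lambda> times squared norm is nonnegative on
    \<open>Z\<close> and vanishes at \<open>v\<close>, so it has no linear term there.\<close>
  have EL: "(\<integral>x. snd (v x) \<bullet> snd (w x) \<partial>M) = \<Lambda> * (\<integral>x. fst (v x) * fst (w x) \<partial>M)" if w: "w \<in> Z" for w
  proof -
    let ?b = "(\<integral>x. snd (v x) \<bullet> snd (w x) \<partial>M) - \<Lambda> * (\<integral>x. fst (v x) * fst (w x) \<partial>M)"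
    let ?c = "nsq M (\<lambda>x. snd (w x)) - \<Lambda> * nsq M (\<lambda>x. fst (w x))"
    have "?b\<^sup>2 \<le> 0 * ?c"
    proof (rule quadratic_nonneg_discriminant)
      fix t
      have "nsq M (\<lambda>x. snd (v x) + t *\<^sub>R snd (w x)) = \<Lambda> + 2 * t * (\<integral>x. snd (v x) \<bullet> snd (w x) \<partial>M) + t\<^sup>2 * nsq M (\<lambda>x. snd (w x))"
        using nsq_add_eq[OF Z_sqi_snd[OF vZ] sqi_scaleR[OF Z_sqi_snd[OF w], of t]] by (simp add: nsq_scaleR v2)
      moreover have "nsq M (\<lambda>x. fst (v x) + t *\<^sub>R fst (w x)) = 1 + 2 * t * (\<integral>x. fst (v x) * fst (w x) \<partial>M) + t\<^sup>2 * nsq M (\<lambda>x. fst (w x))"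
        using nsq_add_eq[OF Z_sqi_fst[OF vZ] sqi_scaleR[OF Z_sqi_fst[OF w], of t]] nsq_scaleR[of M t "\<lambda>x. fst (w x)"]
        by (simp add: v1 mult.left_commute[of _ t])
      ultimately show "0 \<le> 0 + 2 * t * ?b + t\<^sup>2 * ?c"
        using LZ[OF Z_add[OF vZ Z_scaleR[OF w, of t]]] by (simp add: algebra_simps)
    qed (use LZ[OF w] in simp)
    then show ?thesis by simp
  qed
  have "first_dirichlet_eigenvalue \<Omega> = \<Lambda>"
    unfolding first_dirichlet_eigenvalue_def
  proof (rule Least_equality)
    show "dirichlet_eigenvalue \<Omega> \<Lambda>"
      unfolding dirichlet_eigenvalue_def
    proof (intro bexI conjI ballI)
      show "(\<lambda>x. fst (v x)) \<in> H10 \<Omega>" by (rule Z_imp_H10[OF vZ])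
      show "\<not> (AE x in M. fst (v x) = 0)"
      proof
        assume "AE x in M. fst (v x) = 0"
        then have "nsq M (\<lambda>x. fst (v x)) = nsq M (\<lambda>x. 0::real)"
          by (intro nsq_cong_AE Z_sqi_fst vZ) auto
        then show False using v1 by (simp add: nsq_def)
      qed
      fix w assume "w \<in> H10 \<Omega>"
      from H10_imp_Z[OF this] have w: "(\<lambda>x. (w x, weak_gradient \<Omega> w x)) \<in> Z" .
      have "(\<integral>x. weak_gradient \<Omega> (\<lambda>x. fst (v x)) x \<bullet> weak_gradient \<Omega> w x \<partial>M) = (\<integral>x. snd (v x) \<bullet> weak_gradient \<Omega> w x \<partial>M)"
      proof (rule integral_cong_AE)
        show "AE x in M. weak_gradient \<Omega> (\<lambda>x. fst (v x)) x \<bullet> weak_gradient \<Omega> w x = snd (v x) \<bullet> weak_gradient \<Omega> w x"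
          using Z_weak_gradient_AE[OF vZ] by eventually_elim simp
        have [measurable]: "weak_gradient \<Omega> w \<in> borel_measurable M" "(\<lambda>x. snd (v x)) \<in> borel_measurable M"
          "weak_gradient \<Omega> (\<lambda>x. fst (v x)) \<in> borel_measurable M"
          using sqi_measurable[OF Z_sqi_snd[OF w]] sqi_measurable[OF Z_sqi_snd[OF vZ]]
            sqi_measurable[OF has_weak_gradient_sqi[OF weak_gradient_AE(1)[OF Z_has_weak_gradient[OF vZ]]]] by simp_all
        show "(\<lambda>x. weak_gradient \<Omega> (\<lambda>x. fst (v x)) x \<bullet> weak_gradient \<Omega> w x) \<in> borel_measurable M"
          "(\<lambda>x. snd (v x) \<bullet> weak_gradient \<Omega> w x) \<in> borel_measurable M" by measurable
      qed
      then show "(\<integral>x. weak_gradient \<Omega> (\<lambda>x. fst (v x)) x \<bullet> weak_gradient \<Omega> w x \<partial>M) = \<Lambda> * (\<integral>x. fst (v x) * w x \<partial>M)"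
        using EL[OF w] by simp
    qed
    \<comment> \<open>Testing an eigenfunction with itself exhibits its eigenvalue as a Rayleigh
      quotient.\<close>
    fix \<mu> assume "dirichlet_eigenvalue \<Omega> \<mu>"
    then obtain u where u: "u \<in> H10 \<Omega>" "\<not> (AE x in M. u x = 0)"
      "(\<integral>x. weak_gradient \<Omega> u x \<bullet> weak_gradient \<Omega> u x \<partial>M) = \<mu> * (\<integral>x. u x * u x \<partial>M)"
      unfolding dirichlet_eigenvalue_def by blast
    note uZ = H10_imp_Z[OF u(1)]
    have su: "sqi M u" using Z_sqi_fst[OF uZ] by simp
    have "nsq M u \<noteq> 0"
    proof
      assume "nsq M u = 0"
      then have "AE x in M. (norm (u x))\<^sup>2 = 0"
        using integral_nonneg_eq_0_iff_AE[OF sqi_integrable[OF su]] by (simp add: nsq_def)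
      then show False using u(2) by simp
    qed
    then have "nsq M u > 0" using nsq_nonneg[of M u] by linarith
    moreover have "\<Lambda> * nsq M u \<le> \<mu> * nsq M u"
      using LZ[OF uZ] u(3) by (simp add: nsq_eq_inner)
    ultimately show "\<Lambda> \<le> \<mu>" by simp
  qed
  then show ?thesis using LZ[OF z] by simp
qed

end

section \<open>The Sobolev inequality in dimension three\<close>

definition vec3 :: "real \<Rightarrow> real \<Rightarrow> real \<Rightarrow> real^3" where
  "vec3 a b c = a *\<^sub>R axis 1 1 + b *\<^sub>R axis 2 1 + c *\<^sub>R axis 3 1"

lemma vec3_nth [simp]: "vec3 a b c $ 1 = a" "vec3 a b c $ 2 = b" "vec3 a b c $ 3 = c"
  by (simp_all add: vec3_def axis_def)

lemma vec3_measurable [measurable]: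
  assumes [measurable]: "f \<in> borel_measurable N" "g \<in> borel_measurable N" "h \<in> borel_measurable N"
  shows "(\<lambda>x. vec3 (f x) (g x) (h x)) \<in> borel_measurable N"
  unfolding vec3_def by measurable

text \<open>Lebesgue measure is characterized by its values on boxes, whose preimages are products
  of intervals. This gives access to iterated integrals in the three coordinates.\<close>

lemma lborel_vec3:
  "(lborel :: (real^3) measure) = distr (lborel \<Otimes>\<^sub>M (lborel \<Otimes>\<^sub>M lborel)) borel (\<lambda>(a, b, c). vec3 a b c)"
proof (rule lborel_eqI)
  have B: "(Basis :: (real^3) set) = range (\<lambda>i. axis i 1)" by (auto simp: Basis_vec_def)
  fix l u :: "real^3" assume le: "\<And>b. b \<in> Basis \<Longrightarrow> l \<bullet> b \<le> u \<bullet> b"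
  have le': "l $ i \<le> u $ i" for i
    using le[of "axis i 1"] by (simp add: B inner_axis)
  have "(\<lambda>(a, b, c). vec3 a b c) -` box l u \<inter> space (lborel \<Otimes>\<^sub>M (lborel \<Otimes>\<^sub>M lborel))
      = box (l$1) (u$1) \<times> (box (l$2) (u$2) \<times> box (l$3) (u$3))"
    by (auto simp: mem_box_cart forall_3 space_pair_measure)
  then have "emeasure (distr (lborel \<Otimes>\<^sub>M (lborel \<Otimes>\<^sub>M lborel)) borel (\<lambda>(a, b, c). vec3 a b c)) (box l u)
      = emeasure (lborel \<Otimes>\<^sub>M (lborel \<Otimes>\<^sub>M lborel)) (box (l$1) (u$1) \<times> (box (l$2) (u$2) \<times> box (l$3) (u$3)))"
    by (subst emeasure_distr) auto
  also have "\<dots> = emeasure lborel (box (l$1) (u$1)) * emeasure (lborel \<Otimes>\<^sub>M lborel) (box (l$2) (u$2) \<times> box (l$3) (u$3))"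
    unfolding lborel_prod
    by (subst lborel_prod[symmetric], subst lborel.emeasure_pair_measure_Times) (auto intro!: borel_open open_Times)
  also have "\<dots> = emeasure lborel (box (l$1) (u$1)) * (emeasure lborel (box (l$2) (u$2)) * emeasure lborel (box (l$3) (u$3)))"
    by (subst lborel.emeasure_pair_measure_Times) auto
  also have "\<dots> = ennreal ((u$1 - l$1) * ((u$2 - l$2) * (u$3 - l$3)))"
    using le' by (simp add: ennreal_mult)
  also have "(u$1 - l$1) * ((u$2 - l$2) * (u$3 - l$3)) = (\<Prod>b\<in>Basis. (u - l) \<bullet> b)"
  proof -
    have inj: "inj (\<lambda>i::3. axis i (1::real))" by (rule injI) (simp add: axis_eq_axis)
    have "(\<Prod>b\<in>Basis. (u - l) \<bullet> b) = (\<Prod>i\<in>UNIV. u $ i - l $ i)"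
      unfolding B by (subst prod.reindex[OF inj]) (simp add: inner_axis)
    also have "\<dots> = (u$1 - l$1) * ((u$2 - l$2) * (u$3 - l$3))"
      unfolding UNIV_3 by (simp add: mult.assoc)
    finally show ?thesis by simp
  qed
  finally show "emeasure (distr (lborel \<Otimes>\<^sub>M (lborel \<Otimes>\<^sub>M lborel)) borel (\<lambda>(a, b, c). vec3 a b c)) (box l u)
      = (\<Prod>b\<in>Basis. (u - l) \<bullet> b)" .
qed simp

lemma nn_integral_vec3:
  fixes f :: "real^3 \<Rightarrow> ennreal"
  assumes [measurable]: "f \<in> borel_measurable borel"
  shows "(\<integral>\<^sup>+x. f x \<partial>lborel) = (\<integral>\<^sup>+a. \<integral>\<^sup>+b. \<integral>\<^sup>+c. f (vec3 a b c) \<partial>lborel \<partial>lborel \<partial>lborel)"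
proof -
  have "(\<integral>\<^sup>+x. f x \<partial>lborel) = (\<integral>\<^sup>+z. f (vec3 (fst z) (fst (snd z)) (snd (snd z))) \<partial>(lborel \<Otimes>\<^sub>M (lborel \<Otimes>\<^sub>M lborel)))"
    by (subst lborel_vec3, subst nn_integral_distr) (auto simp: case_prod_beta)
  also have "\<dots> = (\<integral>\<^sup>+a. \<integral>\<^sup>+p. f (vec3 a (fst p) (snd p)) \<partial>(lborel \<Otimes>\<^sub>M lborel) \<partial>lborel)"
  proof -
    have "sigma_finite_measure (lborel \<Otimes>\<^sub>M lborel :: (real \<times> real) measure)"
      unfolding lborel_prod by unfold_locales
    from sigma_finite_measure.nn_integral_fst[OF this, symmetric, of "\<lambda>z. f (vec3 (fst z) (fst (snd z)) (snd (snd z)))" lborel]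
    show ?thesis by simp
  qed
  also have "\<dots> = (\<integral>\<^sup>+a. \<integral>\<^sup>+b. \<integral>\<^sup>+c. f (vec3 a b c) \<partial>lborel \<partial>lborel \<partial>lborel)"
  proof (rule nn_integral_cong)
    fix a
    show "(\<integral>\<^sup>+p. f (vec3 a (fst p) (snd p)) \<partial>(lborel \<Otimes>\<^sub>M lborel)) = (\<integral>\<^sup>+b. \<integral>\<^sup>+c. f (vec3 a b c) \<partial>lborel \<partial>lborel)"
      using lborel.nn_integral_fst[symmetric, of "\<lambda>p. f (vec3 a (fst p) (snd p))" lborel] by simp
  qed
  finally show ?thesis .
qed

text \<open>Cauchy-Schwarz in c bounds the inner integral by a product of a function of b and a
  function of a. A second application in (a, b) against C then leaves an integral that
  factorizes.\<close>

lemma loomis_whitney: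
  fixes A B C :: "real \<Rightarrow> real \<Rightarrow> ennreal"
  assumes [measurable]: "case_prod A \<in> borel_measurable (borel \<Otimes>\<^sub>M borel)"
    "case_prod B \<in> borel_measurable (borel \<Otimes>\<^sub>M borel)" "case_prod C \<in> borel_measurable (borel \<Otimes>\<^sub>M borel)"
  shows "(\<integral>\<^sup>+a. \<integral>\<^sup>+b. \<integral>\<^sup>+c. A b c * B a c * C a b \<partial>lborel \<partial>lborel \<partial>lborel)\<^sup>2 \<le>
    (\<integral>\<^sup>+b. \<integral>\<^sup>+c. (A b c)\<^sup>2 \<partial>lborel \<partial>lborel) * (\<integral>\<^sup>+a. \<integral>\<^sup>+c. (B a c)\<^sup>2 \<partial>lborel \<partial>lborel)
      * (\<integral>\<^sup>+a. \<integral>\<^sup>+b. (C a b)\<^sup>2 \<partial>lborel \<partial>lborel)"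
proof -
  define I where "I a b = (\<integral>\<^sup>+c. A b c * B a c \<partial>lborel)" for a b
  define P where "P b = (\<integral>\<^sup>+c. (A b c)\<^sup>2 \<partial>lborel)" for b
  define R where "R a = (\<integral>\<^sup>+c. (B a c)\<^sup>2 \<partial>lborel)" for a
  have [measurable]: "(\<lambda>p. I (fst p) (snd p)) \<in> borel_measurable (borel \<Otimes>\<^sub>M borel)" unfolding I_def by measurable
  have [measurable]: "P \<in> borel_measurable borel" "R \<in> borel_measurable borel"
    unfolding P_def[abs_def] R_def[abs_def] by measurable
  have IPR: "(I a b)\<^sup>2 \<le> P b * R a" for a b
    unfolding I_def P_def R_def by (rule Cauchy_Schwarz_nn_integral) measurable
  have "(\<integral>\<^sup>+a. \<integral>\<^sup>+b. \<integral>\<^sup>+c. A b c * B a c * C a b \<partial>lborel \<partial>lborel \<partial>lborel) = (\<integral>\<^sup>+a. \<integral>\<^sup>+b. I a b * C a b \<partial>lborel \<partial>lborel)"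
    unfolding I_def by (intro nn_integral_cong nn_integral_multc) measurable
  also have "\<dots> = (\<integral>\<^sup>+p. I (fst p) (snd p) * C (fst p) (snd p) \<partial>(lborel \<Otimes>\<^sub>M lborel))"
    using lborel.nn_integral_fst[of "\<lambda>p. I (fst p) (snd p) * C (fst p) (snd p)" lborel] by simp
  finally have "(\<integral>\<^sup>+a. \<integral>\<^sup>+b. \<integral>\<^sup>+c. A b c * B a c * C a b \<partial>lborel \<partial>lborel \<partial>lborel)\<^sup>2
      = (\<integral>\<^sup>+p. I (fst p) (snd p) * C (fst p) (snd p) \<partial>(lborel \<Otimes>\<^sub>M lborel))\<^sup>2" by simp
  also have "\<dots> \<le> (\<integral>\<^sup>+p. (I (fst p) (snd p))\<^sup>2 \<partial>(lborel \<Otimes>\<^sub>M lborel)) * (\<integral>\<^sup>+p. (C (fst p) (snd p))\<^sup>2 \<partial>(lborel \<Otimes>\<^sub>M lborel))"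
    by (rule Cauchy_Schwarz_nn_integral) measurable
  also have "(\<integral>\<^sup>+p. (C (fst p) (snd p))\<^sup>2 \<partial>(lborel \<Otimes>\<^sub>M lborel)) = (\<integral>\<^sup>+a. \<integral>\<^sup>+b. (C a b)\<^sup>2 \<partial>lborel \<partial>lborel)"
    using lborel.nn_integral_fst[of "\<lambda>p. (C (fst p) (snd p))\<^sup>2" lborel] by simp
  also have "(\<integral>\<^sup>+p. (I (fst p) (snd p))\<^sup>2 \<partial>(lborel \<Otimes>\<^sub>M lborel)) = (\<integral>\<^sup>+a. \<integral>\<^sup>+b. (I a b)\<^sup>2 \<partial>lborel \<partial>lborel)"
    using lborel.nn_integral_fst[of "\<lambda>p. (I (fst p) (snd p))\<^sup>2" lborel] by simp
  also have "\<dots> \<le> (\<integral>\<^sup>+a. \<integral>\<^sup>+b. P b * R a \<partial>lborel \<partial>lborel)"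
    by (intro nn_integral_mono IPR)
  also have "\<dots> = (\<integral>\<^sup>+a. (\<integral>\<^sup>+b. P b \<partial>lborel) * R a \<partial>lborel)"
    by (intro nn_integral_cong nn_integral_multc) measurable
  also have "\<dots> = (\<integral>\<^sup>+b. P b \<partial>lborel) * (\<integral>\<^sup>+a. R a \<partial>lborel)"
    by (rule nn_integral_cmult) measurable
  finally show ?thesis unfolding P_def R_def by (simp add: mult_right_mono)
qed

text \<open>Square roots are needed because the inequality above measures its factors in L^2,
  whereas the line integrals are controlled in L^1. Mapping infinity to infinity makes squaring an
  exact inverse.\<close>

definition esqrt :: "ennreal \<Rightarrow> ennreal" where
  "esqrt x = (if x = \<infinity> then \<infinity> else ennreal (sqrt (enn2real x)))"

lemma esqrt_square: "(esqrt x)\<^sup>2 = x"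
  by (cases x) (auto simp: esqrt_def ennreal_power)

lemma esqrt_measurable [measurable]: "esqrt \<in> borel_measurable borel"
  unfolding esqrt_def[abs_def] by measurable

lemma ennreal_power2_le_imp_le:
  fixes x y :: ennreal assumes "x\<^sup>2 \<le> y\<^sup>2" shows "x \<le> y"
proof (cases x; cases y)
  fix a b assume *: "x = ennreal a" "0 \<le> a" "y = ennreal b" "0 \<le> b"
  then have "a\<^sup>2 \<le> b\<^sup>2" using assms by (simp add: ennreal_power)
  then have "a \<le> b" by (rule power2_le_imp_le[OF _ *(4)])
  then show ?thesis unfolding *(1,3) by (rule ennreal_leI)
next
  fix b assume *: "x = top" "y = ennreal b" "0 \<le> b"
  have "x\<^sup>2 = top" unfolding *(1) power2_eq_square by simp
  moreover have "y\<^sup>2 < top" unfolding *(2) using *(3) by (simp add: ennreal_power)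
  ultimately show ?thesis using assms by simp
qed auto

text \<open>The value at \<open>x\<close> is the integral of the derivative along a line that starts
  outside the support; \<open>T\<close> below is large enough for the starting point to be
  there.\<close>

lemma test_function_le_line_integral:
  fixes f :: "'a::euclidean_space \<Rightarrow> real"
  assumes f: "f \<in> test_functions UNIV" and h: "h \<noteq> 0"
  shows "ennreal \<bar>f x\<bar> \<le> (\<integral>\<^sup>+t. ennreal \<bar>grad f (x + t *\<^sub>R h) \<bullet> h\<bar> \<partial>lborel)"
proof -
  note sm = test_functions_smooth[OF f]
  obtain R where R: "R > 0" "\<And>x. x \<in> supp f \<Longrightarrow> norm x \<le> R"
    using compact_imp_bounded[OF test_functions_compact[OF f]] by (auto simp: bounded_pos)
  define T where "T = (R + norm x + 1) / norm h"
  have Rx: "R + norm x + 1 > 0" using R(1) norm_ge_zero[of x] by linarith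
  then have T: "T > 0" using h by (simp add: T_def)
  let ?x = "x - T *\<^sub>R h"
  have "norm (T *\<^sub>R h) = R + norm x + 1" using h Rx by (simp add: T_def)
  then have "norm ?x > R" using norm_triangle_ineq4[of x ?x] by simp
  then have fx: "f ?x = 0" using R(2) by (force intro: not_in_supp)
  define p where "p t = grad f (?x + t *\<^sub>R h) \<bullet> h" for t
  have cp: "continuous_on S p" for S
    unfolding p_def[abs_def]
    by (intro continuous_intros continuous_on_compose2[OF continuous_on_grad[OF sm]]) auto
  have I: "integral\<^sup>L lborel (\<lambda>t. indicator {0..T} t *\<^sub>R p t) = f (?x + T *\<^sub>R h) - f (?x + 0 *\<^sub>R h)"
  proof (rule integral_FTC_atLeastAtMost[of 0 T "\<lambda>t. f (?x + t *\<^sub>R h)"])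
    show "((\<lambda>t. f (?x + t *\<^sub>R h)) has_vector_derivative p t) (at t within {0..T})" for t
      using smooth_line_derivative[OF sm] unfolding p_def has_real_derivative_iff_has_vector_derivative .
  qed (use cp T in auto)
  then have "ennreal \<bar>f x\<bar> = ennreal (norm (integral\<^sup>L lborel (\<lambda>t. indicator {0..T} t *\<^sub>R p t)))" by (simp add: fx)
  also have "\<dots> \<le> (\<integral>\<^sup>+t. ennreal (norm (indicator {0..T} t *\<^sub>R p t)) \<partial>lborel)"
    by (rule integral_norm_bound_ennreal[OF borel_integrable_compact]) (auto intro: cp)
  also have "\<dots> \<le> (\<integral>\<^sup>+t. ennreal \<bar>p t\<bar> \<partial>lborel)"
    by (intro nn_integral_mono ennreal_leI) (auto simp: indicator_def)
  also have "\<dots> = (\<integral>\<^sup>+t. ennreal \<bar>grad f (x + (t + - T) *\<^sub>R h) \<bullet> h\<bar> \<partial>lborel)"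
    by (intro nn_integral_cong) (simp add: p_def algebra_simps)
  also have "\<dots> = (\<integral>\<^sup>+t. ennreal \<bar>grad f (x + t *\<^sub>R h) \<bullet> h\<bar> \<partial>lborel)"
  proof (rule lborel_nn_integral_translate)
    have "continuous_on UNIV (\<lambda>t. \<bar>grad f (x + t *\<^sub>R h) \<bullet> h\<bar>)"
      by (intro continuous_intros continuous_on_compose2[OF continuous_on_grad[OF sm]]) auto
    then show "(\<lambda>t. ennreal \<bar>grad f (x + t *\<^sub>R h) \<bullet> h\<bar>) \<in> borel_measurable borel"
      by (intro measurable_compose[OF borel_measurable_continuous_onI measurable_ennreal])
  qed
  finally show ?thesis .
qed

text \<open>The Loomis-Whitney inequality applied to \<open>u\<^sup>4\<close>, whose gradient is \<open>4 u\<^sup>3 \<nabla>u\<close>.\<close>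

lemma sobolev_test:
  fixes u :: "real^3 \<Rightarrow> real"
  assumes u: "u \<in> test_functions UNIV"
  shows "(\<integral>\<^sup>+x. ennreal ((u x)^6) \<partial>lborel) \<le> 4096 * (\<integral>\<^sup>+x. ennreal ((norm (grad u x))\<^sup>2) \<partial>lborel)^3"
proof -
  note smu = test_functions_smooth[OF u]
  define f where "f x = u x * (u x * (u x * u x))" for x
  have f: "f \<in> test_functions UNIV"
    unfolding f_def[abs_def] by (intro test_functions_mult u smooth_on_mult smu open_UNIV)
  have gf: "grad f x = (4 * (u x)^3) *\<^sub>R grad u x" for x
    unfolding f_def[abs_def]
    by (rule gradI) (auto intro!: derivative_eq_intros smooth_has_derivative_grad[OF smu] simp: power3_eq_cube algebra_simps)
  have [measurable]: "u \<in> borel_measurable borel" "grad u \<in> borel_measurable borel" "grad f \<in> borel_measurable borel"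
    by (intro borel_measurable_continuous_onI smooth_on_imp_continuous_on continuous_on_grad smu
        test_functions_smooth[OF f])+
  let ?e = "\<lambda>i::3. axis i (1::real)"
  define g where "g i x = ennreal \<bar>grad f x \<bullet> ?e i\<bar>" for i x
  have [measurable]: "g i \<in> borel_measurable borel" for i unfolding g_def[abs_def] by measurable
  define \<alpha> where "\<alpha> b c = (\<integral>\<^sup>+a. g 1 (vec3 a b c) \<partial>lborel)" for b c
  define \<gamma> where "\<gamma> a c = (\<integral>\<^sup>+b. g 2 (vec3 a b c) \<partial>lborel)" for a c
  define \<delta> where "\<delta> a b = (\<integral>\<^sup>+c. g 3 (vec3 a b c) \<partial>lborel)" for a b
  have [measurable]: "case_prod \<alpha> \<in> borel_measurable (borel \<Otimes>\<^sub>M borel)"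
    "case_prod \<gamma> \<in> borel_measurable (borel \<Otimes>\<^sub>M borel)" "case_prod \<delta> \<in> borel_measurable (borel \<Otimes>\<^sub>M borel)"
    unfolding \<alpha>_def \<gamma>_def \<delta>_def by measurable
  have ne: "?e i \<noteq> 0" for i by (simp add: axis_eq_0_iff)
  have b1: "ennreal \<bar>f (vec3 a b c)\<bar> \<le> \<alpha> b c" for a b c
  proof -
    have "ennreal \<bar>f (vec3 a b c)\<bar> \<le> (\<integral>\<^sup>+t. g 1 (vec3 (t + a) b c) \<partial>lborel)"
      using test_function_le_line_integral[OF f ne[of 1], of "vec3 a b c"] by (simp add: g_def vec3_def algebra_simps)
    also have "\<dots> = \<alpha> b c" unfolding \<alpha>_def by (rule lborel_nn_integral_translate) measurable
    finally show ?thesis .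
  qed
  have b2: "ennreal \<bar>f (vec3 a b c)\<bar> \<le> \<gamma> a c" for a b c
  proof -
    have "ennreal \<bar>f (vec3 a b c)\<bar> \<le> (\<integral>\<^sup>+t. g 2 (vec3 a (t + b) c) \<partial>lborel)"
      using test_function_le_line_integral[OF f ne[of 2], of "vec3 a b c"] by (simp add: g_def vec3_def algebra_simps)
    also have "\<dots> = \<gamma> a c" unfolding \<gamma>_def by (rule lborel_nn_integral_translate) measurable
    finally show ?thesis .
  qed
  have b3: "ennreal \<bar>f (vec3 a b c)\<bar> \<le> \<delta> a b" for a b c
  proof -
    have "ennreal \<bar>f (vec3 a b c)\<bar> \<le> (\<integral>\<^sup>+t. g 3 (vec3 a b (t + c)) \<partial>lborel)"
      using test_function_le_line_integral[OF f ne[of 3], of "vec3 a b c"] by (simp add: g_def vec3_def algebra_simps)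
    also have "\<dots> = \<delta> a b" unfolding \<delta>_def by (rule lborel_nn_integral_translate) measurable
    finally show ?thesis .
  qed
  let ?S = "\<integral>\<^sup>+x. ennreal ((u x)^6) \<partial>lborel" and ?E = "\<integral>\<^sup>+x. ennreal ((norm (grad u x))\<^sup>2) \<partial>lborel"
  let ?W = "\<integral>\<^sup>+x. ennreal (4 * \<bar>u x\<bar>^3 * norm (grad u x)) \<partial>lborel"
  \<comment> \<open>Each of the three line integrals bounds u^4, so their product bounds u^12, and
    the product of the square roots bounds u^6.\<close>
  have pt: "ennreal ((u (vec3 a b c))^6) \<le> esqrt (\<alpha> b c) * esqrt (\<gamma> a c) * esqrt (\<delta> a b)" for a b c
  proof (rule ennreal_power2_le_imp_le)
    let ?u = "u (vec3 a b c)"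
    have fu: "\<bar>f (vec3 a b c)\<bar> = ?u^4" by (simp add: f_def power4_eq_xxxx abs_mult)
    have "(ennreal (?u^6))\<^sup>2 = ennreal (?u^4) * ennreal (?u^4) * ennreal (?u^4)"
      by (simp add: ennreal_power flip: ennreal_mult power_mult power_add)
    also have "\<dots> \<le> \<alpha> b c * \<gamma> a c * \<delta> a b"
      using b1[of a b c] b2[of a b c] b3[of a b c] unfolding fu by (intro mult_mono) auto
    also have "\<dots> = (esqrt (\<alpha> b c) * esqrt (\<gamma> a c) * esqrt (\<delta> a b))\<^sup>2"
      by (simp add: power_mult_distrib esqrt_square)
    finally show "(ennreal (?u^6))\<^sup>2 \<le> (esqrt (\<alpha> b c) * esqrt (\<gamma> a c) * esqrt (\<delta> a b))\<^sup>2" .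
  qed
  have gW: "(\<integral>\<^sup>+x. g i x \<partial>lborel) \<le> ?W" for i
  proof (intro nn_integral_mono)
    fix x
    have "\<bar>grad f x \<bullet> ?e i\<bar> \<le> norm (grad f x) * norm (?e i)" by (rule Cauchy_Schwarz_ineq2)
    also have "\<dots> = 4 * \<bar>u x\<bar>^3 * norm (grad u x)" by (simp add: gf abs_mult power_abs)
    finally show "g i x \<le> ennreal (4 * \<bar>u x\<bar>^3 * norm (grad u x))" unfolding g_def by (intro ennreal_leI)
  qed
  have i1: "(\<integral>\<^sup>+b. \<integral>\<^sup>+c. \<alpha> b c \<partial>lborel \<partial>lborel) \<le> ?W"
  proof -
    have "(\<integral>\<^sup>+b. \<integral>\<^sup>+c. \<alpha> b c \<partial>lborel \<partial>lborel) = (\<integral>\<^sup>+b. \<integral>\<^sup>+a. \<integral>\<^sup>+c. g 1 (vec3 a b c) \<partial>lborel \<partial>lborel \<partial>lborel)"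
      unfolding \<alpha>_def by (intro nn_integral_cong lborel_pair.Fubini') measurable
    also have "\<dots> = (\<integral>\<^sup>+a. \<integral>\<^sup>+b. \<integral>\<^sup>+c. g 1 (vec3 a b c) \<partial>lborel \<partial>lborel \<partial>lborel)"
      by (rule lborel_pair.Fubini') measurable
    finally show ?thesis using gW[of 1] by (simp add: nn_integral_vec3)
  qed
  have i2: "(\<integral>\<^sup>+a. \<integral>\<^sup>+c. \<gamma> a c \<partial>lborel \<partial>lborel) \<le> ?W"
  proof -
    have "(\<integral>\<^sup>+a. \<integral>\<^sup>+c. \<gamma> a c \<partial>lborel \<partial>lborel) = (\<integral>\<^sup>+a. \<integral>\<^sup>+b. \<integral>\<^sup>+c. g 2 (vec3 a b c) \<partial>lborel \<partial>lborel \<partial>lborel)"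
      unfolding \<gamma>_def by (intro nn_integral_cong lborel_pair.Fubini') measurable
    then show ?thesis using gW[of 2] by (simp add: nn_integral_vec3)
  qed
  have i3: "(\<integral>\<^sup>+a. \<integral>\<^sup>+b. \<delta> a b \<partial>lborel \<partial>lborel) \<le> ?W"
    using gW[of 3] unfolding \<delta>_def by (simp add: nn_integral_vec3)
  have "?S = (\<integral>\<^sup>+a. \<integral>\<^sup>+b. \<integral>\<^sup>+c. ennreal ((u (vec3 a b c))^6) \<partial>lborel \<partial>lborel \<partial>lborel)"
    by (rule nn_integral_vec3) measurable
  also have "\<dots> \<le> (\<integral>\<^sup>+a. \<integral>\<^sup>+b. \<integral>\<^sup>+c. esqrt (\<alpha> b c) * esqrt (\<gamma> a c) * esqrt (\<delta> a b) \<partial>lborel \<partial>lborel \<partial>lborel)"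
    by (intro nn_integral_mono pt)
  finally have "?S\<^sup>2 \<le> (\<integral>\<^sup>+a. \<integral>\<^sup>+b. \<integral>\<^sup>+c. esqrt (\<alpha> b c) * esqrt (\<gamma> a c) * esqrt (\<delta> a b) \<partial>lborel \<partial>lborel \<partial>lborel)\<^sup>2"
    by (rule power_mono_ennreal)
  also have "\<dots> \<le> (\<integral>\<^sup>+b. \<integral>\<^sup>+c. (esqrt (\<alpha> b c))\<^sup>2 \<partial>lborel \<partial>lborel) * (\<integral>\<^sup>+a. \<integral>\<^sup>+c. (esqrt (\<gamma> a c))\<^sup>2 \<partial>lborel \<partial>lborel)
      * (\<integral>\<^sup>+a. \<integral>\<^sup>+b. (esqrt (\<delta> a b))\<^sup>2 \<partial>lborel \<partial>lborel)"
    by (rule loomis_whitney) measurable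
  also have "\<dots> \<le> ?W * ?W * ?W"
    unfolding esqrt_square by (intro mult_mono i1 i2 i3) auto
  finally have SW: "?S\<^sup>2 \<le> ?W^3" by (simp add: power3_eq_cube)
  have WE: "?W\<^sup>2 \<le> 16 * ?S * ?E"
  proof -
    have "?W = (\<integral>\<^sup>+x. ennreal (4 * \<bar>u x\<bar>^3) * ennreal (norm (grad u x)) \<partial>lborel)"
      by (intro nn_integral_cong) (simp add: ennreal_mult)
    then have "?W\<^sup>2 = (\<integral>\<^sup>+x. ennreal (4 * \<bar>u x\<bar>^3) * ennreal (norm (grad u x)) \<partial>lborel)\<^sup>2" by simp
    also have "\<dots> \<le> (\<integral>\<^sup>+x. (ennreal (4 * \<bar>u x\<bar>^3))\<^sup>2 \<partial>lborel) * (\<integral>\<^sup>+x. (ennreal (norm (grad u x)))\<^sup>2 \<partial>lborel)"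
      by (rule Cauchy_Schwarz_nn_integral) measurable
    also have "(\<integral>\<^sup>+x. (ennreal (4 * \<bar>u x\<bar>^3))\<^sup>2 \<partial>lborel) = (\<integral>\<^sup>+x. 16 * ennreal ((u x)^6) \<partial>lborel)"
    proof (intro nn_integral_cong)
      fix x
      have "(4 * \<bar>u x\<bar>^3)\<^sup>2 = 16 * (u x)^6" by (simp add: power_mult_distrib flip: power_mult)
      then show "(ennreal (4 * \<bar>u x\<bar>^3))\<^sup>2 = 16 * ennreal ((u x)^6)"
        by (simp add: ennreal_power ennreal_mult')
    qed
    also have "\<dots> = 16 * ?S" by (rule nn_integral_cmult) measurable
    finally show ?thesis by (simp add: ennreal_power)
  qed
  \<comment> \<open>With S, E and W the three integrals, S^4 \<le> W^6 \<le> (16 S E)^3. Finiteness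
    of S allows the cancellation of S^3, which leaves the constant 16^3 = 4096.\<close>
  have S_fin: "?S \<noteq> \<infinity>"
  proof -
    have "integrable lborel (\<lambda>x. (u x)^6)"
      by (rule continuous_compact_support_integrable[of _ "supp u"])
        (auto intro!: continuous_on_power smooth_on_imp_continuous_on[OF smu] test_functions_compact[OF u] simp: not_in_supp)
    then show ?thesis by (subst nn_integral_eq_integral) auto
  qed
  have E_fin: "?E \<noteq> \<infinity>"
  proof -
    have "integrable lborel (\<lambda>x. (norm (grad u x))\<^sup>2)"
      by (rule continuous_compact_support_integrable[of _ "supp u"])
        (auto intro!: continuous_on_power continuous_on_norm continuous_on_grad[OF smu] test_functions_compact[OF u] simp: grad_eq_0)
    then show ?thesis by (subst nn_integral_eq_integral) auto
  qed
  obtain s where s: "?S = ennreal s" "s \<ge> 0" using S_fin by (cases ?S) auto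
  obtain e where e: "?E = ennreal e" "e \<ge> 0" using E_fin by (cases ?E) auto
  have "?S^4 = (?S\<^sup>2)\<^sup>2" by (simp flip: power_mult)
  also have "\<dots> \<le> (?W^3)\<^sup>2" by (rule power_mono_ennreal[OF SW])
  also have "\<dots> = (?W\<^sup>2)^3" by (simp flip: power_mult)
  also have "\<dots> \<le> (16 * ?S * ?E)^3" by (rule power_mono_ennreal[OF WE])
  also have "16 * ?S * ?E = ennreal (16 * s * e)"
    unfolding s(1) e(1) using s(2) e(2) by (simp add: ennreal_mult')
  also have "(ennreal (16 * s * e))^3 = ennreal ((16 * s * e)^3)"
    by (rule ennreal_power) (use s(2) e(2) in simp)
  also have "?S^4 = ennreal (s^4)"
    unfolding s(1) by (rule ennreal_power[OF s(2)])
  finally have "ennreal (s^4) \<le> ennreal ((16 * s * e)^3)" .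
  then have le: "s^4 \<le> (16 * s * e)^3" using s e by (subst (asm) ennreal_le_iff) auto
  have "s \<le> 4096 * e^3"
  proof (cases "s = 0")
    case False
    then have "s > 0" using s by simp
    have "s * s^3 \<le> (4096 * e^3) * s^3"
      using le by (simp add: power_mult_distrib power4_eq_xxxx power3_eq_cube mult_ac)
    then show ?thesis using \<open>s > 0\<close> by simp
  qed (use e in auto)
  then have "ennreal s \<le> ennreal (4096 * e^3)" by (rule ennreal_leI)
  also have "\<dots> = 4096 * ?E^3" using e by (simp add: ennreal_mult' ennreal_power)
  finally show ?thesis using s by simp
qed

locale bounded_open3 = bounded_open \<Omega> for \<Omega> :: "(real^3) set"
begin

text \<open>The bound for test functions depends only on their gradients, which stay bounded along
  an approximating sequence; Fatou's lemma carries it to the limit.\<close>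

lemma Z_sobolev:
  assumes z: "z \<in> Z" shows "integrable M (\<lambda>x. (fst (z x))^6)"
proof -
  obtain \<eta> where e: "\<And>k::nat. \<eta> k \<in> test_functions \<Omega>" "(\<lambda>k. nsq M (\<lambda>x. gr (\<eta> k) x - z x)) \<longlonglongrightarrow> 0"
    using Z_seq[OF z] by blast
  obtain r where r: "strict_mono (r::nat\<Rightarrow>nat)" "AE x in M. (\<lambda>n. gr (\<eta> (r n)) x) \<longlonglongrightarrow> z x"
    by (rule nsq_AE_subseq[of M "\<lambda>k. gr (\<eta> k)", OF sqi_gr_test[OF e(1)] Z_sqi[OF z] e(2)])
  have "(\<lambda>k. nsq M (gr (\<eta> k))) \<longlonglongrightarrow> nsq M z"
    by (rule nsq_tendsto[OF sqi_gr_test[OF e(1)] Z_sqi[OF z] e(2)])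
  then have "Bseq (\<lambda>k. nsq M (gr (\<eta> k)))" by (intro convergent_imp_Bseq) (auto simp: convergent_def)
  then obtain K where K: "\<And>k. nsq M (gr (\<eta> k)) \<le> K" unfolding Bseq_def by (force simp: abs_le_iff)
  have b: "(\<integral>\<^sup>+x. ennreal ((\<eta> k x)^6) \<partial>M) \<le> ennreal (4096 * K^3)" for k
  proof -
    have K': "nsq M (grad (\<eta> k)) \<le> K"
      using K[of k] nsq_fst_snd[OF sqi_gr_test[OF e(1)[of k]]] nsq_nonneg[of M "\<eta> k"]
      unfolding fst_gr snd_gr by linarith
    have "(\<integral>\<^sup>+x. ennreal ((\<eta> k x)^6) \<partial>M) = (\<integral>\<^sup>+x. ennreal ((\<eta> k x)^6) * indicator \<Omega> x \<partial>lebesgue)"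
      by (rule nn_integral_restrict_space) simp
    also have "\<dots> \<le> (\<integral>\<^sup>+x. ennreal ((\<eta> k x)^6) \<partial>lebesgue)"
      by (intro nn_integral_mono) (auto simp: indicator_def)
    also have "\<dots> = (\<integral>\<^sup>+x. ennreal ((\<eta> k x)^6) \<partial>lborel)" by (rule nn_integral_completion)
    also have "\<dots> \<le> 4096 * (ennreal (nsq M (grad (\<eta> k))))^3"
      unfolding nsq_test_eq_nn_integral[OF e(1)] by (rule sobolev_test[OF test_functions_UNIV[OF e(1)]])
    also have "\<dots> = ennreal (4096 * (nsq M (grad (\<eta> k)))^3)"
      by (simp add: ennreal_mult' ennreal_power)
    also have "\<dots> \<le> ennreal (4096 * K^3)"
      using K' by (intro ennreal_leI mult_left_mono power_mono) auto
    finally show ?thesis .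
  qed
  have [measurable]: "(\<lambda>x. fst (z x)) \<in> borel_measurable M" by (rule sqi_measurable[OF Z_sqi_fst[OF z]])
  have [measurable]: "\<eta> k \<in> borel_measurable M" for k by (rule sqi_measurable[OF sqi_test[OF e(1)]])
  have "(\<integral>\<^sup>+x. ennreal ((fst (z x))^6) \<partial>M) = (\<integral>\<^sup>+x. liminf (\<lambda>n. ennreal ((\<eta> (r n) x)^6)) \<partial>M)"
  proof (rule nn_integral_cong_AE)
    show "AE x in M. ennreal ((fst (z x))^6) = liminf (\<lambda>n. ennreal ((\<eta> (r n) x)^6))"
      using r(2)
    proof eventually_elim
      case (elim x)
      have "(\<lambda>n. \<eta> (r n) x) \<longlonglongrightarrow> fst (z x)" using tendsto_fst[OF elim] by simp
      then have "(\<lambda>n. ennreal ((\<eta> (r n) x)^6)) \<longlonglongrightarrow> ennreal ((fst (z x))^6)"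
        by (intro tendsto_ennrealI tendsto_power)
      then show ?case by (intro lim_imp_Liminf[symmetric]) auto
    qed
  qed
  also have "\<dots> \<le> liminf (\<lambda>n. \<integral>\<^sup>+x. ennreal ((\<eta> (r n) x)^6) \<partial>M)"
    by (rule nn_integral_liminf) measurable
  also have "\<dots> \<le> ennreal (4096 * K^3)"
    by (rule Liminf_le[OF _ always_eventually]) (auto intro: b)
  finally have "(\<integral>\<^sup>+x. ennreal ((fst (z x))^6) \<partial>M) < \<infinity>" by (auto intro: order_le_less_trans)
  then show ?thesis by (intro integrableI_bounded) (auto simp: power_abs)
qed

end

section \<open>Minimization and the maximum principle\<close>

text \<open>Convexity of the squared norm in the form of a subgradient inequality, as
  \<open>minimizer_exists\<close> expects it.\<close>

lemma nsq_ge_tangent: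
  assumes "sqi M a" "sqi M b"
  shows "nsq M a + 2 * (\<integral>x. a x \<bullet> (b x - a x) \<partial>M) \<le> nsq M b"
  using nsq_add_eq[OF assms(1) sqi_diff[OF assms(2,1)]] nsq_nonneg[of M "\<lambda>x. b x - a x"] by simp

lemma nsq_midpoint:
  assumes "sqi M a" "sqi M b"
  shows "nsq M (\<lambda>x. (1/2) *\<^sub>R (a x + b x)) = (nsq M a + nsq M b) / 2 - nsq M (\<lambda>x. a x - b x) / 4"
proof -
  have "nsq M (\<lambda>x. (1/2) *\<^sub>R (a x + b x)) = (1/2)\<^sup>2 * nsq M (\<lambda>x. a x + b x)" by (rule nsq_scaleR)
  then show ?thesis using nsq_parallelogram[OF assms] by (simp add: power2_eq_square field_simps)
qed

lemma nsq_critical: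
  assumes "sqi M a" "sqi M b" "\<And>t. nsq M a \<le> nsq M (\<lambda>x. a x + t *\<^sub>R b x)"
  shows "(\<integral>x. a x \<bullet> b x \<partial>M) = 0"
proof -
  have "(\<integral>x. a x \<bullet> b x \<partial>M)\<^sup>2 \<le> 0 * nsq M b"
  proof (rule quadratic_nonneg_discriminant)
    fix t show "0 \<le> 0 + 2 * t * (\<integral>x. a x \<bullet> b x \<partial>M) + t\<^sup>2 * nsq M b"
      using assms(3)[of t] nsq_add_eq[OF assms(1) sqi_scaleR[OF assms(2), of t]] by (simp add: nsq_scaleR)
  qed simp
  then show ?thesis by simp
qed

lemma nsq_eq_0_imp_AE:
  assumes "sqi M f" "nsq M f = 0" shows "AE x in M. f x = 0"
proof -
  have "AE x in M. (norm (f x))\<^sup>2 = 0"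
    using integral_nonneg_eq_0_iff_AE[OF sqi_integrable[OF assms(1)]] assms(2) by (simp add: nsq_def)
  then show ?thesis by simp
qed

context bounded_open
begin

text \<open>Minimizing sequences of a uniformly convex functional are Cauchy, so no weak compactness is needed.\<close>

lemma minimizer_exists:
  fixes J :: "('a \<Rightarrow> real \<times> 'a) \<Rightarrow> real"
  assumes c: "c > 0"
    and mid: "\<And>z w. z \<in> Z \<Longrightarrow> w \<in> Z \<Longrightarrow>
      J (\<lambda>x. (1/2) *\<^sub>R (z x + w x)) \<le> (J z + J w) / 2 - c * nsq M (\<lambda>x. z x - w x)"
    and sub: "\<And>z. z \<in> Z \<Longrightarrow> \<exists>g. sqi M g \<and> (\<forall>w\<in>Z. J z + (\<integral>x. g x \<bullet> (w x - z x) \<partial>M) \<le> J w)"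
  obtains z where "z \<in> Z" "\<forall>w\<in>Z. J z \<le> J w"
proof -
  obtain g where g: "sqi M g" "\<And>w. w \<in> Z \<Longrightarrow> J (\<lambda>x. 0) + (\<integral>x. g x \<bullet> (w x - 0) \<partial>M) \<le> J w"
    using sub[OF Z_zero] by blast
  \<comment> \<open>The midpoint inequality with 0 and the subgradient at 0 bound J w - J 0 below by
    the integral of g w plus 2 c times the squared norm of w. Nonnegativity of the squared norm of g
    + 4 c w, divided by 8 c, completes the square.\<close>
  have lb: "J (\<lambda>x. 0) - nsq M g / (8 * c) \<le> J w" if w: "w \<in> Z" for w
  proof -
    let ?I = "\<integral>x. g x \<bullet> w x \<partial>M" and ?N = "nsq M w"
    have w2: "(\<lambda>x. (1/2) *\<^sub>R (w x + 0)) \<in> Z" using Z_scaleR[OF w, of "1/2"] by simp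
    have "J (\<lambda>x. 0) + ?I / 2 \<le> J (\<lambda>x. (1/2) *\<^sub>R (w x + 0))"
      using g(2)[OF w2] by simp
    also have "\<dots> \<le> (J w + J (\<lambda>x. 0)) / 2 - c * ?N" using mid[OF w Z_zero] by simp
    finally have 1: "J (\<lambda>x. 0) + ?I + 2 * c * ?N \<le> J w" by (simp add: field_simps)
    have "?I\<^sup>2 \<le> nsq M g * ?N" by (rule nsq_Cauchy_Schwarz[OF g(1) Z_sqi[OF w]])
    have "0 \<le> nsq M (\<lambda>x. g x + (4 * c) *\<^sub>R w x)" by simp
    then have "0 \<le> nsq M g + 8 * c * ?I + 16 * c * c * ?N"
      using nsq_add_eq[OF g(1) sqi_scaleR[OF Z_sqi[OF w], of "4 * c"]] by (simp add: nsq_scaleR power2_eq_square)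
    then have "- (nsq M g / (8 * c)) \<le> ?I + 2 * c * ?N" using c by (simp add: field_simps)
    with 1 show ?thesis by linarith
  qed
  define m where "m = Inf (J ` Z)"
  have bdd: "bdd_below (J ` Z)" by (rule bdd_belowI2[of Z]) (rule lb)
  have mle: "m \<le> J w" if "w \<in> Z" for w unfolding m_def using that by (intro cInf_lower bdd) auto
  have "\<exists>z\<in>Z. J z < m + inverse (real (Suc n))" for n
    using cInf_lessD[of "J ` Z" "m + inverse (real (Suc n))"] Z_zero unfolding m_def by auto
  then obtain z where z: "\<And>n. z n \<in> Z" "\<And>n. J (z n) < m + inverse (real (Suc n))" by metis
  \<comment> \<open>The midpoint of two nearly minimal elements cannot go below the infimum, so the
    uniform convexity term must be small.\<close>
  have est: "c * nsq M (\<lambda>x. z i x - z j x) \<le> (inverse (real (Suc i)) + inverse (real (Suc j))) / 2" for i j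
    using mid[OF z(1)[of i] z(1)[of j]] mle[OF Z_scaleR[OF Z_add[OF z(1)[of i] z(1)[of j]], of "1/2"]] z(2)[of i] z(2)[of j]
    by argo
  have C: "\<exists>N. \<forall>i\<ge>N. \<forall>j\<ge>N. nsq M (\<lambda>x. z i x - z j x) < e" if e: "e > 0" for e
  proof -
    obtain N where N: "inverse (real (Suc N)) < c * e" using reals_Archimedean[of "c * e"] c e by auto
    have "nsq M (\<lambda>x. z i x - z j x) < e" if ij: "i \<ge> N" "j \<ge> N" for i j
    proof -
      have "inverse (real (Suc i)) \<le> inverse (real (Suc N))" "inverse (real (Suc j)) \<le> inverse (real (Suc N))"
        using ij by (intro le_imp_inverse_le; simp)+
      moreover have "t < y" if "a \<le> n" "b \<le> n" "t \<le> (a + b) / 2" "n < y" for a b n t y :: real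
        using that by argo
      ultimately have "c * nsq M (\<lambda>x. z i x - z j x) < c * e" using est[of i j] N by blast
      then show ?thesis using c by simp
    qed
    then show ?thesis by blast
  qed
  obtain z' where z': "sqi M z'" "(\<lambda>n. nsq M (\<lambda>x. z n x - z' x)) \<longlonglongrightarrow> 0"
    by (rule M.sqi_complete[of z, OF Z_sqi[OF z(1)] C])
  have zZ: "z' \<in> Z" by (rule Z_closed[OF z(1) z'])
  \<comment> \<open>A subgradient at the limit bounds J z' by J (z n) minus a linear term that tends
    to 0. This provides the lower semicontinuity needed at the limit.\<close>
  obtain h where h: "sqi M h" "\<And>w. w \<in> Z \<Longrightarrow> J z' + (\<integral>x. h x \<bullet> (w x - z' x) \<partial>M) \<le> J w"
    using sub[OF zZ] by blast
  have l: "(\<lambda>n. \<integral>x. z n x \<bullet> h x \<partial>M) \<longlonglongrightarrow> (\<integral>x. z' x \<bullet> h x \<partial>M)"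
    by (rule sqi_tendsto_inner_const[OF Z_sqi[OF z(1)] z'(1) h(1) z'(2)])
  have l1: "(\<lambda>n. J z' + ((\<integral>x. z n x \<bullet> h x \<partial>M) - (\<integral>x. z' x \<bullet> h x \<partial>M))) \<longlonglongrightarrow> J z' + ((\<integral>x. z' x \<bullet> h x \<partial>M) - (\<integral>x. z' x \<bullet> h x \<partial>M))"
    by (intro tendsto_add tendsto_diff tendsto_const l)
  have l2: "(\<lambda>n. m + inverse (real (Suc n))) \<longlonglongrightarrow> m + 0"
    by (intro tendsto_add tendsto_const LIMSEQ_inverse_real_of_nat)
  have "J z' + ((\<integral>x. z' x \<bullet> h x \<partial>M) - (\<integral>x. z' x \<bullet> h x \<partial>M)) \<le> m + 0"
  proof (rule LIMSEQ_le[OF l1 l2], intro exI allI impI)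
    fix n
    have "(\<integral>x. h x \<bullet> (z n x - z' x) \<partial>M) = (\<integral>x. z n x \<bullet> h x - z' x \<bullet> h x \<partial>M)"
      by (simp add: inner_diff_right inner_commute)
    also have "\<dots> = (\<integral>x. z n x \<bullet> h x \<partial>M) - (\<integral>x. z' x \<bullet> h x \<partial>M)"
      by (intro Bochner_Integration.integral_diff sqi_inner Z_sqi z zZ h)
    finally show "J z' + ((\<integral>x. z n x \<bullet> h x \<partial>M) - (\<integral>x. z' x \<bullet> h x \<partial>M)) \<le> m + inverse (real (Suc n))"
      using h(2)[OF z(1)[of n]] z(2)[of n] by simp
  qed
  then have "J z' \<le> m" by simp
  then show ?thesis using mle order_trans zZ by (intro that[of z']) blast+
qed

text \<open>A function with the boundary values of \<open>G\<close>, together with its gradient,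
  parametrized by the linear space \<open>Z\<close>. Minimization over a class of prescribed trace
  thereby becomes minimization over \<open>Z\<close>.\<close>

definition aff :: "('a \<Rightarrow> real) \<Rightarrow> ('a \<Rightarrow> real \<times> 'a) \<Rightarrow> 'a \<Rightarrow> real \<times> 'a" where
  "aff G y x = gr G x + y x"

lemma sqi_aff: "smooth_on UNIV G \<Longrightarrow> y \<in> Z \<Longrightarrow> sqi M (aff G y)"
  unfolding aff_def[abs_def] by (intro sqi_add sqi_gr Z_sqi)

lemma frontier_disjoint: "x \<in> frontier \<Omega> \<Longrightarrow> x \<notin> \<Omega>"
  using open_\<Omega> by (simp add: frontier_def interior_open)

lemma beta_lipschitz: "\<bar>\<beta> s - \<beta> t\<bar> \<le> 2 * \<bar>s - t\<bar>"
proof -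
  have "norm (\<beta> s - \<beta> t) \<le> 2 * norm (s - t)"
    by (rule field_differentiable_bound[of UNIV \<beta> \<beta>'])
      (use beta'_le_2 beta'_nonneg in \<open>auto intro: beta_has_derivative\<close>)
  then show ?thesis by simp
qed

text \<open>The composition vanishes near the boundary, where \<open>G \<le> K\<close>.\<close>

lemma beta_cutoff_test:
  assumes G: "smooth_on UNIV G" and K: "\<And>x. x \<in> frontier \<Omega> \<Longrightarrow> G x < K" and e: "\<eta> \<in> test_functions \<Omega>"
  defines "f \<equiv> \<lambda>x. if x \<in> \<Omega> then \<beta> (G x + \<eta> x - K) else 0"
  shows "f \<in> test_functions \<Omega>"
    and "x \<in> \<Omega> \<Longrightarrow> gr f x = (\<beta> (G x + \<eta> x - K), \<beta>' (G x + \<eta> x - K) *\<^sub>R (grad G x + grad \<eta> x))"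
proof -
  let ?p = "\<lambda>x. G x + \<eta> x - K"
  have sp: "smooth_on UNIV ?p"
    by (intro smooth_on_diff smooth_on_add smooth_on_const G test_functions_smooth[OF e]) auto
  have sb: "smooth_on UNIV (\<lambda>x. \<beta> (?p x))"
    by (rule smooth_on_compose[OF _ smooth_beta sp]) auto
  \<comment> \<open>On the frontier \<eta> vanishes and G < K strictly, so this compact set stays
    inside \<Omega>; outside it the truncation is 0.\<close>
  define C where "C = closure \<Omega> \<inter> ?p -` {0..}"
  have "closed C"
    unfolding C_def using smooth_on_imp_continuous_on[OF sp]
    by (intro closed_Int closed_closure continuous_closed_vimage) (auto simp: continuous_on_eq_continuous_at)
  then have C: "compact C"
    using bounded_\<Omega> by (auto simp: compact_eq_bounded_closed C_def intro: bounded_subset[OF bounded_closure])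
  have CO: "C \<subseteq> \<Omega>"
  proof
    fix x assume x: "x \<in> C"
    show "x \<in> \<Omega>"
    proof (rule ccontr)
      assume "x \<notin> \<Omega>"
      then have "x \<in> frontier \<Omega>" using x open_\<Omega> by (auto simp: C_def frontier_def interior_open)
      moreover have "\<eta> x = 0" using \<open>x \<notin> \<Omega>\<close> test_functions_supp[OF e] by (intro not_in_supp) blast
      ultimately show False using K[of x] x by (simp add: C_def)
    qed
  qed
  have f0: "f x = 0" if "x \<notin> C" for x
    using that closure_subset[of \<Omega>] by (auto simp: f_def C_def)
  have "smooth_on UNIV f"
  proof (rule smooth_on_local)
    fix x :: 'a
    show "\<exists>V. open V \<and> x \<in> V \<and> smooth_on V f"
    proof (cases "x \<in> \<Omega>")
      case True
      have "smooth_on \<Omega> f"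
        by (rule smooth_on_cong[OF open_\<Omega> _ smooth_on_subset[OF sb]]) (auto simp: f_def)
      then show ?thesis using True open_\<Omega> by blast
    next
      case False
      have "smooth_on (- C) f"
        by (rule smooth_on_cong[OF open_Compl[OF \<open>closed C\<close>] _ smooth_on_const[of _ 0]]) (simp add: f0)
      then show ?thesis using False CO \<open>closed C\<close> by (intro exI[of _ "- C"]) (auto intro: open_Compl)
    qed
  qed
  then show "f \<in> test_functions \<Omega>" using C CO f0 by (rule test_functionsI)
  assume x: "x \<in> \<Omega>"
  have "grad f x = grad (\<lambda>x. \<beta> (?p x)) x"
    by (rule grad_cong_open[OF open_\<Omega> x]) (simp add: f_def)
  also have "\<dots> = \<beta>' (?p x) *\<^sub>R grad ?p x"
    by (rule grad_compose[OF beta_has_derivative smooth_differentiable[OF sp]])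
  also have "grad ?p x = grad G x + grad \<eta> x"
    using gr_add[OF G test_functions_smooth[OF e], of x]
      gr_diff[OF smooth_on_add[OF open_UNIV G test_functions_smooth[OF e]] smooth_on_const[of UNIV K], of x]
    by (simp add: gr_def)
  finally show "gr f x = (\<beta> (?p x), \<beta>' (?p x) *\<^sub>R (grad G x + grad \<eta> x))"
    using x by (simp add: gr_def f_def)
qed

text \<open>A chain rule for the truncation. Approximation by test functions is not enough by
  itself, because the factor in \<beta>' depends on the approximating function as well; it is
  handled by an almost everywhere convergent subsequence and dominated convergence.\<close>

lemma beta_cutoff_Z:
  assumes G: "smooth_on UNIV G" and K: "\<And>x. x \<in> frontier \<Omega> \<Longrightarrow> G x < K" and y: "y \<in> Z"
  shows "(\<lambda>x. (\<beta> (fst (aff G y x) - K), \<beta>' (fst (aff G y x) - K) *\<^sub>R snd (aff G y x))) \<in> Z"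
proof -
  let ?w = "\<lambda>x. (\<beta> (fst (aff G y x) - K), \<beta>' (fst (aff G y x) - K) *\<^sub>R snd (aff G y x))"
  obtain \<eta> where e: "\<And>k::nat. \<eta> k \<in> test_functions \<Omega>" "(\<lambda>k. nsq M (\<lambda>x. gr (\<eta> k) x - y x)) \<longlonglongrightarrow> 0"
    using Z_seq[OF y] by blast
  obtain r where r: "strict_mono (r::nat\<Rightarrow>nat)" "AE x in M. (\<lambda>n. gr (\<eta> (r n)) x) \<longlonglongrightarrow> y x"
    by (rule nsq_AE_subseq[of M "\<lambda>k. gr (\<eta> k)", OF sqi_gr_test[OF e(1)] Z_sqi[OF y] e(2)])
  have e2: "(\<lambda>n. nsq M (\<lambda>x. gr (\<eta> (r n)) x - y x)) \<longlonglongrightarrow> 0"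
    using LIMSEQ_subseq_LIMSEQ[OF e(2) r(1)] by (simp add: o_def)
  have sA: "sqi M (\<lambda>x. snd (aff G y x))" "sqi M (aff G y)" using sqi_aff[OF G y] sqi_snd by blast+
  have bm: "continuous_on UNIV \<beta>" "continuous_on UNIV \<beta>'"
    using smooth_beta smooth_beta' smooth_on_imp_continuous_on by blast+
  have bm': "\<beta> \<in> borel_measurable borel" "\<beta>' \<in> borel_measurable borel"
    using bm borel_measurable_continuous_onI by blast+
  have [measurable]: "(\<lambda>x. fst (aff G y x)) \<in> borel_measurable M" "(\<lambda>x. snd (aff G y x)) \<in> borel_measurable M"
    using sqi_measurable[OF sqi_fst[OF sA(2)]] sqi_measurable[OF sA(1)] .
  have mb: "(\<lambda>x. \<beta>' (fst (aff G y x) - K)) \<in> borel_measurable M" "(\<lambda>x. \<beta> (fst (aff G y x) - K)) \<in> borel_measurable M"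
    by (rule measurable_compose[OF _ bm'(2)] measurable_compose[OF _ bm'(1)], measurable)+
  have sw: "sqi M ?w"
  proof (rule sqi_Pair)
    show "sqi M (\<lambda>x. \<beta> (fst (aff G y x) - K))"
      by (rule M.sqi_bounded[OF mb(2), of 1]) (use beta_le_1 beta_nonneg in auto)
    show "sqi M (\<lambda>x. \<beta>' (fst (aff G y x) - K) *\<^sub>R snd (aff G y x))"
      by (rule sqi_bounded_scaleR[OF mb(1) _ sA(1), of 2]) (use beta'_le_2 beta'_nonneg in auto)
  qed
  define f where "f n = (\<lambda>x. if x \<in> \<Omega> then \<beta> (G x + \<eta> (r n) x - K) else 0)" for n
  have f: "f n \<in> test_functions \<Omega>"
    "x \<in> \<Omega> \<Longrightarrow> gr (f n) x = (\<beta> (G x + \<eta> (r n) x - K), \<beta>' (G x + \<eta> (r n) x - K) *\<^sub>R (grad G x + grad (\<eta> (r n)) x))" for n x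
    using beta_cutoff_test[OF G K e(1)[of "r n"]] unfolding f_def by blast+
  \<comment> \<open>The part of the gradient error in which only the argument of \<beta>' changes,
    multiplied by the fixed limit gradient. Since \<beta>' takes values in [0, 2], four times the
    squared limit gradient is a majorant.\<close>
  let ?b = "\<lambda>n x. (\<beta>' (G x + \<eta> (r n) x - K) - \<beta>' (fst (aff G y x) - K)) *\<^sub>R snd (aff G y x)"
  have [measurable]: "\<eta> n \<in> borel_measurable M" "G \<in> borel_measurable M" for n
    using sqi_measurable[OF sqi_test[OF e(1)]] sqi_measurable[OF sqi_smooth[OF G]] .
  have mb2: "(\<lambda>x. \<beta>' (G x + \<eta> (r n) x - K)) \<in> borel_measurable M" for n
    by (rule measurable_compose[OF _ bm'(2)]) measurable
  have b2: "\<bar>\<beta>' s - \<beta>' t\<bar> \<le> 2" for s t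
    using beta'_le_2[of s] beta'_le_2[of t] beta'_nonneg[of s] beta'_nonneg[of t] by linarith
  have sb: "sqi M (?b n)" for n
    by (rule sqi_bounded_scaleR[OF borel_measurable_diff[OF mb2 mb(1)] AE_I2[OF b2] sA(1)])
  have "(\<lambda>n. nsq M (?b n)) \<longlonglongrightarrow> (\<integral>x. 0 \<partial>M)"
    unfolding nsq_def
  proof (rule integral_dominated_convergence[where w="\<lambda>x. 4 * (norm (snd (aff G y x)))\<^sup>2"])
    show "integrable M (\<lambda>x. 4 * (norm (snd (aff G y x)))\<^sup>2)" using sqi_integrable[OF sA(1)] by simp
    show "(\<lambda>x. (norm (?b n x))\<^sup>2) \<in> borel_measurable M" for n using sqi_measurable[OF sb[of n]] by measurable
    show "AE x in M. (\<lambda>n. (norm (?b n x))\<^sup>2) \<longlonglongrightarrow> 0"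
      using r(2)
    proof eventually_elim
      case (elim x)
      have l: "(\<lambda>n. \<eta> (r n) x) \<longlonglongrightarrow> fst (y x)" using tendsto_fst[OF elim] by simp
      have "isCont \<beta>' (fst (aff G y x) - K)" using bm(2) by (simp add: continuous_on_eq_continuous_at)
      moreover have "(\<lambda>n. G x + \<eta> (r n) x - K) \<longlonglongrightarrow> fst (aff G y x) - K"
        unfolding aff_def fst_add fst_gr by (intro tendsto_add tendsto_diff tendsto_const l)
      ultimately have "(\<lambda>n. \<beta>' (G x + \<eta> (r n) x - K)) \<longlonglongrightarrow> \<beta>' (fst (aff G y x) - K)"
        by (rule isCont_tendsto_compose)
      then have "(\<lambda>n. (norm (?b n x))\<^sup>2) \<longlonglongrightarrow> (norm ((\<beta>' (fst (aff G y x) - K) - \<beta>' (fst (aff G y x) - K)) *\<^sub>R snd (aff G y x)))\<^sup>2"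
        by (intro tendsto_power tendsto_norm tendsto_scaleR tendsto_diff tendsto_const)
      then show ?case by simp
    qed
    show "AE x in M. norm ((norm (?b n x))\<^sup>2) \<le> 4 * (norm (snd (aff G y x)))\<^sup>2" for n
    proof (rule AE_I2)
      fix x
      have "norm (?b n x) \<le> 2 * norm (snd (aff G y x))"
        unfolding norm_scaleR by (intro mult_right_mono b2 norm_ge_zero)
      then have "(norm (?b n x))\<^sup>2 \<le> (2 * norm (snd (aff G y x)))\<^sup>2" by (intro power_mono) auto
      then show "norm ((norm (?b n x))\<^sup>2) \<le> 4 * (norm (snd (aff G y x)))\<^sup>2" by (simp add: power_mult_distrib)
    qed
  qed simp
  then have lb: "(\<lambda>n. nsq M (?b n)) \<longlonglongrightarrow> 0" by simp
  \<comment> \<open>The Lipschitz constant 2 gives 4 times the squared error of the values.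
    Splitting the gradient error costs a factor 2 and |\<beta>'| \<le> 2 a factor 4, hence the
    8.\<close>
  have bound: "nsq M (\<lambda>x. gr (f n) x - ?w x) \<le> 8 * nsq M (\<lambda>x. gr (\<eta> (r n)) x - y x) + 2 * nsq M (?b n)" for n
  proof -
    have sd: "sqi M (\<lambda>x. gr (\<eta> (r n)) x - y x)" by (rule sqi_diff[OF sqi_gr_test[OF e(1)] Z_sqi[OF y]])
    have "nsq M (\<lambda>x. gr (f n) x - ?w x)
        \<le> (\<integral>x. 8 * (norm (gr (\<eta> (r n)) x - y x))\<^sup>2 + 2 * (norm (?b n x))\<^sup>2 \<partial>M)"
      unfolding nsq_def
    proof (rule integral_mono)
      show "integrable M (\<lambda>x. (norm (gr (f n) x - ?w x))\<^sup>2)"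
        by (rule sqi_integrable[OF sqi_diff[OF sqi_gr_test[OF f(1)] sw]])
      show "integrable M (\<lambda>x. 8 * (norm (gr (\<eta> (r n)) x - y x))\<^sup>2 + 2 * (norm (?b n x))\<^sup>2)"
        using sqi_integrable[OF sd] sqi_integrable[OF sb[of n]] by (intro Bochner_Integration.integrable_add) auto
      fix x assume "x \<in> space M"
      then have x: "x \<in> \<Omega>" by simp
      let ?s = "G x + \<eta> (r n) x - K" and ?t = "fst (aff G y x) - K"
      let ?a = "\<eta> (r n) x - fst (y x)" and ?q = "grad (\<eta> (r n)) x - snd (y x)"
      have "\<bar>\<beta> ?s - \<beta> ?t\<bar> \<le> 2 * \<bar>?a\<bar>" using beta_lipschitz[of ?s ?t] by (simp add: aff_def)
      then have "\<bar>\<beta> ?s - \<beta> ?t\<bar>\<^sup>2 \<le> (2 * \<bar>?a\<bar>)\<^sup>2" by (intro power_mono) auto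
      then have 1: "(\<beta> ?s - \<beta> ?t)\<^sup>2 \<le> 4 * ?a\<^sup>2" by (simp add: power_mult_distrib)
      have "\<beta>' ?s *\<^sub>R (grad G x + grad (\<eta> (r n)) x) - \<beta>' ?t *\<^sub>R snd (aff G y x) = \<beta>' ?s *\<^sub>R ?q + ?b n x"
        by (simp add: aff_def algebra_simps)
      then have "(norm (\<beta>' ?s *\<^sub>R (grad G x + grad (\<eta> (r n)) x) - \<beta>' ?t *\<^sub>R snd (aff G y x)))\<^sup>2
          \<le> 2 * (norm (\<beta>' ?s *\<^sub>R ?q))\<^sup>2 + 2 * (norm (?b n x))\<^sup>2"
        using norm_add_square_le[of "\<beta>' ?s *\<^sub>R ?q" "?b n x"] by simp
      moreover have "(norm (\<beta>' ?s *\<^sub>R ?q))\<^sup>2 \<le> 4 * (norm ?q)\<^sup>2"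
      proof -
        have "norm (\<beta>' ?s *\<^sub>R ?q) \<le> 2 * norm ?q"
          using beta'_le_2[of ?s] beta'_nonneg[of ?s] by (simp add: mult_right_mono)
        then have "(norm (\<beta>' ?s *\<^sub>R ?q))\<^sup>2 \<le> (2 * norm ?q)\<^sup>2" by (intro power_mono) auto
        then show ?thesis by (simp add: power_mult_distrib)
      qed
      moreover have "(norm (gr (\<eta> (r n)) x - y x))\<^sup>2 = ?a\<^sup>2 + (norm ?q)\<^sup>2"
        using norm_Pair_square[of ?a ?q] by (simp add: gr_def minus_prod_def)
      moreover have "(norm (gr (f n) x - ?w x))\<^sup>2 = (\<beta> ?s - \<beta> ?t)\<^sup>2
          + (norm (\<beta>' ?s *\<^sub>R (grad G x + grad (\<eta> (r n)) x) - \<beta>' ?t *\<^sub>R snd (aff G y x)))\<^sup>2"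
        unfolding f(2)[OF x] by (simp add: norm_Pair_square)
      ultimately show "(norm (gr (f n) x - ?w x))\<^sup>2 \<le> 8 * (norm (gr (\<eta> (r n)) x - y x))\<^sup>2 + 2 * (norm (?b n x))\<^sup>2"
        using 1 zero_le_power2[of ?a] by linarith
    qed
    also have "\<dots> = 8 * nsq M (\<lambda>x. gr (\<eta> (r n)) x - y x) + 2 * nsq M (?b n)"
      using sqi_integrable[OF sd] sqi_integrable[OF sb[of n]] unfolding nsq_def
      by (subst Bochner_Integration.integral_add) auto
    finally show ?thesis .
  qed
  have "(\<lambda>n. 8 * nsq M (\<lambda>x. gr (\<eta> (r n)) x - y x) + 2 * nsq M (?b n)) \<longlonglongrightarrow> 8 * 0 + 2 * 0"
    by (intro tendsto_add tendsto_mult tendsto_const lb e2)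
  then have "(\<lambda>n. 8 * nsq M (\<lambda>x. gr (\<eta> (r n)) x - y x) + 2 * nsq M (?b n)) \<longlonglongrightarrow> 0" by simp
  then have "(\<lambda>n. nsq M (\<lambda>x. gr (f n) x - ?w x)) \<longlonglongrightarrow> 0"
    by (rule tendsto_sandwich[OF _ _ tendsto_const, rotated 2]) (use bound in \<open>auto intro!: always_eventually\<close>)
  from ZI_seq[OF sw f(1) this] show ?thesis .
qed

text \<open>The equation is tested with \<beta> of the excess over the level. The gradient term and
  the zero order term are then both nonnegative while their sum is 0, so the test function has zero
  gradient and vanishes by the Poincare inequality. Nonnegativity of \<open>K\<close> gives the zero
  order term its sign.\<close>

lemma maximum_principle:
  assumes G: "smooth_on UNIV G" and K: "\<And>x. x \<in> frontier \<Omega> \<Longrightarrow> G x \<le> K" "K \<ge> 0" and y: "y \<in> Z"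
    and k: "\<And>x. k x \<ge> 0"
    and eq: "\<And>w. w \<in> Z \<Longrightarrow> (\<integral>x. snd (aff G y x) \<bullet> snd (w x) \<partial>M) = - (\<integral>x. fst (aff G y x) * k x * fst (w x) \<partial>M)"
  shows "AE x in M. fst (aff G y x) \<le> K"
proof -
  \<comment> \<open>The level is raised by \<delta> because truncation inside \<open>Z\<close>
    requires a strict inequality on the frontier.\<close>
  have step: "AE x in M. fst (aff G y x) \<le> K + \<delta>" if d: "\<delta> > 0" for \<delta>
  proof -
    let ?p = "\<lambda>x. fst (aff G y x) - (K + \<delta>)"
    let ?w = "\<lambda>x. (\<beta> (?p x), \<beta>' (?p x) *\<^sub>R snd (aff G y x))"
    have w: "?w \<in> Z" by (rule beta_cutoff_Z[OF G _ y]) (use K(1) d in force)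
    have "(\<integral>x. snd (aff G y x) \<bullet> snd (?w x) \<partial>M) = - (\<integral>x. fst (aff G y x) * k x * fst (?w x) \<partial>M)"
      by (rule eq[OF w])
    also have "\<dots> \<le> 0"
    proof -
      have "0 \<le> fst (aff G y x) * k x * fst (?w x)" for x
      proof (cases "?p x > 0")
        case True
        then have "fst (aff G y x) \<ge> 0" using K(2) d by linarith
        then show ?thesis using k[of x] by simp
      next
        case False
        then have b0: "\<beta> (?p x) = 0" by simp
        show ?thesis unfolding fst_conv b0 by simp
      qed
      then show ?thesis by simp
    qed
    finally have le: "(\<integral>x. snd (aff G y x) \<bullet> snd (?w x) \<partial>M) \<le> 0" .
    have nn: "0 \<le> snd (aff G y x) \<bullet> snd (?w x)" for x by simp
    have i: "integrable M (\<lambda>x. snd (aff G y x) \<bullet> snd (?w x))"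
      by (rule sqi_inner[OF sqi_snd[OF sqi_aff[OF G y]] Z_sqi_snd[OF w]])
    have "(\<integral>x. snd (aff G y x) \<bullet> snd (?w x) \<partial>M) = 0"
      by (rule antisym[OF le integral_nonneg_AE]) (rule AE_I2[OF nn])
    then have "AE x in M. snd (aff G y x) \<bullet> snd (?w x) = 0"
      using integral_nonneg_eq_0_iff_AE[OF i] nn by auto
    then have "AE x in M. snd (?w x) = 0" by eventually_elim auto
    then have "nsq M (\<lambda>x. snd (?w x)) = nsq M (\<lambda>x. 0 :: 'a)"
      by (intro nsq_cong_AE[OF Z_sqi_snd[OF w] sqi_zero]) auto
    then have s0: "nsq M (\<lambda>x. snd (?w x)) = 0" by (simp add: nsq_def)
    obtain P where "P > 0" "\<And>z. z \<in> Z \<Longrightarrow> nsq M (\<lambda>x. fst (z x)) \<le> P * nsq M (\<lambda>x. snd (z x))"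
      using poincare by blast
    from this(2)[OF w] have "nsq M (\<lambda>x. fst (?w x)) \<le> 0" unfolding s0 by simp
    then have "nsq M (\<lambda>x. fst (?w x)) = 0" by (rule antisym[OF _ nsq_nonneg])
    from nsq_eq_0_imp_AE[OF Z_sqi_fst[OF w] this] show ?thesis by eventually_elim simp
  qed
  have "AE x in M. \<forall>n. fst (aff G y x) \<le> K + inverse (real (Suc n))"
    unfolding AE_all_countable by (intro allI step) simp
  then show ?thesis
  proof eventually_elim
    case (elim x)
    have "(\<lambda>n. K + inverse (real (Suc n))) \<longlonglongrightarrow> K + 0"
      by (intro tendsto_add tendsto_const LIMSEQ_inverse_real_of_nat)
    from LIMSEQ_le_const[OF this] elim show ?case by auto
  qed
qed

lemma maximum_principle_abs:
  assumes G: "smooth_on UNIV G" and K: "\<And>x. x \<in> frontier \<Omega> \<Longrightarrow> \<bar>G x\<bar> \<le> K" "K \<ge> 0" and y: "y \<in> Z"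
    and k: "\<And>x. k x \<ge> 0"
    and eq: "\<And>w. w \<in> Z \<Longrightarrow> (\<integral>x. snd (aff G y x) \<bullet> snd (w x) \<partial>M) = - (\<integral>x. fst (aff G y x) * k x * fst (w x) \<partial>M)"
  shows "AE x in M. \<bar>fst (aff G y x)\<bar> \<le> K"
proof -
  have g: "aff (\<lambda>x. - G x) (\<lambda>x. - y x) x = - aff G y x" for x
    using gr_cmult[OF G, of "-1" x] by (simp add: aff_def)
  have u: "AE x in M. fst (aff G y x) \<le> K"
    by (rule maximum_principle[OF G _ K(2) y k eq]) (use K(1) in force)
  have "AE x in M. fst (aff (\<lambda>x. - G x) (\<lambda>x. - y x) x) \<le> K"
  proof (rule maximum_principle[OF smooth_on_minus[OF open_UNIV G] _ K(2) _ k])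
    show "(\<lambda>x. - y x) \<in> Z" using Z_scaleR[OF y, of "-1"] by simp
    show "- G x \<le> K" if "x \<in> frontier \<Omega>" for x using K(1)[OF that] by linarith
    fix w assume w: "w \<in> Z"
    show "(\<integral>x. snd (aff (\<lambda>x. - G x) (\<lambda>x. - y x) x) \<bullet> snd (w x) \<partial>M)
      = - (\<integral>x. fst (aff (\<lambda>x. - G x) (\<lambda>x. - y x) x) * k x * fst (w x) \<partial>M)"
      using eq[OF w] unfolding g by simp
  qed
  then have "AE x in M. - fst (aff G y x) \<le> K" unfolding g by simp
  with u show ?thesis by eventually_elim linarith
qed

subsection \<open>Coercivity\<close>

text \<open>Its L^2 product with a pair q is the bilinear form of the first equation, the integral
  of \<nabla>p \<bullet> \<nabla>q + (m^2 - \<phi>^2) p q.\<close>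

definition opS :: "real \<Rightarrow> ('a \<Rightarrow> real) \<Rightarrow> ('a \<Rightarrow> real \<times> 'a) \<Rightarrow> 'a \<Rightarrow> real \<times> 'a" where
  "opS m \<phi> p x = ((m\<^sup>2 - (\<phi> x)\<^sup>2) * fst (p x), snd (p x))"

lemma sqi_opS:
  assumes "\<phi> \<in> borel_measurable M" "AE x in M. \<bar>\<phi> x\<bar> \<le> K" "sqi M p"
  shows "sqi M (opS m \<phi> p)"
proof -
  have [measurable]: "\<phi> \<in> borel_measurable M" by fact
  have "AE x in M. \<bar>m\<^sup>2 - (\<phi> x)\<^sup>2\<bar> \<le> m\<^sup>2 + K\<^sup>2"
    using assms(2)
  proof eventually_elim
    case (elim x)
    then have "\<bar>\<phi> x\<bar>\<^sup>2 \<le> K\<^sup>2" by (intro power_mono) auto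
    then have "(\<phi> x)\<^sup>2 \<le> K\<^sup>2" by simp
    then show ?case using zero_le_power2[of m] zero_le_power2[of "\<phi> x"] zero_le_power2[of K]
      by (intro abs_leI) linarith+
  qed
  from sqi_bounded_scaleR[OF _ this sqi_fst[OF assms(3)]]
  have "sqi M (\<lambda>x. (m\<^sup>2 - (\<phi> x)\<^sup>2) *\<^sub>R fst (p x))" by measurable
  then have "sqi M (\<lambda>x. (m\<^sup>2 - (\<phi> x)\<^sup>2) * fst (p x))" by simp
  from sqi_Pair[OF this sqi_snd[OF assms(3)]] show ?thesis unfolding opS_def[abs_def] .
qed

text \<open>The eigenvalue inequality absorbs the possibly negative zero order term into the
  gradient, and the Poincare inequality then restores the full norm. It matters that
  \<open>c\<close> depends on \<phi> only through the bound \<open>K\<close>, since \<phi> will vary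
  with u.\<close>

lemma coercive:
  assumes ne: "\<Omega> \<noteq> {}" and K: "K\<^sup>2 < m\<^sup>2 + first_dirichlet_eigenvalue \<Omega>"
  obtains c where "c > 0" "\<And>\<phi> d. \<phi> \<in> borel_measurable M \<Longrightarrow> AE x in M. \<bar>\<phi> x\<bar> \<le> K \<Longrightarrow> d \<in> Z \<Longrightarrow>
    c * nsq M d \<le> (\<integral>x. opS m \<phi> d x \<bullet> d x \<partial>M)"
proof -
  obtain P where P: "P > 0" "\<And>z. z \<in> Z \<Longrightarrow> nsq M (\<lambda>x. fst (z x)) \<le> P * nsq M (\<lambda>x. snd (z x))"
    using poincare by blast
  let ?l = "first_dirichlet_eigenvalue \<Omega>"
  define q where "q = (if K\<^sup>2 - m\<^sup>2 \<le> 0 then 1 else 1 - (K\<^sup>2 - m\<^sup>2) / ?l)"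
  have q0: "q > 0" unfolding q_def using K by (auto simp: field_simps)
  have main: "q / (P + 1) * nsq M d \<le> (\<integral>x. opS m \<phi> d x \<bullet> d x \<partial>M)"
    if a: "\<phi> \<in> borel_measurable M" "AE x in M. \<bar>\<phi> x\<bar> \<le> K" and d: "d \<in> Z" for \<phi> d
  proof -
    let ?a = "nsq M (\<lambda>x. fst (d x))" and ?b = "nsq M (\<lambda>x. snd (d x))"
    have "?b - (K\<^sup>2 - m\<^sup>2) * ?a = (\<integral>x. (norm (snd (d x)))\<^sup>2 - (K\<^sup>2 - m\<^sup>2) * (norm (fst (d x)))\<^sup>2 \<partial>M)"
      unfolding nsq_def using sqi_integrable[OF Z_sqi_fst[OF d]] sqi_integrable[OF Z_sqi_snd[OF d]]
      by (subst Bochner_Integration.integral_diff) auto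
    also have "\<dots> \<le> (\<integral>x. opS m \<phi> d x \<bullet> d x \<partial>M)"
    proof (rule integral_mono_AE)
      show "integrable M (\<lambda>x. (norm (snd (d x)))\<^sup>2 - (K\<^sup>2 - m\<^sup>2) * (norm (fst (d x)))\<^sup>2)"
        using sqi_integrable[OF Z_sqi_fst[OF d]] sqi_integrable[OF Z_sqi_snd[OF d]]
        by (intro Bochner_Integration.integrable_diff) auto
      show "integrable M (\<lambda>x. opS m \<phi> d x \<bullet> d x)"
        by (rule sqi_inner[OF sqi_opS[OF a Z_sqi[OF d]] Z_sqi[OF d]])
      show "AE x in M. (norm (snd (d x)))\<^sup>2 - (K\<^sup>2 - m\<^sup>2) * (norm (fst (d x)))\<^sup>2 \<le> opS m \<phi> d x \<bullet> d x"
        using a(2)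
      proof eventually_elim
        case (elim x)
        then have "\<bar>\<phi> x\<bar>\<^sup>2 \<le> K\<^sup>2" by (intro power_mono) auto
        then have "(m\<^sup>2 - K\<^sup>2) * (fst (d x))\<^sup>2 \<le> (m\<^sup>2 - (\<phi> x)\<^sup>2) * (fst (d x))\<^sup>2" by (intro mult_right_mono) auto
        moreover have "opS m \<phi> d x \<bullet> d x = (m\<^sup>2 - (\<phi> x)\<^sup>2) * (fst (d x))\<^sup>2 + (norm (snd (d x)))\<^sup>2"
          by (simp add: opS_def inner_prod_def power2_norm_eq_inner[of "snd (d x)"] power2_eq_square[of "fst (d x)"])
        ultimately show ?case by (simp add: left_diff_distrib)
      qed
    qed
    finally have 1: "?b - (K\<^sup>2 - m\<^sup>2) * ?a \<le> (\<integral>x. opS m \<phi> d x \<bullet> d x \<partial>M)" .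
    have "q * ?b \<le> ?b - (K\<^sup>2 - m\<^sup>2) * ?a"
    proof (cases "K\<^sup>2 - m\<^sup>2 \<le> 0")
      case True
      then have "(K\<^sup>2 - m\<^sup>2) * ?a \<le> 0" by (rule mult_nonpos_nonneg) simp
      then show ?thesis using True by (simp add: q_def)
    next
      case False
      then have l: "?l > 0" using K by linarith
      have "?a \<le> ?b / ?l" using first_dirichlet_eigenvalue_rayleigh[OF ne d] l by (simp add: field_simps)
      then have "(K\<^sup>2 - m\<^sup>2) * ?a \<le> (K\<^sup>2 - m\<^sup>2) * (?b / ?l)" using False by (intro mult_left_mono) auto
      then show ?thesis using False by (simp add: q_def algebra_simps)
    qed
    moreover have "q / (P + 1) * nsq M d \<le> q * ?b"
    proof -
      have "nsq M d \<le> (P + 1) * ?b" using nsq_fst_snd[OF Z_sqi[OF d]] P(2)[OF d] by (simp add: algebra_simps)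
      then have "q * nsq M d \<le> q * ((P + 1) * ?b)" using q0 by (intro mult_left_mono) auto
      then show ?thesis using P(1) by (simp add: field_simps)
    qed
    ultimately show ?thesis using 1 by linarith
  qed
  show ?thesis
    by (rule that[of "q / (P + 1)"]) (use q0 P(1) main in auto)
qed

end

section \<open>Existence of a solution\<close>

context bounded_open3
begin

text \<open>The exponent 6 is what the Sobolev inequality provides in dimension three; smooth
  functions have it too because \<Omega> is bounded, so the class contains all functions with
  prescribed smooth boundary values used here.\<close>

definition in6 :: "(real^3 \<Rightarrow> real) \<Rightarrow> bool" where
  "in6 f \<longleftrightarrow> f \<in> borel_measurable M \<and> integrable M (\<lambda>x. (f x)^6)"

lemma in6_measurable: "in6 f \<Longrightarrow> f \<in> borel_measurable M"
  by (simp add: in6_def)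

lemma in6_Z: "z \<in> Z \<Longrightarrow> in6 (\<lambda>x. fst (z x))"
  using Z_sobolev sqi_measurable[OF Z_sqi_fst] by (simp add: in6_def)

lemma in6_smooth: assumes "smooth_on UNIV F" shows "in6 F"
proof -
  have c: "continuous_on UNIV (\<lambda>x. (F x)^6)"
    by (intro continuous_on_power smooth_on_imp_continuous_on assms)
  have "integrable M (\<lambda>x. (F x)^6)" by (rule M.sqi_imp_integrable[OF sqi_continuous[OF c]])
  then show ?thesis using sqi_measurable[OF sqi_smooth[OF assms]] by (simp add: in6_def)
qed

lemma power6_add_le: "(a + b)^6 \<le> 64 * (a^6 + (b::real)^6)"
proof -
  have "\<bar>a + b\<bar> \<le> 2 * max \<bar>a\<bar> \<bar>b\<bar>" by linarith
  then have "\<bar>a + b\<bar>^6 \<le> (2 * max \<bar>a\<bar> \<bar>b\<bar>)^6" by (intro power_mono) auto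
  also have "\<dots> = 64 * (max \<bar>a\<bar> \<bar>b\<bar>)^6" by (simp add: power_mult_distrib)
  also have "(max \<bar>a\<bar> \<bar>b\<bar>)^6 \<le> a^6 + b^6"
    by (cases "\<bar>a\<bar> \<le> \<bar>b\<bar>") (simp_all add: max_def power_even_abs)
  finally show ?thesis by (simp add: power_even_abs)
qed

lemma in6_add: assumes "in6 f" "in6 g" shows "in6 (\<lambda>x. f x + g x)"
proof -
  note [measurable] = in6_measurable[OF assms(1)] in6_measurable[OF assms(2)]
  have "integrable M (\<lambda>x. (f x + g x)^6)"
  proof (rule Bochner_Integration.integrable_bound)
    show "integrable M (\<lambda>x. 64 * ((f x)^6 + (g x)^6))" using assms by (auto simp: in6_def)
    show "AE x in M. norm ((f x + g x)^6) \<le> norm (64 * ((f x)^6 + (g x)^6))"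
      using power6_add_le[of "f _" "g _"] by (intro AE_I2) simp
  qed measurable
  then show ?thesis by (simp add: in6_def)
qed

lemma power4_le: "x^4 \<le> 1 + (x::real)^6"
proof (cases "\<bar>x\<bar> \<le> 1")
  case True
  have "\<bar>x\<bar>^4 \<le> 1" using True by (intro power_le_one) auto
  then have "x^4 \<le> 1" by (simp add: power_even_abs)
  moreover have "0 \<le> x^6" by (rule zero_le_even_power) simp
  ultimately show ?thesis by linarith
next
  case False
  then have "\<bar>x\<bar>^4 \<le> \<bar>x\<bar>^6" by (intro power_increasing) auto
  then show ?thesis by (simp add: power_even_abs)
qed

lemma product_square_le: "(a * b)\<^sup>2 \<le> 2 + a^6 + (b::real)^6"
proof -
  have "0 \<le> (a\<^sup>2 - b\<^sup>2)\<^sup>2" by simp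
  then have "2 * (a * b)\<^sup>2 \<le> a^4 + b^4"
    by (simp add: power2_diff power_mult_distrib flip: power_mult)
  moreover have "0 \<le> (a * b)\<^sup>2" by simp
  ultimately show ?thesis using power4_le[of a] power4_le[of b] by linarith
qed

lemma product_cube_square_le: "(a * b\<^sup>2)\<^sup>2 \<le> a^6 + (b::real)^6"
proof -
  have eq: "(a * b\<^sup>2)\<^sup>2 = \<bar>a\<bar>^2 * \<bar>b\<bar>^4" by (simp add: power_mult_distrib power_even_abs flip: power_mult)
  show ?thesis
  proof (cases "\<bar>a\<bar> \<le> \<bar>b\<bar>")
    case True
    then have "\<bar>a\<bar>^2 * \<bar>b\<bar>^4 \<le> \<bar>b\<bar>^2 * \<bar>b\<bar>^4" by (intro mult_right_mono power_mono) auto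
    also have "\<dots> = b^6" by (simp add: power_even_abs flip: power_add)
    finally have "\<bar>a\<bar>^2 * \<bar>b\<bar>^4 \<le> b^6" .
    moreover have "0 \<le> a^6" by (rule zero_le_even_power) simp
    ultimately show ?thesis unfolding eq by linarith
  next
    case False
    then have "\<bar>a\<bar>^2 * \<bar>b\<bar>^4 \<le> \<bar>a\<bar>^2 * \<bar>a\<bar>^4" by (intro mult_left_mono power_mono) auto
    also have "\<dots> = a^6" by (simp add: power_even_abs flip: power_add)
    finally have "\<bar>a\<bar>^2 * \<bar>b\<bar>^4 \<le> a^6" .
    moreover have "0 \<le> b^6" by (rule zero_le_even_power) simp
    ultimately show ?thesis unfolding eq by linarith
  qed
qed

text \<open>The second part puts \<phi> u^2 into L^2: its square \<phi>^2 u^4 is at most the sixth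
  power of the larger factor. The right-hand side of the second equation can therefore be paired
  with any L^2 function.\<close>

lemma sqi_product:
  assumes "in6 f" "in6 g" shows "sqi M (\<lambda>x. f x * g x)" "sqi M (\<lambda>x. f x * (g x)\<^sup>2)"
proof -
  note [measurable] = in6_measurable[OF assms(1)] in6_measurable[OF assms(2)]
  have i: "integrable M (\<lambda>x. (f x)^6)" "integrable M (\<lambda>x. (g x)^6)" using assms by (auto simp: in6_def)
  show "sqi M (\<lambda>x. f x * g x)"
  proof (rule sqi_bound)
    show "integrable M (\<lambda>x. 2 + (f x)^6 + (g x)^6)"
      using i by (intro Bochner_Integration.integrable_add) auto
    show "AE x in M. (norm (f x * g x))\<^sup>2 \<le> 2 + (f x)^6 + (g x)^6"
      using product_square_le[of "f _" "g _"] by (intro AE_I2) simp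
  qed measurable
  show "sqi M (\<lambda>x. f x * (g x)\<^sup>2)"
  proof (rule sqi_bound)
    show "integrable M (\<lambda>x. (f x)^6 + (g x)^6)"
      using i by (intro Bochner_Integration.integrable_add) auto
    show "AE x in M. (norm (f x * (g x)\<^sup>2))\<^sup>2 \<le> (f x)^6 + (g x)^6"
      using product_cube_square_le[of "f _" "g _"] by (intro AE_I2) simp
  qed measurable
qed

lemma in6_aff: "smooth_on UNIV F \<Longrightarrow> v \<in> Z \<Longrightarrow> in6 (\<lambda>x. fst (aff F v x))"
  unfolding aff_def fst_add fst_gr by (intro in6_add in6_smooth in6_Z)

lemma aff_affine:
  "aff G (\<lambda>x. (1/2) *\<^sub>R (z x + w x)) = (\<lambda>x. (1/2) *\<^sub>R (aff G z x + aff G w x))"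
  "(\<lambda>x. aff G z x - aff G w x) = (\<lambda>x. z x - w x)"
  "aff G (\<lambda>x. z x + t *\<^sub>R w x) = (\<lambda>x. aff G z x + t *\<^sub>R w x)"
  by (auto simp: aff_def[abs_def] fun_eq_iff algebra_simps scaleR_2[symmetric])

text \<open>For given \<open>u\<close> the energy \<open>\<integral> |\<nabla>\<phi>|\<^sup>2 + \<phi>\<^sup>2 u\<^sup>2\<close> of \<open>\<phi>\<close> is the square norm of \<open>opT u (\<phi>, \<nabla>\<phi>)\<close>.\<close>

definition opT :: "(real^3 \<Rightarrow> real) \<Rightarrow> (real^3 \<Rightarrow> real \<times> (real^3)) \<Rightarrow> real^3 \<Rightarrow> real \<times> (real^3)" where
  "opT u p x = (fst (p x) * u x, snd (p x))"

lemma opT_linear: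
  "opT u (\<lambda>x. c *\<^sub>R p x) = (\<lambda>x. c *\<^sub>R opT u p x)" "opT u (\<lambda>x. p x + q x) = (\<lambda>x. opT u p x + opT u q x)"
  "opT u (\<lambda>x. p x - q x) = (\<lambda>x. opT u p x - opT u q x)"
  by (simp_all add: opT_def fun_eq_iff algebra_simps)

lemma sqi_opT:
  assumes "in6 u" "in6 (\<lambda>x. fst (p x))" "sqi M p" shows "sqi M (opT u p)"
  unfolding opT_def[abs_def] by (intro sqi_Pair sqi_product(1) sqi_snd assms)

lemma sqi_opT_Z: "in6 u \<Longrightarrow> w \<in> Z \<Longrightarrow> sqi M (opT u w)"
  by (intro sqi_opT in6_Z Z_sqi)

lemma sqi_opT_aff: "in6 u \<Longrightarrow> smooth_on UNIV G \<Longrightarrow> w \<in> Z \<Longrightarrow> sqi M (opT u (aff G w))"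
  by (intro sqi_opT in6_aff sqi_aff)

text \<open>The functional is a squared norm, so its midpoint defect is a quarter of the squared
  norm of \<open>opT u\<close> applied to the difference. The gradient part of that controls the
  full norm by the Poincare inequality, which gives the modulus 1 / (4 (P + 1)).\<close>

lemma phi_exists:
  assumes u: "in6 u" and G: "smooth_on UNIV G"
  obtains y where "y \<in> Z" "\<forall>w\<in>Z. nsq M (opT u (aff G y)) \<le> nsq M (opT u (aff G w))"
proof -
  obtain P where P: "P > 0" "\<And>z. z \<in> Z \<Longrightarrow> nsq M (\<lambda>x. fst (z x)) \<le> P * nsq M (\<lambda>x. snd (z x))"
    using poincare by blast
  let ?J = "\<lambda>y. nsq M (opT u (aff G y))"
  show ?thesis
  proof (rule minimizer_exists[of "1 / (4 * (P + 1))" ?J])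
    show "1 / (4 * (P + 1)) > 0" using P(1) by simp
    fix z w assume z: "z \<in> Z" and w: "w \<in> Z"
    have d: "(\<lambda>x. z x - w x) \<in> Z" by (rule Z_diff[OF z w])
    have "?J (\<lambda>x. (1/2) *\<^sub>R (z x + w x)) = (?J z + ?J w) / 2 - nsq M (\<lambda>x. opT u (aff G z) x - opT u (aff G w) x) / 4"
      unfolding aff_affine opT_linear by (rule nsq_midpoint) (intro sqi_opT_aff u G z w)+
    also have "(\<lambda>x. opT u (aff G z) x - opT u (aff G w) x) = opT u (\<lambda>x. z x - w x)"
      unfolding opT_linear(3)[symmetric] aff_affine ..
    finally have 1: "?J (\<lambda>x. (1/2) *\<^sub>R (z x + w x)) = (?J z + ?J w) / 2 - nsq M (opT u (\<lambda>x. z x - w x)) / 4" .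
    let ?b = "nsq M (\<lambda>x. snd (z x - w x))"
    have "nsq M (\<lambda>x. z x - w x) \<le> (P + 1) * ?b"
      using nsq_fst_snd[OF Z_sqi[OF d]] P(2)[OF d] by (simp add: algebra_simps)
    moreover have "?b \<le> nsq M (opT u (\<lambda>x. z x - w x))"
      using nsq_fst_snd[OF sqi_opT_Z[OF u d]] nsq_nonneg[of M "\<lambda>x. fst (opT u (\<lambda>x. z x - w x) x)"]
      by (simp add: opT_def)
    ultimately have "nsq M (\<lambda>x. z x - w x) \<le> (P + 1) * nsq M (opT u (\<lambda>x. z x - w x))"
      using P(1) by (intro order_trans[OF _ mult_left_mono[of ?b "nsq M (opT u (\<lambda>x. z x - w x))" "P + 1"]]) auto
    then have "1 / (4 * (P + 1)) * nsq M (\<lambda>x. z x - w x) \<le> nsq M (opT u (\<lambda>x. z x - w x)) / 4"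
      using P(1) by (simp add: field_simps)
    then show "?J (\<lambda>x. (1/2) *\<^sub>R (z x + w x)) \<le> (?J z + ?J w) / 2 - 1 / (4 * (P + 1)) * nsq M (\<lambda>x. z x - w x)"
      unfolding 1 by simp
  next
    fix z assume z: "z \<in> Z"
    let ?g = "\<lambda>x. 2 *\<^sub>R (fst (aff G z x) * (u x)\<^sup>2, snd (aff G z x))"
    have g: "sqi M ?g"
      by (intro sqi_scaleR sqi_Pair sqi_product(2) sqi_snd sqi_aff in6_aff u G z)
    have "?J z + (\<integral>x. ?g x \<bullet> (w x - z x) \<partial>M) \<le> ?J w" if w: "w \<in> Z" for w
    proof -
      have "(\<lambda>x. opT u (aff G w) x - opT u (aff G z) x) = opT u (\<lambda>x. w x - z x)"
        unfolding opT_linear(3)[symmetric] aff_affine ..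
      from fun_cong[OF this] have "2 * (opT u (aff G z) x \<bullet> (opT u (aff G w) x - opT u (aff G z) x)) = ?g x \<bullet> (w x - z x)" for x
        by (simp add: opT_def inner_prod_def power2_eq_square)
      then have "2 * (\<integral>x. opT u (aff G z) x \<bullet> (opT u (aff G w) x - opT u (aff G z) x) \<partial>M) = (\<integral>x. ?g x \<bullet> (w x - z x) \<partial>M)"
        by (simp add: integral_mult_right_zero[symmetric] del: integral_mult_right_zero)
      then show ?thesis
        using nsq_ge_tangent[OF sqi_opT_aff[OF u G z] sqi_opT_aff[OF u G w]] by simp
    qed
    with g show "\<exists>g. sqi M g \<and> (\<forall>w\<in>Z. ?J z + (\<integral>x. g x \<bullet> (w x - z x) \<partial>M) \<le> ?J w)" by blast
  qed (rule that)
qed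

text \<open>Stationarity of a squared norm along lines in \<open>Z\<close>. Integrability is
  recorded as well, because the equations for two different functions u are later
  subtracted.\<close>

lemma phi_equation:
  assumes u: "in6 u" and G: "smooth_on UNIV G" and y: "y \<in> Z"
    and min: "\<forall>w\<in>Z. nsq M (opT u (aff G y)) \<le> nsq M (opT u (aff G w))" and w: "w \<in> Z"
  shows "(\<integral>x. snd (aff G y x) \<bullet> snd (w x) \<partial>M) = - (\<integral>x. fst (aff G y x) * (u x)\<^sup>2 * fst (w x) \<partial>M)"
    "integrable M (\<lambda>x. fst (aff G y x) * (u x)\<^sup>2 * fst (w x))"
proof -
  have "(\<integral>x. opT u (aff G y) x \<bullet> opT u w x \<partial>M) = 0"
  proof (rule nsq_critical[OF sqi_opT_aff[OF u G y] sqi_opT_Z[OF u w]])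
    fix t
    have "opT u (aff G (\<lambda>x. y x + t *\<^sub>R w x)) = (\<lambda>x. opT u (aff G y) x + t *\<^sub>R opT u w x)"
      unfolding aff_affine opT_linear ..
    with bspec[OF min Z_add[OF y Z_scaleR[OF w, of t]]]
    show "nsq M (opT u (aff G y)) \<le> nsq M (\<lambda>x. opT u (aff G y) x + t *\<^sub>R opT u w x)" by simp
  qed
  moreover have i: "integrable M (\<lambda>x. (fst (aff G y x) * (u x)\<^sup>2) * fst (w x))"
    by (intro sqi_mult sqi_product(2) in6_aff u G y Z_sqi_fst w)
  moreover have i2: "integrable M (\<lambda>x. snd (aff G y x) \<bullet> snd (w x))"
    by (intro sqi_inner sqi_snd sqi_aff G y Z_sqi w)
  moreover have "opT u (aff G y) x \<bullet> opT u w x = (fst (aff G y x) * (u x)\<^sup>2) * fst (w x) + snd (aff G y x) \<bullet> snd (w x)" for x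
    by (simp add: opT_def inner_prod_def power2_eq_square)
  ultimately have "(\<integral>x. (fst (aff G y x) * (u x)\<^sup>2) * fst (w x) \<partial>M) + (\<integral>x. snd (aff G y x) \<bullet> snd (w x) \<partial>M) = 0"
    by (simp add: Bochner_Integration.integral_add[OF i i2])
  then show "(\<integral>x. snd (aff G y x) \<bullet> snd (w x) \<partial>M) = - (\<integral>x. fst (aff G y x) * (u x)\<^sup>2 * fst (w x) \<partial>M)" by simp
  show "integrable M (\<lambda>x. fst (aff G y x) * (u x)\<^sup>2 * fst (w x))" by (rule i)
qed

section \<open>The quadratic form of the first equation and the reduced functional\<close>

lemma opS_inner:
  "opS m \<phi> p x \<bullet> q x = (m\<^sup>2 - (\<phi> x)\<^sup>2) * fst (p x) * fst (q x) + snd (p x) \<bullet> snd (q x)"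
  by (simp add: opS_def inner_prod_def)

lemma opS_quadratic:
  assumes a: "\<phi> \<in> borel_measurable M" "AE x in M. \<bar>\<phi> x\<bar> \<le> K" and p: "sqi M p" and d: "sqi M d"
  shows "(\<integral>x. opS m \<phi> (\<lambda>x. p x + d x) x \<bullet> (p x + d x) \<partial>M)
    = (\<integral>x. opS m \<phi> p x \<bullet> p x \<partial>M) + 2 * (\<integral>x. opS m \<phi> p x \<bullet> d x \<partial>M) + (\<integral>x. opS m \<phi> d x \<bullet> d x \<partial>M)"
proof -
  note s = sqi_opS[OF a p, of m] sqi_opS[OF a d, of m]
  have eq: "opS m \<phi> (\<lambda>x. p x + d x) x \<bullet> (p x + d x)
      = (opS m \<phi> p x \<bullet> p x + 2 * (opS m \<phi> p x \<bullet> d x)) + opS m \<phi> d x \<bullet> d x" for x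
  proof -
    have "snd (d x) \<bullet> snd (p x) = snd (p x) \<bullet> snd (d x)" by (rule inner_commute)
    then show ?thesis by (simp add: opS_def inner_prod_def inner_add_left inner_add_right algebra_simps)
  qed
  show ?thesis
    unfolding eq using sqi_inner[OF s(1) p] sqi_inner[OF s(1) d] sqi_inner[OF s(2) d]
    by (subst Bochner_Integration.integral_add, auto)+
qed

text \<open>The energy \<open>A \<phi> v = \<integral> |\<nabla>u|\<^sup>2 + (m\<^sup>2 - \<phi>\<^sup>2) u\<^sup>2 - |\<nabla>\<phi>|\<^sup>2\<close> is concave in \<open>\<phi>\<close>, and uniformly convex in \<open>u\<close>
  as long as \<open>|\<phi>| \<le> K\<close>. So \<open>u\<close> is found by minimizing the maximum over \<open>\<phi>\<close>, which is attained at the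
  solution \<open>\<phi>\<close> of the second equation and inherits uniform convexity.\<close>

theorem solution_exists:
  assumes ne: "\<Omega> \<noteq> {}" and F: "smooth_on UNIV F" and G: "smooth_on UNIV G"
    and GK: "\<And>x. x \<in> frontier \<Omega> \<Longrightarrow> \<bar>G x\<bar> \<le> K" and K0: "K \<ge> 0" and K: "K\<^sup>2 < m\<^sup>2 + first_dirichlet_eigenvalue \<Omega>"
  obtains v y where "v \<in> Z" "y \<in> Z" "AE x in M. \<bar>fst (aff G y x)\<bar> \<le> K"
    "\<And>w. w \<in> Z \<Longrightarrow> (\<integral>x. opS m (\<lambda>x. fst (aff G y x)) (aff F v) x \<bullet> w x \<partial>M) = 0"
    "\<And>w. w \<in> Z \<Longrightarrow> (\<integral>x. snd (aff G y x) \<bullet> snd (w x) \<partial>M) = - (\<integral>x. fst (aff G y x) * (fst (aff F v x))\<^sup>2 * fst (w x) \<partial>M)"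
proof -
  define U where "U v x = fst (aff F v x)" for v x
  have U6: "in6 (U v)" if "v \<in> Z" for v unfolding U_def[abs_def] by (rule in6_aff[OF F that])
  define Y where "Y v = (SOME y. y \<in> Z \<and> (\<forall>w\<in>Z. nsq M (opT (U v) (aff G y)) \<le> nsq M (opT (U v) (aff G w))))" for v
  have Y: "Y v \<in> Z" "\<forall>w\<in>Z. nsq M (opT (U v) (aff G (Y v))) \<le> nsq M (opT (U v) (aff G w))" if v: "v \<in> Z" for v
  proof -
    have "\<exists>y. y \<in> Z \<and> (\<forall>w\<in>Z. nsq M (opT (U v) (aff G y)) \<le> nsq M (opT (U v) (aff G w)))"
      using phi_exists[OF U6[OF v] G] by blast
    from someI_ex[OF this] show "Y v \<in> Z" "\<forall>w\<in>Z. nsq M (opT (U v) (aff G (Y v))) \<le> nsq M (opT (U v) (aff G w))"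
      unfolding Y_def by blast+
  qed
  note Yeq = phi_equation[OF U6 G Y]
  define \<phi> where "\<phi> v x = fst (aff G (Y v) x)" for v x
  have \<phi>K: "AE x in M. \<bar>\<phi> v x\<bar> \<le> K" if v: "v \<in> Z" for v
    unfolding \<phi>_def
    by (rule maximum_principle_abs[OF G GK K0 Y(1)[OF v] _ Yeq(1)[OF v v v]]) auto
  have \<phi>m: "\<phi> v \<in> borel_measurable M" if v: "v \<in> Z" for v
    unfolding \<phi>_def[abs_def] by (rule sqi_measurable[OF sqi_fst[OF sqi_aff[OF G Y(1)[OF v]]]])
  define Q where "Q f p = (\<integral>x. opS m f p x \<bullet> p x \<partial>M)" for f p
  \<comment> \<open>The reduced energy: the value at the solution \<phi> of the second equation
    belonging to \<open>v\<close>.\<close>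
  define J where "J v = Q (\<phi> v) (aff F v) - nsq M (\<lambda>x. snd (aff G (Y v) x))" for v
  \<comment> \<open>Rearranged in this way, \<phi> enters only through minus the squared norm of
    \<open>opT\<close>, so the minimizer of that norm maximizes the energy.\<close>
  have QT: "Q (\<lambda>x. fst (aff G y x)) (aff F v) - nsq M (\<lambda>x. snd (aff G y x))
      = nsq M (\<lambda>x. snd (aff F v x)) + m\<^sup>2 * nsq M (U v) - nsq M (opT (U v) (aff G y))"
    if v: "v \<in> Z" and y: "y \<in> Z" for v y
  proof -
    let ?f = "\<lambda>x. fst (aff G y x)"
    have i1: "integrable M (\<lambda>x. (norm (snd (aff F v x)))\<^sup>2)" by (rule sqi_integrable[OF sqi_snd[OF sqi_aff[OF F v]]])
    have i2: "integrable M (\<lambda>x. m\<^sup>2 * (norm (U v x))\<^sup>2)"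
      unfolding U_def using sqi_integrable[OF sqi_fst[OF sqi_aff[OF F v]]] by simp
    have i3: "sqi M (\<lambda>x. ?f x * U v x)" by (rule sqi_product(1)[OF in6_aff[OF G y] U6[OF v]])
    have "Q ?f (aff F v) = (\<integral>x. ((norm (snd (aff F v x)))\<^sup>2 + m\<^sup>2 * (norm (U v x))\<^sup>2) - (norm (?f x * U v x))\<^sup>2 \<partial>M)"
      unfolding Q_def
      by (rule Bochner_Integration.integral_cong[OF refl])
        (simp add: opS_inner U_def dot_square_norm power_mult_distrib left_diff_distrib mult.assoc flip: power2_eq_square)
    also have "\<dots> = nsq M (\<lambda>x. snd (aff F v x)) + m\<^sup>2 * nsq M (U v) - nsq M (\<lambda>x. ?f x * U v x)"
      unfolding nsq_def using i1 i2 sqi_integrable[OF i3]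
      by (subst Bochner_Integration.integral_diff, simp, simp, subst Bochner_Integration.integral_add) auto
    finally show ?thesis
      using nsq_fst_snd[OF sqi_opT_aff[OF U6[OF v] G y]] by (simp add: opT_def)
  qed
  \<comment> \<open>The maximum property, with competitors \<phi> belonging to other functions
    \<open>v'\<close>. For these the bound by \<open>K\<close> is available, and with it
    coercivity.\<close>
  have JA: "Q (\<phi> v') (aff F v) - nsq M (\<lambda>x. snd (aff G (Y v') x)) \<le> J v" if v: "v \<in> Z" and v': "v' \<in> Z" for v v'
    using QT[OF v Y(1)[OF v']] QT[OF v Y(1)[OF v]] Y(2)[OF v] Y(1)[OF v'] unfolding J_def \<phi>_def[abs_def] by force
  obtain c where c: "c > 0" "\<And>\<phi> d. \<phi> \<in> borel_measurable M \<Longrightarrow> AE x in M. \<bar>\<phi> x\<bar> \<le> K \<Longrightarrow> d \<in> Z \<Longrightarrow>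
    c * nsq M d \<le> (\<integral>x. opS m \<phi> d x \<bullet> d x \<partial>M)"
    using coercive[OF ne K] by blast
  have cQ: "c * nsq M d \<le> Q (\<phi> v) d" if "v \<in> Z" "d \<in> Z" for v d
    unfolding Q_def by (rule c(2)[OF \<phi>m \<phi>K]) (use that in auto)
  have Qadd: "Q (\<phi> v) (\<lambda>x. p x + d x) = Q (\<phi> v) p + 2 * (\<integral>x. opS m (\<phi> v) p x \<bullet> d x \<partial>M) + Q (\<phi> v) d"
    if "v \<in> Z" "sqi M p" "sqi M d" for v p d
    unfolding Q_def by (rule opS_quadratic[OF \<phi>m[OF that(1)] \<phi>K[OF that(1)] that(2,3)])
  have Qscale: "Q f (\<lambda>x. t *\<^sub>R p x) = t\<^sup>2 * Q f p" for f t p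
  proof -
    have "opS m f (\<lambda>x. t *\<^sub>R p x) x \<bullet> (t *\<^sub>R p x) = t\<^sup>2 * (opS m f p x \<bullet> p x)" for x
      by (simp add: opS_def inner_prod_def power2_eq_square algebra_simps)
    then show ?thesis unfolding Q_def by simp
  qed
  have Qmid: "Q (\<phi> v) (\<lambda>x. (1/2) *\<^sub>R (p x + q x)) = (Q (\<phi> v) p + Q (\<phi> v) q) / 2 - Q (\<phi> v) (\<lambda>x. p x - q x) / 4"
    if v: "v \<in> Z" and p: "sqi M p" and q: "sqi M q" for v p q
  proof -
    have s: "(\<integral>x. opS m (\<phi> v) p x \<bullet> ((- 1) *\<^sub>R q x) \<partial>M) = - (\<integral>x. opS m (\<phi> v) p x \<bullet> q x \<partial>M)" by simp
    have "Q (\<phi> v) (\<lambda>x. p x - q x) = Q (\<phi> v) p - 2 * (\<integral>x. opS m (\<phi> v) p x \<bullet> q x \<partial>M) + Q (\<phi> v) q"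
      using Qadd[OF v p sqi_scaleR[OF q, of "-1"]] s Qscale[of "\<phi> v" "-1" q] by simp
    moreover have "Q (\<phi> v) (\<lambda>x. (1/2) *\<^sub>R (p x + q x)) = (1/2)\<^sup>2 * Q (\<phi> v) (\<lambda>x. p x + q x)" by (rule Qscale)
    ultimately show ?thesis using Qadd[OF v p q] by (simp add: power2_eq_square field_simps)
  qed
  obtain v where v: "v \<in> Z" "\<forall>w\<in>Z. J v \<le> J w"
  proof (rule minimizer_exists[of "c / 4" J])
    fix z w assume z: "z \<in> Z" and w: "w \<in> Z"
    let ?h = "\<lambda>x. (1/2) *\<^sub>R (z x + w x)"
    have h: "?h \<in> Z" by (rule Z_scaleR[OF Z_add[OF z w]])
    have "J ?h = (Q (\<phi> ?h) (aff F z) + Q (\<phi> ?h) (aff F w)) / 2 - Q (\<phi> ?h) (\<lambda>x. z x - w x) / 4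
        - nsq M (\<lambda>x. snd (aff G (Y ?h) x))"
      unfolding J_def aff_affine(1)[of F] Qmid[OF h sqi_aff[OF F z] sqi_aff[OF F w]] aff_affine(2)[of F] ..
    then show "J ?h \<le> (J z + J w) / 2 - c / 4 * nsq M (\<lambda>x. z x - w x)"
      using JA[OF z h] JA[OF w h] cQ[OF h Z_diff[OF z w]] by argo
  next
    fix z assume z: "z \<in> Z"
    let ?g = "\<lambda>x. 2 *\<^sub>R opS m (\<phi> z) (aff F z) x"
    have "sqi M ?g" by (intro sqi_scaleR sqi_opS[OF \<phi>m[OF z] \<phi>K[OF z]] sqi_aff F z)
    moreover have "J z + (\<integral>x. ?g x \<bullet> (w x - z x) \<partial>M) \<le> J w" if w: "w \<in> Z" for w
    proof -
      have "aff F w = (\<lambda>x. aff F z x + (w x - z x))" by (simp add: aff_def[abs_def] fun_eq_iff)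
      then have "Q (\<phi> z) (aff F w) = Q (\<phi> z) (aff F z) + 2 * (\<integral>x. opS m (\<phi> z) (aff F z) x \<bullet> (w x - z x) \<partial>M) + Q (\<phi> z) (\<lambda>x. w x - z x)"
        using Qadd[OF z sqi_aff[OF F z] Z_sqi[OF Z_diff[OF w z]]] by simp
      moreover have "0 \<le> Q (\<phi> z) (\<lambda>x. w x - z x)"
        using order_trans[OF mult_nonneg_nonneg[OF less_imp_le[OF c(1)] nsq_nonneg] cQ[OF z Z_diff[OF w z]]] .
      moreover have "(\<integral>x. ?g x \<bullet> (w x - z x) \<partial>M) = 2 * (\<integral>x. opS m (\<phi> z) (aff F z) x \<bullet> (w x - z x) \<partial>M)" by simp
      ultimately show ?thesis using JA[OF w z] unfolding J_def[of z] by linarith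
    qed
    ultimately show "\<exists>g. sqi M g \<and> (\<forall>w\<in>Z. J z + (\<integral>x. g x \<bullet> (w x - z x) \<partial>M) \<le> J w)" by blast
  qed (use c(1) in auto)
  \<comment> \<open>One-sided variation of J at its minimizer. J v \<le> J (v + s w) is compared
    with the energy at \<open>v\<close> for the \<phi> of the perturbed point; as s tends to 0, the
    perturbed \<phi> must be shown to converge.\<close>
  have half: "0 \<le> (\<integral>x. opS m (\<phi> v) (aff F v) x \<bullet> w x \<partial>M)" if w: "w \<in> Z" for w
  proof -
    define s where "s n = inverse (real (Suc n))" for n
    have s0: "0 < s n" "s n \<le> 1" for n by (auto simp: s_def field_simps)
    have sl: "s \<longlonglongrightarrow> 0" unfolding s_def[abs_def] by (rule LIMSEQ_inverse_real_of_nat)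
    define V where "V n x = v x + s n *\<^sub>R w x" for n x
    have V: "V n \<in> Z" for n unfolding V_def[abs_def] by (intro Z_add Z_scaleR v w)
    have affV: "aff F (V n) = (\<lambda>x. aff F v x + s n *\<^sub>R w x)" for n unfolding V_def[abs_def] by (rule aff_affine(3))
    let ?u = "U v" and ?w = "\<lambda>x. fst (w x)"
    have UV: "U (V n) x = ?u x + s n * ?w x" for n x unfolding U_def affV by simp
    have w6: "in6 ?w" by (rule in6_Z[OF w])
    have suw: "sqi M (\<lambda>x. ?u x * ?w x)" "sqi M (\<lambda>x. ?w x * ?w x)"
      by (intro sqi_product(1) U6 v w6)+
    obtain P where P: "P > 0" "\<And>z. z \<in> Z \<Longrightarrow> nsq M (\<lambda>x. fst (z x)) \<le> P * nsq M (\<lambda>x. snd (z x))"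
      using poincare by blast
    let ?C = "8 * nsq M (\<lambda>x. ?u x * ?w x) + 2 * nsq M (\<lambda>x. ?w x * ?w x)"
    \<comment> \<open>Lipschitz dependence of \<phi> on u. The two equations are subtracted and
      tested with the difference d; the term d^2 times the square of the perturbed u has a
      favourable sign. What remains is \<phi> times the change of u^2, which is O(s) in L^2, and the
      Poincare inequality closes the estimate.\<close>
    have conv: "nsq M (\<lambda>x. \<phi> (V n) x - \<phi> v x) \<le> (P * K)\<^sup>2 * ((s n)\<^sup>2 * ?C)" for n
    proof -
      let ?d = "\<lambda>x. Y (V n) x - Y v x" and ?q = "\<lambda>x. (U (V n) x)\<^sup>2 - (?u x)\<^sup>2"
      have d: "?d \<in> Z" by (intro Z_diff Y V v)
      have fd: "fst (?d x) = \<phi> (V n) x - \<phi> v x" for x by (simp add: \<phi>_def aff_def)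
      have q: "?q = (\<lambda>x. s n *\<^sub>R (2 *\<^sub>R (?u x * ?w x) + s n *\<^sub>R (?w x * ?w x)))"
        by (simp add: UV fun_eq_iff power2_eq_square algebra_simps)
      have sq: "sqi M ?q" unfolding q by (intro sqi_scaleR sqi_add suw)
      have nq: "nsq M ?q \<le> (s n)\<^sup>2 * ?C"
      proof -
        have "nsq M (\<lambda>x. 2 *\<^sub>R (?u x * ?w x) + s n *\<^sub>R (?w x * ?w x)) \<le>
            2 * nsq M (\<lambda>x. 2 *\<^sub>R (?u x * ?w x)) + 2 * nsq M (\<lambda>x. s n *\<^sub>R (?w x * ?w x))"
          by (rule nsq_add_le) (intro sqi_scaleR suw)+
        also have "\<dots> = 8 * nsq M (\<lambda>x. ?u x * ?w x) + 2 * ((s n)\<^sup>2 * nsq M (\<lambda>x. ?w x * ?w x))"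
          unfolding nsq_scaleR by simp
        also have "\<dots> \<le> ?C"
          using s0[of n] by (simp add: mult_left_le_one_le power_le_one)
        finally show ?thesis unfolding q nsq_scaleR by (intro mult_left_mono) auto
      qed
      note e1 = Yeq[OF V[of n] V[of n] V[of n] d] and e2 = Yeq[OF v(1) v(1) v(1) d]
      have sK: "sqi M (\<lambda>x. \<phi> v x *\<^sub>R ?q x)" by (rule sqi_bounded_scaleR[OF \<phi>m[OF v(1)] \<phi>K[OF v(1)] sq])
      have i2: "integrable M (\<lambda>x. (\<phi> v x *\<^sub>R ?q x) \<bullet> fst (?d x))" by (rule sqi_inner[OF sK Z_sqi_fst[OF d]])
      have i3: "integrable M (\<lambda>x. (\<phi> (V n) x - \<phi> v x) * (U (V n) x)\<^sup>2 * fst (?d x))"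
      proof -
        have "(\<lambda>x. (\<phi> (V n) x - \<phi> v x) * (U (V n) x)\<^sup>2 * fst (?d x))
          = (\<lambda>x. fst (aff G (Y (V n)) x) * (U (V n) x)\<^sup>2 * fst (?d x)
            - fst (aff G (Y v) x) * (?u x)\<^sup>2 * fst (?d x) - (\<phi> v x *\<^sub>R ?q x) \<bullet> fst (?d x))"
          by (simp add: \<phi>_def fun_eq_iff algebra_simps)
        then show ?thesis using e1(2) e2(2) i2 by simp
      qed
      have "nsq M (\<lambda>x. snd (?d x)) = (\<integral>x. snd (aff G (Y (V n)) x) \<bullet> snd (?d x) - snd (aff G (Y v) x) \<bullet> snd (?d x) \<partial>M)"
        unfolding nsq_eq_inner by (rule Bochner_Integration.integral_cong) (auto simp: aff_def inner_diff_left inner_diff_right inner_add_left)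
      also have "\<dots> = (\<integral>x. snd (aff G (Y (V n)) x) \<bullet> snd (?d x) \<partial>M) - (\<integral>x. snd (aff G (Y v) x) \<bullet> snd (?d x) \<partial>M)"
        by (intro Bochner_Integration.integral_diff sqi_inner sqi_snd sqi_aff G Y V v Z_sqi d)
      also have "\<dots> = (\<integral>x. fst (aff G (Y v) x) * (?u x)\<^sup>2 * fst (?d x) \<partial>M)
          - (\<integral>x. fst (aff G (Y (V n)) x) * (U (V n) x)\<^sup>2 * fst (?d x) \<partial>M)"
        unfolding e1(1) e2(1) by simp
      also have "\<dots> = (\<integral>x. fst (aff G (Y v) x) * (?u x)\<^sup>2 * fst (?d x) - fst (aff G (Y (V n)) x) * (U (V n) x)\<^sup>2 * fst (?d x) \<partial>M)"
        by (rule Bochner_Integration.integral_diff[symmetric, OF e2(2) e1(2)])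
      also have "\<dots> = (\<integral>x. - ((\<phi> (V n) x - \<phi> v x) * (U (V n) x)\<^sup>2 * fst (?d x)) - (\<phi> v x *\<^sub>R ?q x) \<bullet> fst (?d x) \<partial>M)"
        by (rule Bochner_Integration.integral_cong) (auto simp: \<phi>_def algebra_simps)
      also have "\<dots> = (\<integral>x. - ((\<phi> (V n) x - \<phi> v x) * (U (V n) x)\<^sup>2 * fst (?d x)) \<partial>M) - (\<integral>x. (\<phi> v x *\<^sub>R ?q x) \<bullet> fst (?d x) \<partial>M)"
        using i3 i2 by (intro Bochner_Integration.integral_diff) auto
      also have "\<dots> \<le> 0 + \<bar>\<integral>x. (\<phi> v x *\<^sub>R ?q x) \<bullet> fst (?d x) \<partial>M\<bar>"
      proof -
        have "0 \<le> (\<integral>x. (\<phi> (V n) x - \<phi> v x) * (U (V n) x)\<^sup>2 * fst (?d x) \<partial>M)"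
        proof (rule integral_nonneg_AE, rule AE_I2)
          fix x
          have "(\<phi> (V n) x - \<phi> v x) * (U (V n) x)\<^sup>2 * fst (?d x) = (fst (?d x) * U (V n) x)\<^sup>2"
            unfolding fd by (simp add: power2_eq_square)
          then show "0 \<le> (\<phi> (V n) x - \<phi> v x) * (U (V n) x)\<^sup>2 * fst (?d x)" by simp
        qed
        then show ?thesis unfolding Bochner_Integration.integral_minus by linarith
      qed
      also have "\<dots> \<le> sqrt (nsq M (\<lambda>x. \<phi> v x *\<^sub>R ?q x)) * sqrt (nsq M (\<lambda>x. fst (?d x)))"
        using nsq_Cauchy_Schwarz_abs[OF sK Z_sqi_fst[OF d]] by simp
      finally have le: "nsq M (\<lambda>x. snd (?d x)) \<le> sqrt (nsq M (\<lambda>x. \<phi> v x *\<^sub>R ?q x)) * sqrt (nsq M (\<lambda>x. fst (?d x)))" .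
      have nK: "nsq M (\<lambda>x. \<phi> v x *\<^sub>R ?q x) \<le> K\<^sup>2 * nsq M ?q"
      proof -
        have "nsq M (\<lambda>x. \<phi> v x *\<^sub>R ?q x) \<le> (\<integral>x. K\<^sup>2 * (norm (?q x))\<^sup>2 \<partial>M)"
          unfolding nsq_def
        proof (rule integral_mono_AE[OF sqi_integrable[OF sK]])
          show "integrable M (\<lambda>x. K\<^sup>2 * (norm (?q x))\<^sup>2)" using sqi_integrable[OF sq] by simp
          show "AE x in M. (norm (\<phi> v x *\<^sub>R ?q x))\<^sup>2 \<le> K\<^sup>2 * (norm (?q x))\<^sup>2"
            using \<phi>K[OF v(1)]
          proof eventually_elim
            case (elim x)
            then have "\<bar>\<phi> v x\<bar>\<^sup>2 \<le> K\<^sup>2" by (intro power_mono) auto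
            then show ?case unfolding norm_scaleR power_mult_distrib by (intro mult_right_mono) auto
          qed
        qed
        then show ?thesis by (simp add: nsq_def)
      qed
      let ?a = "sqrt (nsq M (\<lambda>x. fst (?d x)))"
      have "?a * ?a \<le> P * (sqrt (nsq M (\<lambda>x. \<phi> v x *\<^sub>R ?q x)) * ?a)"
        using P(2)[OF d] mult_left_mono[OF le less_imp_le[OF P(1)]] by simp
      then have "?a \<le> P * sqrt (nsq M (\<lambda>x. \<phi> v x *\<^sub>R ?q x))"
      proof (cases "?a = 0")
        case False
        then have "?a > 0" using real_sqrt_ge_zero[OF nsq_nonneg] by (simp add: less_le)
        moreover assume "?a * ?a \<le> P * (sqrt (nsq M (\<lambda>x. \<phi> v x *\<^sub>R ?q x)) * ?a)"
        ultimately show ?thesis by (simp only: mult.assoc[symmetric] mult_le_cancel_right)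
      next
        case True
        show ?thesis unfolding True using P(1) by simp
      qed
      then have "?a\<^sup>2 \<le> (P * sqrt (nsq M (\<lambda>x. \<phi> v x *\<^sub>R ?q x)))\<^sup>2" by (intro power_mono) auto
      then have "nsq M (\<lambda>x. fst (?d x)) \<le> P\<^sup>2 * nsq M (\<lambda>x. \<phi> v x *\<^sub>R ?q x)" by (simp add: power_mult_distrib)
      also have "\<dots> \<le> P\<^sup>2 * (K\<^sup>2 * ((s n)\<^sup>2 * ?C))"
        by (intro mult_left_mono order_trans[OF nK] nq) auto
      finally show ?thesis unfolding fd by (simp add: power_mult_distrib mult.assoc)
    qed
    \<comment> \<open>In J (V n) and in its lower comparison the gradient term of the same \<phi>
      cancels, so only the first and second order terms in s survive; one factor s is divided
      out.\<close>
    have ge: "0 \<le> 2 * (\<integral>x. opS m (\<phi> (V n)) (aff F v) x \<bullet> w x \<partial>M) + s n * Q (\<phi> (V n)) w" for n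
    proof -
      have "J v \<le> J (V n)" using v V by blast
      moreover have "Q (\<phi> (V n)) (aff F v) - nsq M (\<lambda>x. snd (aff G (Y (V n)) x)) \<le> J v" by (rule JA[OF v(1) V])
      moreover have "J (V n) = Q (\<phi> (V n)) (aff F v) + 2 * (\<integral>x. opS m (\<phi> (V n)) (aff F v) x \<bullet> (s n *\<^sub>R w x) \<partial>M) + (s n)\<^sup>2 * Q (\<phi> (V n)) w
          - nsq M (\<lambda>x. snd (aff G (Y (V n)) x))"
        unfolding J_def affV Qadd[OF V sqi_aff[OF F v(1)] sqi_scaleR[OF Z_sqi[OF w]]] Qscale ..
      ultimately have "0 \<le> 2 * (s n * (\<integral>x. opS m (\<phi> (V n)) (aff F v) x \<bullet> w x \<partial>M)) + (s n)\<^sup>2 * Q (\<phi> (V n)) w"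
        by simp
      also have "\<dots> = s n * (2 * (\<integral>x. opS m (\<phi> (V n)) (aff F v) x \<bullet> w x \<partial>M) + s n * Q (\<phi> (V n)) w)"
        by (simp add: power2_eq_square algebra_simps)
      finally show ?thesis using s0[of n] by (simp add: zero_le_mult_iff)
    qed
    \<comment> \<open>An upper bound independent of \<open>n\<close>, obtained by dropping the
      negative contribution of \<phi>^2; it makes the second order term vanish in the limit.\<close>
    have Qb: "Q (\<phi> (V n)) w \<le> nsq M (\<lambda>x. snd (w x)) + m\<^sup>2 * nsq M ?w" for n
    proof -
      have "Q (\<phi> (V n)) w \<le> (\<integral>x. (norm (snd (w x)))\<^sup>2 + m\<^sup>2 * (norm (?w x))\<^sup>2 \<partial>M)"
        unfolding Q_def
      proof (rule integral_mono)
        show "integrable M (\<lambda>x. opS m (\<phi> (V n)) w x \<bullet> w x)"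
          by (rule sqi_inner[OF sqi_opS[OF \<phi>m[OF V] \<phi>K[OF V] Z_sqi[OF w]] Z_sqi[OF w]])
        show "integrable M (\<lambda>x. (norm (snd (w x)))\<^sup>2 + m\<^sup>2 * (norm (?w x))\<^sup>2)"
          using sqi_integrable[OF Z_sqi_fst[OF w]] sqi_integrable[OF Z_sqi_snd[OF w]]
          by (intro Bochner_Integration.integrable_add) auto
        fix x
        have "0 \<le> (\<phi> (V n) x)\<^sup>2 * (?w x)\<^sup>2" by simp
        then show "opS m (\<phi> (V n)) w x \<bullet> w x \<le> (norm (snd (w x)))\<^sup>2 + m\<^sup>2 * (norm (?w x))\<^sup>2"
          unfolding opS_inner power2_norm_eq_inner[of "snd (w x)"] by (simp add: power2_eq_square algebra_simps)
      qed
      also have "\<dots> = nsq M (\<lambda>x. snd (w x)) + m\<^sup>2 * nsq M ?w"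
        using sqi_integrable[OF Z_sqi_fst[OF w]] sqi_integrable[OF Z_sqi_snd[OF w]] unfolding nsq_def
        by (subst Bochner_Integration.integral_add) auto
      finally show ?thesis .
    qed
    let ?I = "\<integral>x. opS m (\<phi> v) (aff F v) x \<bullet> w x \<partial>M" and ?D = "nsq M (\<lambda>x. snd (w x)) + m\<^sup>2 * nsq M ?w"
    \<comment> \<open>The difference of the squares of two functions bounded by \<open>K\<close> is
      at most 2 K times the distance of the functions, and Cauchy-Schwarz brings in the Lipschitz
      estimate.\<close>
    have dif: "(\<integral>x. opS m (\<phi> (V n)) (aff F v) x \<bullet> w x \<partial>M) \<le> ?I + 2 * K * (sqrt ((P * K)\<^sup>2 * ((s n)\<^sup>2 * ?C)) * sqrt (nsq M (\<lambda>x. ?u x * ?w x)))" for n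
    proof -
      let ?d = "\<lambda>x. \<phi> (V n) x - \<phi> v x"
      have sd: "sqi M ?d"
        unfolding \<phi>_def by (intro sqi_diff sqi_fst sqi_aff G Y V v)
      have sd': "sqi M (\<lambda>x. \<bar>?d x\<bar>)" "sqi M (\<lambda>x. \<bar>?u x * ?w x\<bar>)" using sd suw(1) by (auto simp: sqi_def)
      have i1: "integrable M (\<lambda>x. opS m (\<phi> (V n)) (aff F v) x \<bullet> w x)" "integrable M (\<lambda>x. opS m (\<phi> v) (aff F v) x \<bullet> w x)"
        by (intro sqi_inner[OF sqi_opS[OF \<phi>m \<phi>K]] sqi_aff F v V Z_sqi w)+
      have i2: "integrable M (\<lambda>x. 2 * K * (\<bar>?d x\<bar> \<bullet> \<bar>?u x * ?w x\<bar>))" using sqi_inner[OF sd'] by simp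
      have "(\<integral>x. opS m (\<phi> (V n)) (aff F v) x \<bullet> w x \<partial>M) \<le> (\<integral>x. opS m (\<phi> v) (aff F v) x \<bullet> w x + 2 * K * (\<bar>?d x\<bar> \<bullet> \<bar>?u x * ?w x\<bar>) \<partial>M)"
      proof (rule integral_mono_AE[OF i1(1) Bochner_Integration.integrable_add[OF i1(2) i2]])
        show "AE x in M. opS m (\<phi> (V n)) (aff F v) x \<bullet> w x \<le> opS m (\<phi> v) (aff F v) x \<bullet> w x + 2 * K * (\<bar>?d x\<bar> \<bullet> \<bar>?u x * ?w x\<bar>)"
          using \<phi>K[OF v(1)] \<phi>K[OF V[of n]]
        proof eventually_elim
          case (elim x)
          have "opS m (\<phi> (V n)) (aff F v) x \<bullet> w x - opS m (\<phi> v) (aff F v) x \<bullet> w x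
              = - (\<phi> (V n) x + \<phi> v x) * (?d x * (?u x * ?w x))"
            unfolding opS_inner U_def by (simp add: power2_eq_square algebra_simps)
          also have "\<dots> \<le> \<bar>\<phi> (V n) x + \<phi> v x\<bar> * \<bar>?d x * (?u x * ?w x)\<bar>"
            by (metis abs_ge_self abs_minus_cancel abs_mult)
          also have "\<dots> \<le> (2 * K) * \<bar>?d x * (?u x * ?w x)\<bar>"
            using elim by (intro mult_right_mono) auto
          also have "\<dots> = 2 * K * (\<bar>?d x\<bar> \<bullet> \<bar>?u x * ?w x\<bar>)" by (simp add: abs_mult)
          finally show ?case by linarith
        qed
      qed
      also have "\<dots> = ?I + 2 * K * (\<integral>x. \<bar>?d x\<bar> \<bullet> \<bar>?u x * ?w x\<bar> \<partial>M)"
        by (subst Bochner_Integration.integral_add[OF i1(2) i2]) (simp only: integral_mult_right_zero)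
      also have "\<dots> \<le> ?I + 2 * K * (sqrt ((P * K)\<^sup>2 * ((s n)\<^sup>2 * ?C)) * sqrt (nsq M (\<lambda>x. ?u x * ?w x)))"
      proof -
        have "(\<integral>x. \<bar>?d x\<bar> \<bullet> \<bar>?u x * ?w x\<bar> \<partial>M) \<le> sqrt (nsq M (\<lambda>x. \<bar>?d x\<bar>)) * sqrt (nsq M (\<lambda>x. \<bar>?u x * ?w x\<bar>))"
          using nsq_Cauchy_Schwarz_abs[OF sd'] by (rule order_trans[OF abs_ge_self])
        also have "\<dots> = sqrt (nsq M ?d) * sqrt (nsq M (\<lambda>x. ?u x * ?w x))" by (simp add: nsq_def)
        also have "\<dots> \<le> sqrt ((P * K)\<^sup>2 * ((s n)\<^sup>2 * ?C)) * sqrt (nsq M (\<lambda>x. ?u x * ?w x))"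
          by (intro mult_right_mono real_sqrt_le_mono conv) auto
        finally show ?thesis using K0 by (intro add_left_mono mult_left_mono) auto
      qed
      finally show ?thesis .
    qed
    have "0 \<le> 2 * (?I + 2 * K * (sqrt ((P * K)\<^sup>2 * (0\<^sup>2 * ?C)) * sqrt (nsq M (\<lambda>x. ?u x * ?w x)))) + 0 * ?D"
    proof (rule LIMSEQ_le_const)
      show "(\<lambda>n. 2 * (?I + 2 * K * (sqrt ((P * K)\<^sup>2 * ((s n)\<^sup>2 * ?C)) * sqrt (nsq M (\<lambda>x. ?u x * ?w x)))) + s n * ?D)
        \<longlonglongrightarrow> 2 * (?I + 2 * K * (sqrt ((P * K)\<^sup>2 * (0\<^sup>2 * ?C)) * sqrt (nsq M (\<lambda>x. ?u x * ?w x)))) + 0 * ?D"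
        by (intro tendsto_add tendsto_mult tendsto_const tendsto_real_sqrt tendsto_power sl)
      have "0 \<le> 2 * (?I + 2 * K * (sqrt ((P * K)\<^sup>2 * ((s n)\<^sup>2 * ?C)) * sqrt (nsq M (\<lambda>x. ?u x * ?w x)))) + s n * ?D" for n
        by (rule order_trans[OF ge[of n] add_mono[OF mult_left_mono[OF dif[of n]]
              mult_left_mono[OF Qb[of n] less_imp_le[OF s0(1)[of n]]]]]) simp
      then show "\<exists>N. \<forall>n\<ge>N. 0 \<le> 2 * (?I + 2 * K * (sqrt ((P * K)\<^sup>2 * ((s n)\<^sup>2 * ?C)) * sqrt (nsq M (\<lambda>x. ?u x * ?w x)))) + s n * ?D" by blast
    qed
    then show ?thesis by simp
  qed
  show ?thesis
  proof (rule that[OF v(1) Y(1)[OF v(1)] \<phi>K[OF v(1), unfolded \<phi>_def]])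
    fix w assume w: "w \<in> Z"
    show "(\<integral>x. opS m (\<lambda>x. fst (aff G (Y v) x)) (aff F v) x \<bullet> w x \<partial>M) = 0"
      using half[OF w] half[OF Z_scaleR[OF w, of "-1"]] by (simp add: \<phi>_def[abs_def])
    show "(\<integral>x. snd (aff G (Y v) x) \<bullet> snd (w x) \<partial>M) = - (\<integral>x. fst (aff G (Y v) x) * (fst (aff F v x))\<^sup>2 * fst (w x) \<partial>M)"
      using Yeq(1)[OF v(1) v(1) v(1) w] by (simp add: U_def)
  qed
qed

end

section \<open>Hausdorff measure\<close>

abbreviation hc :: "real \<Rightarrow> 'a::metric_space set \<Rightarrow> ennreal" where "hc \<equiv> hausdorff2_content"

definition cover_size :: "'a::metric_space set \<Rightarrow> ennreal" where
  "cover_size C = ennreal (pi / 4 * (diameter C)\<^sup>2)"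

definition covers :: "real \<Rightarrow> 'a::metric_space set \<Rightarrow> (nat \<Rightarrow> 'a set) set" where
  "covers \<delta> A = {C. A \<subseteq> (\<Union>i. C i) \<and> (\<forall>i. bounded (C i) \<and> diameter (C i) \<le> \<delta>)}"

lemma hc_eq: "hc \<delta> A = (INF C\<in>covers \<delta> A. \<Sum>i. cover_size (C i))"
  by (simp add: hausdorff2_content_def covers_def cover_size_def)

lemma cover_size_empty [simp]: "cover_size {} = 0"
  by (simp add: cover_size_def)

lemma hc_mono: "A \<subseteq> B \<Longrightarrow> hc \<delta> A \<le> hc \<delta> B"
  unfolding hc_eq by (rule INF_superset_mono) (auto simp: covers_def)

lemma hc_antimono:
  assumes "\<delta> \<le> \<delta>'" shows "hc \<delta>' A \<le> hc \<delta> A"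
proof -
  have "covers \<delta> A \<subseteq> covers \<delta>' A" using assms order_trans unfolding covers_def by blast
  then show ?thesis unfolding hc_eq by (rule INF_superset_mono) simp
qed

lemma hc_empty: assumes "\<delta> > 0" shows "hc \<delta> {} = 0"
proof -
  have "(\<lambda>_. {}) \<in> covers \<delta> {}" using assms by (simp add: covers_def)
  then have "hc \<delta> {} \<le> (\<Sum>i::nat. cover_size {})" unfolding hc_eq by (rule INF_lower2) simp
  then show ?thesis by simp
qed

text \<open>Covers of the single sets that are optimal up to e / 2^(i+1) are merged into one
  sequence through an enumeration of pairs.\<close>

lemma hc_subadditive: "hc \<delta> (\<Union>i::nat. A i) \<le> (\<Sum>i. hc \<delta> (A i))"
proof (cases "(\<Sum>i. hc \<delta> (A i)) = \<infinity>")
  case False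
  have fin: "hc \<delta> (A i) < \<infinity>" for i
  proof -
    have "hc \<delta> (A i) \<le> (\<Sum>i. hc \<delta> (A i))"
      using sum_le_suminf[of "\<lambda>i. hc \<delta> (A i)" "{i}"] by simp
    then show ?thesis using False by (simp add: less_top[symmetric] top_unique) (metis top.not_eq_extremum top_unique)
  qed
  show ?thesis
  proof (rule ennreal_le_epsilon)
    fix e :: real assume e: "e > 0"
    have "\<exists>C\<in>covers \<delta> (A i). (\<Sum>j. cover_size (C j)) \<le> hc \<delta> (A i) + ennreal (e * (1/2) ^ Suc i)" for i
    proof -
      have "0 < ennreal (e * (1/2) ^ Suc i)" using e by (simp add: ennreal_zero_less_mult_iff)
      then have "hc \<delta> (A i) < hc \<delta> (A i) + ennreal (e * (1/2) ^ Suc i)"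
        using fin[of i] ennreal_add_left_cancel_less[of "hc \<delta> (A i)" 0] by auto
      then show ?thesis unfolding hc_eq[of \<delta> "A i"] INF_less_iff by (meson less_imp_le)
    qed
    then obtain C where C: "\<And>i. C i \<in> covers \<delta> (A i)"
      "\<And>i. (\<Sum>j. cover_size (C i j)) \<le> hc \<delta> (A i) + ennreal (e * (1/2) ^ Suc i)" by metis
    define D where "D n = (case prod_decode n of (i, j) \<Rightarrow> C i j)" for n
    have "D \<in> covers \<delta> (\<Union>i. A i)"
      unfolding covers_def
    proof (intro CollectI conjI allI)
      show "(\<Union>i. A i) \<subseteq> (\<Union>n. D n)"
      proof
        fix x assume "x \<in> (\<Union>i. A i)"
        then obtain i j where "x \<in> C i j" using C(1) by (force simp: covers_def)
        then have "x \<in> D (prod_encode (i, j))" by (simp add: D_def)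
        then show "x \<in> (\<Union>n. D n)" by blast
      qed
      show "bounded (D n)" "diameter (D n) \<le> \<delta>" for n
        using C(1) by (auto simp: D_def covers_def split: prod.splits)
    qed
    then have "hc \<delta> (\<Union>i. A i) \<le> (\<Sum>n. cover_size (D n))" unfolding hc_eq by (rule INF_lower2) simp
    also have "\<dots> = (\<Sum>n. (\<lambda>p. cover_size (C (fst p) (snd p))) (prod_decode n))"
      by (simp add: D_def case_prod_beta)
    also have "\<dots> = (\<Sum>i. \<Sum>j. cover_size (C i j))"
      using suminf_ennreal_2dimen[of "\<lambda>i. \<Sum>j. cover_size (C i j)" "\<lambda>p. cover_size (C (fst p) (snd p))"]
      by (simp add: o_def)
    also have "\<dots> \<le> (\<Sum>i. hc \<delta> (A i) + ennreal (e * (1/2) ^ Suc i))"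
      by (intro suminf_le C(2)) auto
    also have "\<dots> = (\<Sum>i. hc \<delta> (A i)) + (\<Sum>i. ennreal (e * (1/2) ^ Suc i))"
      by (rule suminf_add[symmetric]) auto
    also have "(\<Sum>i. ennreal (e * (1/2) ^ Suc i)) = ennreal e"
    proof (rule suminf_ennreal_eq)
      show "(\<lambda>i. e * (1/2) ^ Suc i) sums e" using sums_mult[OF power_half_series, of e] by simp
    qed (use e in simp)
    finally show "hc \<delta> (\<Union>i. A i) \<le> (\<Sum>i. hc \<delta> (A i)) + ennreal e" .
  qed
qed simp

section \<open>The outer measure and its measurable sets\<close>

definition H2 :: "'a::metric_space set \<Rightarrow> ennreal" where
  "H2 A = (SUP \<delta>\<in>{0<..}. hc \<delta> A)"

lemma hc_le_H2: "\<delta> > 0 \<Longrightarrow> hc \<delta> A \<le> H2 A"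
  unfolding H2_def by (rule SUP_upper) simp

text \<open>Along a sequence of scales the contents increase, so sums and suprema can be
  exchanged.\<close>

lemma H2_seq: "H2 A = (SUP n. hc (inverse (real (Suc n))) A)"
proof (rule antisym)
  show "H2 A \<le> (SUP n. hc (inverse (real (Suc n))) A)"
    unfolding H2_def
  proof (rule SUP_least)
    fix \<delta> :: real assume "\<delta> \<in> {0<..}"
    then obtain n where "inverse (real (Suc n)) < \<delta>" using reals_Archimedean[of \<delta>] by auto
    then have "hc \<delta> A \<le> hc (inverse (real (Suc n))) A" by (intro hc_antimono) simp
    also have "\<dots> \<le> (SUP n. hc (inverse (real (Suc n))) A)" by (rule SUP_upper) simp
    finally show "hc \<delta> A \<le> (SUP n. hc (inverse (real (Suc n))) A)" .
  qed
  show "(SUP n. hc (inverse (real (Suc n))) A) \<le> H2 A" by (intro SUP_least hc_le_H2) simp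
qed

lemma H2_incseq: "incseq (\<lambda>n. hc (inverse (real (Suc n))) A)"
  by (rule monoI, rule hc_antimono, rule le_imp_inverse_le) auto

lemma H2_empty [simp]: "H2 {} = 0"
  unfolding H2_seq by (subst hc_empty) auto

lemma H2_mono: "A \<subseteq> B \<Longrightarrow> H2 A \<le> H2 B"
  unfolding H2_seq by (intro SUP_mono) (use hc_mono in blast)

lemma H2_subadditive: "H2 (\<Union>i::nat. A i) \<le> (\<Sum>i. H2 (A i))"
  unfolding H2_def[of "\<Union>i. A i"]
proof (rule SUP_least)
  fix \<delta> :: real assume "\<delta> \<in> {0<..}"
  have "hc \<delta> (\<Union>i. A i) \<le> (\<Sum>i. hc \<delta> (A i))" by (rule hc_subadditive)
  also have "\<dots> \<le> (\<Sum>i. H2 (A i))"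
    by (intro suminf_le hc_le_H2) (use \<open>\<delta> \<in> {0<..}\<close> in auto)
  finally show "hc \<delta> (\<Union>i. A i) \<le> (\<Sum>i. H2 (A i))" .
qed

lemma H2_subadditive2: "H2 (A \<union> B) \<le> H2 A + H2 B"
proof -
  have "H2 (A \<union> B) = H2 (\<Union>i. binaryset A B i)" by (simp add: UN_binaryset_eq)
  also have "\<dots> \<le> (\<Sum>i. H2 (binaryset A B i))" by (rule H2_subadditive)
  also have "\<dots> = H2 A + H2 B" by (simp add: suminf_binaryset_eq)
  finally show ?thesis .
qed

text \<open>A set of diameter less than \<open>d\<close> cannot meet both \<open>A\<close> and \<open>B\<close>.\<close>

lemma H2_metric:
  assumes d: "d > 0" "\<And>a b. a \<in> A \<Longrightarrow> b \<in> B \<Longrightarrow> d \<le> dist a b"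
  shows "H2 A + H2 B \<le> H2 (A \<union> B)"
proof -
  have sep: "hc \<delta> A + hc \<delta> B \<le> hc \<delta> (A \<union> B)" if "\<delta> < d" for \<delta>
    unfolding hc_eq[of \<delta> "A \<union> B"]
  proof (rule INF_greatest)
    fix C assume C: "C \<in> covers \<delta> (A \<union> B)"
    define CA where "CA i = (if C i \<inter> A \<noteq> {} then C i else {})" for i
    define CB where "CB i = (if C i \<inter> B \<noteq> {} then C i else {})" for i
    have bd: "bounded (C i)" "diameter (C i) \<le> \<delta>" for i using C by (auto simp: covers_def)
    have \<delta>0: "\<delta> \<ge> 0" using diameter_ge_0[OF bd(1)] bd(2) order_trans by blast
    have "A \<subseteq> (\<Union>i. CA i)" "B \<subseteq> (\<Union>i. CB i)"
      using C by (fastforce simp: covers_def CA_def CB_def)+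
    then have "CA \<in> covers \<delta> A" "CB \<in> covers \<delta> B"
      using bd \<delta>0 by (auto simp: covers_def CA_def CB_def)
    then have "hc \<delta> A \<le> (\<Sum>i. cover_size (CA i))" "hc \<delta> B \<le> (\<Sum>i. cover_size (CB i))"
      unfolding hc_eq by (auto intro: INF_lower)
    then have "hc \<delta> A + hc \<delta> B \<le> (\<Sum>i. cover_size (CA i)) + (\<Sum>i. cover_size (CB i))" by (rule add_mono)
    also have "\<dots> = (\<Sum>i. cover_size (CA i) + cover_size (CB i))" by (rule suminf_add) auto
    also have "\<dots> \<le> (\<Sum>i. cover_size (C i))"
    proof (rule suminf_le)
      fix i
      have "\<not> (C i \<inter> A \<noteq> {} \<and> C i \<inter> B \<noteq> {})"
      proof
        assume "C i \<inter> A \<noteq> {} \<and> C i \<inter> B \<noteq> {}"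
        then obtain a b where ab: "a \<in> C i" "a \<in> A" "b \<in> C i" "b \<in> B" by blast
        have "dist a b \<le> \<delta>" using diameter_bounded_bound[OF bd(1) ab(1,3)] bd(2) order_trans by blast
        then show False using d(2)[OF ab(2,4)] that by linarith
      qed
      then show "cover_size (CA i) + cover_size (CB i) \<le> cover_size (C i)" by (auto simp: CA_def CB_def)
    qed auto
    finally show "hc \<delta> A + hc \<delta> B \<le> (\<Sum>i. cover_size (C i))" .
  qed
  have "H2 A + H2 B = (SUP n. hc (inverse (real (Suc n))) A + hc (inverse (real (Suc n))) B)"
    unfolding H2_seq by (rule ennreal_SUP_add[symmetric, OF H2_incseq H2_incseq])
  also have "\<dots> \<le> H2 (A \<union> B)"
  proof (rule SUP_least)
    fix n
    let ?\<delta> = "min (inverse (real (Suc n))) (d/2)"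
    have p: "?\<delta> > 0" using d(1) by simp
    have "hc (inverse (real (Suc n))) A + hc (inverse (real (Suc n))) B \<le> hc ?\<delta> A + hc ?\<delta> B"
      by (intro add_mono hc_antimono) auto
    also have "\<dots> \<le> hc ?\<delta> (A \<union> B)" by (rule sep) (use d(1) in auto)
    also have "\<dots> \<le> H2 (A \<union> B)" by (rule hc_le_H2[OF p])
    finally show "hc (inverse (real (Suc n))) A + hc (inverse (real (Suc n))) B \<le> H2 (A \<union> B)" .
  qed
  finally show ?thesis .
qed

text \<open>Caratheodory's criterion for a metric outer measure. The points of A off F are split
  into layers by their distance to F. Layers of equal parity are separated by a positive distance,
  which makes the layer measures summable; the tail near F is then negligible.\<close>

lemma H2_caratheodory_closed:
  fixes F A :: "'a::metric_space set"
  assumes F: "closed F" shows "H2 (F \<inter> A) + H2 (A - F) \<le> H2 A"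
proof (cases "F = {} \<or> H2 A = \<infinity>")
  case True
  then show ?thesis by auto
next
  case False
  then have ne: "F \<noteq> {}" and fin: "H2 A \<noteq> \<infinity>" by auto
  let ?r = "\<lambda>n. inverse (real (Suc n))"
  define D where "D n = {x\<in>A. ?r n \<le> infdist x F}" for n
  define R where "R n = {x\<in>A. ?r (Suc n) \<le> infdist x F \<and> infdist x F < ?r n}" for n
  have tri: "infdist x F - infdist y F \<le> dist x y" for x y using infdist_triangle[of x F y] by linarith
  have D: "H2 (F \<inter> A) + H2 (D n) \<le> H2 A" for n
  proof -
    have "H2 (F \<inter> A) + H2 (D n) \<le> H2 ((F \<inter> A) \<union> D n)"
    proof (rule H2_metric[of "?r n"])
      fix a b assume "a \<in> F \<inter> A" "b \<in> D n"
      then show "?r n \<le> dist a b" using tri[of b a] by (simp add: D_def dist_commute)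
    qed simp
    also have "\<dots> \<le> H2 A" by (rule H2_mono) (auto simp: D_def)
    finally show ?thesis .
  qed
  have alt: "(\<Sum>k<N. H2 (R (2 * k + j))) \<le> H2 A" for N j
  proof -
    have "(\<Sum>k<N. H2 (R (2 * k + j))) \<le> H2 (\<Union>k<N. R (2 * k + j))"
    proof (induction N)
      case (Suc N)
      show ?case
      proof (cases "N = 0")
        case False
        have "(\<Sum>k<Suc N. H2 (R (2 * k + j))) \<le> H2 (\<Union>k<N. R (2 * k + j)) + H2 (R (2 * N + j))"
          using Suc by (simp add: add_right_mono)
        also have "\<dots> \<le> H2 ((\<Union>k<N. R (2 * k + j)) \<union> R (2 * N + j))"
        \<comment> \<open>Points of the earlier layers are at distance at least 1/(2N+j) from F,
          those of the new layer at distance less than 1/(2N+j+1); the difference separates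
          them.\<close>
        proof (rule H2_metric[of "?r (2 * N + j - 1) - ?r (2 * N + j)"])
          show "0 < ?r (2 * N + j - 1) - ?r (2 * N + j)"
            unfolding diff_gt_0_iff_gt by (rule less_imp_inverse_less) (use False in auto)
          fix a b assume "a \<in> (\<Union>k<N. R (2 * k + j))" and b: "b \<in> R (2 * N + j)"
          then obtain k where k: "k < N" "a \<in> R (2 * k + j)" by blast
          have "?r (2 * N + j - 1) \<le> ?r (Suc (2 * k + j))"
            using k(1) by (intro le_imp_inverse_le) auto
          also have "\<dots> \<le> infdist a F" using k(2) by (simp add: R_def)
          finally show "?r (2 * N + j - 1) - ?r (2 * N + j) \<le> dist a b"
            using tri[of a b] b by (simp add: R_def)
        qed
        also have "(\<Union>k<N. R (2 * k + j)) \<union> R (2 * N + j) = (\<Union>k<Suc N. R (2 * k + j))"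
          by (auto simp: lessThan_Suc)
        finally show ?thesis .
      qed (simp add: lessThan_Suc)
    qed simp
    also have "\<dots> \<le> H2 A" by (rule H2_mono) (auto simp: R_def)
    finally show ?thesis .
  qed
  have part: "(\<Sum>k<N. H2 (R k)) \<le> H2 A + H2 A" for N
  proof -
    have "(\<Sum>k<N. H2 (R k)) \<le> (\<Sum>k<2 * N. H2 (R k))" by (intro sum_mono2) auto
    also have "\<dots> = (\<Sum>k<N. H2 (R (2 * k))) + (\<Sum>k<N. H2 (R (2 * k + 1)))"
      by (induction N) (simp_all add: algebra_simps)
    also have "\<dots> \<le> H2 A + H2 A" using alt[of 0 N] alt[of 1 N] by (intro add_mono) auto
    finally show ?thesis .
  qed
  let ?S = "\<Sum>k. H2 (R k)"
  have S: "?S \<noteq> \<infinity>"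
  proof -
    have "?S \<le> H2 A + H2 A" by (rule suminf_le_const) (use part in auto)
    then show ?thesis using fin by (metis ennreal_add_eq_top infinity_ennreal_def top_unique)
  qed
  let ?x = "H2 (F \<inter> A) + H2 (A - F)"
  \<comment> \<open>The head of the series is added on both sides to avoid subtraction of extended
    reals; in the limit the finite sum S cancels.\<close>
  have step: "?x + (\<Sum>k<n. H2 (R k)) \<le> H2 A + ?S" for n
  proof -
    have "A - F \<subseteq> D n \<union> (\<Union>k. R (k + n))"
    proof
      fix x assume x: "x \<in> A - F"
      then have p: "infdist x F > 0" using in_closed_iff_infdist_zero[OF F ne] infdist_nonneg[of x F] by (simp add: less_le)
      show "x \<in> D n \<union> (\<Union>k. R (k + n))"
      proof (cases "?r n \<le> infdist x F")
        case False
        define j where "j = (LEAST j. ?r j \<le> infdist x F)"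
        obtain k where "?r k < infdist x F" using reals_Archimedean[OF p] by blast
        then have j: "?r j \<le> infdist x F" 
          unfolding j_def by (intro LeastI[of "\<lambda>j. ?r j \<le> infdist x F", OF less_imp_le])
        have "j > n"
        proof (rule ccontr)
          assume "\<not> j > n"
          then have "?r n \<le> ?r j" by (intro le_imp_inverse_le) auto
          then show False using j False by linarith
        qed
        then obtain i where i: "j = Suc (i + n)" using less_imp_Suc_add[of n j] by (auto simp: add.commute)
        have "\<not> ?r (i + n) \<le> infdist x F" using not_less_Least[of "i + n" "\<lambda>j. ?r j \<le> infdist x F"] i unfolding j_def by simp
        then have "x \<in> R (i + n)" using x j i by (simp add: R_def)
        then show ?thesis by blast
      qed (use x in \<open>simp add: D_def\<close>)
    qed
    then have "H2 (A - F) \<le> H2 (D n) + H2 (\<Union>k. R (k + n))"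
      using H2_mono H2_subadditive2 order_trans by blast
    also have "\<dots> \<le> H2 (D n) + (\<Sum>k. H2 (R (k + n)))" by (intro add_left_mono H2_subadditive)
    finally have "?x + (\<Sum>k<n. H2 (R k)) \<le> (H2 (F \<inter> A) + H2 (D n)) + ((\<Sum>k. H2 (R (k + n))) + (\<Sum>k<n. H2 (R k)))"
      by (simp add: add.assoc add_left_mono add_right_mono)
    also have "(\<Sum>k. H2 (R (k + n))) + (\<Sum>k<n. H2 (R k)) = ?S"
      by (rule suminf_offset[symmetric]) simp
    finally show ?thesis using D[of n] by (meson add_right_mono order_trans)
  qed
  have "(\<lambda>n. ?x + (\<Sum>k<n. H2 (R k))) \<longlonglongrightarrow> ?x + ?S"
    by (intro tendsto_add tendsto_const summable_LIMSEQ) simp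
  then have "?x + ?S \<le> H2 A + ?S"
    by (rule LIMSEQ_le_const2) (use step in auto)
  then show ?thesis using S by (simp add: ennreal_add_left_cancel_le add.commute[of _ ?S])
qed

text \<open>\<open>measure_of\<close> returns the given set function only where it is a measure, and
  the zero measure otherwise. That it is a measure on Borel sets follows because the Caratheodory
  measurable sets form a sigma-algebra containing all closed sets.\<close>

lemma emeasure_hausdorff2:
  assumes "A \<in> sets (borel :: 'a::metric_space measure)" shows "emeasure hausdorff2 A = H2 (A :: 'a set)"
proof -
  interpret P: sigma_algebra UNIV "Pow UNIV :: 'a set set" by (rule sigma_algebra_Pow)
  have o: "outer_measure_space (Pow UNIV) (H2 :: 'a set \<Rightarrow> ennreal)"
    unfolding outer_measure_space_def positive_def increasing_def countably_subadditive_def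
    by (auto intro: H2_mono H2_subadditive)
  let ?L = "lambda_system UNIV (Pow UNIV) (H2 :: 'a set \<Rightarrow> ennreal)"
  have ms: "measure_space UNIV ?L H2" by (rule P.caratheodory_lemma[OF o])
  then interpret L: sigma_algebra UNIV ?L by (simp add: measure_space_def)
  have "F \<in> ?L" if F: "closed F" for F :: "'a set"
    unfolding lambda_system_def
  proof (intro CollectI conjI ballI)
    fix x :: "'a set"
    have "H2 (F \<inter> x) + H2 ((UNIV - F) \<inter> x) \<le> H2 x"
      using H2_caratheodory_closed[OF F, of x] by (simp add: Diff_eq Int_commute)
    moreover have "H2 x \<le> H2 (F \<inter> x) + H2 ((UNIV - F) \<inter> x)"
    proof -
      have "x = (F \<inter> x) \<union> ((UNIV - F) \<inter> x)" by blast
      then show ?thesis using H2_subadditive2 by metis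
    qed
    ultimately show "H2 (F \<inter> x) + H2 ((UNIV - F) \<inter> x) = H2 x" by (rule antisym)
  qed simp
  then have "sigma_sets UNIV (Collect closed) \<subseteq> ?L" by (intro L.sigma_sets_subset) auto
  then have sub: "sets (borel :: 'a measure) \<subseteq> ?L" unfolding borel_eq_closed by simp
  have "measure_space UNIV (sets borel) (H2 :: 'a set \<Rightarrow> ennreal)"
    using measure_down[OF ms _ sub] sets.sigma_algebra_axioms[of "borel :: 'a measure"] by simp
  then have "emeasure (measure_of UNIV (sets borel) H2) A = H2 A"
    using assms by (intro emeasure_measure_of_sigma) (auto simp: measure_space_def)
  then show ?thesis unfolding hausdorff2_def H2_def[abs_def] .
qed

lemma sets_hausdorff2 [simp]: "sets (hausdorff2 :: 'a::metric_space measure) = sets borel"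
  unfolding hausdorff2_def using sets.sigma_sets_eq[of "borel :: 'a measure"] by simp

lemma space_hausdorff2 [simp]: "space (hausdorff2 :: 'a::metric_space measure) = UNIV"
  unfolding hausdorff2_def by simp

text \<open>Each covering set of diameter \<open>d \<le> T\<close> sweeps out, over a length \<open>T\<close>, a set contained in a box of
  volume \<open>(2 d)\<^sup>2 (2 d + 2 T) \<le> 16 d\<^sup>2 T\<close>.\<close>

lemma tube_emeasure_le:
  fixes A B :: "(real^3) set"
  assumes B: "B \<in> sets borel" and b: "b \<in> Basis" and s: "\<bar>s\<bar> = 1" and T: "T > 0"
    and sub: "\<And>x. x \<in> B \<Longrightarrow> \<exists>t\<in>{0..T}. x + (t * s) *\<^sub>R b \<in> A"
  shows "emeasure lborel B \<le> ennreal (64 / pi * T) * H2 A"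
proof -
  \<comment> \<open>The box volume 16 d^2 T equals 64 T / pi times the normalized size (pi/4) d^2 of
    the covering set.\<close>
  let ?k = "64 / pi * T"
  have k: "?k > 0" using T by simp
  have kk: "ennreal (1 / ?k) * ennreal ?k = 1" "ennreal ?k * ennreal (1 / ?k) = 1"
    by (subst ennreal_mult[symmetric], use T in auto)+
  have "ennreal (1 / ?k) * emeasure lborel B \<le> hc T A"
    unfolding hc_eq
  proof (rule INF_greatest)
    fix C assume C: "C \<in> covers T A"
    define a where "a i = (SOME a. a \<in> C i)" for i
    let ?d = "\<lambda>i. diameter (C i)"
    define w where "w i = ?d i *\<^sub>R One + T *\<^sub>R b" for i
    define X where "X i = (if C i = {} then {} else cbox (a i - w i) (a i + w i))" for i
    have bd: "bounded (C i)" "?d i \<le> T" "?d i \<ge> 0" for i using C diameter_ge_0 by (auto simp: covers_def)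
    have wj: "w i \<bullet> j = ?d i + (if j = b then T else 0)" if "j \<in> Basis" for i j
      using that b by (simp add: w_def inner_add_left inner_Basis)
    have w0: "0 \<le> w i \<bullet> j" if "j \<in> Basis" for i j using bd(3)[of i] T by (simp add: wj[OF that])
    have "B \<subseteq> (\<Union>i. X i)"
    proof
      fix x assume "x \<in> B"
      then obtain t where t: "t \<in> {0..T}" "x + (t * s) *\<^sub>R b \<in> A" using sub by blast
      then obtain i where i: "x + (t * s) *\<^sub>R b \<in> C i" using C by (auto simp: covers_def)
      then have ai: "a i \<in> C i" unfolding a_def by (rule someI)
      have dd: "norm (x + (t * s) *\<^sub>R b - a i) \<le> ?d i"
        using diameter_bounded_bound[OF bd(1) i ai] by (simp add: dist_norm)
      have "x \<in> cbox (a i - w i) (a i + w i)"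
        unfolding mem_box
      proof
        fix j :: "real^3" assume j: "j \<in> Basis"
        have "\<bar>(x + (t * s) *\<^sub>R b - a i) \<bullet> j\<bar> \<le> ?d i" using Basis_le_norm[OF j] dd order_trans by blast
        moreover have "\<bar>((t * s) *\<^sub>R b) \<bullet> j\<bar> \<le> (if j = b then T else 0)"
          using t(1) s b j by (simp add: inner_Basis abs_mult)
        moreover have "(x + (t * s) *\<^sub>R b - a i) \<bullet> j = x \<bullet> j + ((t * s) *\<^sub>R b) \<bullet> j - a i \<bullet> j"
          by (simp add: inner_diff_left inner_add_left)
        ultimately show "(a i - w i) \<bullet> j \<le> x \<bullet> j \<and> x \<bullet> j \<le> (a i + w i) \<bullet> j"
          unfolding inner_diff_left[of "a i"] inner_add_left[of "a i"] wj[OF j] by linarith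
      qed
      then show "x \<in> (\<Union>i. X i)" using i by (auto simp: X_def)
    qed
    then have "emeasure lborel B \<le> emeasure lborel (\<Union>i. X i)" by (rule emeasure_mono) (simp add: X_def)
    also have "\<dots> \<le> (\<Sum>i. emeasure lborel (X i))" by (rule emeasure_subadditive_countably) (auto simp: X_def)
    also have "\<dots> \<le> (\<Sum>i. ennreal ?k * cover_size (C i))"
    proof (rule suminf_le)
      fix i
      show "emeasure lborel (X i) \<le> ennreal ?k * cover_size (C i)"
      proof (cases "C i = {}")
        case False
        have "emeasure lborel (X i) = ennreal (\<Prod>j\<in>Basis. ((a i + w i) - (a i - w i)) \<bullet> j)"
          using False w0[of _ i] by (simp add: X_def emeasure_lborel_cbox inner_add_left inner_diff_left)
        also have "(\<Prod>j\<in>Basis. ((a i + w i) - (a i - w i)) \<bullet> j) = (\<Prod>j\<in>Basis. 2 * ?d i + (if j = b then 2 * T else 0))"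
        proof (rule prod.cong[OF refl])
          fix j :: "real^3" assume j: "j \<in> Basis"
          show "((a i + w i) - (a i - w i)) \<bullet> j = 2 * ?d i + (if j = b then 2 * T else 0)"
            unfolding inner_diff_left inner_add_left wj[OF j] by simp
        qed
        also have "\<dots> = (2 * ?d i + 2 * T) * (\<Prod>j\<in>Basis - {b}. 2 * ?d i + (if j = b then 2 * T else 0))"
          by (subst prod.remove[OF finite_Basis b]) simp
        also have "(\<Prod>j\<in>Basis - {b}. 2 * ?d i + (if j = b then 2 * T else 0)) = (\<Prod>j\<in>Basis - {b}. 2 * ?d i)"
          by (rule prod.cong) auto
        also have "\<dots> = (2 * ?d i)\<^sup>2" using b by (simp add: card_Diff_singleton)
        also have "(2 * ?d i + 2 * T) * (2 * ?d i)\<^sup>2 \<le> (4 * T) * (2 * ?d i)\<^sup>2"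
          using bd(2)[of i] by (intro mult_right_mono) auto
        also have "(4 * T) * (2 * ?d i)\<^sup>2 = ?k * (pi / 4 * (?d i)\<^sup>2)" by (simp add: power_mult_distrib)
        finally have "emeasure lborel (X i) \<le> ennreal (?k * (pi / 4 * (?d i)\<^sup>2))" by (simp add: ennreal_leI)
        then show ?thesis unfolding cover_size_def by (simp only: ennreal_mult'[OF less_imp_le[OF k]])
      qed (simp add: X_def)
    qed auto
    also have "\<dots> = ennreal ?k * (\<Sum>i. cover_size (C i))" by (rule ennreal_suminf_cmult)
    finally have "ennreal (1 / ?k) * emeasure lborel B \<le> ennreal (1 / ?k) * (ennreal ?k * (\<Sum>i. cover_size (C i)))"
      by (rule mult_left_mono) simp
    also have "\<dots> = (\<Sum>i. cover_size (C i))"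
      by (simp only: mult.assoc[symmetric] kk mult_1_left)
    finally show "ennreal (1 / ?k) * emeasure lborel B \<le> (\<Sum>i. cover_size (C i))" .
  qed
  also have "\<dots> \<le> H2 A" by (rule hc_le_H2[OF T])
  finally have "ennreal ?k * (ennreal (1 / ?k) * emeasure lborel B) \<le> ennreal ?k * H2 A"
    by (rule mult_left_mono) simp
  moreover have "ennreal ?k * (ennreal (1 / ?k) * emeasure lborel B) = emeasure lborel B"
    by (simp only: mult.assoc[symmetric] kk mult_1_left)
  ultimately show ?thesis by simp
qed

section \<open>Functions with zero trace\<close>

context bounded_open3
begin

text \<open>The nonzero gradient of the defining function has a nonzero component along some
  coordinate axis. Increase at a uniform rate in that direction is all that is used of the boundary;
  it replaces a representation as a graph.\<close>

lemma smooth_boundary_local: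
  assumes sb: "smooth_boundary \<Omega>" and p: "p \<in> frontier \<Omega>"
  obtains r c \<Psi> b s where "r > 0" "c > 0" "smooth_on UNIV \<Psi>" "b \<in> Basis" "\<bar>s\<bar> = (1::real)" "\<Psi> p = 0"
    "\<And>x. x \<in> cball p r \<Longrightarrow> x \<in> \<Omega> \<longleftrightarrow> \<Psi> x < 0" "\<And>x. x \<in> cball p r \<Longrightarrow> c \<le> grad \<Psi> x \<bullet> (s *\<^sub>R b)"
proof -
  obtain U \<psi> where U: "open U" "p \<in> U" "smooth_on U \<psi>" "\<forall>x\<in>U. \<exists>v. frechet_derivative \<psi> (at x) v \<noteq> 0"
    "\<Omega> \<inter> U = {x\<in>U. \<psi> x < 0}"
    using sb p unfolding smooth_boundary_def by blast
  obtain r0 \<Psi> where \<Psi>: "r0 > 0" "cball p r0 \<subseteq> U" "smooth_on UNIV \<Psi>" "\<And>x. x \<in> cball p r0 \<Longrightarrow> \<Psi> x = \<psi> x"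
    using smooth_on_extend_local[OF U(1-3)] by blast
  have sg: "x \<in> \<Omega> \<longleftrightarrow> \<Psi> x < 0" if "x \<in> cball p r0" for x
  proof -
    have xu: "x \<in> U" using that \<Psi>(2) by blast
    have "x \<in> \<Omega> \<longleftrightarrow> x \<in> {x\<in>U. \<psi> x < 0}" unfolding U(5)[symmetric] using xu by blast
    then show ?thesis using xu \<Psi>(4)[OF that] by simp
  qed
  have fd: "frechet_derivative \<Psi> (at p) = frechet_derivative \<psi> (at p)"
    by (rule frechet_derivative_cong_open[of "ball p r0"]) (use \<Psi> in auto)
  obtain v where "frechet_derivative \<psi> (at p) v \<noteq> 0" using U by blast
  then have "grad \<Psi> p \<bullet> v \<noteq> 0"
    using frechet_derivative_eqI[OF smooth_has_derivative_grad[OF \<Psi>(3)], of p v] fd by simp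
  then have "grad \<Psi> p \<noteq> 0" by auto
  then obtain b where b: "b \<in> Basis" "grad \<Psi> p \<bullet> b \<noteq> 0" using euclidean_all_zero_iff[of "grad \<Psi> p"] by blast
  define s where "s = sgn (grad \<Psi> p \<bullet> b)"
  have s: "\<bar>s\<bar> = 1" using b(2) by (simp add: s_def abs_sgn_eq)
  let ?g = "\<lambda>x. grad \<Psi> x \<bullet> (s *\<^sub>R b)"
  \<comment> \<open>Half the slope at \<open>p\<close> persists on a neighbourhood by continuity of
    the gradient.\<close>
  define c where "c = ?g p / 2"
  have gp: "?g p = \<bar>grad \<Psi> p \<bullet> b\<bar>" by (simp add: s_def abs_sgn mult.commute)
  then have c: "c > 0" using b(2) by (simp add: c_def)
  have "continuous_on UNIV ?g" by (intro continuous_intros continuous_on_grad \<Psi>(3))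
  then have "open {x. c < ?g x}" by (intro open_Collect_less continuous_on_const)
  moreover have "p \<in> {x. c < ?g x}" using c by (simp add: c_def)
  ultimately obtain d where d: "d > 0" "ball p d \<subseteq> {x. c < ?g x}" by (rule openE)
  define r where "r = min r0 (d/2)"
  have r: "r > 0" "cball p r \<subseteq> cball p r0" using \<Psi>(1) d(1) by (auto simp: r_def)
  have p0: "\<Psi> p = 0"
  proof -
    have "\<not> \<Psi> p < 0" using sg[of p] frontier_disjoint[OF p] \<Psi>(1) by simp
    moreover have "\<not> \<Psi> p > 0"
    proof
      assume "\<Psi> p > 0"
      have "open {x. 0 < \<Psi> x}"
        by (intro open_Collect_less continuous_on_const smooth_on_imp_continuous_on[OF \<Psi>(3)])
      moreover have "p \<in> {x. 0 < \<Psi> x}" using \<open>\<Psi> p > 0\<close> by simp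
      ultimately obtain e where e: "e > 0" "ball p e \<subseteq> {x. 0 < \<Psi> x}" by (rule openE)
      have "p \<in> closure \<Omega>" using p by (simp add: frontier_def)
      moreover have "min e r0 > 0" using e(1) \<Psi>(1) by simp
      ultimately obtain x where "x \<in> \<Omega>" "dist x p < min e r0" unfolding closure_approachable by blast
      moreover from this have "x \<in> ball p e" by (simp add: dist_commute)
      ultimately show False using sg[of x] e(2) by (auto simp: dist_commute)
    qed
    ultimately show ?thesis by simp
  qed
  show ?thesis
  proof (rule that[OF r(1) c \<Psi>(3) b(1) s p0])
    show "x \<in> \<Omega> \<longleftrightarrow> \<Psi> x < 0" if "x \<in> cball p r" for x using that r(2) sg by blast
    show "c \<le> ?g x" if "x \<in> cball p r" for x
    proof -
      have "x \<in> ball p d" using that d(1) by (auto simp: r_def)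
      then show ?thesis using d(2) less_imp_le by blast
    qed
  qed
qed

text \<open>The strip estimate is stated with extended real integrals over the whole space, its
  applications with real integrals over \<Omega>; this converts between the two.\<close>

lemma nn_integral_indicator_M:
  assumes f: "continuous_on UNIV f" "\<And>x. f x \<ge> 0" and A: "A \<in> sets borel" "A \<subseteq> \<Omega>"
  shows "(\<integral>\<^sup>+x. ennreal (f x) * indicator A x \<partial>lborel) = ennreal (\<integral>x. indicator A x * f x \<partial>M)"
    "integrable M (\<lambda>x. indicator A x * f x)"
proof -
  have [measurable]: "f \<in> borel_measurable M" "(indicator A :: _ \<Rightarrow> real) \<in> borel_measurable M"
    using continuous_imp_measurable_M[OF f(1)] A by (auto intro: borel_imp_measurable_M)
  obtain B where B: "B \<ge> 0" "\<And>x. x \<in> \<Omega> \<Longrightarrow> norm (f x) \<le> B" using continuous_bounded_on[OF f(1)] by blast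
  have m: "(\<lambda>x. indicator A x * f x) \<in> borel_measurable M" by measurable
  show i: "integrable M (\<lambda>x. indicator A x * f x)"
    by (rule M.integrable_const_bound[OF _ m, of B], rule AE_I2) (use B in \<open>simp add: indicator_def\<close>)
  have "ennreal (\<integral>x. indicator A x * f x \<partial>M) = (\<integral>\<^sup>+x. ennreal (indicator A x * f x) \<partial>M)"
    by (rule nn_integral_eq_integral[symmetric, OF i]) (use f(2) in auto)
  also have "\<dots> = (\<integral>\<^sup>+x. ennreal (indicator A x * f x) * indicator \<Omega> x \<partial>lebesgue)"
    by (rule nn_integral_restrict_space) simp
  also have "\<dots> = (\<integral>\<^sup>+x. ennreal (f x) * indicator A x \<partial>lebesgue)"
    by (rule nn_integral_cong) (use A(2) in \<open>auto simp: indicator_def\<close>)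
  also have "\<dots> = (\<integral>\<^sup>+x. ennreal (f x) * indicator A x \<partial>lborel)" by (rule nn_integral_completion)
  finally show "(\<integral>\<^sup>+x. ennreal (f x) * indicator A x \<partial>lborel) = ennreal (\<integral>x. indicator A x * f x \<partial>M)" by simp
qed

text \<open>Points of the strip are compared with the point where the line in direction \<open>s *\<^sub>R b\<close> through them
  leaves \<open>\<Omega>\<close>. The tube estimate says that the image of Lebesgue measure under this exit map is
  dominated by a multiple of surface measure.\<close>

lemma strip_estimate_nn:
  assumes r: "r > 0" and c: "c > 0" and \<Psi>: "smooth_on UNIV \<Psi>" and b: "b \<in> Basis" and s: "\<bar>s\<bar> = (1::real)"
    and sg: "\<And>x. x \<in> cball p r \<Longrightarrow> x \<in> \<Omega> \<longleftrightarrow> \<Psi> x < 0"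
    and gr: "\<And>x. x \<in> cball p r \<Longrightarrow> c \<le> grad \<Psi> x \<bullet> (s *\<^sub>R b)"
    and v: "smooth_on UNIV v" and e: "e > 0" "e / c \<le> r / 2"
  defines "S \<equiv> {x \<in> \<Omega> \<inter> cball p (r/2). \<Psi> x > - e}" and "S' \<equiv> {x \<in> \<Omega> \<inter> cball p r. \<Psi> x > - e}" and "T \<equiv> e / c"
  shows "(\<integral>\<^sup>+x. ennreal ((v x)\<^sup>2) * indicator S x \<partial>lborel) \<le>
    ennreal (2 * (64 / pi * T)) * (\<integral>\<^sup>+x. ennreal ((v x)\<^sup>2) \<partial>surface_measure \<Omega>)
      + ennreal (2 * T\<^sup>2) * (\<integral>\<^sup>+x. ennreal ((norm (grad v x))\<^sup>2) * indicator S' x \<partial>lborel)"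
proof -
  define h where "h = s *\<^sub>R b"
  have nh: "norm h = 1" using b s by (simp add: h_def)
  have T: "T > 0" "T \<le> r / 2" using e c by (auto simp: T_def)
  have c\<Psi>: "continuous_on UNIV \<Psi>" by (rule smooth_on_imp_continuous_on[OF \<Psi>])
  have inr: "x + t *\<^sub>R h \<in> cball p r" if "x \<in> cball p (r/2)" "0 \<le> t" "t \<le> T" for x t
  proof -
    have "dist p (x + t *\<^sub>R h) \<le> dist p x + dist x (x + t *\<^sub>R h)" by (rule dist_triangle)
    also have "dist x (x + t *\<^sub>R h) = norm (t *\<^sub>R h)" by (simp add: dist_norm)
    finally have "dist p (x + t *\<^sub>R h) \<le> dist p x + norm (t *\<^sub>R h)" .
    also have "\<dots> \<le> r / 2 + T" using that nh by (intro add_mono) auto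
    finally show ?thesis using T(2) by simp
  qed
  \<comment> \<open>Along the chosen direction \<Psi> grows at least at rate c, so a point with
    \<Psi> > -e reaches the zero set within time T = e / c.\<close>
  have mono: "\<Psi> (x + t1 *\<^sub>R h) + c * (t2 - t1) \<le> \<Psi> (x + t2 *\<^sub>R h)"
    if x: "x \<in> cball p (r/2)" and t: "0 \<le> t1" "t1 \<le> t2" "t2 \<le> T" for x t1 t2
  proof -
    have "\<Psi> (x + t1 *\<^sub>R h) - c * t1 \<le> \<Psi> (x + t2 *\<^sub>R h) - c * t2"
    proof (rule DERIV_nonneg_imp_nondecreasing[OF t(2), of "\<lambda>t. \<Psi> (x + t *\<^sub>R h) - c * t"])
      fix t assume t': "t1 \<le> t" "t \<le> t2"
      have "((\<lambda>t. \<Psi> (x + t *\<^sub>R h) - c * t) has_real_derivative (grad \<Psi> (x + t *\<^sub>R h) \<bullet> h - c)) (at t)"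
        by (auto intro!: derivative_eq_intros smooth_line_derivative[OF \<Psi>])
      moreover have "0 \<le> grad \<Psi> (x + t *\<^sub>R h) \<bullet> h - c"
        using gr[OF inr[OF x, of t]] t t' by (simp add: h_def)
      ultimately show "\<exists>y. ((\<lambda>t. \<Psi> (x + t *\<^sub>R h) - c * t) has_real_derivative y) (at t) \<and> 0 \<le> y" by blast
    qed
    then show ?thesis by (simp add: algebra_simps)
  qed
  have ex: "\<exists>t\<in>{0..T}. \<Psi> (x + t *\<^sub>R h) = 0" if x: "x \<in> S" for x
  proof -
    have x': "x \<in> cball p (r/2)" "x \<in> cball p r" "\<Psi> x > - e" "\<Psi> x < 0"
      using x sg[of x] r by (auto simp: S_def)
    have "\<Psi> (x + 0 *\<^sub>R h) \<le> 0" using x' by simp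
    moreover have "0 \<le> \<Psi> (x + T *\<^sub>R h)"
      using mono[OF x'(1), of 0 T] T x'(3) c by (simp add: T_def)
    moreover have "continuous_on {0..T} (\<lambda>t. \<Psi> (x + t *\<^sub>R h))"
      by (intro continuous_on_compose2[OF c\<Psi>] continuous_intros) auto
    ultimately obtain t where "0 \<le> t" "t \<le> T" "\<Psi> (x + t *\<^sub>R h) = 0"
      using IVT'[of "\<lambda>t. \<Psi> (x + t *\<^sub>R h)" 0 0 T] T(1) by auto
    then show ?thesis by auto
  qed
  \<comment> \<open>The exit time; 0 is a default value off the strip.\<close>
  define \<tau> where "\<tau> x = (if x \<in> S then SOME t. t \<in> {0..T} \<and> \<Psi> (x + t *\<^sub>R h) = 0 else 0)" for x
  have \<tau>: "0 \<le> \<tau> x" "\<tau> x \<le> T" "\<Psi> (x + \<tau> x *\<^sub>R h) = 0" if x: "x \<in> S" for x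
  proof -
    have "\<exists>t. t \<in> {0..T} \<and> \<Psi> (x + t *\<^sub>R h) = 0" using ex[OF x] by blast
    from someI_ex[OF this] show "0 \<le> \<tau> x" "\<tau> x \<le> T" "\<Psi> (x + \<tau> x *\<^sub>R h) = 0" using x by (auto simp: \<tau>_def)
  qed
  \<comment> \<open>Strict monotonicity turns a bound on the exit time into an open condition on
    \<open>x\<close>, which yields Borel measurability of the exit map.\<close>
  have \<tau>lt: "a < \<tau> x \<longleftrightarrow> \<Psi> (x + a *\<^sub>R h) < 0" if x: "x \<in> S" and a: "0 \<le> a" "a \<le> T" for x a
  proof
    have x': "x \<in> cball p (r/2)" using x by (simp add: S_def)
    show "\<Psi> (x + a *\<^sub>R h) < 0" if "a < \<tau> x"
      using mono[OF x' a(1) less_imp_le[OF that] \<tau>(2)[OF x]] \<tau>(3)[OF x] mult_pos_pos[OF c, of "\<tau> x - a"] that by simp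
    show "a < \<tau> x" if neg: "\<Psi> (x + a *\<^sub>R h) < 0"
    proof (rule ccontr)
      assume "\<not> a < \<tau> x"
      then have "\<tau> x \<le> a" by simp
      then have "0 \<le> c * (a - \<tau> x)" using c by simp
      with mono[OF x' \<tau>(1)[OF x] \<open>\<tau> x \<le> a\<close> a(2)] \<tau>(3)[OF x] neg show False by linarith
    qed
  qed
  have opS: "open {x. \<Psi> x > - e}" using c\<Psi> by (intro open_Collect_less) auto
  have Sm[measurable]: "S \<in> sets borel" "S' \<in> sets borel"
  proof -
    have "S = \<Omega> \<inter> cball p (r/2) \<inter> {x. \<Psi> x > - e}" "S' = \<Omega> \<inter> cball p r \<inter> {x. \<Psi> x > - e}"
      by (auto simp: S_def S'_def)
    then show "S \<in> sets borel" "S' \<in> sets borel" using opS open_\<Omega> by (auto intro!: sets.Int borel_open)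
  qed
  have \<tau>m[measurable]: "\<tau> \<in> borel_measurable borel"
    unfolding borel_measurable_iff_greater
  proof
    fix a :: real
    have "{w. a < \<tau> w} \<in> sets borel"
    proof (cases "0 \<le> a \<and> a \<le> T")
      case True
      have "{w. a < \<tau> w} = S \<inter> {w. \<Psi> (w + a *\<^sub>R h) < 0}"
      proof (intro equalityI subsetI)
        fix w assume w: "w \<in> {w. a < \<tau> w}"
        then have "w \<in> S" using True by (auto simp: \<tau>_def split: if_splits)
        then show "w \<in> S \<inter> {w. \<Psi> (w + a *\<^sub>R h) < 0}" using w \<tau>lt[of w a] True by simp
      next
        fix w assume "w \<in> S \<inter> {w. \<Psi> (w + a *\<^sub>R h) < 0}"
        then show "w \<in> {w. a < \<tau> w}" using \<tau>lt[of w a] True by simp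
      qed
      moreover have "open {w. \<Psi> (w + a *\<^sub>R h) < 0}"
        by (intro open_Collect_less continuous_on_compose2[OF c\<Psi>] continuous_intros) auto
      ultimately show ?thesis by auto
    next
      case False
      have "{w. a < \<tau> w} = UNIV \<or> {w. a < \<tau> w} = {}"
      proof (cases "a < 0")
        case True
        have "a < \<tau> w" for w using \<tau>(1)[of w] True by (cases "w \<in> S") (auto simp: \<tau>_def)
        then show ?thesis by auto
      next
        case False
        have "\<not> a < \<tau> w" for w
          using \<tau>(2)[of w] False \<open>\<not> (0 \<le> a \<and> a \<le> T)\<close> T by (cases "w \<in> S") (auto simp: \<tau>_def)
        then show ?thesis by auto
      qed
      then show ?thesis by auto
    qed
    then show "{w \<in> space borel. a < \<tau> w} \<in> sets borel" by simp
  qed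
  define y where "y x = x + \<tau> x *\<^sub>R h" for x
  have ym[measurable]: "y \<in> borel_measurable borel" unfolding y_def[abs_def] by measurable
  have yf: "y x \<in> frontier \<Omega>" if x: "x \<in> S" for x
  proof -
    have x': "x \<in> cball p (r/2)" using x by (simp add: S_def)
    have "y x \<notin> \<Omega>" using sg[OF inr[OF x' \<tau>(1,2)[OF x]]] \<tau>(3)[OF x] by (simp add: y_def)
    moreover have "y x \<in> closure \<Omega>"
      unfolding closure_approachable
    proof (intro allI impI)
      fix d :: real assume d: "d > 0"
      have x\<Omega>: "\<Psi> (x + 0 *\<^sub>R h) < 0" using x sg[of x] r by (auto simp: S_def)
      then have tp: "0 < \<tau> x" using \<tau>lt[OF x, of 0] T(1) by simp
      define t where "t = max 0 (\<tau> x - d/2)"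
      have t: "0 \<le> t" "t < \<tau> x" "\<tau> x - t < d" using tp d by (auto simp: t_def)
      have "\<Psi> (x + t *\<^sub>R h) < 0" using \<tau>lt[OF x, of t] t \<tau>(2)[OF x] by simp
      then have "x + t *\<^sub>R h \<in> \<Omega>" using sg[OF inr[OF x' t(1)]] t \<tau>(2)[OF x] by simp
      moreover have "dist (x + t *\<^sub>R h) (y x) < d"
      proof -
        have "x + t *\<^sub>R h - y x = (t - \<tau> x) *\<^sub>R h" by (simp add: y_def scaleR_left_diff_distrib)
        then show ?thesis using t nh by (simp add: dist_norm)
      qed
      ultimately show "\<exists>w\<in>\<Omega>. dist w (y x) < d" by blast
    qed
    ultimately show ?thesis using open_\<Omega> by (simp add: frontier_def interior_open)
  qed
  have vm[measurable]: "v \<in> borel_measurable borel" "grad v \<in> borel_measurable borel"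
    by (intro borel_measurable_continuous_onI smooth_on_imp_continuous_on continuous_on_grad v)+
  let ?K = "64 / pi * T"
  let ?N = "distr (restrict_space lborel S) borel y"
  let ?H = "scale_measure (ennreal ?K) (density hausdorff2 (indicator (frontier \<Omega>)))"
  have fb: "frontier \<Omega> \<in> sets borel" by (rule borel_closed) simp
  have yr: "y \<in> measurable (restrict_space lborel S) borel" by (rule measurable_restrict_space1) measurable
  \<comment> \<open>All points of the strip whose exit point lies in A reach the boundary part of A
    within time T, so the tube estimate compares the two measures set by set.\<close>
  have "?N \<le> ?H"
  proof (subst le_measure)
    show "sets ?N = sets ?H" by simp
    show "\<forall>A\<in>sets ?N. emeasure ?N A \<le> emeasure ?H A"
    proof
      fix A assume "A \<in> sets ?N"
      then have A: "A \<in> sets borel" by simp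
      have yA: "y -` A \<in> sets borel" using measurable_sets[OF ym A] by simp
      have "emeasure ?N A = emeasure lborel (S \<inter> y -` A)"
        using A Sm by (subst emeasure_distr[OF yr]) (auto simp: emeasure_restrict_space space_restrict_space Int_commute)
      also have "\<dots> \<le> ennreal ?K * H2 (A \<inter> frontier \<Omega>)"
      proof (rule tube_emeasure_le[OF _ b s T(1)])
        show "S \<inter> y -` A \<in> sets borel" using Sm yA by auto
        show "\<exists>t\<in>{0..T}. x + (t * s) *\<^sub>R b \<in> A \<inter> frontier \<Omega>" if "x \<in> S \<inter> y -` A" for x
          using that \<tau>[of x] yf[of x] by (intro bexI[of _ "\<tau> x"]) (auto simp: y_def h_def)
      qed
      also have "H2 (A \<inter> frontier \<Omega>) = emeasure (density hausdorff2 (indicator (frontier \<Omega>))) A"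
      proof -
        have "emeasure (density hausdorff2 (indicator (frontier \<Omega>))) A = (\<integral>\<^sup>+x. indicator (frontier \<Omega>) x * indicator A x \<partial>(hausdorff2 :: (real^3) measure))"
          using A fb by (intro emeasure_density borel_measurable_indicator) simp_all
        also have "\<dots> = (\<integral>\<^sup>+x. indicator (A \<inter> frontier \<Omega>) x \<partial>hausdorff2)"
          by (rule nn_integral_cong) (auto simp: indicator_def)
        also have "\<dots> = emeasure hausdorff2 (A \<inter> frontier \<Omega>)"
          by (rule nn_integral_indicator) (use A fb in simp)
        also have "\<dots> = H2 (A \<inter> frontier \<Omega>)" by (rule emeasure_hausdorff2) (use A fb in simp)
        finally show ?thesis ..
      qed
      finally show "emeasure ?N A \<le> emeasure ?H A" by simp
    qed
  qed
  then have "(\<integral>\<^sup>+x. ennreal ((v x)\<^sup>2) \<partial>?N) \<le> (\<integral>\<^sup>+x. ennreal ((v x)\<^sup>2) \<partial>?H)"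
    by (intro nn_integral_mono_measure) simp_all
  also have "\<dots> = ennreal ?K * (\<integral>\<^sup>+x. ennreal ((v x)\<^sup>2) \<partial>surface_measure \<Omega>)"
  proof -
    have vh: "(\<lambda>x. ennreal ((v x)\<^sup>2)) \<in> borel_measurable (hausdorff2 :: (real^3) measure)"
      using vm by (simp cong: measurable_cong_sets)
    have ih: "(indicator (frontier \<Omega>) :: real^3 \<Rightarrow> ennreal) \<in> borel_measurable hausdorff2"
      by (rule borel_measurable_indicator) (use fb in simp)
    have "(\<integral>\<^sup>+x. ennreal ((v x)\<^sup>2) \<partial>?H) = ennreal ?K * (\<integral>\<^sup>+x. ennreal ((v x)\<^sup>2) \<partial>density hausdorff2 (indicator (frontier \<Omega>)))"
      by (rule nn_integral_scale_measure) (use vh in simp)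
    also have "(\<integral>\<^sup>+x. ennreal ((v x)\<^sup>2) \<partial>density hausdorff2 (indicator (frontier \<Omega>))) = (\<integral>\<^sup>+x. ennreal ((v x)\<^sup>2) \<partial>surface_measure \<Omega>)"
      unfolding surface_measure_def using fb
      by (simp add: nn_integral_density[OF ih vh] nn_integral_restrict_space mult.commute)
    finally show ?thesis .
  qed
  also have "(\<integral>\<^sup>+x. ennreal ((v x)\<^sup>2) \<partial>?N) = (\<integral>\<^sup>+x. ennreal ((v (y x))\<^sup>2) * indicator S x \<partial>lborel)"
    using Sm by (subst nn_integral_distr[OF yr]) (auto simp: nn_integral_restrict_space)
  finally have first: "(\<integral>\<^sup>+x. ennreal ((v (y x))\<^sup>2) * indicator S x \<partial>lborel)
      \<le> ennreal ?K * (\<integral>\<^sup>+x. ennreal ((v x)\<^sup>2) \<partial>surface_measure \<Omega>)" .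
  let ?G = "\<lambda>x. ennreal ((norm (grad v x))\<^sup>2) * indicator S' x"
  have Gm[measurable]: "?G \<in> borel_measurable borel" by measurable
  \<comment> \<open>The value at \<open>x\<close> is compared with the value at its exit point; the
    difference is an integral of the gradient along the segment between them.\<close>
  have pt: "ennreal ((v x)\<^sup>2) * indicator S x \<le> 2 * (ennreal ((v (y x))\<^sup>2) * indicator S x)
      + 2 * (ennreal T * (\<integral>\<^sup>+t. ?G (x + t *\<^sub>R h) * indicator {0..T} t \<partial>lborel))" for x
  proof (cases "x \<in> S")
    case True
    have x': "x \<in> cball p (r/2)" "\<Psi> x > - e" using True by (auto simp: S_def)
    have "ennreal ((v (x + \<tau> x *\<^sub>R h) - v x)\<^sup>2) \<le> ennreal (\<tau> x) * (\<integral>\<^sup>+t. ennreal ((grad v (x + t *\<^sub>R h) \<bullet> h)\<^sup>2) * indicator {0..\<tau> x} t \<partial>lborel)"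
      by (rule line_estimate[OF v \<tau>(1)[OF True]])
    also have "\<dots> \<le> ennreal T * (\<integral>\<^sup>+t. ?G (x + t *\<^sub>R h) * indicator {0..T} t \<partial>lborel)"
    proof (rule mult_mono)
      show "ennreal (\<tau> x) \<le> ennreal T" using \<tau>(2)[OF True] by (rule ennreal_leI)
      show "(\<integral>\<^sup>+t. ennreal ((grad v (x + t *\<^sub>R h) \<bullet> h)\<^sup>2) * indicator {0..\<tau> x} t \<partial>lborel) \<le> (\<integral>\<^sup>+t. ?G (x + t *\<^sub>R h) * indicator {0..T} t \<partial>lborel)"
      proof (rule nn_integral_mono_AE)
        \<comment> \<open>The endpoint of the segment lies on the frontier and hence outside
          \<open>S'\<close>; it is discarded as a null set.\<close>
        have "AE t in lborel. t \<noteq> \<tau> x" by (rule AE_lborel_singleton)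
        then show "AE t in lborel. ennreal ((grad v (x + t *\<^sub>R h) \<bullet> h)\<^sup>2) * indicator {0..\<tau> x} t \<le> ?G (x + t *\<^sub>R h) * indicator {0..T} t"
        proof eventually_elim
          case (elim t)
          show ?case
          proof (cases "t \<in> {0..\<tau> x}")
            case t: True
            then have t': "0 \<le> t" "t < \<tau> x" "t \<le> T" using elim \<tau>(2)[OF True] by auto
            have "x + t *\<^sub>R h \<in> S'"
            proof -
              have "\<Psi> (x + t *\<^sub>R h) < 0" using \<tau>lt[OF True t'(1,3)] t'(2) by simp
              moreover have "\<Psi> (x + t *\<^sub>R h) > - e"
                using mono[OF x'(1) order_refl t'(1,3)] x'(2) mult_nonneg_nonneg[OF less_imp_le[OF c] t'(1)] by simp
              ultimately show ?thesis using inr[OF x'(1) t'(1,3)] sg by (simp add: S'_def)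
            qed
            moreover have "(grad v (x + t *\<^sub>R h) \<bullet> h)\<^sup>2 \<le> (norm (grad v (x + t *\<^sub>R h)))\<^sup>2"
              using power_mono[OF Cauchy_Schwarz_ineq2[of "grad v (x + t *\<^sub>R h)" h] abs_ge_zero, of 2] nh by simp
            ultimately show ?thesis using t' by (simp add: indicator_def ennreal_leI)
          qed simp
        qed
      qed
    qed auto
    finally have d: "ennreal ((v (y x) - v x)\<^sup>2) \<le> ennreal T * (\<integral>\<^sup>+t. ?G (x + t *\<^sub>R h) * indicator {0..T} t \<partial>lborel)"
      by (simp add: y_def)
    have "(v x)\<^sup>2 \<le> 2 * (v (y x))\<^sup>2 + 2 * (v (y x) - v x)\<^sup>2"
      using norm_diff_square_le[of "v (y x)" "v (y x) - v x"] by simp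
    then have "ennreal ((v x)\<^sup>2) \<le> ennreal (2 * (v (y x))\<^sup>2 + 2 * (v (y x) - v x)\<^sup>2)" by (rule ennreal_leI)
    also have "\<dots> = 2 * ennreal ((v (y x))\<^sup>2) + 2 * ennreal ((v (y x) - v x)\<^sup>2)"
      by (simp add: ennreal_plus ennreal_mult')
    also have "\<dots> \<le> 2 * ennreal ((v (y x))\<^sup>2) + 2 * (ennreal T * (\<integral>\<^sup>+t. ?G (x + t *\<^sub>R h) * indicator {0..T} t \<partial>lborel))"
      by (intro add_left_mono mult_left_mono d) simp
    finally show ?thesis using True by simp
  qed simp
  have "(\<integral>\<^sup>+x. ennreal ((v x)\<^sup>2) * indicator S x \<partial>lborel) \<le>
      (\<integral>\<^sup>+x. 2 * (ennreal ((v (y x))\<^sup>2) * indicator S x) + 2 * (ennreal T * (\<integral>\<^sup>+t. ?G (x + t *\<^sub>R h) * indicator {0..T} t \<partial>lborel)) \<partial>lborel)"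
    by (intro nn_integral_mono pt)
  also have "\<dots> = 2 * (\<integral>\<^sup>+x. ennreal ((v (y x))\<^sup>2) * indicator S x \<partial>lborel)
      + 2 * (ennreal T * (\<integral>\<^sup>+x. \<integral>\<^sup>+t. ?G (x + t *\<^sub>R h) * indicator {0..T} t \<partial>lborel \<partial>lborel))"
    by (simp add: nn_integral_add nn_integral_cmult)
  also have "(\<integral>\<^sup>+x. \<integral>\<^sup>+t. ?G (x + t *\<^sub>R h) * indicator {0..T} t \<partial>lborel \<partial>lborel)
      = (\<integral>\<^sup>+t. \<integral>\<^sup>+x. ?G (x + t *\<^sub>R h) * indicator {0..T} t \<partial>lborel \<partial>lborel)"
    by (rule lborel_pair.Fubini') measurable
  also have "\<dots> = (\<integral>\<^sup>+t. (\<integral>\<^sup>+x. ?G x \<partial>lborel) * indicator {0..T} t \<partial>lborel)"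
  proof (rule nn_integral_cong)
    fix t :: real
    have "(\<integral>\<^sup>+x. ?G (x + t *\<^sub>R h) * indicator {0..T} t \<partial>lborel) = (\<integral>\<^sup>+x. ?G (x + t *\<^sub>R h) \<partial>lborel) * indicator {0..T} t"
      by (rule nn_integral_multc) measurable
    also have "(\<integral>\<^sup>+x. ?G (x + t *\<^sub>R h) \<partial>lborel) = (\<integral>\<^sup>+x. ?G x \<partial>lborel)"
      by (rule lborel_nn_integral_translate[OF Gm])
    finally show "(\<integral>\<^sup>+x. ?G (x + t *\<^sub>R h) * indicator {0..T} t \<partial>lborel) = (\<integral>\<^sup>+x. ?G x \<partial>lborel) * indicator {0..T} t" .
  qed
  also have "\<dots> = (\<integral>\<^sup>+x. ?G x \<partial>lborel) * ennreal T"
    using T(1) by (simp add: nn_integral_cmult_indicator)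
  also have "2 * (\<integral>\<^sup>+x. ennreal ((v (y x))\<^sup>2) * indicator S x \<partial>lborel) + 2 * (ennreal T * ((\<integral>\<^sup>+x. ?G x \<partial>lborel) * ennreal T))
      \<le> 2 * (ennreal ?K * (\<integral>\<^sup>+x. ennreal ((v x)\<^sup>2) \<partial>surface_measure \<Omega>)) + 2 * (ennreal T * ((\<integral>\<^sup>+x. ?G x \<partial>lborel) * ennreal T))"
    by (intro add_right_mono mult_left_mono first) simp
  also have "2 * (ennreal ?K * (\<integral>\<^sup>+x. ennreal ((v x)\<^sup>2) \<partial>surface_measure \<Omega>)) = ennreal (2 * ?K) * (\<integral>\<^sup>+x. ennreal ((v x)\<^sup>2) \<partial>surface_measure \<Omega>)"
  proof -
    have "ennreal (2 * ?K) = 2 * ennreal ?K" using T(1) by (subst ennreal_mult') simp_all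
    then show ?thesis by (simp only: mult.assoc)
  qed
  also have "2 * (ennreal T * ((\<integral>\<^sup>+x. ?G x \<partial>lborel) * ennreal T)) = ennreal (2 * T\<^sup>2) * (\<integral>\<^sup>+x. ?G x \<partial>lborel)"
  proof -
    have "ennreal (2 * T\<^sup>2) = 2 * (ennreal T * ennreal T)" using T(1) by (simp add: ennreal_mult' power2_eq_square)
    then show ?thesis by (simp add: mult_ac)
  qed
  finally show ?thesis .
qed

section \<open>Localization of pairs and cutoffs near the boundary\<close>

lemma kappa_derivative:
  obtains B where "B \<ge> 0" "\<And>t. (\<kappa> has_real_derivative grad \<kappa> t) (at t)" "\<And>t. \<bar>grad \<kappa> t\<bar> \<le> B"
    "\<And>t. t > 1 \<Longrightarrow> grad \<kappa> t = 0"
proof -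
  have D: "(\<kappa> has_real_derivative grad \<kappa> t) (at t)" for t
    using smooth_has_derivative_grad[OF smooth_kappa UNIV_I, of t] by (simp add: has_field_derivative_def)
  have z: "grad \<kappa> t = 0" if "t \<notin> {1/2..1}" for t
  proof (cases "t < 1/2")
    case True
    then show ?thesis using grad_cong_open[of "{..<1/2}" t \<kappa> "\<lambda>_. 0"] by (simp add: kappa_eq_0)
  next
    case False
    then show ?thesis using that grad_cong_open[of "{1<..}" t \<kappa> "\<lambda>_. 1"] by (simp add: kappa_eq_1)
  qed
  obtain B where "B \<ge> 0" "\<And>t. norm (grad \<kappa> t) \<le> B"
    using continuous_compact_support_bounded[OF continuous_on_grad[OF smooth_kappa] compact_Icc z] by blast
  then show ?thesis using D z by (intro that[of B]) auto
qed

text \<open>The product rule for a cutoff applied to a pair, stated for pairs that need not come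
  from a smooth function.\<close>

definition loc :: "(real^3 \<Rightarrow> real) \<Rightarrow> (real^3 \<Rightarrow> real \<times> (real^3)) \<Rightarrow> real^3 \<Rightarrow> real \<times> (real^3)" where
  "loc \<theta> z x = (\<theta> x * fst (z x), \<theta> x *\<^sub>R snd (z x) + fst (z x) *\<^sub>R grad \<theta> x)"

lemma loc_gr: "smooth_on UNIV \<theta> \<Longrightarrow> smooth_on UNIV w \<Longrightarrow> gr (\<lambda>x. \<theta> x * w x) x = loc \<theta> (gr w) x"
  by (simp add: gr_mult loc_def)

lemma loc_diff: "loc \<theta> p x - loc \<theta> q x = loc \<theta> (\<lambda>x. p x - q x) x"
  by (simp add: loc_def algebra_simps)

lemma norm_loc_le:
  assumes "\<bar>\<theta> x\<bar> \<le> B" "norm (grad \<theta> x) \<le> B" "B \<ge> 0"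
  shows "(norm (loc \<theta> z x))\<^sup>2 \<le> 3 * B\<^sup>2 * (norm (z x))\<^sup>2"
proof -
  let ?a = "fst (z x)" and ?q = "snd (z x)"
  have "\<bar>\<theta> x\<bar>\<^sup>2 \<le> B\<^sup>2" "(norm (grad \<theta> x))\<^sup>2 \<le> B\<^sup>2" 
    by (rule power_mono[OF assms(1) abs_ge_zero], rule power_mono[OF assms(2) norm_ge_zero])
  then have 1: "\<bar>\<theta> x\<bar>\<^sup>2 * ?a\<^sup>2 \<le> B\<^sup>2 * ?a\<^sup>2" "\<bar>\<theta> x\<bar>\<^sup>2 * (norm ?q)\<^sup>2 \<le> B\<^sup>2 * (norm ?q)\<^sup>2"
      "(norm (grad \<theta> x))\<^sup>2 * ?a\<^sup>2 \<le> B\<^sup>2 * ?a\<^sup>2"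
    by (auto intro!: mult_right_mono)
  have 2: "(norm (\<theta> x *\<^sub>R ?q + ?a *\<^sub>R grad \<theta> x))\<^sup>2 \<le> 2 * (\<bar>\<theta> x\<bar>\<^sup>2 * (norm ?q)\<^sup>2) + 2 * ((norm (grad \<theta> x))\<^sup>2 * ?a\<^sup>2)"
    using norm_add_square_le[of "\<theta> x *\<^sub>R ?q" "?a *\<^sub>R grad \<theta> x"] by (simp add: power_mult_distrib mult.commute)
  have 3: "(norm (loc \<theta> z x))\<^sup>2 = \<bar>\<theta> x\<bar>\<^sup>2 * ?a\<^sup>2 + (norm (\<theta> x *\<^sub>R ?q + ?a *\<^sub>R grad \<theta> x))\<^sup>2"
    by (simp add: loc_def norm_Pair_square power_mult_distrib)
  have 4: "(norm (z x))\<^sup>2 = ?a\<^sup>2 + (norm ?q)\<^sup>2"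
    using norm_Pair_square[of ?a ?q] by simp
  have 5: "0 \<le> B\<^sup>2 * (norm ?q)\<^sup>2" by simp
  have "\<bar>\<theta> x\<bar>\<^sup>2 * ?a\<^sup>2 + (norm (\<theta> x *\<^sub>R ?q + ?a *\<^sub>R grad \<theta> x))\<^sup>2 \<le> 3 * (B\<^sup>2 * ?a\<^sup>2) + 3 * (B\<^sup>2 * (norm ?q)\<^sup>2)"
    using 1 2 5 by linarith
  then show ?thesis unfolding 3 4 by (simp add: distrib_left mult.assoc)
qed

lemma sqi_loc:
  assumes \<theta>: "smooth_on UNIV \<theta>" and z: "sqi M z" shows "sqi M (loc \<theta> z)"
    and "\<exists>C\<ge>0. \<forall>z. sqi M z \<longrightarrow> nsq M (loc \<theta> z) \<le> C * nsq M z"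
proof -
  obtain B where B: "B \<ge> 0" "\<And>x. x \<in> \<Omega> \<Longrightarrow> norm (gr \<theta> x) \<le> B"
    using continuous_bounded_on[OF continuous_on_gr[OF \<theta>]] by blast
  have b: "\<bar>\<theta> x\<bar> \<le> B" "norm (grad \<theta> x) \<le> B" if "x \<in> \<Omega>" for x
    using B(2)[OF that] norm_fst_le[of "\<theta> x" "grad \<theta> x"] norm_snd_le[of "grad \<theta> x" "\<theta> x"] by (auto simp: gr_def)
  have [measurable]: "\<theta> \<in> borel_measurable M" "grad \<theta> \<in> borel_measurable M"
    using sqi_measurable sqi_smooth[OF \<theta>] sqi_grad[OF \<theta>] by blast+
  have s: "sqi M (loc \<theta> z)" if z: "sqi M z" for z
  proof (rule sqi_bound)
    have [measurable]: "(\<lambda>x. fst (z x)) \<in> borel_measurable M" "(\<lambda>x. snd (z x)) \<in> borel_measurable M"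
      using sqi_measurable[OF sqi_fst[OF z]] sqi_measurable[OF sqi_snd[OF z]] .
    show "loc \<theta> z \<in> borel_measurable M" unfolding loc_def[abs_def] by measurable
    show "integrable M (\<lambda>x. 3 * B\<^sup>2 * (norm (z x))\<^sup>2)" using sqi_integrable[OF z] by simp
    show "AE x in M. (norm (loc \<theta> z x))\<^sup>2 \<le> 3 * B\<^sup>2 * (norm (z x))\<^sup>2"
      by (rule AE_I2) (use norm_loc_le b B(1) in simp)
  qed
  show "sqi M (loc \<theta> z)" by (rule s[OF z])
  have "nsq M (loc \<theta> z) \<le> 3 * B\<^sup>2 * nsq M z" if z: "sqi M z" for z
  proof -
    have "nsq M (loc \<theta> z) \<le> (\<integral>x. 3 * B\<^sup>2 * (norm (z x))\<^sup>2 \<partial>M)"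
      unfolding nsq_def
      by (rule integral_mono[OF sqi_integrable[OF s[OF z]]]) (use sqi_integrable[OF z] norm_loc_le b B(1) in auto)
    then show ?thesis by (simp add: nsq_def)
  qed
  then show "\<exists>C\<ge>0. \<forall>z. sqi M z \<longrightarrow> nsq M (loc \<theta> z) \<le> C * nsq M z"
    by (intro exI[of _ "3 * B\<^sup>2"]) auto
qed

lemma loc_tendsto:
  assumes \<theta>: "smooth_on UNIV \<theta>" and z: "sqi M z" and w: "\<And>k::nat. smooth_on UNIV (w k)"
    "(\<lambda>k. nsq M (\<lambda>x. gr (w k) x - z x)) \<longlonglongrightarrow> 0"
  shows "(\<lambda>k. nsq M (\<lambda>x. gr (\<lambda>x. \<theta> x * w k x) x - loc \<theta> z x)) \<longlonglongrightarrow> 0"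
proof -
  obtain C where C: "C \<ge> 0" "\<And>z. sqi M z \<Longrightarrow> nsq M (loc \<theta> z) \<le> C * nsq M z"
    using sqi_loc(2)[OF \<theta> z] by blast
  have eq: "(\<lambda>x. gr (\<lambda>x. \<theta> x * w k x) x - loc \<theta> z x) = loc \<theta> (\<lambda>x. gr (w k) x - z x)" for k
    by (simp add: fun_eq_iff loc_gr[OF \<theta> w(1)] loc_diff)
  have "(\<lambda>k. C * nsq M (\<lambda>x. gr (w k) x - z x)) \<longlonglongrightarrow> C * 0" by (intro tendsto_mult tendsto_const w)
  then have "(\<lambda>k. C * nsq M (\<lambda>x. gr (w k) x - z x)) \<longlonglongrightarrow> 0" by simp
  then show ?thesis unfolding eq
    by (rule tendsto_sandwich[OF _ _ tendsto_const, rotated 2])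
      (use C(2)[OF sqi_diff[OF sqi_gr[OF w(1)] z]] in \<open>auto intro!: always_eventually\<close>)
qed

lemma loc_interior:
  assumes \<theta>: "\<theta> \<in> test_functions \<Omega>" and z: "sqi M z" and w: "\<And>k::nat. smooth_on UNIV (w k)"
    "(\<lambda>k. nsq M (\<lambda>x. gr (w k) x - z x)) \<longlonglongrightarrow> 0"
  shows "loc \<theta> z \<in> Z"
  by (rule ZI_seq[OF sqi_loc(1)[OF test_functions_smooth[OF \<theta>] z] test_functions_mult[OF \<theta> w(1)]
        loc_tendsto[OF test_functions_smooth[OF \<theta>] z w]])

text \<open>The cutoff \<open>\<kappa> (- \<Psi> / e)\<close> vanishes near the boundary and differs from \<open>1\<close> only in the strip
  \<open>\<Psi> > - 2 e\<close>, where its gradient is \<open>O(1/e)\<close>; the strip estimate absorbs this factor.\<close>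

lemma cutoff_estimate:
  assumes r: "r > 0" and c: "c > 0" and \<Psi>: "smooth_on UNIV \<Psi>" and b: "b \<in> Basis" and s: "\<bar>s\<bar> = (1::real)"
    and sg: "\<And>x. x \<in> cball p r \<Longrightarrow> x \<in> \<Omega> \<longleftrightarrow> \<Psi> x < 0"
    and gr': "\<And>x. x \<in> cball p r \<Longrightarrow> c \<le> grad \<Psi> x \<bullet> (s *\<^sub>R b)"
  obtains L1 L2 where "L1 \<ge> 0" "L2 \<ge> 0"
    "\<And>v e i. smooth_on UNIV v \<Longrightarrow> compact (supp v) \<Longrightarrow> supp v \<subseteq> ball p (r/2) \<Longrightarrow> e > 0 \<Longrightarrow> 2 * e / c \<le> r / 2 \<Longrightarrow>
       (\<integral>\<^sup>+x. ennreal ((v x)\<^sup>2) \<partial>surface_measure \<Omega>) = ennreal i \<Longrightarrow> i \<ge> 0 \<Longrightarrow>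
       \<exists>f\<in>test_functions \<Omega>. nsq M (\<lambda>x. gr f x - gr v x) \<le>
         L1 * (\<integral>x. indicator {x \<in> \<Omega> \<inter> cball p r. \<Psi> x > - (2 * e)} x * (norm (gr v x))\<^sup>2 \<partial>M) + L2 * (i / e)"
proof -
  obtain Bk where Bk: "Bk \<ge> 0" "\<And>t. (\<kappa> has_real_derivative grad \<kappa> t) (at t)" "\<And>t. \<bar>grad \<kappa> t\<bar> \<le> Bk"
    "\<And>t. t > 1 \<Longrightarrow> grad \<kappa> t = 0" using kappa_derivative by blast
  obtain Bp where Bp: "Bp \<ge> 0" "\<And>x. x \<in> \<Omega> \<Longrightarrow> norm (grad \<Psi> x) \<le> Bp"
    using continuous_bounded_on[OF continuous_on_grad[OF \<Psi>]] by blast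
  define D where "D = Bk * Bp"
  have D0: "D \<ge> 0" using Bk(1) Bp(1) by (simp add: D_def)
  \<comment> \<open>These come from 2 W + 2 (D/e)^2 A with A \<le> (128/pi) T i + 2 T^2 W and T = 2
    e / c. The factor T^2 cancels 1/e^2 in front of the energy, while the boundary term keeps one
    1/e.\<close>
  let ?L1 = "2 + 16 * D\<^sup>2 / c\<^sup>2" and ?L2 = "512 * D\<^sup>2 / (pi * c)"
  show ?thesis
  proof (rule that[of ?L1 ?L2])
    show "?L1 \<ge> 0" by simp
    show "?L2 \<ge> 0" using c by simp
    fix v e i
    assume v: "smooth_on UNIV v" and cv: "compact (supp v)" and sv: "supp v \<subseteq> ball p (r/2)"
      and e: "e > 0" "2 * e / c \<le> r / 2" and i: "(\<integral>\<^sup>+x. ennreal ((v x)\<^sup>2) \<partial>surface_measure \<Omega>) = ennreal i" "i \<ge> 0"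
    let ?k = "\<lambda>x. \<kappa> ((- 1 / e) * \<Psi> x)"
    let ?f = "\<lambda>x. v x * ?k x"
    have sk: "smooth_on UNIV ?k" by (rule smooth_on_compose[OF _ smooth_kappa smooth_on_cmult]) (use \<Psi> in auto)
    have sf: "smooth_on UNIV ?f" by (rule smooth_on_mult[OF open_UNIV v sk])
    let ?C = "supp v \<inter> {x. \<Psi> x \<le> - e / 2}"
    have "closed {x. \<Psi> x \<le> - e / 2}"
      by (intro closed_Collect_le continuous_on_const smooth_on_imp_continuous_on[OF \<Psi>])
    then have cC: "compact ?C" by (rule compact_Int_closed[OF cv])
    have CO: "?C \<subseteq> \<Omega>"
    proof
      fix x assume x: "x \<in> ?C"
      then have "x \<in> cball p r" using sv r by auto
      moreover have "\<Psi> x < 0" using x e(1) by auto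
      ultimately show "x \<in> \<Omega>" using sg by blast
    qed
    have f: "?f \<in> test_functions \<Omega>"
    proof (rule test_functionsI[OF sf cC CO])
      fix x assume "x \<notin> ?C"
      then consider "x \<notin> supp v" | "\<Psi> x > - e / 2" by force
      then show "?f x = 0"
      proof cases
        case 2
        then have "(- 1 / e) * \<Psi> x \<le> 1/2" using e(1) by (simp add: field_simps)
        then show ?thesis by (simp add: kappa_eq_0)
      qed (simp add: not_in_supp)
    qed
    let ?S = "{x \<in> \<Omega> \<inter> cball p (r/2). \<Psi> x > - (2 * e)}" and ?S' = "{x \<in> \<Omega> \<inter> cball p r. \<Psi> x > - (2 * e)}"
    have Sm: "?S \<in> sets borel" "?S' \<in> sets borel"
    proof -
      have "open {x. \<Psi> x > - (2 * e)}"
        by (intro open_Collect_less continuous_on_const smooth_on_imp_continuous_on[OF \<Psi>])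
      moreover have "?S = \<Omega> \<inter> cball p (r/2) \<inter> {x. \<Psi> x > - (2 * e)}" "?S' = \<Omega> \<inter> cball p r \<inter> {x. \<Psi> x > - (2 * e)}"
        by auto
      ultimately show "?S \<in> sets borel" "?S' \<in> sets borel" using open_\<Omega> by (simp_all add: sets.Int borel_open)
    qed
    let ?T = "2 * e / c"
    have T: "?T > 0" using e c by simp
    define A where "A = (\<integral>x. indicator ?S x * (v x)\<^sup>2 \<partial>M)"
    define B where "B = (\<integral>x. indicator ?S' x * (norm (grad v x))\<^sup>2 \<partial>M)"
    define W where "W = (\<integral>x. indicator ?S' x * (norm (gr v x))\<^sup>2 \<partial>M)"
    have c1: "continuous_on UNIV (\<lambda>x. (v x)\<^sup>2)" "continuous_on UNIV (\<lambda>x. (norm (grad v x))\<^sup>2)" "continuous_on UNIV (\<lambda>x. (norm (gr v x))\<^sup>2)"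
      by (intro continuous_on_power continuous_on_norm continuous_on_grad continuous_on_gr smooth_on_imp_continuous_on v)+
    have sub: "?S \<subseteq> \<Omega>" "?S' \<subseteq> \<Omega>" by auto
    note iA = nn_integral_indicator_M[OF c1(1) zero_le_power2 Sm(1) sub(1)]
      and iB = nn_integral_indicator_M[OF c1(2) zero_le_power2 Sm(2) sub(2)]
      and iW = nn_integral_indicator_M[OF c1(3) zero_le_power2 Sm(2) sub(2)]
    have A0: "0 \<le> A" "0 \<le> B" unfolding A_def B_def by simp_all
    have se: "(\<integral>\<^sup>+x. ennreal ((v x)\<^sup>2) * indicator ?S x \<partial>lborel) \<le>
        ennreal (2 * (64 / pi * ?T)) * (\<integral>\<^sup>+x. ennreal ((v x)\<^sup>2) \<partial>surface_measure \<Omega>)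
          + ennreal (2 * ?T\<^sup>2) * (\<integral>\<^sup>+x. ennreal ((norm (grad v x))\<^sup>2) * indicator ?S' x \<partial>lborel)"
      by (rule strip_estimate_nn[OF r c \<Psi> b s sg gr' v _ e(2)]) (use e(1) in auto)
    have "ennreal A \<le> ennreal (2 * (64 / pi * ?T)) * ennreal i + ennreal (2 * ?T\<^sup>2) * ennreal B"
      using se unfolding A_def B_def iA(1) iB(1) i(1) .
    also have "\<dots> = ennreal (2 * (64 / pi * ?T) * i + 2 * ?T\<^sup>2 * B)"
    proof -
      have t0: "0 \<le> 2 * (64 / pi * ?T)" using T by (intro mult_nonneg_nonneg) simp_all
      have t1: "0 \<le> 2 * (64 / pi * ?T) * i" by (rule mult_nonneg_nonneg[OF t0 i(2)])
      have d0: "0 \<le> 2 * ?T\<^sup>2" by simp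
      have d1: "0 \<le> 2 * ?T\<^sup>2 * B" by (rule mult_nonneg_nonneg[OF d0 A0(2)])
      show ?thesis
        unfolding ennreal_mult[OF t0 i(2), symmetric] ennreal_mult[OF d0 A0(2), symmetric]
        by (rule ennreal_plus[OF t1 d1, symmetric])
    qed
    finally have AB: "A \<le> 2 * (64 / pi * ?T) * i + 2 * ?T\<^sup>2 * B"
    proof (subst (asm) ennreal_le_iff)
      have "0 \<le> 2 * (64 / pi * ?T) * i" using T i(2) by (intro mult_nonneg_nonneg) simp_all
      moreover have "0 \<le> 2 * ?T\<^sup>2 * B" using A0 by (intro mult_nonneg_nonneg) simp_all
      ultimately show "0 \<le> 2 * (64 / pi * ?T) * i + 2 * ?T\<^sup>2 * B" by (rule add_nonneg_nonneg)
    qed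
    have BW: "B \<le> W"
      unfolding B_def W_def
    proof (rule integral_mono[OF iB(2) iW(2)])
      show "indicator ?S' x * (norm (grad v x))\<^sup>2 \<le> indicator ?S' x * (norm (gr v x))\<^sup>2" for x
        using norm_Pair_square[of "v x" "grad v x"] by (intro mult_left_mono) (auto simp: gr_def)
    qed
    have "nsq M (\<lambda>x. gr ?f x - gr v x) \<le> (\<integral>x. 2 * (indicator ?S' x * (norm (gr v x))\<^sup>2) + 2 * (D / e)\<^sup>2 * (indicator ?S x * (v x)\<^sup>2) \<partial>M)"
      unfolding nsq_def
    proof (rule integral_mono[OF sqi_integrable[OF sqi_diff[OF sqi_gr[OF sf] sqi_gr[OF v]]]])
      show "integrable M (\<lambda>x. 2 * (indicator ?S' x * (norm (gr v x))\<^sup>2) + 2 * (D / e)\<^sup>2 * (indicator ?S x * (v x)\<^sup>2))"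
        using iA(2) iW(2) by (intro Bochner_Integration.integrable_add integrable_mult_right) auto
      fix x assume "x \<in> space M"
      then have x: "x \<in> \<Omega>" by simp
      let ?t = "(- 1 / e) * \<Psi> x"
      have gk: "grad ?k x = grad \<kappa> ?t *\<^sub>R ((- 1 / e) *\<^sub>R grad \<Psi> x)"
      proof -
        have "grad (\<lambda>x. (- 1 / e) * \<Psi> x) x = (- 1 / e) *\<^sub>R grad \<Psi> x"
          using gr_cmult[OF \<Psi>, of "- 1 / e" x] by (simp add: gr_def)
        then show ?thesis
          using grad_compose[OF Bk(2) smooth_differentiable[OF smooth_on_cmult[OF open_UNIV \<Psi>]], of "- 1 / e" x] by simp
      qed
      have gf: "gr ?f x = (v x * ?k x, v x *\<^sub>R grad ?k x + ?k x *\<^sub>R grad v x)" by (rule gr_mult[OF v sk])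
      show "(norm (gr ?f x - gr v x))\<^sup>2 \<le> 2 * (indicator ?S' x * (norm (gr v x))\<^sup>2) + 2 * (D / e)\<^sup>2 * (indicator ?S x * (v x)\<^sup>2)"
      proof (cases "x \<in> supp v")
        case False
        have "gr v x = 0" by (rule gr_eq_0[OF False])
        then have z: "v x = 0" "grad v x = 0" by (simp_all add: gr_def zero_prod_def)
        have "gr ?f x - gr v x = 0" unfolding gf unfolding gr_def z by (simp add: zero_prod_def)
        then show ?thesis by simp
      next
        case True
        then have xb: "x \<in> cball p (r/2)" "x \<in> cball p r" using sv r by auto
        show ?thesis
        proof (cases "\<Psi> x \<le> - (2 * e)")
          case True
          \<comment> \<open>At \<Psi> \<le> -2 e the argument lies beyond the point 1 where the step
            becomes constant, so the cutoff is 1 and its gradient 0.\<close>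
          then have t: "?t \<ge> 2" using e(1) by (simp add: field_simps)
          have "?k x = 1" "grad \<kappa> ?t = 0" using t by (auto intro: kappa_eq_1 Bk(4))
          then have "gr ?f x - gr v x = 0" unfolding gf gk unfolding gr_def by (simp add: zero_prod_def)
          then show ?thesis by simp
        next
          case False
          then have S: "x \<in> ?S" "x \<in> ?S'" using x xb by auto
          have k: "\<bar>?k x - 1\<bar> \<le> 1" using kappa_nonneg[of ?t] kappa_le_1[of ?t] by linarith
          have d: "gr ?f x - gr v x = ((?k x - 1) * v x, (?k x - 1) *\<^sub>R grad v x + v x *\<^sub>R grad ?k x)"
            unfolding gf unfolding gr_def by (simp add: algebra_simps)
          have "norm (grad ?k x) \<le> D / e"
          proof -
            have "norm (grad ?k x) = \<bar>grad \<kappa> ?t\<bar> * norm (grad \<Psi> x) / e"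
              unfolding gk using e(1) by (simp add: abs_mult)
            also have "\<dots> \<le> Bk * Bp / e" using Bk Bp(1) Bp(2)[OF x] e(1) by (intro divide_right_mono mult_mono) auto
            finally show ?thesis by (simp add: D_def)
          qed
          then have gk2: "(norm (grad ?k x))\<^sup>2 \<le> (D / e)\<^sup>2" by (intro power_mono) auto
          have k2: "(?k x - 1)\<^sup>2 \<le> 1" using k by (simp add: abs_square_le_1)
          have "(norm (gr ?f x - gr v x))\<^sup>2 = (?k x - 1)\<^sup>2 * (v x)\<^sup>2 + (norm ((?k x - 1) *\<^sub>R grad v x + v x *\<^sub>R grad ?k x))\<^sup>2"
            unfolding d norm_Pair_square by (simp add: power_mult_distrib)
          also have "\<dots> \<le> 1 * (v x)\<^sup>2 + (2 * (1 * (norm (grad v x))\<^sup>2) + 2 * ((v x)\<^sup>2 * (D / e)\<^sup>2))"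
          proof (rule add_mono)
            show "(?k x - 1)\<^sup>2 * (v x)\<^sup>2 \<le> 1 * (v x)\<^sup>2" by (intro mult_right_mono k2) simp
            have "(norm ((?k x - 1) *\<^sub>R grad v x + v x *\<^sub>R grad ?k x))\<^sup>2
                \<le> 2 * ((?k x - 1)\<^sup>2 * (norm (grad v x))\<^sup>2) + 2 * ((v x)\<^sup>2 * (norm (grad ?k x))\<^sup>2)"
              using norm_add_square_le[of "(?k x - 1) *\<^sub>R grad v x" "v x *\<^sub>R grad ?k x"] by (simp add: power_mult_distrib)
            also have "\<dots> \<le> 2 * (1 * (norm (grad v x))\<^sup>2) + 2 * ((v x)\<^sup>2 * (D / e)\<^sup>2)"
              by (intro add_mono mult_left_mono mult_right_mono k2 gk2) auto
            finally show "(norm ((?k x - 1) *\<^sub>R grad v x + v x *\<^sub>R grad ?k x))\<^sup>2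
                \<le> 2 * (1 * (norm (grad v x))\<^sup>2) + 2 * ((v x)\<^sup>2 * (D / e)\<^sup>2)" .
          qed
          also have "\<dots> \<le> 2 * (norm (gr v x))\<^sup>2 + 2 * (D / e)\<^sup>2 * (v x)\<^sup>2"
            using norm_Pair_square[of "v x" "grad v x"] by (simp add: gr_def mult.commute)
          finally show ?thesis using S by simp
        qed
      qed
    qed
    also have "\<dots> = 2 * W + 2 * (D / e)\<^sup>2 * A"
      unfolding A_def W_def using iA(2) iW(2)
      by (subst Bochner_Integration.integral_add) auto
    also have "\<dots> \<le> 2 * W + 2 * (D / e)\<^sup>2 * (2 * (64 / pi * ?T) * i + 2 * ?T\<^sup>2 * W)"
    proof (intro add_left_mono mult_left_mono)
      have "2 * ?T\<^sup>2 * B \<le> 2 * ?T\<^sup>2 * W" by (intro mult_left_mono BW) auto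
      with AB show "A \<le> 2 * (64 / pi * ?T) * i + 2 * ?T\<^sup>2 * W" by linarith
    qed simp
    also have "\<dots> = ?L1 * W + ?L2 * (i / e)"
      using e(1) c by (simp add: field_simps power2_eq_square)
    finally show "\<exists>f\<in>test_functions \<Omega>. nsq M (\<lambda>x. gr f x - gr v x) \<le> ?L1 * (\<integral>x. indicator ?S' x * (norm (gr v x))\<^sup>2 \<partial>M) + ?L2 * (i / e)"
      using f unfolding W_def by blast
  qed
qed

text \<open>Smooth functions approximating the localized pair are cut off near the boundary. The
  cost is their energy in a thin strip plus their boundary integral divided by the width; the first
  is small for thin strips, the second tends to 0 for each fixed width.\<close>

lemma loc_boundary:
  assumes sb: "smooth_boundary \<Omega>" and p: "p \<in> frontier \<Omega>"
    and z: "sqi M z" and w: "\<And>k::nat. smooth_on UNIV (w k)" "(\<lambda>k. nsq M (\<lambda>x. gr (w k) x - z x)) \<longlonglongrightarrow> 0"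
    and tr: "(\<lambda>k. \<integral>\<^sup>+x. ennreal ((w k x)\<^sup>2) \<partial>surface_measure \<Omega>) \<longlonglongrightarrow> 0"
  shows "\<exists>U. open U \<and> p \<in> U \<and> (\<forall>\<theta>. smooth_on UNIV \<theta> \<and> compact (supp \<theta>) \<and> supp \<theta> \<subseteq> U \<longrightarrow> loc \<theta> z \<in> Z)"
proof -
  obtain r c \<Psi> b s where l: "r > 0" "c > 0" "smooth_on UNIV \<Psi>" "b \<in> Basis" "\<bar>s\<bar> = (1::real)" "\<Psi> p = 0"
    "\<And>x. x \<in> cball p r \<Longrightarrow> x \<in> \<Omega> \<longleftrightarrow> \<Psi> x < 0" "\<And>x. x \<in> cball p r \<Longrightarrow> c \<le> grad \<Psi> x \<bullet> (s *\<^sub>R b)"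
    using smooth_boundary_local[OF sb p] by blast
  obtain L1 L2 where L: "L1 \<ge> 0" "L2 \<ge> 0"
    "\<And>v e i. smooth_on UNIV v \<Longrightarrow> compact (supp v) \<Longrightarrow> supp v \<subseteq> ball p (r/2) \<Longrightarrow> e > 0 \<Longrightarrow> 2 * e / c \<le> r / 2 \<Longrightarrow>
       (\<integral>\<^sup>+x. ennreal ((v x)\<^sup>2) \<partial>surface_measure \<Omega>) = ennreal i \<Longrightarrow> i \<ge> 0 \<Longrightarrow>
       \<exists>f\<in>test_functions \<Omega>. nsq M (\<lambda>x. gr f x - gr v x) \<le>
         L1 * (\<integral>x. indicator {x \<in> \<Omega> \<inter> cball p r. \<Psi> x > - (2 * e)} x * (norm (gr v x))\<^sup>2 \<partial>M) + L2 * (i / e)"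
    using cutoff_estimate[OF l(1-5,7,8)] by blast
  have main: "loc \<theta> z \<in> Z" if \<theta>: "smooth_on UNIV \<theta>" "compact (supp \<theta>)" "supp \<theta> \<subseteq> ball p (r/2)" for \<theta>
  proof -
    let ?\<zeta> = "loc \<theta> z"
    have s\<zeta>: "sqi M ?\<zeta>" by (rule sqi_loc(1)[OF \<theta>(1) z])
    define v where "v k x = \<theta> x * w k x" for k x
    have v: "smooth_on UNIV (v k)" for k unfolding v_def[abs_def] by (rule smooth_on_mult[OF open_UNIV \<theta>(1) w(1)])
    have sv: "supp (v k) \<subseteq> supp \<theta>" for k by (rule supp_subset) (auto simp: v_def not_in_supp)
    have cv: "compact (supp (v k))" for k
      using compact_Int_closed[OF \<theta>(2) closed_supp[of "v k"]] sv[of k] by (simp add: Int_absorb1)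
    have sv': "supp (v k) \<subseteq> ball p (r/2)" for k using sv \<theta>(3) by blast
    let ?\<delta> = "\<lambda>k. nsq M (\<lambda>x. gr (v k) x - ?\<zeta> x)"
    have \<delta>: "?\<delta> \<longlonglongrightarrow> 0" unfolding v_def[abs_def] by (rule loc_tendsto[OF \<theta>(1) z w])
    define I where "I k = (\<integral>\<^sup>+x. ennreal ((v k x)\<^sup>2) \<partial>surface_measure \<Omega>)" for k
    obtain B where B: "B \<ge> 0" "\<And>x. norm (\<theta> x) \<le> B"
      using continuous_compact_support_bounded[of \<theta> "supp \<theta>", OF smooth_on_imp_continuous_on[OF \<theta>(1)] \<theta>(2) not_in_supp[of _ \<theta>]] by blast
    have Ile: "I k \<le> ennreal (B\<^sup>2) * (\<integral>\<^sup>+x. ennreal ((w k x)\<^sup>2) \<partial>surface_measure \<Omega>)" for k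
    proof -
      have "w k \<in> borel_measurable borel"
        by (intro borel_measurable_continuous_onI smooth_on_imp_continuous_on w)
      then have wm: "w k \<in> borel_measurable hausdorff2" by (simp cong: measurable_cong_sets)
      have wm: "w k \<in> borel_measurable (surface_measure \<Omega>)"
        unfolding surface_measure_def by (rule measurable_restrict_space1[OF wm])
      have "I k \<le> (\<integral>\<^sup>+x. ennreal (B\<^sup>2) * ennreal ((w k x)\<^sup>2) \<partial>surface_measure \<Omega>)"
        unfolding I_def
      proof (rule nn_integral_mono)
        fix x
        have "\<bar>\<theta> x\<bar>\<^sup>2 \<le> B\<^sup>2" using B(2)[of x] by (intro power_mono) auto
        then have "(v k x)\<^sup>2 \<le> B\<^sup>2 * (w k x)\<^sup>2" by (simp add: v_def power_mult_distrib mult_right_mono)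
        then show "ennreal ((v k x)\<^sup>2) \<le> ennreal (B\<^sup>2) * ennreal ((w k x)\<^sup>2)"
          by (simp add: ennreal_mult[symmetric] ennreal_leI)
      qed
      also have "\<dots> = ennreal (B\<^sup>2) * (\<integral>\<^sup>+x. ennreal ((w k x)\<^sup>2) \<partial>surface_measure \<Omega>)"
        by (rule nn_integral_cmult) (use wm in measurable)
      finally show ?thesis .
    qed
    have I0: "I \<longlonglongrightarrow> 0"
    proof (rule tendsto_sandwich[OF _ _ tendsto_const])
      have "(\<lambda>k. ennreal (B\<^sup>2) * (\<integral>\<^sup>+x. ennreal ((w k x)\<^sup>2) \<partial>surface_measure \<Omega>)) \<longlonglongrightarrow> ennreal (B\<^sup>2) * 0"
        by (intro tendsto_mult_ennreal tendsto_const tr) auto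
      then show "(\<lambda>k. ennreal (B\<^sup>2) * (\<integral>\<^sup>+x. ennreal ((w k x)\<^sup>2) \<partial>surface_measure \<Omega>)) \<longlonglongrightarrow> 0" by simp
    qed (use Ile in \<open>auto intro!: always_eventually\<close>)
    define i where "i k = enn2real (I k)" for k
    have i0: "i \<longlonglongrightarrow> 0"
      unfolding i_def[abs_def] by (rule tendsto_enn2real) (use I0 in auto)
    have "\<forall>\<^sub>F k in sequentially. I k < 1" by (rule order_tendstoD(2)[OF I0]) simp
    then have Ii: "\<forall>\<^sub>F k in sequentially. I k = ennreal (i k)"
      by eventually_elim (auto simp: i_def less_top intro!: ennreal_enn2real[symmetric] dest: order_less_trans[OF _ ennreal_one_less_top])
    let ?S = "\<lambda>e. {x \<in> \<Omega> \<inter> cball p r. \<Psi> x > - (2 * e)}"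
    have Sm: "?S e \<in> sets borel" for e
    proof -
      have "open {x. \<Psi> x > - (2 * e)}"
        by (intro open_Collect_less continuous_on_const smooth_on_imp_continuous_on[OF l(3)])
      moreover have "?S e = \<Omega> \<inter> cball p r \<inter> {x. \<Psi> x > - (2 * e)}" by auto
      ultimately show ?thesis using open_\<Omega> by (simp add: sets.Int borel_open)
    qed
    have im: "(indicator (?S e) :: _ \<Rightarrow> real) \<in> borel_measurable M" for e
      by (rule borel_imp_measurable_M) (use Sm in simp)
    have ii: "integrable M (\<lambda>x. indicator (?S e) x * (norm (q x))\<^sup>2)" if q: "sqi M q" for e and q :: "_ \<Rightarrow> real \<times> (real^3)"
    proof (rule Bochner_Integration.integrable_bound[OF sqi_integrable[OF q]])
      show "(\<lambda>x. indicator (?S e) x * (norm (q x))\<^sup>2) \<in> borel_measurable M"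
        by (rule borel_measurable_times[OF im borel_measurable_power[OF measurable_compose[OF sqi_measurable[OF q] borel_measurable_norm]]])
    qed (auto simp: indicator_def)
    let ?Y = "\<lambda>e. \<integral>x. indicator (?S e) x * (norm (?\<zeta> x))\<^sup>2 \<partial>M"
    define e0 where "e0 = c * r / 4"
    have e0: "e0 > 0" "2 * e0 / c \<le> r / 2" using l(1,2) by (auto simp: e0_def)
    let ?e = "\<lambda>n. e0 * inverse (real (Suc n))"
    have en: "?e n > 0" "2 * ?e n / c \<le> r / 2" for n
    proof -
      show "?e n > 0" using e0 by simp
      have "?e n \<le> e0 * 1" using e0 by (intro mult_left_mono) (auto simp: field_simps)
      then have "2 * ?e n / c \<le> 2 * e0 / c" using l(2) by (intro divide_right_mono) auto
      then show "2 * ?e n / c \<le> r / 2" using e0(2) by linarith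
    qed
    \<comment> \<open>Every point of \<Omega> in the ball has \<Psi> < 0 and so leaves the strips
      eventually: the strips shrink to the empty set.\<close>
    have "(\<lambda>n. ?Y (?e n)) \<longlonglongrightarrow> (\<integral>x. 0 \<partial>M)"
    proof (rule integral_dominated_convergence[where w="\<lambda>x. (norm (?\<zeta> x))\<^sup>2"])
      show "(\<lambda>x. indicator (?S (?e n)) x * (norm (?\<zeta> x))\<^sup>2) \<in> borel_measurable M" for n
        using ii[OF s\<zeta>] by (rule borel_measurable_integrable)
      show "AE x in M. norm (indicator (?S (?e n)) x * (norm (?\<zeta> x))\<^sup>2) \<le> (norm (?\<zeta> x))\<^sup>2" for n
        by (auto simp: indicator_def)
      show "AE x in M. (\<lambda>n. indicator (?S (?e n)) x * (norm (?\<zeta> x))\<^sup>2) \<longlonglongrightarrow> 0"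
      proof (rule AE_I2)
        fix x assume "x \<in> space M"
        then have x: "x \<in> \<Omega>" by simp
        have "\<forall>\<^sub>F n in sequentially. indicator (?S (?e n)) x * (norm (?\<zeta> x))\<^sup>2 = 0"
        proof (cases "x \<in> cball p r")
          case True
          then have neg: "- \<Psi> x / 2 > 0" using l(7) x by simp
          have "(\<lambda>n. e0 * inverse (real (Suc n))) \<longlonglongrightarrow> e0 * 0"
            by (intro tendsto_mult tendsto_const LIMSEQ_inverse_real_of_nat)
          then have "\<forall>\<^sub>F n in sequentially. ?e n < - \<Psi> x / 2" using neg by (intro order_tendstoD(2)) auto
          then show ?thesis by eventually_elim (auto simp: indicator_def)
        qed (auto simp: indicator_def)
        then show "(\<lambda>n. indicator (?S (?e n)) x * (norm (?\<zeta> x))\<^sup>2) \<longlonglongrightarrow> 0" by (rule tendsto_eventually)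
      qed
    qed (use sqi_integrable[OF s\<zeta>] in auto)
    then have Y0: "(\<lambda>n. ?Y (?e n)) \<longlonglongrightarrow> 0" by simp
    show "loc \<theta> z \<in> Z"
      unfolding Z_def
    proof (intro CollectI conjI s\<zeta> allI impI)
      \<comment> \<open>The order of choices matters: the width is fixed by the energy of the limit,
        and only then is the index taken large, because the boundary term carries the inverse
        width.\<close>
      fix t :: real assume t: "t > 0"
      have "(\<lambda>n. 4 * L1 * ?Y (?e n)) \<longlonglongrightarrow> 4 * L1 * 0" by (intro tendsto_mult tendsto_const Y0)
      then have "\<forall>\<^sub>F n in sequentially. 4 * L1 * ?Y (?e n) < t / 2" using t by (intro order_tendstoD(2)) auto
      then obtain n where n: "4 * L1 * ?Y (?e n) < t / 2" by (auto simp: eventually_sequentially)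
      let ?E = "?e n"
      have "(\<lambda>k. (4 * L1 + 2) * ?\<delta> k + 2 * (L2 * (i k / ?E))) \<longlonglongrightarrow> (4 * L1 + 2) * 0 + 2 * (L2 * (0 / ?E))"
        by (intro tendsto_add tendsto_mult tendsto_divide tendsto_const \<delta> i0) (use e0(1) in simp)
      then have "\<forall>\<^sub>F k in sequentially. (4 * L1 + 2) * ?\<delta> k + 2 * (L2 * (i k / ?E)) < t / 2"
        using t by (intro order_tendstoD(2)) auto
      with Ii have "\<forall>\<^sub>F k in sequentially. I k = ennreal (i k) \<and> (4 * L1 + 2) * ?\<delta> k + 2 * (L2 * (i k / ?E)) < t / 2"
        by (rule eventually_conj)
      then obtain k where k: "I k = ennreal (i k)" "(4 * L1 + 2) * ?\<delta> k + 2 * (L2 * (i k / ?E)) < t / 2"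
        by (auto simp: eventually_sequentially)
      have "i k \<ge> 0" by (simp add: i_def)
      from L(3)[OF v[of k] cv sv' en k(1)[unfolded I_def] this] obtain f where f: "f \<in> test_functions \<Omega>"
        "nsq M (\<lambda>x. gr f x - gr (v k) x) \<le> L1 * (\<integral>x. indicator (?S ?E) x * (norm (gr (v k) x))\<^sup>2 \<partial>M) + L2 * (i k / ?E)"
        by blast
      let ?W = "\<integral>x. indicator (?S ?E) x * (norm (gr (v k) x))\<^sup>2 \<partial>M"
      have sgv: "sqi M (gr (v k))" by (rule sqi_gr[OF v])
      have "?W \<le> (\<integral>x. 2 * (indicator (?S ?E) x * (norm (?\<zeta> x))\<^sup>2) + 2 * (norm (gr (v k) x - ?\<zeta> x))\<^sup>2 \<partial>M)"
      proof (rule integral_mono[OF ii[OF sgv]])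
        show "integrable M (\<lambda>x. 2 * (indicator (?S ?E) x * (norm (?\<zeta> x))\<^sup>2) + 2 * (norm (gr (v k) x - ?\<zeta> x))\<^sup>2)"
          using ii[OF s\<zeta>] sqi_integrable[OF sqi_diff[OF sgv s\<zeta>]] by (intro Bochner_Integration.integrable_add integrable_mult_right) auto
        show "indicator (?S ?E) x * (norm (gr (v k) x))\<^sup>2 \<le> 2 * (indicator (?S ?E) x * (norm (?\<zeta> x))\<^sup>2) + 2 * (norm (gr (v k) x - ?\<zeta> x))\<^sup>2" for x
          using norm_add_square_le[of "?\<zeta> x" "gr (v k) x - ?\<zeta> x"] by (simp add: indicator_def)
      qed
      also have "\<dots> = 2 * ?Y ?E + 2 * ?\<delta> k"
        using ii[OF s\<zeta>] sqi_integrable[OF sqi_diff[OF sgv s\<zeta>]] unfolding nsq_def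
        by (subst Bochner_Integration.integral_add) auto
      finally have W: "?W \<le> 2 * ?Y ?E + 2 * ?\<delta> k" .
      have "nsq M (\<lambda>x. gr f x - ?\<zeta> x) \<le> 2 * nsq M (\<lambda>x. gr f x - gr (v k) x) + 2 * ?\<delta> k"
        by (rule nsq_triangle_le[OF sqi_gr_test[OF f(1)] sgv s\<zeta>])
      also have "\<dots> \<le> 2 * (L1 * (2 * ?Y ?E + 2 * ?\<delta> k) + L2 * (i k / ?E)) + 2 * ?\<delta> k"
        using order_trans[OF f(2) add_right_mono[OF mult_left_mono[OF W L(1)]]] by (intro add_right_mono mult_left_mono) auto
      also have "\<dots> = 4 * L1 * ?Y ?E + ((4 * L1 + 2) * ?\<delta> k + 2 * (L2 * (i k / ?E)))"
        by (simp add: algebra_simps)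
      also have "\<dots> < t / 2 + t / 2" by (rule add_strict_mono[OF n k(2)])
      finally show "\<exists>\<eta>\<in>test_functions \<Omega>. nsq M (\<lambda>x. gr \<eta> x - ?\<zeta> x) < t" using f(1) by auto
    qed
  qed
  show ?thesis
    by (rule exI[of _ "ball p (r/2)"]) (use l(1) main in auto)
qed

text \<open>Membership in \<open>Z\<close> is local: interior pieces are approximated by multiplying
  with a test function, boundary pieces by the cutoff construction. A finite sum of cutoffs equal to
  1 on the closure recovers \<open>z\<close>.\<close>

theorem zero_trace_imp_Z:
  assumes sb: "smooth_boundary \<Omega>"
    and z: "sqi M z" and w: "\<And>k::nat. smooth_on UNIV (w k)" "(\<lambda>k. nsq M (\<lambda>x. gr (w k) x - z x)) \<longlonglongrightarrow> 0"
    and tr: "(\<lambda>k. \<integral>\<^sup>+x. ennreal ((w k x)\<^sup>2) \<partial>surface_measure \<Omega>) \<longlonglongrightarrow> 0"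
  shows "z \<in> Z"
proof -
  let ?Q = "\<lambda>\<theta>. smooth_on UNIV \<theta> \<and> loc \<theta> z \<in> Z"
  have cO: "compact (closure \<Omega>)" using bounded_\<Omega> by simp
  obtain \<theta> where \<theta>: "smooth_on UNIV \<theta>" "\<And>x. x \<in> closure \<Omega> \<Longrightarrow> \<theta> x = 1" "?Q \<theta>"
  proof (rule smooth_localize[OF cO, of ?Q])
    have "loc (\<lambda>x. 0) z = (\<lambda>x. 0)" by (simp add: loc_def[abs_def] zero_prod_def)
    then show "?Q (\<lambda>x. 0)" using Z_zero by simp
  next
    fix f g assume "?Q f" "?Q g"
    then have fg: "smooth_on UNIV f" "smooth_on UNIV g" "loc f z \<in> Z" "loc g z \<in> Z" by auto
    have "loc (\<lambda>x. f x + g x) z = (\<lambda>x. loc f z x + loc g z x)"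
      by (simp add: loc_def fun_eq_iff grad_add[OF fg(1,2)[THEN smooth_differentiable]] algebra_simps)
    then show "?Q (\<lambda>x. f x + g x)" using Z_add[OF fg(3,4)] smooth_on_add[OF open_UNIV fg(1,2)] by simp
  next
    fix p assume p: "p \<in> closure \<Omega>"
    show "\<exists>U. open U \<and> p \<in> U \<and> (\<forall>\<theta>. smooth_on UNIV \<theta> \<and> compact (supp \<theta>) \<and> supp \<theta> \<subseteq> U \<longrightarrow> ?Q \<theta>)"
    proof (cases "p \<in> \<Omega>")
      case True
      have "?Q \<theta>" if "smooth_on UNIV \<theta> \<and> compact (supp \<theta>) \<and> supp \<theta> \<subseteq> \<Omega>" for \<theta>
        using loc_interior[OF _ z w] that by (auto simp: test_functions_iff)
      then show ?thesis using True open_\<Omega> by blast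
    next
      case False
      then have "p \<in> frontier \<Omega>" using p open_\<Omega> by (simp add: frontier_def interior_open)
      from loc_boundary[OF sb this z w tr] obtain U where
        "open U" "p \<in> U" "\<forall>\<theta>. smooth_on UNIV \<theta> \<and> compact (supp \<theta>) \<and> supp \<theta> \<subseteq> U \<longrightarrow> loc \<theta> z \<in> Z"
        by (elim exE conjE)
      then show ?thesis by (intro exI[of _ U]) simp
    qed
  next
    fix \<theta> assume "smooth_on UNIV \<theta>" "\<And>x. x \<in> closure \<Omega> \<Longrightarrow> \<theta> x = 1" "?Q \<theta>"
    then show thesis by (rule that)
  qed
  have "AE x in M. loc \<theta> z x = z x"
  proof (rule AE_I2)
    fix x assume "x \<in> space M"
    then have x: "x \<in> \<Omega>" by simp
    have one: "\<theta> y = 1" if "y \<in> \<Omega>" for y using \<theta>(2)[of y] that closure_subset[of \<Omega>] by blast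
    have "grad \<theta> x = grad (\<lambda>_. 1) x" by (rule grad_cong_open[OF open_\<Omega> x one])
    then show "loc \<theta> z x = z x" using one[OF x] by (simp add: loc_def)
  qed
  with Z_cong_AE[OF conjunct2[OF \<theta>(3)] z] show ?thesis by blast
qed

section \<open>Traces of affine perturbations\<close>

lemma space_surface [simp]: "space (surface_measure \<Omega>) = frontier \<Omega>"
  by (simp add: surface_measure_def space_restrict_space)

lemma surface_measurable:
  assumes "continuous_on UNIV F" and eq: "\<And>x. x \<in> frontier \<Omega> \<Longrightarrow> F x = f x"
  shows "f \<in> borel_measurable (surface_measure \<Omega>)"
proof -
  have "F \<in> borel_measurable borel" by (rule borel_measurable_continuous_onI[OF assms(1)])
  then have "F \<in> borel_measurable hausdorff2" by (simp cong: measurable_cong_sets)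
  then have "F \<in> borel_measurable (surface_measure \<Omega>)"
    unfolding surface_measure_def by (rule measurable_restrict_space1)
  moreover have "F \<in> borel_measurable (surface_measure \<Omega>) \<longleftrightarrow> f \<in> borel_measurable (surface_measure \<Omega>)"
    by (rule measurable_cong) (simp add: eq)
  ultimately show ?thesis by blast
qed

lemma test_function_frontier:
  assumes "\<eta> \<in> test_functions \<Omega>" "x \<in> frontier \<Omega>" shows "\<eta> x = 0"
proof -
  have "supp \<eta> \<subseteq> \<Omega>" using assms(1) by (simp add: test_functions_iff)
  then have "x \<notin> supp \<eta>" using frontier_disjoint[OF assms(2)] by blast
  then show ?thesis by (simp add: not_in_supp)
qed

lemma aff_has_weak_gradient:
  assumes F: "smooth_on UNIV F" and v: "v \<in> Z"
  shows "has_weak_gradient \<Omega> (\<lambda>x. fst (aff F v x)) (\<lambda>x. snd (aff F v x))"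
  using has_weak_gradient_lincomb[OF sqi_smooth[OF F] has_weak_gradient_smooth[OF F] Z_sqi_fst[OF v] Z_has_weak_gradient[OF v], of 1]
  by (simp add: aff_def gr_def)

lemma aff_in_H1:
  assumes F: "smooth_on UNIV F" and v: "v \<in> Z"
  shows "(\<lambda>x. fst (aff F v x)) \<in> H1 \<Omega>"
  by (rule H1I[OF sqi_fst[OF sqi_aff[OF F v]] aff_has_weak_gradient[OF F v]])

text \<open>The approximants F + \<eta> have exactly the right boundary values, since test functions
  vanish on the frontier; the trace error is identically 0.\<close>

lemma has_trace_aff:
  assumes F: "smooth_on UNIV F" and v: "v \<in> Z" and eq: "\<And>x. x \<in> frontier \<Omega> \<Longrightarrow> F x = f x"
  shows "has_trace \<Omega> (\<lambda>x. fst (aff F v x)) f"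
proof -
  obtain \<eta> where e: "\<And>k::nat. \<eta> k \<in> test_functions \<Omega>" "(\<lambda>k. nsq M (\<lambda>x. gr (\<eta> k) x - v x)) \<longlonglongrightarrow> 0"
    using Z_seq[OF v] by blast
  let ?w = "\<lambda>k x. F x + \<eta> k x"
  have w: "smooth_on UNIV (?w k)" for k by (rule smooth_on_add[OF open_UNIV F test_functions_smooth[OF e(1)]])
  have d: "gr (?w k) x - (fst (aff F v x), snd (aff F v x)) = gr (\<eta> k) x - v x" for k x
    unfolding prod.collapse using gr_add[OF F test_functions_smooth[OF e(1)], of k x] by (simp add: aff_def)
  have "H1_norm \<Omega> (\<lambda>x. ?w k x - fst (aff F v x)) = sqrt (nsq M (\<lambda>x. gr (\<eta> k) x - v x))" for k
    using H1_norm_diff_eq[OF w sqi_fst[OF sqi_aff[OF F v]] aff_has_weak_gradient[OF F v], of k] unfolding d .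
  then have 1: "(\<lambda>k. H1_norm \<Omega> (\<lambda>x. ?w k x - fst (aff F v x))) \<longlonglongrightarrow> 0"
    using tendsto_real_sqrt[OF e(2)] by simp
  have "(\<integral>\<^sup>+x. ennreal ((?w k x - f x)\<^sup>2) \<partial>surface_measure \<Omega>) = (\<integral>\<^sup>+x. 0 \<partial>surface_measure \<Omega>)" for k
    by (rule nn_integral_cong) (simp add: eq test_function_frontier[OF e(1)])
  then have 2: "(\<lambda>k. \<integral>\<^sup>+x. ennreal ((?w k x - f x)\<^sup>2) \<partial>surface_measure \<Omega>) \<longlonglongrightarrow> 0" by simp
  show ?thesis
    unfolding has_trace_def
    using aff_in_H1[OF F v] surface_measurable[OF smooth_on_imp_continuous_on[OF F] eq] w 1 2
    by (intro conjI exI[of _ ?w] allI) simp_all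
qed

text \<open>Subtracting the extension \<open>F\<close> from the approximating smooth functions
  reduces prescribed traces to zero traces.\<close>

lemma has_trace_imp_Z:
  assumes sb: "smooth_boundary \<Omega>" and tr: "has_trace \<Omega> u f" and F: "smooth_on UNIV F"
    and eq: "\<And>x. x \<in> frontier \<Omega> \<Longrightarrow> F x = f x"
  shows "(\<lambda>x. (u x, weak_gradient \<Omega> u x) - gr F x) \<in> Z"
proof -
  obtain w where u: "u \<in> H1 \<Omega>" and w: "\<forall>k. smooth_on UNIV (w k)"
    "(\<lambda>k::nat. H1_norm \<Omega> (\<lambda>x. w k x - u x)) \<longlonglongrightarrow> 0"
    "(\<lambda>k. \<integral>\<^sup>+x. ennreal ((w k x - f x)\<^sup>2) \<partial>(surface_measure \<Omega>)) \<longlonglongrightarrow> 0"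
    using tr unfolding has_trace_def by (elim conjE exE)
  have wk: "smooth_on UNIV (w k)" for k using w(1) by blast
  have h: "sqi M u" "has_weak_gradient \<Omega> u (weak_gradient \<Omega> u)" using H1D[OF u] .
  let ?W = "\<lambda>k x. w k x - F x"
  show ?thesis
  proof (rule zero_trace_imp_Z[OF sb, of _ ?W])
    show "sqi M (\<lambda>x. (u x, weak_gradient \<Omega> u x) - gr F x)"
      by (rule sqi_diff[OF sqi_Pair[OF h(1) has_weak_gradient_sqi[OF h(2)]] sqi_gr[OF F]])
    show "smooth_on UNIV (?W k)" for k by (rule smooth_on_diff[OF open_UNIV wk F])
    have d: "gr (?W k) x - ((u x, weak_gradient \<Omega> u x) - gr F x) = gr (w k) x - (u x, weak_gradient \<Omega> u x)" for k x
      using gr_diff[OF wk F, of k x] by (simp add: algebra_simps)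
    have "nsq M (\<lambda>x. gr (w k) x - (u x, weak_gradient \<Omega> u x)) = (H1_norm \<Omega> (\<lambda>x. w k x - u x))\<^sup>2" for k
      unfolding H1_norm_diff_eq[OF wk h] by simp
    then show "(\<lambda>k. nsq M (\<lambda>x. gr (?W k) x - ((u x, weak_gradient \<Omega> u x) - gr F x))) \<longlonglongrightarrow> 0"
      unfolding d using tendsto_power[OF w(2), of 2] by simp
    have "(\<integral>\<^sup>+x. ennreal ((?W k x)\<^sup>2) \<partial>surface_measure \<Omega>) = (\<integral>\<^sup>+x. ennreal ((w k x - f x)\<^sup>2) \<partial>surface_measure \<Omega>)" for k
      by (rule nn_integral_cong) (simp add: eq)
    then show "(\<lambda>k. \<integral>\<^sup>+x. ennreal ((?W k x)\<^sup>2) \<partial>surface_measure \<Omega>) \<longlonglongrightarrow> 0" using w(3) by simp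
  qed
qed

text \<open>For test functions the surface term is 0, and the estimate passes to \<open>F\<close> by
  approximation. The factor 2 of the strip estimate is doubled once for the energies and once for
  the values, hence 8.\<close>

lemma smooth_Z_strip:
  assumes F: "smooth_on UNIV F" "gr F \<in> Z" and r: "r > 0" and c: "c > 0" and \<Psi>: "smooth_on UNIV \<Psi>"
    and b: "b \<in> Basis" and s: "\<bar>s\<bar> = (1::real)"
    and sg: "\<And>x. x \<in> cball p r \<Longrightarrow> x \<in> \<Omega> \<longleftrightarrow> \<Psi> x < 0"
    and gr': "\<And>x. x \<in> cball p r \<Longrightarrow> c \<le> grad \<Psi> x \<bullet> (s *\<^sub>R b)"
    and e: "e > 0" "e / c \<le> r / 2"
  shows "(\<integral>x. indicator {x \<in> \<Omega> \<inter> cball p (r/2). \<Psi> x > - e} x * (F x)\<^sup>2 \<partial>M)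
    \<le> 8 * (e / c)\<^sup>2 * (\<integral>x. indicator {x \<in> \<Omega> \<inter> cball p r. \<Psi> x > - e} x * (norm (grad F x))\<^sup>2 \<partial>M)"
proof -
  let ?S = "{x \<in> \<Omega> \<inter> cball p (r/2). \<Psi> x > - e}" and ?S' = "{x \<in> \<Omega> \<inter> cball p r. \<Psi> x > - e}"
  have Sm: "?S \<in> sets borel" "?S' \<in> sets borel"
  proof -
    have "open {x. \<Psi> x > - e}"
      by (intro open_Collect_less continuous_on_const smooth_on_imp_continuous_on[OF \<Psi>])
    moreover have "?S = \<Omega> \<inter> cball p (r/2) \<inter> {x. \<Psi> x > - e}" "?S' = \<Omega> \<inter> cball p r \<inter> {x. \<Psi> x > - e}"
      by auto
    ultimately show "?S \<in> sets borel" "?S' \<in> sets borel" using open_\<Omega> by (simp_all add: sets.Int borel_open)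
  qed
  have sub: "?S \<subseteq> \<Omega>" "?S' \<subseteq> \<Omega>" by auto
  let ?T = "e / c"
  have c1: "continuous_on UNIV (\<lambda>x. (v x)\<^sup>2)" "continuous_on UNIV (\<lambda>x. (norm (grad v x))\<^sup>2)" if v: "smooth_on UNIV v" for v :: "real^3 \<Rightarrow> real"
    by (intro continuous_on_power continuous_on_norm continuous_on_grad smooth_on_imp_continuous_on v)+
  note iA = nn_integral_indicator_M[OF c1(1) zero_le_power2 Sm(1) sub(1)]
    and iB = nn_integral_indicator_M[OF c1(2) zero_le_power2 Sm(2) sub(2)]
  define X where "X v = (\<integral>x. indicator ?S x * (v x)\<^sup>2 \<partial>M)" for v :: "real^3 \<Rightarrow> real"
  define Y where "Y v = (\<integral>x. indicator ?S' x * (norm (grad v x))\<^sup>2 \<partial>M)" for v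
  obtain \<eta> where n: "\<And>k::nat. \<eta> k \<in> test_functions \<Omega>" "(\<lambda>k. nsq M (\<lambda>x. gr (\<eta> k) x - gr F x)) \<longlonglongrightarrow> 0"
    using Z_seq[OF F(2)] by blast
  let ?\<delta> = "\<lambda>k. nsq M (\<lambda>x. gr (\<eta> k) x - gr F x)"
  have le: "X F \<le> 8 * ?T\<^sup>2 * Y F + (8 * ?T\<^sup>2 + 2) * ?\<delta> k" for k
  proof -
    note v = test_functions_smooth[OF n(1)[of k]]
    note sd = sqi_integrable[OF sqi_diff[OF sqi_gr[OF v] sqi_gr[OF F(1)]]]
    have z: "(\<integral>\<^sup>+x. ennreal ((\<eta> k x)\<^sup>2) \<partial>surface_measure \<Omega>) = 0"
    proof -
      have "(\<integral>\<^sup>+x. ennreal ((\<eta> k x)\<^sup>2) \<partial>surface_measure \<Omega>) = (\<integral>\<^sup>+x. 0 \<partial>surface_measure \<Omega>)"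
        by (rule nn_integral_cong) (simp add: test_function_frontier[OF n(1)])
      then show ?thesis by simp
    qed
    have "(\<integral>\<^sup>+x. ennreal ((\<eta> k x)\<^sup>2) * indicator ?S x \<partial>lborel) \<le>
        ennreal (2 * (64 / pi * ?T)) * (\<integral>\<^sup>+x. ennreal ((\<eta> k x)\<^sup>2) \<partial>surface_measure \<Omega>)
          + ennreal (2 * ?T\<^sup>2) * (\<integral>\<^sup>+x. ennreal ((norm (grad (\<eta> k) x))\<^sup>2) * indicator ?S' x \<partial>lborel)"
      by (rule strip_estimate_nn[OF r c \<Psi> b s _ _ v e]) (use sg gr' in auto)
    then have "ennreal (X (\<eta> k)) \<le> ennreal (2 * ?T\<^sup>2) * ennreal (Y (\<eta> k))"
      unfolding z iA(1)[OF v] iB(1)[OF v] X_def[symmetric] Y_def[symmetric] mult_zero_right add_0 .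
    also have "\<dots> = ennreal (2 * ?T\<^sup>2 * Y (\<eta> k))" by (rule ennreal_mult[symmetric]) (simp_all add: Y_def)
    finally have 1: "X (\<eta> k) \<le> 2 * ?T\<^sup>2 * Y (\<eta> k)"
      by (subst (asm) ennreal_le_iff) (simp_all add: Y_def)
    have "Y (\<eta> k) \<le> (\<integral>x. 2 * (indicator ?S' x * (norm (grad F x))\<^sup>2) + 2 * (norm (gr (\<eta> k) x - gr F x))\<^sup>2 \<partial>M)"
      unfolding Y_def
    proof (rule integral_mono[OF iB(2)[OF v]])
      show "integrable M (\<lambda>x. 2 * (indicator ?S' x * (norm (grad F x))\<^sup>2) + 2 * (norm (gr (\<eta> k) x - gr F x))\<^sup>2)"
        by (intro Bochner_Integration.integrable_add integrable_mult_right iB(2)[OF F(1)] sd)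
      fix x
      have "(norm (grad (\<eta> k) x))\<^sup>2 \<le> 2 * (norm (grad F x))\<^sup>2 + 2 * (norm (grad (\<eta> k) x - grad F x))\<^sup>2"
        using norm_add_square_le[of "grad F x" "grad (\<eta> k) x - grad F x"] by simp
      moreover have "(norm (gr (\<eta> k) x - gr F x))\<^sup>2 = (\<eta> k x - F x)\<^sup>2 + (norm (grad (\<eta> k) x - grad F x))\<^sup>2"
        by (simp add: gr_def norm_Pair_square)
      moreover have "0 \<le> (\<eta> k x - F x)\<^sup>2" "0 \<le> (norm (grad (\<eta> k) x - grad F x))\<^sup>2" by simp_all
      ultimately have "(norm (grad (\<eta> k) x))\<^sup>2 \<le> 2 * (norm (grad F x))\<^sup>2 + 2 * (norm (gr (\<eta> k) x - gr F x))\<^sup>2" by linarith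
      then show "indicator ?S' x * (norm (grad (\<eta> k) x))\<^sup>2 \<le> 2 * (indicator ?S' x * (norm (grad F x))\<^sup>2) + 2 * (norm (gr (\<eta> k) x - gr F x))\<^sup>2"
        by (simp add: indicator_def)
    qed
    also have "\<dots> = 2 * Y F + 2 * ?\<delta> k"
      using iB(2)[OF F(1)] sd unfolding Y_def nsq_def by (subst Bochner_Integration.integral_add) auto
    finally have 2: "Y (\<eta> k) \<le> 2 * Y F + 2 * ?\<delta> k" .
    have "X F \<le> (\<integral>x. 2 * (indicator ?S x * (\<eta> k x)\<^sup>2) + 2 * (norm (gr (\<eta> k) x - gr F x))\<^sup>2 \<partial>M)"
      unfolding X_def
    proof (rule integral_mono[OF iA(2)[OF F(1)]])
      show "integrable M (\<lambda>x. 2 * (indicator ?S x * (\<eta> k x)\<^sup>2) + 2 * (norm (gr (\<eta> k) x - gr F x))\<^sup>2)"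
        by (intro Bochner_Integration.integrable_add integrable_mult_right iA(2)[OF v] sd)
      fix x
      have "(F x)\<^sup>2 \<le> 2 * (\<eta> k x)\<^sup>2 + 2 * (\<eta> k x - F x)\<^sup>2"
        using norm_add_square_le[of "\<eta> k x" "F x - \<eta> k x"] by (simp add: power2_commute)
      moreover have "(norm (gr (\<eta> k) x - gr F x))\<^sup>2 = (\<eta> k x - F x)\<^sup>2 + (norm (grad (\<eta> k) x - grad F x))\<^sup>2"
        by (simp add: gr_def norm_Pair_square)
      moreover have "0 \<le> (\<eta> k x - F x)\<^sup>2" "0 \<le> (norm (grad (\<eta> k) x - grad F x))\<^sup>2" by simp_all
      ultimately have "(F x)\<^sup>2 \<le> 2 * (\<eta> k x)\<^sup>2 + 2 * (norm (gr (\<eta> k) x - gr F x))\<^sup>2" by linarith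
      then show "indicator ?S x * (F x)\<^sup>2 \<le> 2 * (indicator ?S x * (\<eta> k x)\<^sup>2) + 2 * (norm (gr (\<eta> k) x - gr F x))\<^sup>2"
        by (simp add: indicator_def)
    qed
    also have "\<dots> = 2 * X (\<eta> k) + 2 * ?\<delta> k"
      using iA(2)[OF v] sd unfolding X_def nsq_def by (subst Bochner_Integration.integral_add) auto
    also have "\<dots> \<le> 2 * (2 * ?T\<^sup>2 * (2 * Y F + 2 * ?\<delta> k)) + 2 * ?\<delta> k"
      by (intro add_right_mono mult_left_mono order_trans[OF 1] 2) simp_all
    also have "\<dots> = 8 * ?T\<^sup>2 * Y F + (8 * ?T\<^sup>2 + 2) * ?\<delta> k" by (simp add: algebra_simps)
    finally show ?thesis .
  qed
  have "(\<lambda>k. 8 * ?T\<^sup>2 * Y F + (8 * ?T\<^sup>2 + 2) * ?\<delta> k) \<longlonglongrightarrow> 8 * ?T\<^sup>2 * Y F + (8 * ?T\<^sup>2 + 2) * 0"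
    by (intro tendsto_add tendsto_mult tendsto_const n(2))
  then have "X F \<le> 8 * ?T\<^sup>2 * Y F + (8 * ?T\<^sup>2 + 2) * 0" by (rule LIMSEQ_le_const) (use le in blast)
  then show ?thesis by (simp add: X_def Y_def)
qed

text \<open>If \<open>F p \<noteq> 0\<close> the strip estimate on a ball of radius \<open>2 e / c\<close> around \<open>p\<close> compares a left-hand
  side of order \<open>e\<^sup>3\<close> with a right-hand side of order \<open>e\<^sup>5\<close>.\<close>

lemma smooth_Z_frontier:
  assumes sb: "smooth_boundary \<Omega>" and F: "smooth_on UNIV F" "gr F \<in> Z" and p: "p \<in> frontier \<Omega>"
  shows "F p = 0"
proof (rule ccontr)
  assume "F p \<noteq> 0"
  define A where "A = (F p)\<^sup>2 / 2"
  have A: "A > 0" "(F p)\<^sup>2 > A" using \<open>F p \<noteq> 0\<close> by (auto simp: A_def)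
  obtain r c \<Psi> b s where l: "r > 0" "c > 0" "smooth_on UNIV \<Psi>" "b \<in> Basis" "\<bar>s\<bar> = (1::real)" "\<Psi> p = 0"
    "\<And>x. x \<in> cball p r \<Longrightarrow> x \<in> \<Omega> \<longleftrightarrow> \<Psi> x < 0" "\<And>x. x \<in> cball p r \<Longrightarrow> c \<le> grad \<Psi> x \<bullet> (s *\<^sub>R b)"
    using smooth_boundary_local[OF sb p] by blast
  define h where "h = s *\<^sub>R b"
  have nh: "norm h = 1" using l(4,5) by (simp add: h_def)
  have "open {x. (F x)\<^sup>2 > A}"
    by (intro open_Collect_less continuous_on_const continuous_on_power smooth_on_imp_continuous_on F)
  then obtain d where d: "d > 0" "cball p d \<subseteq> {x. (F x)\<^sup>2 > A}" using A(2) open_contains_cball by blast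
  obtain B where B: "B \<ge> 0" "\<And>x. x \<in> \<Omega> \<Longrightarrow> norm (grad F x) \<le> B"
    using continuous_bounded_on[OF continuous_on_grad[OF F(1)]] by blast
  obtain L where L: "L \<ge> c" "\<And>x y. x \<in> cball p r \<Longrightarrow> y \<in> cball p r \<Longrightarrow> \<bar>\<Psi> x - \<Psi> y\<bar> \<le> L * norm (x - y)"
  proof -
    have "bounded (grad \<Psi> ` cball p r)"
      by (intro compact_imp_bounded compact_continuous_image continuous_on_subset[OF continuous_on_grad[OF l(3)]]) auto
    then obtain L0 where L0: "\<And>x. x \<in> cball p r \<Longrightarrow> norm (grad \<Psi> x) \<le> L0" unfolding bounded_iff by blast
    have "\<bar>\<Psi> x - \<Psi> y\<bar> \<le> max c L0 * norm (x - y)" if "x \<in> cball p r" "y \<in> cball p r" for x y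
    proof -
      have "norm (\<Psi> x - \<Psi> y) \<le> max c L0 * norm (x - y)"
      proof (rule differentiable_bound[of "cball p r" \<Psi> "\<lambda>x v. grad \<Psi> x \<bullet> v"])
        show "(\<Psi> has_derivative (\<bullet>) (grad \<Psi> z)) (at z within cball p r)" for z
          by (rule has_derivative_at_withinI[OF smooth_has_derivative_grad[OF l(3) UNIV_I]])
        show "onorm ((\<bullet>) (grad \<Psi> z)) \<le> max c L0" if "z \<in> cball p r" for z
        proof (rule onorm_bound)
          show "norm (grad \<Psi> z \<bullet> v) \<le> max c L0 * norm v" for v
            using Cauchy_Schwarz_ineq2[of "grad \<Psi> z" v] mult_right_mono[OF L0[OF that] norm_ge_zero[of v]]
              mult_right_mono[OF max.cobounded2[of L0 c] norm_ge_zero[of v]] by simp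
        qed (use l(2) in simp)
      qed (use that in auto)
      then show ?thesis by simp
    qed
    then show thesis using that[of "max c L0"] by simp
  qed
  have L0: "L > 0" using L(1) l(2) by linarith
  define \<kappa>0 where "\<kappa>0 = c / (3 * L\<^sup>2)"
  have k0: "\<kappa>0 > 0" using l(2) L0 by (simp add: \<kappa>0_def)
  \<comment> \<open>From 8 (e/c)^2 B^2 times the volume of a ball of radius 2 e / c: up to the
    volume of the unit ball this is 64 B^2 e^5 / c^5, and e^3 is split off.\<close>
  define K where "K = 64 * B\<^sup>2 / c ^ 5"
  have "((\<lambda>e. K * e\<^sup>2) \<longlongrightarrow> K * 0\<^sup>2) (at_right 0)" by (intro tendsto_intros)
  then have "\<forall>\<^sub>F e in at_right 0. K * e\<^sup>2 < A * \<kappa>0 ^ 3" using A k0 by (intro order_tendstoD(2)) auto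
  moreover have "\<forall>\<^sub>F e in at_right 0. e \<in> {0<..<min (c * r / 2) (c * d / 2)}"
    by (rule eventually_at_right_real) (use l(1,2) d(1) in simp)
  ultimately have "\<forall>\<^sub>F e in at_right 0. K * e\<^sup>2 < A * \<kappa>0 ^ 3 \<and> e \<in> {0<..<min (c * r / 2) (c * d / 2)}"
    by (rule eventually_conj)
  then obtain e where e: "K * e\<^sup>2 < A * \<kappa>0 ^ 3" "e > 0" "e < c * r / 2" "e < c * d / 2"
    using eventually_happens[of _ "at_right (0::real)"] by (auto simp: trivial_limit_at_right_real)
  define R where "R = 2 * e / c"
  have R: "R > 0" "R \<le> r" "R \<le> d" "e / c = R / 2" using e l(2) by (auto simp: R_def field_simps)
  have Rr: "cball p R \<subseteq> cball p r" using R(2) by auto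
  let ?S = "{x \<in> \<Omega> \<inter> cball p (R/2). \<Psi> x > - e}" and ?S' = "{x \<in> \<Omega> \<inter> cball p R. \<Psi> x > - e}"
  have est: "(\<integral>x. indicator ?S x * (F x)\<^sup>2 \<partial>M) \<le> 8 * (e / c)\<^sup>2 * (\<integral>x. indicator ?S' x * (norm (grad F x))\<^sup>2 \<partial>M)"
    by (rule smooth_Z_strip[OF F R(1) l(2,3,4,5)]) (use l(7,8) Rr e(2) R(4) in auto)
  have Sm: "?S \<in> sets borel" "?S' \<in> sets borel"
  proof -
    have "open {x. \<Psi> x > - e}"
      by (intro open_Collect_less continuous_on_const smooth_on_imp_continuous_on[OF l(3)])
    moreover have "?S = \<Omega> \<inter> cball p (R/2) \<inter> {x. \<Psi> x > - e}" "?S' = \<Omega> \<inter> cball p R \<inter> {x. \<Psi> x > - e}"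
      by auto
    ultimately show "?S \<in> sets borel" "?S' \<in> sets borel" using open_\<Omega> by (simp_all add: sets.Int borel_open)
  qed
  have sub: "?S \<subseteq> \<Omega>" "?S' \<subseteq> \<Omega>" by auto
  have c1: "continuous_on UNIV (\<lambda>x. (F x)\<^sup>2)" "continuous_on UNIV (\<lambda>x. (norm (grad F x))\<^sup>2)"
    by (intro continuous_on_power continuous_on_norm continuous_on_grad smooth_on_imp_continuous_on F)+
  \<comment> \<open>The point q = p - t h has depth between c t and L t = e/3. The radius \<rho>
    satisfies L \<rho> = c t, so on the ball around q the function \<Psi> stays below 0 and above
    -2e/3: a ball of radius proportional to e fits into the strip.\<close>
  define t where "t = e / (3 * L)"
  define \<rho> where "\<rho> = \<kappa>0 * e"
  have t: "t > 0" using e(2) L0 by (simp add: t_def)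
  have \<rho>: "\<rho> > 0" using e(2) k0 by (simp add: \<rho>_def)
  have Lr: "L * \<rho> = c * t" using L0 by (simp add: \<rho>_def \<kappa>0_def t_def power2_eq_square field_simps)
  have "c * t \<le> L * t" using L(1) t by (intro mult_right_mono) auto
  then have "L * \<rho> \<le> L * t" using Lr by simp
  then have rt: "\<rho> \<le> t" using L0 by simp
  have Lt: "3 * (L * t) = e" using L0 by (simp add: t_def)
  have "3 * (c * t) \<le> e" using \<open>c * t \<le> L * t\<close> Lt by linarith
  then have tR: "3 * t \<le> R / 2" using l(2) unfolding R(4)[symmetric] by (simp add: field_simps)
  define q where "q = p - t *\<^sub>R h"
  have \<Psi>q: "\<Psi> q \<le> - (c * t)"
  proof -
    have "\<Psi> (q + 0 *\<^sub>R h) - c * 0 \<le> \<Psi> (q + t *\<^sub>R h) - c * t"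
    proof (rule DERIV_nonneg_imp_nondecreasing[of 0 t "\<lambda>t. \<Psi> (q + t *\<^sub>R h) - c * t"])
      show "0 \<le> t" using t by simp
      fix u assume u: "0 \<le> u" "u \<le> t"
      have "((\<lambda>t. \<Psi> (q + t *\<^sub>R h) - c * t) has_real_derivative (grad \<Psi> (q + u *\<^sub>R h) \<bullet> h - c)) (at u)"
        by (auto intro!: derivative_eq_intros smooth_line_derivative[OF l(3)])
      moreover have "q + u *\<^sub>R h \<in> cball p r"
      proof -
        have "p - (q + u *\<^sub>R h) = (t - u) *\<^sub>R h" by (simp add: q_def algebra_simps)
        then have "dist p (q + u *\<^sub>R h) = t - u" using u nh by (simp add: dist_norm)
        then show ?thesis using u t tR R(1,2) by simp
      qed
      then have "0 \<le> grad \<Psi> (q + u *\<^sub>R h) \<bullet> h - c" using l(8) by (simp add: h_def)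
      ultimately show "\<exists>y. ((\<lambda>t. \<Psi> (q + t *\<^sub>R h) - c * t) has_real_derivative y) (at u) \<and> 0 \<le> y" by blast
    qed
    then show ?thesis by (simp add: q_def l(6))
  qed
  have qp: "dist p q = t" using t nh by (simp add: q_def dist_norm)
  have ball: "ball q \<rho> \<subseteq> ?S"
  proof
    fix x assume "x \<in> ball q \<rho>"
    then have xq: "norm (x - q) < \<rho>" by (simp add: dist_norm norm_minus_commute)
    have "dist p x \<le> dist p q + dist q x" by (rule dist_triangle)
    then have px: "dist p x \<le> 2 * t" using qp xq rt by (simp add: dist_norm norm_minus_commute)
    have xr: "x \<in> cball p r" "q \<in> cball p r" "x \<in> cball p (R/2)" using px qp t tR R(1,2) by auto
    have "\<bar>\<Psi> x - \<Psi> q\<bar> \<le> L * norm (x - q)" by (rule L(2)[OF xr(1,2)])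
    also have "\<dots> < L * \<rho>" using xq L0 by simp
    finally have d1: "\<bar>\<Psi> x - \<Psi> q\<bar> < c * t" unfolding Lr .
    have "\<bar>\<Psi> p - \<Psi> q\<bar> \<le> L * norm (p - q)" by (rule L(2)) (use xr l(1) in auto)
    then have d2: "\<bar>\<Psi> q\<bar> \<le> L * t" using qp l(6) by (simp add: dist_norm)
    have "0 < L * t" using L0 t by simp
    then have "\<Psi> x < 0" "\<Psi> x > - e" using d1 d2 \<Psi>q Lt \<open>c * t \<le> L * t\<close> by linarith+
    then show "x \<in> ?S" using xr l(7)[OF xr(1)] by simp
  qed
  have bO: "ball q \<rho> \<subseteq> \<Omega>" using ball by auto
  have mM: "measure M X = measure lebesgue X" if "X \<subseteq> \<Omega>" "X \<in> sets lebesgue" for X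
    by (rule measure_restrict_space) (use that in auto)
  let ?V = "unit_ball_vol (real DIM(real^3))"
  have V: "?V > 0" by simp
  have "A * (?V * \<rho> ^ 3) = A * measure M (ball q \<rho>)"
    using content_ball[of \<rho> q] \<rho> by (subst mM[OF bO]) (auto simp: measure_completion)
  also have "\<dots> = (\<integral>x. A * indicator (ball q \<rho>) x \<partial>M)"
    using bO by (simp add: Int_absorb2)
  also have "\<dots> \<le> (\<integral>x. indicator ?S x * (F x)\<^sup>2 \<partial>M)"
  proof (rule integral_mono[OF _ nn_integral_indicator_M(2)[OF c1(1) zero_le_power2 Sm(1) sub(1)]])
    have "ball q \<rho> \<in> sets M" using bO by (simp add: sets_restrict_space_iff)
    then show "integrable M (\<lambda>x. A * indicator (ball q \<rho>) x)"
      by (intro integrable_mult_right integrable_real_indicator) (auto simp: M.emeasure_finite less_top[symmetric])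
    fix x
    show "A * indicator (ball q \<rho>) x \<le> indicator ?S x * (F x)\<^sup>2"
    proof (cases "x \<in> ball q \<rho>")
      case True
      then have xS: "x \<in> ?S" using ball by blast
      then have "x \<in> cball p d" using R(1,3) by auto
      then have "A < (F x)\<^sup>2" using d(2) by blast
      then show ?thesis using xS True by simp
    qed simp
  qed
  also note est
  also have "8 * (e / c)\<^sup>2 * (\<integral>x. indicator ?S' x * (norm (grad F x))\<^sup>2 \<partial>M) \<le> 8 * (e / c)\<^sup>2 * (B\<^sup>2 * (?V * R ^ 3))"
  proof (rule mult_left_mono)
    have S'M: "?S' \<in> sets M" using Sm(2) sub(2) by (simp add: sets_restrict_space_iff)
    have "(\<integral>x. indicator ?S' x * (norm (grad F x))\<^sup>2 \<partial>M) \<le> (\<integral>x. B\<^sup>2 * indicator ?S' x \<partial>M)"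
    proof (rule integral_mono[OF nn_integral_indicator_M(2)[OF c1(2) zero_le_power2 Sm(2) sub(2)]])
      show "integrable M (\<lambda>x. B\<^sup>2 * indicator ?S' x)" using S'M
        by (intro integrable_mult_right integrable_real_indicator) (auto simp: M.emeasure_finite less_top[symmetric])
      fix x assume "x \<in> space M"
      then have "(norm (grad F x))\<^sup>2 \<le> B\<^sup>2" by (intro power_mono B(2)) simp_all
      then show "indicator ?S' x * (norm (grad F x))\<^sup>2 \<le> B\<^sup>2 * indicator ?S' x" by (simp add: indicator_def)
    qed
    also have "\<dots> = B\<^sup>2 * measure M ?S'" using sub(2) by (simp add: Int_absorb2)
    also have "measure M ?S' = measure lebesgue ?S'" by (rule mM[OF sub(2)]) (use Sm(2) in simp)
    also have "B\<^sup>2 * measure lebesgue ?S' \<le> B\<^sup>2 * measure lebesgue (cball p R)"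
    proof (rule mult_left_mono)
      show "measure lebesgue ?S' \<le> measure lebesgue (cball p R)"
        by (rule measure_mono_fmeasurable) (use Sm(2) in auto)
    qed simp
    also have "measure lebesgue (cball p R) = ?V * R ^ 3"
      using content_cball[of R p] R(1) by (simp add: measure_completion)
    finally show "(\<integral>x. indicator ?S' x * (norm (grad F x))\<^sup>2 \<partial>M) \<le> B\<^sup>2 * (?V * R ^ 3)" .
  qed simp
  also have "\<dots> = ?V * e ^ 3 * (K * e\<^sup>2)"
    unfolding K_def R_def using l(2) by (simp add: field_simps power2_eq_square power3_eq_cube eval_nat_numeral)
  finally have "A * (?V * \<rho> ^ 3) \<le> ?V * e ^ 3 * (K * e\<^sup>2)" .
  moreover have "A * (?V * \<rho> ^ 3) = ?V * e ^ 3 * (A * \<kappa>0 ^ 3)" by (simp add: \<rho>_def power_mult_distrib)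
  moreover have "?V * e ^ 3 * (K * e\<^sup>2) < ?V * e ^ 3 * (A * \<kappa>0 ^ 3)"
    using e(1,2) V by (intro mult_strict_left_mono) simp_all
  ultimately show False by linarith
qed

text \<open>A function that is 0 almost everywhere has weak gradient 0, so \<open>gr F\<close> would
  be minus an element of \<open>Z\<close>. Then F would vanish on the frontier.\<close>

lemma aff_nontrivial:
  assumes sb: "smooth_boundary \<Omega>" and F: "smooth_on UNIV F" and v: "v \<in> Z" and p: "p \<in> frontier \<Omega>" "F p \<noteq> 0"
  shows "nontrivial_on \<Omega> (\<lambda>x. fst (aff F v x))"
  unfolding nontrivial_on_def
proof
  assume u0: "AE x in M. fst (aff F v x) = 0"
  have "has_weak_gradient \<Omega> (\<lambda>x. fst (aff F v x)) (\<lambda>x. 0)"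
    unfolding has_weak_gradient_def
  proof (intro conjI ballI)
    show "(\<lambda>x. 0 :: real^3) \<in> L2_on \<Omega>" by (simp add: L2_on_iff)
    fix \<eta> and b :: "real^3"
    have "(\<integral>x. fst (aff F v x) * frechet_derivative \<eta> (at x) b \<partial>M) = 0"
      by (rule integral_eq_zero_AE) (use u0 in eventually_elim, simp)
    then show "(\<integral>x. fst (aff F v x) * frechet_derivative \<eta> (at x) b \<partial>M) = - (\<integral>x. (0 \<bullet> b) * \<eta> x \<partial>M)" by simp
  qed
  from has_weak_gradient_unique[OF aff_has_weak_gradient[OF F v] this]
  have "AE x in M. snd (aff F v x) = 0" .
  with u0 have "AE x in M. (- 1) *\<^sub>R v x = gr F x"
  proof eventually_elim
    case (elim x)
    then have "aff F v x = 0" by (simp add: prod_eq_iff)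
    then have "gr F x = - v x" unfolding aff_def by (rule eq_neg_iff_add_eq_0[THEN iffD2])
    then show ?case by simp
  qed
  with Z_cong_AE[OF Z_scaleR[OF v] sqi_gr[OF F]] have "gr F \<in> Z" by blast
  from smooth_Z_frontier[OF sb F this p(1)] p(2) show False by blast
qed

section \<open>Existence and uniqueness\<close>

lemma gradient_form_eq:
  assumes "has_weak_gradient \<Omega> u U" "has_weak_gradient \<Omega> w W"
  shows "(\<integral>x. weak_gradient \<Omega> u x \<bullet> weak_gradient \<Omega> w x \<partial>M) = (\<integral>x. U x \<bullet> W x \<partial>M)"
proof (rule integral_cong_AE)
  note [measurable] = assms[THEN has_weak_gradient_sqi, THEN sqi_measurable]
    assms[THEN weak_gradient_AE(1), THEN has_weak_gradient_sqi, THEN sqi_measurable]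
  show "(\<lambda>x. weak_gradient \<Omega> u x \<bullet> weak_gradient \<Omega> w x) \<in> borel_measurable M" "(\<lambda>x. U x \<bullet> W x) \<in> borel_measurable M"
    by measurable
  show "AE x in M. weak_gradient \<Omega> u x \<bullet> weak_gradient \<Omega> w x = U x \<bullet> W x"
    using assms[THEN weak_gradient_AE(2)] by eventually_elim simp
qed

text \<open>Replaces the weak gradients selected by choice with explicit ones, which turns the weak
  form of the first equation into the product with \<open>opS\<close>.\<close>

lemma energy_form_eq:
  assumes h: "has_weak_gradient \<Omega> u U" "has_weak_gradient \<Omega> w W"
    and [measurable]: "u \<in> borel_measurable M" "w \<in> borel_measurable M" "\<phi> \<in> borel_measurable M"
  shows "(\<integral>x. weak_gradient \<Omega> u x \<bullet> weak_gradient \<Omega> w x - (\<phi> x)\<^sup>2 * u x * w x + m\<^sup>2 * u x * w x \<partial>M)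
    = (\<integral>x. opS m \<phi> (\<lambda>x. (u x, U x)) x \<bullet> (w x, W x) \<partial>M)"
proof (rule integral_cong_AE)
  note [measurable] = h[THEN has_weak_gradient_sqi, THEN sqi_measurable]
    h[THEN weak_gradient_AE(1), THEN has_weak_gradient_sqi, THEN sqi_measurable]
  show "(\<lambda>x. weak_gradient \<Omega> u x \<bullet> weak_gradient \<Omega> w x - (\<phi> x)\<^sup>2 * u x * w x + m\<^sup>2 * u x * w x) \<in> borel_measurable M"
    by measurable
  show "(\<lambda>x. opS m \<phi> (\<lambda>x. (u x, U x)) x \<bullet> (w x, W x)) \<in> borel_measurable M"
    unfolding opS_def inner_Pair fst_conv snd_conv by measurable
  show "AE x in M. weak_gradient \<Omega> u x \<bullet> weak_gradient \<Omega> w x - (\<phi> x)\<^sup>2 * u x * w x + m\<^sup>2 * u x * w x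
      = opS m \<phi> (\<lambda>x. (u x, U x)) x \<bullet> (w x, W x)"
    using h[THEN weak_gradient_AE(2)] by eventually_elim (simp add: opS_def inner_Pair algebra_simps)
qed

theorem nontrivial_solution_exists:
  assumes ne: "\<Omega> \<noteq> {}" and sb: "smooth_boundary \<Omega>" and F: "smooth_on UNIV F" and G: "smooth_on UNIV G"
    and Ff: "\<And>x. x \<in> frontier \<Omega> \<Longrightarrow> F x = f x" and Gg: "\<And>x. x \<in> frontier \<Omega> \<Longrightarrow> G x = g x"
    and GK: "\<And>x. x \<in> frontier \<Omega> \<Longrightarrow> \<bar>G x\<bar> \<le> K" and K0: "K \<ge> 0" and K: "K\<^sup>2 < m\<^sup>2 + first_dirichlet_eigenvalue \<Omega>"
    and p: "p \<in> frontier \<Omega>" "F p \<noteq> 0"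
  shows "\<exists>u \<phi>. weak_solution \<Omega> m f g u \<phi> \<and> nontrivial_on \<Omega> u"
proof -
  obtain v y where v: "v \<in> Z" and y: "y \<in> Z"
    and e1: "\<And>w. w \<in> Z \<Longrightarrow> (\<integral>x. opS m (\<lambda>x. fst (aff G y x)) (aff F v) x \<bullet> w x \<partial>M) = 0"
    and e2: "\<And>w. w \<in> Z \<Longrightarrow> (\<integral>x. snd (aff G y x) \<bullet> snd (w x) \<partial>M) = - (\<integral>x. fst (aff G y x) * (fst (aff F v x))\<^sup>2 * fst (w x) \<partial>M)"
  proof (rule solution_exists[OF ne F G GK K0 K])
    fix v y assume "v \<in> Z" "y \<in> Z"
      "\<And>w. w \<in> Z \<Longrightarrow> (\<integral>x. opS m (\<lambda>x. fst (aff G y x)) (aff F v) x \<bullet> w x \<partial>M) = 0"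
      "\<And>w. w \<in> Z \<Longrightarrow> (\<integral>x. snd (aff G y x) \<bullet> snd (w x) \<partial>M) = - (\<integral>x. fst (aff G y x) * (fst (aff F v x))\<^sup>2 * fst (w x) \<partial>M)"
    then show thesis by (rule that)
  qed
  let ?u = "\<lambda>x. fst (aff F v x)" and ?\<phi> = "\<lambda>x. fst (aff G y x)"
  note gu = aff_has_weak_gradient[OF F v] and gp = aff_has_weak_gradient[OF G y]
  have "weak_solution \<Omega> m f g ?u ?\<phi>"
    unfolding weak_solution_def
  proof (intro conjI ballI aff_in_H1 F G v y has_trace_aff Ff Gg)
    fix w assume w: "w \<in> H10 \<Omega>"
    then have wH: "w \<in> H1 \<Omega>" by (simp add: H10_def)
    note wZ = H10_imp_Z[OF w] and gw = H1D(2)[OF wH]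
    have "(\<integral>x. weak_gradient \<Omega> ?u x \<bullet> weak_gradient \<Omega> w x - (?\<phi> x)\<^sup>2 * ?u x * w x + m\<^sup>2 * ?u x * w x \<partial>M)
        = (\<integral>x. opS m ?\<phi> (\<lambda>x. (fst (aff F v x), snd (aff F v x))) x \<bullet> (w x, weak_gradient \<Omega> w x) \<partial>M)"
      by (rule energy_form_eq[OF gu gw sqi_measurable[OF sqi_fst[OF sqi_aff[OF F v]]] sqi_measurable[OF H1D(1)[OF wH]]
            sqi_measurable[OF sqi_fst[OF sqi_aff[OF G y]]]])
    also have "\<dots> = 0" using e1[OF wZ] by simp
    finally show "(\<integral>x. weak_gradient \<Omega> ?u x \<bullet> weak_gradient \<Omega> w x - (?\<phi> x)\<^sup>2 * ?u x * w x + m\<^sup>2 * ?u x * w x \<partial>M) = 0" .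
    have "(\<integral>x. weak_gradient \<Omega> ?\<phi> x \<bullet> weak_gradient \<Omega> w x \<partial>M) = (\<integral>x. snd (aff G y x) \<bullet> weak_gradient \<Omega> w x \<partial>M)"
      by (rule gradient_form_eq[OF gp gw])
    also have "\<dots> = - (\<integral>x. ?\<phi> x * (?u x)\<^sup>2 * w x \<partial>M)" using e2[OF wZ] by simp
    finally show "(\<integral>x. - (weak_gradient \<Omega> ?\<phi> x \<bullet> weak_gradient \<Omega> w x) \<partial>M) = (\<integral>x. ?\<phi> x * (?u x)\<^sup>2 * w x \<partial>M)" by simp
  qed
  moreover have "nontrivial_on \<Omega> ?u" by (rule aff_nontrivial[OF sb F v p])
  ultimately show ?thesis by blast
qed

text \<open>The given \<phi> is not assumed bounded. Its trace places \<phi> minus the extension of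
  its boundary values in \<open>Z\<close>, so the maximum principle applies to any weak solution
  with coefficient u^2, and coercivity becomes available.\<close>

theorem no_nontrivial_solution:
  assumes ne: "\<Omega> \<noteq> {}" and sb: "smooth_boundary \<Omega>" and G: "smooth_on UNIV G"
    and f0: "\<And>x. x \<in> frontier \<Omega> \<Longrightarrow> f x = 0" and Gg: "\<And>x. x \<in> frontier \<Omega> \<Longrightarrow> G x = g x"
    and GK: "\<And>x. x \<in> frontier \<Omega> \<Longrightarrow> \<bar>G x\<bar> \<le> K" and K0: "K \<ge> 0" and K: "K\<^sup>2 < m\<^sup>2 + first_dirichlet_eigenvalue \<Omega>"
    and sol: "weak_solution \<Omega> m f g u \<phi>"
  shows "\<not> nontrivial_on \<Omega> u"
proof -
  have H: "u \<in> H1 \<Omega>" "\<phi> \<in> H1 \<Omega>" "has_trace \<Omega> u f" "has_trace \<Omega> \<phi> g"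
    and e1: "\<forall>v\<in>H10 \<Omega>. (\<integral>x. weak_gradient \<Omega> u x \<bullet> weak_gradient \<Omega> v x - (\<phi> x)\<^sup>2 * u x * v x + m\<^sup>2 * u x * v x \<partial>M) = 0"
    and e2: "\<forall>v\<in>H10 \<Omega>. (\<integral>x. - (weak_gradient \<Omega> \<phi> x \<bullet> weak_gradient \<Omega> v x) \<partial>M) = (\<integral>x. \<phi> x * (u x)\<^sup>2 * v x \<partial>M)"
    using sol unfolding weak_solution_def by blast+
  define z where "z x = (u x, weak_gradient \<Omega> u x)" for x
  have "(\<lambda>x. (u x, weak_gradient \<Omega> u x) - gr (\<lambda>x. 0) x) \<in> Z"
    by (rule has_trace_imp_Z[OF sb H(3)]) (simp_all add: f0)
  then have zZ: "z \<in> Z" by (simp add: z_def[abs_def] gr_def zero_prod_def)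
  define y where "y x = (\<phi> x, weak_gradient \<Omega> \<phi> x) - gr G x" for x
  have yZ: "y \<in> Z" unfolding y_def[abs_def] by (rule has_trace_imp_Z[OF sb H(4) G Gg])
  have ay: "aff G y x = (\<phi> x, weak_gradient \<Omega> \<phi> x)" for x by (simp add: aff_def y_def)
  note mu = sqi_measurable[OF H1D(1)[OF H(1)]] and mp = sqi_measurable[OF H1D(1)[OF H(2)]]
  have "AE x in M. \<bar>fst (aff G y x)\<bar> \<le> K"
  proof (rule maximum_principle_abs[OF G GK K0 yZ, of "\<lambda>x. (u x)\<^sup>2"])
    show "0 \<le> (u x)\<^sup>2" for x by simp
    fix w assume w: "w \<in> Z"
    have "(\<integral>x. weak_gradient \<Omega> \<phi> x \<bullet> snd (w x) \<partial>M) = (\<integral>x. weak_gradient \<Omega> \<phi> x \<bullet> weak_gradient \<Omega> (\<lambda>x. fst (w x)) x \<partial>M)"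
      by (rule gradient_form_eq[OF H1D(2)[OF H(2)] Z_has_weak_gradient[OF w], symmetric])
    moreover have "- (\<integral>x. weak_gradient \<Omega> \<phi> x \<bullet> weak_gradient \<Omega> (\<lambda>x. fst (w x)) x \<partial>M) = (\<integral>x. \<phi> x * (u x)\<^sup>2 * fst (w x) \<partial>M)"
      using bspec[OF e2 Z_imp_H10[OF w]] by simp
    ultimately show "(\<integral>x. snd (aff G y x) \<bullet> snd (w x) \<partial>M) = - (\<integral>x. fst (aff G y x) * (u x)\<^sup>2 * fst (w x) \<partial>M)"
      unfolding ay by simp
  qed
  then have bd: "AE x in M. \<bar>\<phi> x\<bar> \<le> K" unfolding ay by simp
  obtain c where c: "c > 0" "\<And>\<phi> d. \<phi> \<in> borel_measurable M \<Longrightarrow> AE x in M. \<bar>\<phi> x\<bar> \<le> K \<Longrightarrow> d \<in> Z \<Longrightarrow>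
    c * nsq M d \<le> (\<integral>x. opS m \<phi> d x \<bullet> d x \<partial>M)"
    using coercive[OF ne K] by blast
  have uH: "u \<in> H10 \<Omega>" using Z_imp_H10[OF zZ] by (simp add: z_def)
  have "c * nsq M z \<le> (\<integral>x. opS m \<phi> z x \<bullet> z x \<partial>M)" by (rule c(2)[OF mp bd zZ])
  also have "\<dots> = (\<integral>x. opS m \<phi> (\<lambda>x. (u x, weak_gradient \<Omega> u x)) x \<bullet> (u x, weak_gradient \<Omega> u x) \<partial>M)"
    by (simp add: z_def[abs_def])
  also have "\<dots> = 0"
    using bspec[OF e1 uH] energy_form_eq[OF H1D(2)[OF H(1)] H1D(2)[OF H(1)] mu mu mp, of m] by simp
  finally have "nsq M z \<le> 0" using c(1) by (simp add: mult_le_0_iff)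
  then have "nsq M z = 0" using nsq_nonneg[of M z] by linarith
  then have "AE x in M. z x = 0" by (rule nsq_eq_0_imp_AE[OF Z_sqi[OF zZ]])
  then have "AE x in M. u x = 0" by eventually_elim (simp add: z_def zero_prod_def)
  then show ?thesis by (simp add: nontrivial_on_def)
qed

end

theorem theorem1:
  fixes \<Omega> :: "(real^3) set" and m q \<omega> :: real and h \<zeta> :: "real^3 \<Rightarrow> real"
  assumes "open \<Omega>" and "connected \<Omega>" and "\<Omega> \<noteq> {}" and "bounded \<Omega>" and "smooth_boundary \<Omega>"
    and "m > 0" and "q \<noteq> 0"
    and "smooth_fun_on_subset (frontier \<Omega>) h" and "smooth_fun_on_subset (frontier \<Omega>) \<zeta>"
    and "(SUP x\<in>frontier \<Omega>. \<bar>q * \<zeta> x - \<omega>\<bar>)\<^sup>2 < m\<^sup>2 + first_dirichlet_eigenvalue \<Omega>"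
  shows "((\<exists>x\<in>frontier \<Omega>. h x \<noteq> 0) \<longrightarrow>
            (\<exists>u \<phi>. weak_solution \<Omega> m (\<lambda>x. sqrt (4 * pi) * q * h x) (\<lambda>x. q * \<zeta> x - \<omega>) u \<phi> \<and>
                   nontrivial_on \<Omega> u)) \<and>
         ((\<forall>x\<in>frontier \<Omega>. h x = 0) \<longrightarrow>
            \<not> (\<exists>u \<phi>. weak_solution \<Omega> m (\<lambda>x. sqrt (4 * pi) * q * h x) (\<lambda>x. q * \<zeta> x - \<omega>) u \<phi> \<and>
                      nontrivial_on \<Omega> u))"
proof -
  interpret bounded_open3 \<Omega> by unfold_locales (fact assms)+
  have cf: "compact (frontier \<Omega>)" using assms(4) by (simp add: compact_frontier_bounded)
  have fne: "frontier \<Omega> \<noteq> {}"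
  proof (rule frontier_not_empty[OF assms(3)])
    show "\<Omega> \<noteq> UNIV" using assms(4) not_bounded_UNIV by metis
  qed
  obtain H where H: "smooth_on UNIV H" "\<And>x. x \<in> frontier \<Omega> \<Longrightarrow> H x = h x"
    using smooth_extension[OF cf assms(8)] by blast
  obtain Y where Y: "smooth_on UNIV Y" "\<And>x. x \<in> frontier \<Omega> \<Longrightarrow> Y x = \<zeta> x"
    using smooth_extension[OF cf assms(9)] by blast
  let ?F = "\<lambda>x. sqrt (4 * pi) * q * H x" and ?G = "\<lambda>x. q * Y x - \<omega>"
  have F: "smooth_on UNIV ?F" by (rule smooth_on_cmult[OF open_UNIV H(1)])
  have G: "smooth_on UNIV ?G" by (rule smooth_on_diff[OF open_UNIV smooth_on_cmult[OF open_UNIV Y(1)] smooth_on_const])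
  have Ff: "?F x = sqrt (4 * pi) * q * h x" and Gg: "?G x = q * \<zeta> x - \<omega>" if "x \<in> frontier \<Omega>" for x
    using H(2)[OF that] Y(2)[OF that] by simp_all
  define K where "K = (SUP x\<in>frontier \<Omega>. \<bar>q * \<zeta> x - \<omega>\<bar>)"
  have K: "K\<^sup>2 < m\<^sup>2 + first_dirichlet_eigenvalue \<Omega>" using assms(10) by (simp add: K_def)
  \<comment> \<open>Boundedness on the compact frontier is what makes the real supremum an actual
    upper bound.\<close>
  have "compact ((\<lambda>x. \<bar>?G x\<bar>) ` frontier \<Omega>)"
    by (intro compact_continuous_image cf continuous_on_rabs continuous_on_subset[OF smooth_on_imp_continuous_on[OF G]] subset_UNIV)
  then have "bdd_above ((\<lambda>x. \<bar>?G x\<bar>) ` frontier \<Omega>)" by (intro bounded_imp_bdd_above compact_imp_bounded)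
  moreover have "(\<lambda>x. \<bar>?G x\<bar>) ` frontier \<Omega> = (\<lambda>x. \<bar>q * \<zeta> x - \<omega>\<bar>) ` frontier \<Omega>"
    by (rule image_cong) (simp_all add: Y(2))
  ultimately have bdd: "bdd_above ((\<lambda>x. \<bar>q * \<zeta> x - \<omega>\<bar>) ` frontier \<Omega>)" by simp
  have GK: "\<bar>?G x\<bar> \<le> K" if "x \<in> frontier \<Omega>" for x
    unfolding Gg[OF that] K_def by (rule cSUP_upper[OF that bdd])
  \<comment> \<open>The frontier of a nonempty bounded set is nonempty, so the supremum is not taken
    over the empty set.\<close>
  have K0: "K \<ge> 0"
  proof -
    obtain x where "x \<in> frontier \<Omega>" using fne by blast
    from GK[OF this] show ?thesis using abs_ge_zero[of "?G x"] by linarith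
  qed
  show ?thesis
  proof (intro conjI impI)
    assume "\<exists>x\<in>frontier \<Omega>. h x \<noteq> 0"
    then obtain p where p: "p \<in> frontier \<Omega>" "h p \<noteq> 0" by blast
    then have "?F p \<noteq> 0" using assms(7) H(2)[OF p(1)] by simp
    from nontrivial_solution_exists[OF assms(3,5) F G Ff Gg GK K0 K p(1) this]
    show "\<exists>u \<phi>. weak_solution \<Omega> m (\<lambda>x. sqrt (4 * pi) * q * h x) (\<lambda>x. q * \<zeta> x - \<omega>) u \<phi> \<and> nontrivial_on \<Omega> u" .
  next
    assume h0: "\<forall>x\<in>frontier \<Omega>. h x = 0"
    have f0: "sqrt (4 * pi) * q * h x = 0" if "x \<in> frontier \<Omega>" for x using h0 that by simp
    show "\<not> (\<exists>u \<phi>. weak_solution \<Omega> m (\<lambda>x. sqrt (4 * pi) * q * h x) (\<lambda>x. q * \<zeta> x - \<omega>) u \<phi> \<and> nontrivial_on \<Omega> u)"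
      using no_nontrivial_solution[where f="\<lambda>x. sqrt (4 * pi) * q * h x", OF assms(3,5) G f0 Gg GK K0 K] by blast
  qed
qed

end
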